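(* Let $M^n$ be a compact spacelike hypersurface of non-negative sectional curvature, with mean curvature vector field parallel in the normal connection (pmc), in a semi-Riemannian warped product space $\varepsilon I\times_a\mathbb{Q}_s^n(c)$ of constant curvature. Then $M^n$ is isoparametric.
   Context: $\mathbb{Q}_s^n(c)$ is the $n$-dimensional semi-Riemannian space form of index $s$ and constant curvature $c$, with metric $g$; $I\subset\mathbb{R}$ is an open interval, $a:I\to\mathbb{R}_+$ is smooth, $\varepsilon\in\{-1,1\}$. $\varepsilon I\times_a\mathbb{Q}_s^n(c)$ is $I\times\mathbb{Q}_s^n(c)$ with metric $\varepsilon\,\pi_I^*(dt^2)+a(\pi_I)^2\,\pi_{\mathbb{Q}}^*g$, where $\pi_I,\pi_{\mathbb{Q}}$ are the projections. A hypersurface is spacelike if its induced metric is positive definite. With $\alpha$ the second fundamental form, the mean curvature vector field is $\vec H=\frac1n\mathrm{tr}(\alpha)$; pmc means $\nabla^\perp\vec H=0$. Isoparametric means that the eigenvalues of the shape operator are constant.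
   Formalization: The hypersurface M is assumed connected (the usual convention); without this the claim fails, e.g. for two concentric round spheres of different radii in flat space, which are pmc and non-negatively curved but have different principal curvatures. *)

theory Defs
  imports "HOL-Analysis.Analysis"
begin

section \<open>Smooth maps and charts\<close>

text \<open>Both notions of smoothness below are only meant for open sets.\<close>

fun times_differentiable_on ::
    "nat \<Rightarrow> 'a::euclidean_space set \<Rightarrow> ('a \<Rightarrow> 'b::real_normed_vector) \<Rightarrow> bool" where
  "times_differentiable_on 0 S f \<longleftrightarrow> continuous_on S f"
| "times_differentiable_on (Suc k) S f \<longleftrightarrow>
     (\<forall>x\<in>S. f differentiable (at x)) \<and>
     (\<forall>v. times_differentiable_on k S (\<lambda>x. frechet_derivative f (at x) v))"

definition smooth_on :: "'a::euclidean_space set \<Rightarrow> ('a \<Rightarrow> 'b::real_normed_vector) \<Rightarrow> bool" where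
  "smooth_on S f \<longleftrightarrow> (\<forall>k. times_differentiable_on k S f)"

text \<open>A chart is a pair of its domain and its coordinate map; the coordinate map is irrelevant
  outside the domain.\<close>

type_synonym ('m, 'e) chart = "'m set \<times> ('m \<Rightarrow> 'e)"

abbreviation chart_image :: "('m, 'e) chart \<Rightarrow> 'e set" where
  "chart_image C \<equiv> snd C ` fst C"

definition chart_inv :: "('m, 'e) chart \<Rightarrow> 'e \<Rightarrow> 'm" where
  "chart_inv C = inv_into (fst C) (snd C)"

definition is_chart :: "'m topology \<Rightarrow> ('m, 'e::euclidean_space) chart \<Rightarrow> bool" where
  "is_chart X C \<longleftrightarrow> openin X (fst C) \<and> open (chart_image C) \<and>
     homeomorphic_map (subtopology X (fst C)) (top_of_set (chart_image C)) (snd C)"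

definition smooth_manifold :: "'m topology \<Rightarrow> ('m, 'e::euclidean_space) chart set \<Rightarrow> bool" where
  "smooth_manifold X A \<longleftrightarrow>
     Hausdorff_space X \<and> second_countable X \<and>
     (\<forall>C\<in>A. is_chart X C) \<and> (\<Union>C\<in>A. fst C) = topspace X \<and>
     (\<forall>C\<in>A. \<forall>D\<in>A. smooth_on (snd C ` (fst C \<inter> fst D)) (snd D \<circ> chart_inv C))"

text \<open>The maximal atlas of an embedded submanifold of a Euclidean space: all charts whose inverse
  is a smooth immersion into the surrounding space.\<close>

definition submanifold_charts :: "'b::euclidean_space set \<Rightarrow> ('b, 'e::euclidean_space) chart set" where
  "submanifold_charts S = {B. is_chart (top_of_set S) B \<and>
     smooth_on (chart_image B) (chart_inv B) \<and>
     (\<forall>y\<in>chart_image B. inj (frechet_derivative (chart_inv B) (at y)))}"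


section \<open>Semi-Riemannian geometry in a chart\<close>

text \<open>A metric assigns a bilinear form to each point. Here \<open>k\<close> is a smooth map (the inverse of a
  chart, or an immersion composed with one) along which a metric is pulled back.\<close>

definition pullback_metric ::
    "('b::euclidean_space \<Rightarrow> 'b \<Rightarrow> 'b \<Rightarrow> real) \<Rightarrow> ('e::euclidean_space \<Rightarrow> 'b) \<Rightarrow> 'e \<Rightarrow> 'e \<Rightarrow> 'e \<Rightarrow> real" where
  "pullback_metric h k x u v =
     h (k x) (frechet_derivative k (at x) u) (frechet_derivative k (at x) v)"

text \<open>The Levi-Civita connection of \<open>g\<close> on constant coordinate fields \<open>u\<close>, \<open>v\<close>, by the Koszul formula.\<close>

definition christoffel ::
    "('e::euclidean_space \<Rightarrow> 'e \<Rightarrow> 'e \<Rightarrow> real) \<Rightarrow> 'e \<Rightarrow> 'e \<Rightarrow> 'e \<Rightarrow> 'e" where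
  "christoffel g x u v = (THE w. \<forall>z. 2 * g x w z =
       frechet_derivative (\<lambda>y. g y v z) (at x) u
     + frechet_derivative (\<lambda>y. g y u z) (at x) v
     - frechet_derivative (\<lambda>y. g y u v) (at x) z)"

text \<open>\<open>R(u,v)w = \<nabla>\<^sub>u\<nabla>\<^sub>v w - \<nabla>\<^sub>v\<nabla>\<^sub>u w\<close> for constant coordinate fields.\<close>

definition curvature ::
    "('e::euclidean_space \<Rightarrow> 'e \<Rightarrow> 'e \<Rightarrow> real) \<Rightarrow> 'e \<Rightarrow> 'e \<Rightarrow> 'e \<Rightarrow> 'e \<Rightarrow> 'e" where
  "curvature g x u v w =
       frechet_derivative (\<lambda>y. christoffel g y v w) (at x) u
     - frechet_derivative (\<lambda>y. christoffel g y u w) (at x) v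
     + christoffel g x u (christoffel g x v w)
     - christoffel g x v (christoffel g x u w)"

definition nondegenerate_plane ::
    "('e::euclidean_space \<Rightarrow> 'e \<Rightarrow> 'e \<Rightarrow> real) \<Rightarrow> 'e \<Rightarrow> 'e \<Rightarrow> 'e \<Rightarrow> bool" where
  "nondegenerate_plane g x u v \<longleftrightarrow> g x u u * g x v v - (g x u v)\<^sup>2 \<noteq> 0"

definition sectional_curvature ::
    "('e::euclidean_space \<Rightarrow> 'e \<Rightarrow> 'e \<Rightarrow> real) \<Rightarrow> 'e \<Rightarrow> 'e \<Rightarrow> 'e \<Rightarrow> real" where
  "sectional_curvature g x u v =
     g x (curvature g x u v v) u / (g x u u * g x v v - (g x u v)\<^sup>2)"

definition constant_curvature ::
    "('b, 'e::euclidean_space) chart set \<Rightarrow> ('b::euclidean_space \<Rightarrow> 'b \<Rightarrow> 'b \<Rightarrow> real) \<Rightarrow> bool" where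
  "constant_curvature S h \<longleftrightarrow> (\<exists>\<kappa>. \<forall>B\<in>S. \<forall>y\<in>chart_image B. \<forall>u v.
     nondegenerate_plane (pullback_metric h (chart_inv B)) y u v \<longrightarrow>
     sectional_curvature (pullback_metric h (chart_inv B)) y u v = \<kappa>)"


section \<open>Space forms and warped products\<close>

definition neg_axes :: "nat \<Rightarrow> 'n::finite set" where
  "neg_axes s = (SOME J. card J = s)"

lemma card_neg_axes:
  assumes "s \<le> CARD('n::finite)"
  shows "card (neg_axes s :: 'n set) = s"
proof -
  have "\<exists>J::'n set. card J = s"
    using obtain_subset_with_card_n[OF assms] by metis
  then show ?thesis
    unfolding neg_axes_def by (rule someI_ex)
qed

text \<open>With \<open>n = CARD('n)\<close>, this is the scalar product of index \<open>s\<close> (if \<open>c \<ge> 0\<close>) or \<open>s + 1\<close>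
  (if \<open>c < 0\<close>) on an \<open>(n+1)\<close>-dimensional space.\<close>

definition flat_form :: "nat \<Rightarrow> real \<Rightarrow> real \<times> (real^'n) \<Rightarrow> real \<times> (real^'n) \<Rightarrow> real" where
  "flat_form s c x y = (if c < 0 then -1 else 1) * fst x * fst y +
     (\<Sum>i\<in>UNIV. (if i \<in> neg_axes s then -1 else 1) * (snd x $ i) * (snd y $ i))"

text \<open>The standard models: a flat hyperplane for \<open>c = 0\<close>, otherwise the hyperquadric
  \<open>\<langle>x,x\<rangle> = 1/c\<close>. The hyperquadric has two components exactly if \<open>c < 0\<close>, \<open>s = 0\<close> (hyperbolic space)
  or \<open>c > 0\<close>, \<open>s = n\<close> (its anti-isometric counterpart), where one component is taken.\<close>

definition space_form :: "nat \<Rightarrow> real \<Rightarrow> (real \<times> (real^'n)) set" where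
  "space_form s c = {x. (if c = 0 then fst x = 0 else flat_form s c x x = 1 / c) \<and>
     ((c < 0 \<and> s = 0) \<or> (c > 0 \<and> s = CARD('n)) \<longrightarrow> fst x > 0)}"

definition warped_product :: "real set \<Rightarrow> nat \<Rightarrow> real \<Rightarrow> (real \<times> real \<times> (real^'n)) set" where
  "warped_product I s c = I \<times> space_form s c"

definition warped_charts ::
    "real set \<Rightarrow> nat \<Rightarrow> real \<Rightarrow> (real \<times> real \<times> (real^'n), real \<times> (real^'n)) chart set" where
  "warped_charts I s c = submanifold_charts (warped_product I s c)"

definition warped_metric ::
    "real \<Rightarrow> (real \<Rightarrow> real) \<Rightarrow> nat \<Rightarrow> real \<Rightarrow> real \<times> real \<times> (real^'n) \<Rightarrow>
     real \<times> real \<times> (real^'n) \<Rightarrow> real \<times> real \<times> (real^'n) \<Rightarrow> real" where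
  "warped_metric \<epsilon> a s c p u v =
     \<epsilon> * fst u * fst v + (a (fst p))\<^sup>2 * flat_form s c (snd u) (snd v)"


section \<open>Hypersurfaces\<close>

text \<open>Below, \<open>C\<close> is a chart of the hypersurface and \<open>B\<close> one of the surrounding manifold, which is
  embedded in a Euclidean space \<open>'b\<close> and has the metric \<open>h\<close> (used on its tangent vectors only).
  Tangent vectors of the surrounding manifold are represented in the coordinates of \<open>B\<close>, except
  for the normal fields \<open>N\<close>, which take values in \<open>'b\<close>.\<close>

definition immersion ::
    "('m, 'e::euclidean_space) chart set \<Rightarrow> 'b::euclidean_space set \<Rightarrow> ('m \<Rightarrow> 'b) \<Rightarrow> bool" where
  "immersion A S f \<longleftrightarrow> (\<forall>C\<in>A. f ` fst C \<subseteq> S \<and> smooth_on (chart_image C) (f \<circ> chart_inv C) \<and>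
     (\<forall>x\<in>chart_image C. inj (frechet_derivative (f \<circ> chart_inv C) (at x))))"

definition induced_metric ::
    "('b::euclidean_space \<Rightarrow> 'b \<Rightarrow> 'b \<Rightarrow> real) \<Rightarrow> ('m \<Rightarrow> 'b) \<Rightarrow> ('m, 'e::euclidean_space) chart \<Rightarrow>
     'e \<Rightarrow> 'e \<Rightarrow> 'e \<Rightarrow> real" where
  "induced_metric h f C = pullback_metric h (f \<circ> chart_inv C)"

definition spacelike ::
    "('m, 'e::euclidean_space) chart set \<Rightarrow> ('b::euclidean_space \<Rightarrow> 'b \<Rightarrow> 'b \<Rightarrow> real) \<Rightarrow>
     ('m \<Rightarrow> 'b) \<Rightarrow> bool" where
  "spacelike A h f \<longleftrightarrow>
     (\<forall>C\<in>A. \<forall>x\<in>chart_image C. \<forall>u. u \<noteq> 0 \<longrightarrow> induced_metric h f C x u u > 0)"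

definition nonneg_sectional_curvature ::
    "('m, 'e::euclidean_space) chart set \<Rightarrow> ('b::euclidean_space \<Rightarrow> 'b \<Rightarrow> 'b \<Rightarrow> real) \<Rightarrow>
     ('m \<Rightarrow> 'b) \<Rightarrow> bool" where
  "nonneg_sectional_curvature A h f \<longleftrightarrow> (\<forall>C\<in>A. \<forall>x\<in>chart_image C. \<forall>u v.
     nondegenerate_plane (induced_metric h f C) x u v \<longrightarrow>
     sectional_curvature (induced_metric h f C) x u v \<ge> 0)"

definition local_rep ::
    "('m \<Rightarrow> 'b) \<Rightarrow> ('m, 'e) chart \<Rightarrow> ('b, 'd) chart \<Rightarrow> 'e \<Rightarrow> 'd" where
  "local_rep f C B = snd B \<circ> f \<circ> chart_inv C"

definition rep_domain ::
    "('m \<Rightarrow> 'b) \<Rightarrow> ('m, 'e) chart \<Rightarrow> ('b, 'd) chart \<Rightarrow> 'e set" where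
  "rep_domain f C B = snd C ` (fst C \<inter> f -` fst B)"

definition normal_part ::
    "('b::euclidean_space \<Rightarrow> 'b \<Rightarrow> 'b \<Rightarrow> real) \<Rightarrow> ('m \<Rightarrow> 'b) \<Rightarrow> ('m, 'e::euclidean_space) chart \<Rightarrow>
     ('b, 'd::euclidean_space) chart \<Rightarrow> 'e \<Rightarrow> 'd \<Rightarrow> 'd" where
  "normal_part h f C B x y = (let F = local_rep f C B in
     THE \<nu>. (\<forall>w. pullback_metric h (chart_inv B) (F x) \<nu> (frechet_derivative F (at x) w) = 0) \<and>
         (\<exists>w. y = frechet_derivative F (at x) w + \<nu>))"

text \<open>Derivative of a vector field \<open>\<xi>\<close> along the hypersurface with respect to the Levi-Civita
  connection of the surrounding manifold.\<close>

definition cov_deriv_along ::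
    "('b::euclidean_space \<Rightarrow> 'b \<Rightarrow> 'b \<Rightarrow> real) \<Rightarrow> ('m \<Rightarrow> 'b) \<Rightarrow> ('m, 'e::euclidean_space) chart \<Rightarrow>
     ('b, 'd::euclidean_space) chart \<Rightarrow> ('e \<Rightarrow> 'd) \<Rightarrow> 'e \<Rightarrow> 'e \<Rightarrow> 'd" where
  "cov_deriv_along h f C B \<xi> x u = (let F = local_rep f C B in
     frechet_derivative \<xi> (at x) u +
     christoffel (pullback_metric h (chart_inv B)) (F x) (frechet_derivative F (at x) u) (\<xi> x))"

definition second_fundamental_form ::
    "('b::euclidean_space \<Rightarrow> 'b \<Rightarrow> 'b \<Rightarrow> real) \<Rightarrow> ('m \<Rightarrow> 'b) \<Rightarrow> ('m, 'e::euclidean_space) chart \<Rightarrow>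
     ('b, 'd::euclidean_space) chart \<Rightarrow> 'e \<Rightarrow> 'e \<Rightarrow> 'e \<Rightarrow> 'd" where
  "second_fundamental_form h f C B x u v = normal_part h f C B x
     (cov_deriv_along h f C B (\<lambda>y. frechet_derivative (local_rep f C B) (at y) v) x u)"

definition normal_connection ::
    "('b::euclidean_space \<Rightarrow> 'b \<Rightarrow> 'b \<Rightarrow> real) \<Rightarrow> ('m \<Rightarrow> 'b) \<Rightarrow> ('m, 'e::euclidean_space) chart \<Rightarrow>
     ('b, 'd::euclidean_space) chart \<Rightarrow> ('e \<Rightarrow> 'd) \<Rightarrow> 'e \<Rightarrow> 'e \<Rightarrow> 'd" where
  "normal_connection h f C B \<xi> x u = normal_part h f C B x (cov_deriv_along h f C B \<xi> x u)"

definition mean_curvature_vector ::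
    "('b::euclidean_space \<Rightarrow> 'b \<Rightarrow> 'b \<Rightarrow> real) \<Rightarrow> ('m \<Rightarrow> 'b) \<Rightarrow> ('m, real^'n) chart \<Rightarrow>
     ('b, 'd::euclidean_space) chart \<Rightarrow> real^'n \<Rightarrow> 'd" where
  "mean_curvature_vector h f C B x =
     (let G = (\<chi> i j. induced_metric h f C x (axis i 1) (axis j 1)) :: real^'n^'n in
      (1 / real CARD('n)) *\<^sub>R (\<Sum>i\<in>UNIV. \<Sum>j\<in>UNIV.
        (matrix_inv G $ i $ j) *\<^sub>R second_fundamental_form h f C B x (axis i 1) (axis j 1)))"

definition pmc ::
    "('m, real^'n) chart set \<Rightarrow> ('b, 'd::euclidean_space) chart set \<Rightarrow>
     ('b::euclidean_space \<Rightarrow> 'b \<Rightarrow> 'b \<Rightarrow> real) \<Rightarrow> ('m \<Rightarrow> 'b) \<Rightarrow> bool" where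
  "pmc A S h f \<longleftrightarrow> (\<forall>C\<in>A. \<forall>B\<in>S. \<forall>x\<in>rep_domain f C B. \<forall>u.
     normal_connection h f C B (mean_curvature_vector h f C B) x u = 0)"

definition unit_normal_field ::
    "('m, 'e::euclidean_space) chart set \<Rightarrow> ('b, 'd::euclidean_space) chart set \<Rightarrow>
     ('b::euclidean_space \<Rightarrow> 'b \<Rightarrow> 'b \<Rightarrow> real) \<Rightarrow> ('m \<Rightarrow> 'b) \<Rightarrow> 'm set \<Rightarrow> ('m \<Rightarrow> 'b) \<Rightarrow> bool" where
  "unit_normal_field A S h f U N \<longleftrightarrow>
     (\<forall>C\<in>A. smooth_on (snd C ` (fst C \<inter> U)) (N \<circ> chart_inv C)) \<and>
     (\<forall>p\<in>U. \<bar>h (f p) (N p) (N p)\<bar> = 1 \<and>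
       (\<forall>B\<in>S. f p \<in> fst B \<longrightarrow>
          N p \<in> range (frechet_derivative (chart_inv B) (at (snd B (f p))))) \<and>
       (\<forall>C\<in>A. p \<in> fst C \<longrightarrow>
          (\<forall>w. h (f p) (N p) (frechet_derivative (f \<circ> chart_inv C) (at (snd C p)) w) = 0)))"

definition shape_operator ::
    "('b::euclidean_space \<Rightarrow> 'b \<Rightarrow> 'b \<Rightarrow> real) \<Rightarrow> ('m \<Rightarrow> 'b) \<Rightarrow> ('m, 'e::euclidean_space) chart \<Rightarrow>
     ('b, 'd::euclidean_space) chart \<Rightarrow> ('m \<Rightarrow> 'b) \<Rightarrow> 'e \<Rightarrow> 'e \<Rightarrow> 'e" where
  "shape_operator h f C B N x u = (THE w. \<forall>v. induced_metric h f C x w v =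
     h (f (chart_inv C x))
       (frechet_derivative (chart_inv B) (at (local_rep f C B x))
         (second_fundamental_form h f C B x u v))
       (N (chart_inv C x)))"

text \<open>The shape operator is determined by a unit normal field, which for a one-sided hypersurface
  exists only locally. The function \<open>m\<close> gives the multiplicities of the eigenvalues.\<close>

definition isoparametric ::
    "'m topology \<Rightarrow> ('m, 'e::euclidean_space) chart set \<Rightarrow> ('b, 'd::euclidean_space) chart set \<Rightarrow>
     ('b::euclidean_space \<Rightarrow> 'b \<Rightarrow> 'b \<Rightarrow> real) \<Rightarrow> ('m \<Rightarrow> 'b) \<Rightarrow> bool" where
  "isoparametric X A S h f \<longleftrightarrow>
     (\<forall>U N. openin X U \<and> connectedin X U \<and> unit_normal_field A S h f U N \<longrightarrow>
       (\<exists>m::real \<Rightarrow> nat. \<forall>C\<in>A. \<forall>B\<in>S. \<forall>p \<in> U \<inter> fst C \<inter> f -` fst B. \<forall>\<mu>.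
          dim {u. shape_operator h f C B N (snd C p) u = \<mu> *\<^sub>R u} = m \<mu>))"

end

theory Submission
  imports Defs
begin

text \<open>
  Let \<open>b\<close> be the scalar second fundamental form of the hypersurface with respect to a local unit normal.
  As the surrounding space has constant curvature, its curvature tensor maps a normal vector to 0 along
  tangent planes, so that \<open>b\<close> satisfies Codazzi's equation; and as the mean curvature vector is parallel,
  \<open>b\<close> has constant trace. For every such tensor on a Riemannian manifold the Simons identity reads
  \<open>1/2 \<Delta>|b|\<^sup>2 = |\<nabla>b|\<^sup>2 + 1/2 \<Sum> (\<lambda>\<^sub>i - \<lambda>\<^sub>j)\<^sup>2 K\<^sub>i\<^sub>j\<close>, where the \<open>\<lambda>\<^sub>i\<close> are the eigenvalues of \<open>b\<close>
  and the \<open>K\<^sub>i\<^sub>j\<close> the sectional curvatures of the planes spanned by its eigenvectors (\<open>simons_algebra\<close>,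
  \<open>simons_inequality\<close>). If the sectional curvatures are non-negative, then \<open>|b|\<^sup>2\<close> is subharmonic. On a
  compact connected manifold it attains its maximum, and by the strong maximum principle it is constant
  (\<open>strong_maximum_principle\<close>, \<open>sqnorm_constant\<close>). Then \<open>\<nabla>b = 0\<close>, hence the traces of the powers of the
  shape operator are constant, and so are its eigenvalues with their multiplicities
  (\<open>parallel_constant_multiplicities\<close>).

  The maximum principle replaces integration of \<open>\<Delta>|b|\<^sup>2\<close> over the compact manifold. It is a local statement
  in a chart and thus needs neither an orientation nor a volume form, and it only asks for \<open>\<Delta>|b|\<^sup>2\<close> at
  one point at a time, where an eigenframe of \<open>b\<close> may be used.

  All computations take place in charts, where a covariant derivative is a directional derivative
  corrected by Christoffel symbols. To compare charts, the second fundamental form is also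
  expressed through the Euclidean space that contains the warped product (\<open>ext_sff\<close>), which makes its
  independence of the chart of the warped product evident. Unit normals exist locally, but \<open>|b|\<^sup>2\<close>
  does not change with their sign and is a function on the whole manifold.

  The warped product enters the argument as an embedded manifold with a smooth family
  of nondegenerate forms on its tangent spaces and with constant curvature. For a hyperquadric, charts
  are found by writing it locally as a graph over the orthogonal complement of a point
  (\<open>warped_charts_cover\<close>), and the tangent spaces are the kernels of the differential of the defining
  equation (\<open>warped_chart_tangent\<close>).
\<close>

section \<open>Directional derivatives and smooth maps\<close>

abbreviation (input) dir_deriv ::
    "'a::real_normed_vector \<Rightarrow> ('a \<Rightarrow> 'b::real_normed_vector) \<Rightarrow> 'a \<Rightarrow> 'b" ("\<partial>") where
  "\<partial> v f \<equiv> \<lambda>x. frechet_derivative f (at x) v"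

lemma pd_eqI: "(f has_derivative f') (at x) \<Longrightarrow> \<partial> v f x = f' v"
  using frechet_derivative_at by metis

lemma pd_has_derivative: "f differentiable (at x) \<Longrightarrow> (f has_derivative (\<lambda>v. \<partial> v f x)) (at x)"
  by (metis frechet_derivative_works)

lemma pd_linear: "f differentiable (at x) \<Longrightarrow> linear (\<lambda>v. \<partial> v f x)"
  using linear_frechet_derivative by blast

lemma pd_cong:
  assumes "open S" "x \<in> S" "\<And>y. y \<in> S \<Longrightarrow> f y = g y"
  shows "\<partial> v f x = \<partial> v g x"
proof (cases "f differentiable at x")
  case True
  then show ?thesis
    using frechet_derivative_transform_within_open[of f x S g] assms by simp
next
  case False
  then have "\<not> g differentiable at x"
    using assms has_derivative_transform_within_open[of g _ x UNIV S f]
    unfolding differentiable_def by auto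
  moreover have "(f has_derivative D) (at x) \<longleftrightarrow> (g has_derivative D) (at x)" for D
    using False \<open>\<not> g differentiable at x\<close> unfolding differentiable_def by blast
  ultimately show ?thesis
    unfolding frechet_derivative_def by simp
qed

lemma differentiable_cong:
  assumes "open S" "x \<in> S" "\<And>y. y \<in> S \<Longrightarrow> f y = g y" "f differentiable (at x)"
  shows "g differentiable (at x)"
  using assms has_derivative_transform_within_open[of f _ x UNIV S g]
  unfolding differentiable_def by auto

lemma pd_chain:
  assumes "F differentiable (at x)" "f differentiable (at (F x))"
  shows "\<partial> v (\<lambda>x. f (F x)) x = \<partial> (\<partial> v F x) f (F x)"
  using frechet_derivative_compose[OF assms] by (simp add: o_def)

lemma pd_add:
  assumes "f differentiable (at x)" "g differentiable (at x)"
  shows "\<partial> v (\<lambda>x. f x + g x) x = \<partial> v f x + \<partial> v g x"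
  by (rule pd_eqI[OF has_derivative_add[OF assms[THEN pd_has_derivative]]])

lemma pd_diff:
  assumes "f differentiable (at x)" "g differentiable (at x)"
  shows "\<partial> v (\<lambda>x. f x - g x) x = \<partial> v f x - \<partial> v g x"
  by (rule pd_eqI[OF has_derivative_diff[OF assms[THEN pd_has_derivative]]])

lemma pd_sum:
  assumes "\<And>i. i \<in> I \<Longrightarrow> f i differentiable (at x)"
  shows "\<partial> v (\<lambda>x. \<Sum>i\<in>I. f i x) x = (\<Sum>i\<in>I. \<partial> v (f i) x)"
  by (rule pd_eqI[OF has_derivative_sum[OF assms[THEN pd_has_derivative]]])

lemma pd_mult:
  fixes f g :: "'a::real_normed_vector \<Rightarrow> real"
  assumes "f differentiable (at x)" "g differentiable (at x)"
  shows "\<partial> v (\<lambda>x. f x * g x) x = \<partial> v f x * g x + f x * \<partial> v g x"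
proof -
  have "((\<lambda>x. f x * g x) has_derivative (\<lambda>v. f x * \<partial> v g x + \<partial> v f x * g x)) (at x)"
    by (rule has_derivative_mult[OF pd_has_derivative[OF assms(1)] pd_has_derivative[OF assms(2)]])
  from pd_eqI[OF this] show ?thesis by simp
qed

lemma pd_bounded_bilinear:
  assumes "bounded_bilinear B" "f differentiable (at x)" "g differentiable (at x)"
  shows "\<partial> v (\<lambda>x. B (f x) (g x)) x = B (f x) (\<partial> v g x) + B (\<partial> v f x) (g x)"
    and "(\<lambda>x. B (f x) (g x)) differentiable (at x)"
proof -
  have *: "((\<lambda>x. B (f x) (g x)) has_derivative (\<lambda>v. B (f x) (\<partial> v g x) + B (\<partial> v f x) (g x))) (at x)"
    by (rule bounded_bilinear.FDERIV[OF assms(1) pd_has_derivative[OF assms(2)] pd_has_derivative[OF assms(3)]])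
  show "\<partial> v (\<lambda>x. B (f x) (g x)) x = B (f x) (\<partial> v g x) + B (\<partial> v f x) (g x)"
    by (rule pd_eqI[OF *])
  show "(\<lambda>x. B (f x) (g x)) differentiable (at x)"
    using * by (rule differentiableI)
qed

lemma pd_bounded_linear:
  assumes "bounded_linear L" "f differentiable (at x)"
  shows "\<partial> v (\<lambda>x. L (f x)) x = L (\<partial> v f x)"
    and "(\<lambda>x. L (f x)) differentiable (at x)"
proof -
  have *: "((\<lambda>x. L (f x)) has_derivative (\<lambda>v. L (\<partial> v f x))) (at x)"
    by (rule bounded_linear.has_derivative[OF assms(1) pd_has_derivative[OF assms(2)]])
  show "\<partial> v (\<lambda>x. L (f x)) x = L (\<partial> v f x)"
    by (rule pd_eqI[OF *])
  show "(\<lambda>x. L (f x)) differentiable (at x)"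
    using * by (rule differentiableI)
qed


abbreviation "td \<equiv> times_differentiable_on"

lemma td_SucI:
  assumes "\<And>v. td k S (\<partial> v f)" "\<And>x. x \<in> S \<Longrightarrow> f differentiable (at x)"
  shows "td (Suc k) S f"
  using assms by simp

lemma td_subset: "td k S f \<Longrightarrow> T \<subseteq> S \<Longrightarrow> td k T f"
  by (induction k arbitrary: f) (auto intro: continuous_on_subset)

lemma td_cong:
  assumes "open S" "\<And>x. x \<in> S \<Longrightarrow> f x = g x" "td k S f"
  shows "td k S g"
  using assms(2,3)
proof (induction k arbitrary: f g)
  case 0
  then show ?case by (simp cong: continuous_on_cong)
next
  case (Suc k)
  have "g differentiable (at x)" if "x \<in> S" for x
    using differentiable_cong[OF assms(1) that] Suc.prems that by auto
  moreover have "td k S (\<partial> v g)" for v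
  proof (rule Suc.IH[of "\<partial> v f"])
    show "\<partial> v f x = \<partial> v g x" if "x \<in> S" for x
      using pd_cong[OF assms(1) that] Suc.prems by auto
    show "td k S (\<partial> v f)"
      using Suc.prems by simp
  qed
  ultimately show ?case by simp
qed

lemma td_continuous: "td k S f \<Longrightarrow> continuous_on S f"
  by (cases k)
    (auto intro!: continuous_at_imp_continuous_on differentiable_imp_continuous_within)

lemma td_SucD: "td (Suc k) S f \<Longrightarrow> td k S f"
proof (induction k arbitrary: f)
  case 0
  then show ?case using td_continuous[of "Suc 0"] by simp
next
  case (Suc k)
  then show ?case by simp
qed

lemma td_const: "td k S (\<lambda>x. c)"
  by (induction k arbitrary: c) auto

lemma td_id: "td k S (\<lambda>x. x)"
  by (cases k) (auto simp: td_const)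

lemma td_add:
  assumes "open S" "td k S f" "td k S g"
  shows "td k S (\<lambda>x. f x + g x)"
  using assms(2,3)
proof (induction k arbitrary: f g)
  case 0
  then show ?case by (simp add: continuous_on_add)
next
  case (Suc k)
  have "td k S (\<partial> v (\<lambda>x. f x + g x))" for v
    by (rule td_cong[OF assms(1), of "\<lambda>x. \<partial> v f x + \<partial> v g x"])
      (use Suc in \<open>auto simp: pd_add\<close>)
  then show ?case using Suc by auto
qed

lemma td_sum:
  assumes "open S" "\<And>i. i \<in> I \<Longrightarrow> td k S (f i)"
  shows "td k S (\<lambda>x. \<Sum>i\<in>I. f i x)"
  using assms(2)
  by (induction I rule: infinite_finite_induct) (auto intro!: td_const td_add assms(1))

lemma td_bounded_bilinear:
  assumes B: "bounded_bilinear B" and "open S" "td k S f" "td k S g"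
  shows "td k S (\<lambda>x. B (f x) (g x))"
  using assms(3,4)
proof (induction k arbitrary: f g)
  case 0
  then show ?case by (simp add: bounded_bilinear.continuous_on[OF B])
next
  case (Suc k)
  have A: "td k S (\<partial> v (\<lambda>x. B (f x) (g x)))" for v
  proof (rule td_cong[OF assms(2), of "\<lambda>x. B (f x) (\<partial> v g x) + B (\<partial> v f x) (g x)"])
    show "td k S (\<lambda>x. B (f x) (\<partial> v g x) + B (\<partial> v f x) (g x))"
      using Suc.prems td_SucD[OF Suc.prems(1)] td_SucD[OF Suc.prems(2)]
      by (intro td_add[OF assms(2)] Suc.IH) simp_all
    show "B (f x) (\<partial> v g x) + B (\<partial> v f x) (g x) = \<partial> v (\<lambda>x. B (f x) (g x)) x" if "x \<in> S" for x
      using Suc.prems that by (subst pd_bounded_bilinear(1)[OF B]) simp_all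
  qed
  have D: "(\<lambda>x. B (f x) (g x)) differentiable at x" if "x \<in> S" for x
    by (rule pd_bounded_bilinear(2)[OF B, of f _ g]) (use Suc.prems that in auto)
  show ?case
    by (rule td_SucI; (rule A | rule D))
qed

lemma td_bounded_linear:
  assumes L: "bounded_linear L" and "open S" "td k S f"
  shows "td k S (\<lambda>x. L (f x))"
  using assms(3)
proof (induction k arbitrary: f)
  case 0
  then show ?case by (simp add: bounded_linear.continuous_on[OF L])
next
  case (Suc k)
  have A: "td k S (\<partial> v (\<lambda>x. L (f x)))" for v
    by (rule td_cong[OF assms(2), of "\<lambda>x. L (\<partial> v f x)"])
      (use Suc in \<open>auto simp: pd_bounded_linear[OF L]\<close>)
  have D: "(\<lambda>x. L (f x)) differentiable at x" if "x \<in> S" for x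
    by (rule pd_bounded_linear(2)[OF L, of f]) (use Suc.prems that in auto)
  show ?case
    by (rule td_SucI; (rule A | rule D))
qed

lemmas td_mult = td_bounded_bilinear[OF bounded_bilinear_mult]
lemmas td_scaleR = td_bounded_bilinear[OF bounded_bilinear_scaleR]
lemmas td_inner = td_bounded_bilinear[OF bounded_bilinear_inner]

lemma pd_basis_expand:
  fixes f :: "'a::euclidean_space \<Rightarrow> 'b::real_normed_vector"
  assumes "f differentiable (at x)"
  shows "\<partial> v f x = (\<Sum>b\<in>Basis. (v \<bullet> b) *\<^sub>R \<partial> b f x)"
proof -
  have "\<partial> v f x = \<partial> (\<Sum>b\<in>Basis. (v \<bullet> b) *\<^sub>R b) f x"
    by (simp add: euclidean_representation)
  also have "\<dots> = (\<Sum>b\<in>Basis. (v \<bullet> b) *\<^sub>R \<partial> b f x)"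
    using pd_linear[OF assms] by (simp add: linear_sum linear_scale)
  finally show ?thesis .
qed

text \<open>The chain rule must be expanded in a basis before the induction hypothesis applies: the derivative
  \<open>\<partial> (\<partial> v F x) f (F x)\<close> has a direction that moves with \<open>x\<close>, whereas iterated
  differentiability speaks of fixed directions only.\<close>

lemma td_compose:
  fixes f :: "'a::euclidean_space \<Rightarrow> 'b::real_normed_vector" and F :: "'c::euclidean_space \<Rightarrow> 'a"
  assumes "open \<Omega>" "td k \<Omega> F" "td k S f" "\<And>x. x \<in> \<Omega> \<Longrightarrow> F x \<in> S"
  shows "td k \<Omega> (\<lambda>x. f (F x))"
  using assms(2,3)
proof (induction k arbitrary: f)
  case 0
  then show ?case using assms(4) by (auto intro: continuous_on_compose2)
next
  case (Suc k)
  have A: "td k \<Omega> (\<partial> v (\<lambda>x. f (F x)))" for v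
  proof (rule td_cong[OF assms(1), of "\<lambda>x. \<Sum>b\<in>Basis. (\<partial> v F x \<bullet> b) *\<^sub>R \<partial> b f (F x)"])
    show "td k \<Omega> (\<lambda>x. \<Sum>b\<in>Basis. (\<partial> v F x \<bullet> b) *\<^sub>R \<partial> b f (F x))"
    proof (rule td_sum[OF assms(1)])
      fix b :: 'a assume "b \<in> Basis"
      have "td k \<Omega> (\<lambda>x. \<partial> v F x \<bullet> b)"
        by (rule td_inner[OF assms(1) _ td_const]) (use Suc.prems in simp)
      moreover have "td k \<Omega> (\<lambda>x. \<partial> b f (F x))"
        by (rule Suc.IH[OF td_SucD[OF Suc.prems(1)]]) (use Suc.prems in simp)
      ultimately show "td k \<Omega> (\<lambda>x. (\<partial> v F x \<bullet> b) *\<^sub>R \<partial> b f (F x))"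
        by (rule td_scaleR[OF assms(1)])
    qed
    show "(\<Sum>b\<in>Basis. (\<partial> v F x \<bullet> b) *\<^sub>R \<partial> b f (F x)) = \<partial> v (\<lambda>x. f (F x)) x" if "x \<in> \<Omega>" for x
    proof -
      have "F differentiable (at x)" "f differentiable (at (F x))"
        using Suc.prems assms(4)[OF that] that by simp_all
      then show ?thesis
        by (simp only: pd_chain pd_basis_expand[of f "F x" "\<partial> v F x"])
    qed
  qed
  have D: "(\<lambda>x. f (F x)) differentiable (at x)" if "x \<in> \<Omega>" for x
  proof -
    have "F differentiable (at x)" "f differentiable (at (F x))"
      using Suc.prems assms(4)[OF that] that by simp_all
    from differentiable_chain_at[OF this] show ?thesis
      by (simp only: o_def)
  qed
  show ?case
    by (rule td_SucI; (rule A | rule D))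
qed

lemma smooth_onD:
  assumes "smooth_on S f"
  shows "x \<in> S \<Longrightarrow> f differentiable (at x)" and "smooth_on S (\<partial> v f)" and "continuous_on S f"
proof -
  have *: "td k S f" for k
    using assms unfolding smooth_on_def by blast
  show "x \<in> S \<Longrightarrow> f differentiable (at x)"
    using *[of "Suc 0"] by simp
  show "smooth_on S (\<partial> v f)"
    unfolding smooth_on_def using *[of "Suc _"] by simp
  show "continuous_on S f"
    using *[of 0] by simp
qed

lemma smooth_on_subset: "smooth_on S f \<Longrightarrow> T \<subseteq> S \<Longrightarrow> smooth_on T f"
  unfolding smooth_on_def using td_subset by blast

lemma smooth_on_cong:
  assumes "open S" "\<And>x. x \<in> S \<Longrightarrow> f x = g x" "smooth_on S f"
  shows "smooth_on S g"
  using assms(3) unfolding smooth_on_def by (intro allI td_cong[OF assms(1,2)]) simp_all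

lemma smooth_on_const: "smooth_on S (\<lambda>x. c)"
  unfolding smooth_on_def using td_const by blast

lemma smooth_on_id: "smooth_on S (\<lambda>x. x)"
  unfolding smooth_on_def using td_id by blast

lemma smooth_on_add: "open S \<Longrightarrow> smooth_on S f \<Longrightarrow> smooth_on S g \<Longrightarrow> smooth_on S (\<lambda>x. f x + g x)"
  unfolding smooth_on_def by (intro allI td_add) simp_all

lemma smooth_on_sum:
  "open S \<Longrightarrow> (\<And>i. i \<in> I \<Longrightarrow> smooth_on S (f i)) \<Longrightarrow> smooth_on S (\<lambda>x. \<Sum>i\<in>I. f i x)"
  unfolding smooth_on_def by (intro allI td_sum) simp_all

lemma smooth_on_bounded_linear:
  "bounded_linear L \<Longrightarrow> open S \<Longrightarrow> smooth_on S f \<Longrightarrow> smooth_on S (\<lambda>x. L (f x))"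
  unfolding smooth_on_def by (intro allI td_bounded_linear[of L]) simp_all

lemma smooth_on_bounded_bilinear:
  "bounded_bilinear B \<Longrightarrow> open S \<Longrightarrow> smooth_on S f \<Longrightarrow> smooth_on S g \<Longrightarrow> smooth_on S (\<lambda>x. B (f x) (g x))"
  unfolding smooth_on_def by (intro allI td_bounded_bilinear[of B]) simp_all

lemmas smooth_on_mult = smooth_on_bounded_bilinear[OF bounded_bilinear_mult]
lemmas smooth_on_scaleR = smooth_on_bounded_bilinear[OF bounded_bilinear_scaleR]
lemmas smooth_on_inner = smooth_on_bounded_bilinear[OF bounded_bilinear_inner]

lemma smooth_on_minus: "open S \<Longrightarrow> smooth_on S f \<Longrightarrow> smooth_on S (\<lambda>x. - f x)"
  by (rule smooth_on_bounded_linear[OF bounded_linear_minus[OF bounded_linear_ident]])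

lemma smooth_on_diff: "open S \<Longrightarrow> smooth_on S f \<Longrightarrow> smooth_on S g \<Longrightarrow> smooth_on S (\<lambda>x. f x - g x)"
  using smooth_on_add[of S f "\<lambda>x. - g x"] smooth_on_minus by auto

lemma smooth_on_compose:
  "open \<Omega> \<Longrightarrow> smooth_on \<Omega> F \<Longrightarrow> smooth_on S f \<Longrightarrow> (\<And>x. x \<in> \<Omega> \<Longrightarrow> F x \<in> S) \<Longrightarrow> smooth_on \<Omega> (\<lambda>x. f (F x))"
  unfolding smooth_on_def by (intro allI td_compose[of \<Omega> _ F S f]) simp_all


subsection \<open>Fields of linear and bilinear maps\<close>

text \<open>In local coordinates a metric is a bilinear form that depends smoothly on the point, smoothness meaning
  smoothness of \<open>y \<mapsto> B y a b\<close> for fixed arguments. Expansion in a basis turns such a field,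
  evaluated at moving arguments, into a finite sum of products of smooth functions.\<close>

lemma bilinear_basis_expand:
  fixes f :: "'a::euclidean_space \<Rightarrow> 'b::euclidean_space \<Rightarrow> 'c::real_vector"
  assumes "bilinear f"
  shows "f a b = (\<Sum>i\<in>Basis. \<Sum>j\<in>Basis. ((a \<bullet> i) * (b \<bullet> j)) *\<^sub>R f i j)"
proof -
  have "f a b = f (\<Sum>i\<in>Basis. (a \<bullet> i) *\<^sub>R i) (\<Sum>j\<in>Basis. (b \<bullet> j) *\<^sub>R j)"
    by (simp add: euclidean_representation)
  also have "\<dots> = (\<Sum>i\<in>Basis. \<Sum>j\<in>Basis. f ((a \<bullet> i) *\<^sub>R i) ((b \<bullet> j) *\<^sub>R j))"
    by (simp add: bilinear_sum[OF assms] sum.cartesian_product)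
  also have "\<dots> = (\<Sum>i\<in>Basis. \<Sum>j\<in>Basis. ((a \<bullet> i) * (b \<bullet> j)) *\<^sub>R f i j)"
    by (simp add: bilinear_lmul[OF assms] bilinear_rmul[OF assms] mult.commute)
  finally show ?thesis .
qed

lemma pd_bilinear_field:
  fixes B :: "'x::real_normed_vector \<Rightarrow> 'a::euclidean_space \<Rightarrow> 'b::euclidean_space \<Rightarrow> 'c::real_normed_vector"
  assumes "open S" "x \<in> S" and bil: "\<And>y. y \<in> S \<Longrightarrow> bilinear (B y)"
    and B: "\<And>a b. (\<lambda>y. B y a b) differentiable (at x)"
    and \<xi>: "\<xi> differentiable (at x)" and \<eta>: "\<eta> differentiable (at x)"
  shows "\<partial> u (\<lambda>y. B y (\<xi> y) (\<eta> y)) x =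
      \<partial> u (\<lambda>y. B y (\<xi> x) (\<eta> x)) x + B x (\<partial> u \<xi> x) (\<eta> x) + B x (\<xi> x) (\<partial> u \<eta> x)"
    and "(\<lambda>y. B y (\<xi> y) (\<eta> y)) differentiable (at x)"
proof -
  define G where "G \<xi> \<eta> y = (\<Sum>i\<in>Basis. \<Sum>j\<in>Basis. ((\<xi> y \<bullet> i) * (\<eta> y \<bullet> j)) *\<^sub>R B y i j)"
    for \<xi> :: "'x \<Rightarrow> 'a" and \<eta> :: "'x \<Rightarrow> 'b" and y
  have G: "G \<xi> \<eta> y = B y (\<xi> y) (\<eta> y)" if "y \<in> S" for \<xi> \<eta> y
    unfolding G_def using bilinear_basis_expand[OF bil[OF that], of "\<xi> y" "\<eta> y"] by (rule sym)
  have summand: "((\<lambda>y. ((\<xi> y \<bullet> i) * (\<eta> y \<bullet> j)) *\<^sub>R B y i j) has_derivative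
      (\<lambda>h. ((\<xi> x \<bullet> i) * (\<eta> x \<bullet> j)) *\<^sub>R \<partial> h (\<lambda>y. B y i j) x +
        ((\<xi> x \<bullet> i) * (\<partial> h \<eta> x \<bullet> j) + (\<partial> h \<xi> x \<bullet> i) * (\<eta> x \<bullet> j)) *\<^sub>R B x i j)) (at x)"
    if \<xi>: "\<xi> differentiable (at x)" and \<eta>: "\<eta> differentiable (at x)" for \<xi> \<eta> i j
    by (rule has_derivative_scaleR[OF has_derivative_mult[OF
            has_derivative_inner_left[OF pd_has_derivative[OF \<xi>]]
            has_derivative_inner_left[OF pd_has_derivative[OF \<eta>]]] pd_has_derivative[OF B]])
  have HG: "(G \<xi> \<eta> has_derivative (\<lambda>h. \<Sum>i\<in>Basis. \<Sum>j\<in>Basis.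
        ((\<xi> x \<bullet> i) * (\<eta> x \<bullet> j)) *\<^sub>R \<partial> h (\<lambda>y. B y i j) x +
        ((\<xi> x \<bullet> i) * (\<partial> h \<eta> x \<bullet> j) + (\<partial> h \<xi> x \<bullet> i) * (\<eta> x \<bullet> j)) *\<^sub>R B x i j)) (at x)"
    if \<xi>: "\<xi> differentiable (at x)" and \<eta>: "\<eta> differentiable (at x)" for \<xi> \<eta>
    unfolding G_def by (rule has_derivative_sum has_derivative_sum summand[OF \<xi> \<eta>])+
  have pdG: "\<partial> u (\<lambda>y. B y (\<xi> y) (\<eta> y)) x = (\<Sum>i\<in>Basis. \<Sum>j\<in>Basis.
        ((\<xi> x \<bullet> i) * (\<eta> x \<bullet> j)) *\<^sub>R \<partial> u (\<lambda>y. B y i j) x +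
        ((\<xi> x \<bullet> i) * (\<partial> u \<eta> x \<bullet> j) + (\<partial> u \<xi> x \<bullet> i) * (\<eta> x \<bullet> j)) *\<^sub>R B x i j)"
    if \<xi>: "\<xi> differentiable (at x)" and \<eta>: "\<eta> differentiable (at x)" for \<xi> \<eta> u
    using pd_cong[OF assms(1,2) G[symmetric, where \<xi>=\<xi> and \<eta>=\<eta>], where v=u] pd_eqI[OF HG[OF \<xi> \<eta>], where v=u]
    by (simp only:)
  have "bilinear (B x)"
    using bil assms(2) .
  show "\<partial> u (\<lambda>y. B y (\<xi> y) (\<eta> y)) x =
      \<partial> u (\<lambda>y. B y (\<xi> x) (\<eta> x)) x + B x (\<partial> u \<xi> x) (\<eta> x) + B x (\<xi> x) (\<partial> u \<eta> x)"
    unfolding pdG[OF \<xi> \<eta>] pdG[OF differentiable_const[of "\<xi> x"] differentiable_const[of "\<eta> x"]]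
    unfolding bilinear_basis_expand[OF \<open>bilinear (B x)\<close>, of "\<partial> u \<xi> x" "\<eta> x"]
      bilinear_basis_expand[OF \<open>bilinear (B x)\<close>, of "\<xi> x" "\<partial> u \<eta> x"]
    by (simp add: sum.distrib scaleR_add_left algebra_simps)
  show "(\<lambda>y. B y (\<xi> y) (\<eta> y)) differentiable (at x)"
    by (rule differentiable_cong[OF assms(1,2) G differentiableI[OF HG[OF \<xi> \<eta>]]])
qed

lemma pd_linear_field:
  fixes L :: "'x::real_normed_vector \<Rightarrow> 'a::euclidean_space \<Rightarrow> 'c::real_normed_vector"
  assumes "open S" "x \<in> S" and lin: "\<And>y. y \<in> S \<Longrightarrow> linear (L y)"
    and L: "\<And>a. (\<lambda>y. L y a) differentiable (at x)" and \<xi>: "\<xi> differentiable (at x)"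
  shows "\<partial> u (\<lambda>y. L y (\<xi> y)) x = \<partial> u (\<lambda>y. L y (\<xi> x)) x + L x (\<partial> u \<xi> x)"
    and "(\<lambda>y. L y (\<xi> y)) differentiable (at x)"
proof -
  define B where "B y a r = r *\<^sub>R L y a" for y a and r :: real
  have bil: "bilinear (B y)" if "y \<in> S" for y
    unfolding bilinear_def B_def using lin[OF that]
    by (auto intro!: linearI simp: linear_add linear_scale scaleR_add_left scaleR_add_right)
  have diff: "(\<lambda>y. B y a r) differentiable (at x)" for a r
    unfolding B_def by (rule differentiable_scaleR[OF differentiable_const L])
  have one: "(\<lambda>y. 1::real) differentiable (at x)" by simp
  have z: "B x a 0 = 0" "B y a 1 = L y a" for y a
    by (simp_all add: B_def)
  show "\<partial> u (\<lambda>y. L y (\<xi> y)) x = \<partial> u (\<lambda>y. L y (\<xi> x)) x + L x (\<partial> u \<xi> x)"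
    using pd_bilinear_field(1)[where B=B and \<xi>=\<xi> and \<eta>="\<lambda>y. 1", OF assms(1,2) bil diff \<xi> one, of u] by (simp add: z)
  show "(\<lambda>y. L y (\<xi> y)) differentiable (at x)"
    using pd_bilinear_field(2)[where B=B and \<xi>=\<xi> and \<eta>="\<lambda>y. 1", OF assms(1,2) bil diff \<xi> one] by (simp add: z)
qed

lemma td_linear_field:
  fixes L :: "'x::euclidean_space \<Rightarrow> 'a::euclidean_space \<Rightarrow> 'c::real_normed_vector"
  assumes "open S" and lin: "\<And>y. y \<in> S \<Longrightarrow> linear (L y)"
    and L: "\<And>a. td k S (\<lambda>y. L y a)" and \<xi>: "td k S \<xi>"
  shows "td k S (\<lambda>y. L y (\<xi> y))"
proof (rule td_cong[OF assms(1)])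
  show "td k S (\<lambda>y. \<Sum>i\<in>Basis. (\<xi> y \<bullet> i) *\<^sub>R L y i)"
    by (rule td_sum[OF assms(1)], rule td_scaleR[OF assms(1) td_inner[OF assms(1) \<xi> td_const] L])
  show "(\<Sum>i\<in>Basis. (\<xi> y \<bullet> i) *\<^sub>R L y i) = L y (\<xi> y)" if "y \<in> S" for y
  proof -
    have "L y (\<Sum>i\<in>Basis. (\<xi> y \<bullet> i) *\<^sub>R i) = (\<Sum>i\<in>Basis. (\<xi> y \<bullet> i) *\<^sub>R L y i)"
      using lin[OF that] by (simp add: linear_sum linear_scale)
    then show ?thesis by (simp add: euclidean_representation)
  qed
qed

lemma smooth_on_linear_field:
  fixes L :: "'x::euclidean_space \<Rightarrow> 'a::euclidean_space \<Rightarrow> 'c::real_normed_vector"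
  assumes "open S" and "\<And>y. y \<in> S \<Longrightarrow> linear (L y)"
    and "\<And>a. smooth_on S (\<lambda>y. L y a)" and "smooth_on S \<xi>"
  shows "smooth_on S (\<lambda>y. L y (\<xi> y))"
  using td_linear_field[OF assms(1,2)] assms(3,4) unfolding smooth_on_def by simp

lemma smooth_on_bilinear_field:
  fixes B :: "'x::euclidean_space \<Rightarrow> 'a::euclidean_space \<Rightarrow> 'b::euclidean_space \<Rightarrow> 'c::real_normed_vector"
  assumes "open S" and bil: "\<And>y. y \<in> S \<Longrightarrow> bilinear (B y)"
    and B: "\<And>a b. smooth_on S (\<lambda>y. B y a b)" and \<xi>: "smooth_on S \<xi>" and \<eta>: "smooth_on S \<eta>"
  shows "smooth_on S (\<lambda>y. B y (\<xi> y) (\<eta> y))"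
proof -
  have "smooth_on S (\<lambda>y. B y a (\<eta> y))" for a
    by (rule smooth_on_linear_field[OF assms(1) _ B \<eta>]) (use bil in \<open>simp add: bilinear_def\<close>)
  with \<xi> show ?thesis
    by (intro smooth_on_linear_field[where L="\<lambda>y a. B y a (\<eta> y)" and \<xi>=\<xi>, OF assms(1)])
      (use bil in \<open>simp_all add: bilinear_def\<close>)
qed

subsection \<open>Smooth solutions of linear systems\<close>

text \<open>A product is differentiable at a zero of a differentiable factor even if the other factor is merely
  continuous. This is what lets a solution of a linear system gain its first derivative.\<close>

lemma has_derivative_scaleR_vanishing:
  fixes e :: "'x::real_normed_vector \<Rightarrow> 'b::real_normed_vector"
  assumes c: "isCont c x0" and e: "(e has_derivative e') (at x0)" and "e x0 = 0"
  shows "((\<lambda>x. c x *\<^sub>R e x) has_derivative (\<lambda>v. c x0 *\<^sub>R e' v)) (at x0)"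
proof -
  have "bounded_linear e'"
    using e by (rule has_derivative_bounded_linear)
  then obtain K where K: "\<And>v. norm (e' v) \<le> norm v * K" and "0 < K"
    using bounded_linear.pos_bounded by blast
  obtain d where "0 < d" and d: "\<And>y. norm (y - x0) < d \<Longrightarrow> norm (e y - e x0 - e' (y - x0)) \<le> 1 * norm (y - x0)"
    using e unfolding has_derivative_at_alt by (meson zero_less_one)
  have bound: "norm (e y) \<le> (K + 1) * norm (y - x0)" if "norm (y - x0) < d" for y
    using norm_triangle_ineq[of "e y - e' (y - x0)" "e' (y - x0)"] d[OF that] K[of "y - x0"]
    by (simp add: \<open>e x0 = 0\<close> algebra_simps)
  have "((\<lambda>x. (c x - c x0) *\<^sub>R e x) has_derivative (\<lambda>v. 0)) (at x0)"
    unfolding has_derivative_at_alt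
  proof (intro conjI allI impI)
    fix r :: real assume "0 < r"
    then have "0 < r / (K + 1)" using \<open>0 < K\<close> by simp
    then obtain d' where "0 < d'" and d': "\<And>y. norm (y - x0) < d' \<Longrightarrow> norm (c y - c x0) < r / (K + 1)"
      using c unfolding continuous_at_eps_delta dist_norm by metis
    have "norm ((c y - c x0) *\<^sub>R e y - (c x0 - c x0) *\<^sub>R e x0 - 0) \<le> r * norm (y - x0)"
      if "norm (y - x0) < min d d'" for y
    proof -
      have "norm ((c y - c x0) *\<^sub>R e y) \<le> (r / (K + 1)) * ((K + 1) * norm (y - x0))"
        unfolding norm_scaleR using that d'[of y] bound[of y] \<open>0 < r / (K + 1)\<close>
        by (intro mult_mono) auto
      then show ?thesis using \<open>0 < K\<close> by simp
    qed
    then show "\<exists>d>0. \<forall>y. norm (y - x0) < d \<longrightarrow>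
        norm ((c y - c x0) *\<^sub>R e y - (c x0 - c x0) *\<^sub>R e x0 - 0) \<le> r * norm (y - x0)"
      using \<open>0 < d\<close> \<open>0 < d'\<close> by (intro exI[of _ "min d d'"]) auto
  qed simp
  from has_derivative_add[OF has_derivative_scaleR_right[OF e, of "c x0"] this] show ?thesis
    by (simp add: scaleR_left_diff_distrib)
qed

text \<open>Injectivity bounds \<open>L x0\<close> below, and \<open>L x\<close> is a small perturbation of it, so that
  \<open>w x - w x0\<close> is controlled by the defect \<open>\<beta> x - L x (w x0)\<close>, which tends to 0.\<close>

lemma linear_solution_continuous:
  fixes L :: "'x::euclidean_space \<Rightarrow> 'a::euclidean_space \<Rightarrow> 'b::euclidean_space"
  assumes S: "open S" and lin: "\<And>x. x \<in> S \<Longrightarrow> linear (L x)" and inj: "\<And>x. x \<in> S \<Longrightarrow> inj (L x)"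
    and eq: "\<And>x. x \<in> S \<Longrightarrow> L x (w x) = \<beta> x"
    and x0: "x0 \<in> S" and Lc: "\<And>a. continuous_on S (\<lambda>x. L x a)" and bc: "continuous_on S \<beta>"
  shows "isCont w x0"
proof -
    obtain m where "0 < m" and m: "\<And>v. m * norm v \<le> norm (L x0 v)"
      using linear_inj_bounded_below_pos[OF lin[OF x0] inj[OF x0]] by blast
    define \<epsilon> where "\<epsilon> x = (\<Sum>a\<in>Basis. norm (L x a - L x0 a))" for x
    define \<rho> where "\<rho> x = \<beta> x - L x (w x0)" for x
    have at: "at x0 within S = at x0"
      using S x0 by (rule at_within_open[rotated])
    have "(\<epsilon> \<longlongrightarrow> \<epsilon> x0) (at x0)"
      using Lc x0 unfolding \<epsilon>_def continuous_on_def at[symmetric]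
      by (intro tendsto_intros) auto
    moreover have "\<epsilon> x0 = 0" by (simp add: \<epsilon>_def)
    ultimately have "\<forall>\<^sub>F x in at x0. \<epsilon> x < m / 2"
      using \<open>0 < m\<close> by (intro order_tendstoD(2)) auto
    moreover have "\<forall>\<^sub>F x in at x0. x \<in> S"
      using S x0 by (rule eventually_at_in_open')
    ultimately have ev: "\<forall>\<^sub>F x in at x0. norm (w x - w x0) \<le> (2 / m) * norm (\<rho> x)"
    proof eventually_elim
      case (elim x)
      define v where "v = w x - w x0"
      have "L x v = \<rho> x"
        unfolding v_def \<rho>_def using lin[OF elim(2)] eq[OF elim(2)] by (simp add: linear_diff)
      have "L x v - L x0 v = (\<Sum>a\<in>Basis. (v \<bullet> a) *\<^sub>R (L x a - L x0 a))"
      proof -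
        have "L x (\<Sum>a\<in>Basis. (v \<bullet> a) *\<^sub>R a) - L x0 (\<Sum>a\<in>Basis. (v \<bullet> a) *\<^sub>R a)
            = (\<Sum>a\<in>Basis. (v \<bullet> a) *\<^sub>R (L x a - L x0 a))"
          using lin[OF elim(2)] lin[OF x0]
          by (simp add: linear_sum linear_scale scaleR_diff_right sum_subtractf)
        then show ?thesis by (simp add: euclidean_representation)
      qed
      then have "norm (L x v - L x0 v) \<le> (\<Sum>a\<in>Basis. norm v * norm (L x a - L x0 a))"
        by (auto intro!: sum_norm_le mult_right_mono Basis_le_norm)
      also have "\<dots> = norm v * \<epsilon> x"
        by (simp add: \<epsilon>_def sum_distrib_left)
      also have "\<dots> \<le> norm v * (m / 2)"
        using elim(1) by (intro mult_left_mono) auto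
      finally have "norm (L x0 v) \<le> norm (\<rho> x) + norm v * (m / 2)"
        using norm_triangle_ineq3[of "L x0 v" "L x v"] \<open>L x v = \<rho> x\<close> by (simp add: norm_minus_commute)
      then have "m / 2 * norm v \<le> norm (\<rho> x)"
        using m[of v] by (simp add: algebra_simps)
      then show ?case
        using \<open>0 < m\<close> unfolding v_def by (simp add: field_simps)
    qed
    have "((\<lambda>x. (2 / m) * norm (\<rho> x)) \<longlongrightarrow> (2 / m) * norm (\<rho> x0)) (at x0)"
      using Lc bc x0 unfolding \<rho>_def continuous_on_def at[symmetric]
      by (intro tendsto_intros) auto
    moreover have "\<rho> x0 = 0"
      using eq[OF x0] by (simp add: \<rho>_def)
    ultimately have lim: "((\<lambda>x. (2 / m) * norm (\<rho> x)) \<longlongrightarrow> 0) (at x0)"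
      by (simp only: norm_zero mult_zero_right)
    have "((\<lambda>x. w x - w x0) \<longlongrightarrow> 0) (at x0)"
      by (rule Lim_null_comparison[OF ev lim])
    from LIM_zero_cancel[OF this] show ?thesis
      unfolding isCont_def .
qed

text \<open>With a left inverse \<open>g\<close> of \<open>L x0\<close> the solution reads
  \<open>w x = g (\<beta> x - (L x - L x0) (w x))\<close>; here \<open>L x - L x0\<close> vanishes at \<open>x0\<close>, so
  that continuity of \<open>w\<close> suffices on the right.\<close>

lemma linear_solution_differentiable:
  fixes L :: "'x::euclidean_space \<Rightarrow> 'a::euclidean_space \<Rightarrow> 'b::euclidean_space"
  assumes S: "open S" and lin: "\<And>x. x \<in> S \<Longrightarrow> linear (L x)" and inj: "\<And>x. x \<in> S \<Longrightarrow> inj (L x)"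
    and eq: "\<And>x. x \<in> S \<Longrightarrow> L x (w x) = \<beta> x"
    and x0: "x0 \<in> S" and Ld: "\<And>a. td (Suc 0) S (\<lambda>x. L x a)" and bd: "td (Suc 0) S \<beta>"
  shows "w differentiable (at x0)"
proof -
    have c: "isCont w x0"
      by (rule linear_solution_continuous[where L=L and w=w and \<beta>=\<beta>,
            OF S lin inj eq x0 td_continuous[OF Ld] td_continuous[OF bd]])
    obtain g where g: "linear g" "g \<circ> L x0 = id"
      using linear_injective_left_inverse[OF lin[OF x0] inj[OF x0]] by blast
    have "(\<lambda>x. (w x \<bullet> a) *\<^sub>R (L x a - L x0 a)) differentiable (at x0)" for a
    proof -
      have "(\<lambda>x. L x a - L x0 a) differentiable (at x0)"
        using Ld x0 by simp
      from has_derivative_scaleR_vanishing[OF _ pd_has_derivative[OF this], of "\<lambda>x. w x \<bullet> a"]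
      show ?thesis
        using c by (intro differentiableI) auto
    qed
    then have "(\<lambda>x. \<beta> x - (\<Sum>a\<in>Basis. (w x \<bullet> a) *\<^sub>R (L x a - L x0 a))) differentiable (at x0)"
      using bd x0 by (intro differentiable_diff differentiable_sum) auto
    then have "(\<lambda>x. g (\<beta> x - (\<Sum>a\<in>Basis. (w x \<bullet> a) *\<^sub>R (L x a - L x0 a)))) differentiable (at x0)"
      by (rule pd_bounded_linear(2)[rotated]) (use g in \<open>simp add: linear_conv_bounded_linear\<close>)
    moreover have "g (\<beta> x - (\<Sum>a\<in>Basis. (w x \<bullet> a) *\<^sub>R (L x a - L x0 a))) = w x" if "x \<in> S" for x
    proof -
      have "(\<Sum>a\<in>Basis. (w x \<bullet> a) *\<^sub>R (L x a - L x0 a)) =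
          L x (\<Sum>a\<in>Basis. (w x \<bullet> a) *\<^sub>R a) - L x0 (\<Sum>a\<in>Basis. (w x \<bullet> a) *\<^sub>R a)"
        using lin[OF that] lin[OF x0]
        by (simp add: linear_sum linear_scale scaleR_diff_right sum_subtractf)
      also have "\<dots> = \<beta> x - L x0 (w x)"
        using eq[OF that] by (simp add: euclidean_representation)
      finally show ?thesis
        using g(2) by (simp add: o_def fun_eq_iff)
    qed
    ultimately show ?thesis
      by (rule differentiable_cong[OF S x0, rotated])
qed

text \<open>Differentiating \<open>L x (w x) = \<beta> x\<close> gives a linear system for \<open>\<partial> v w\<close> with the same
  operators \<open>L x\<close> and a right-hand side that involves \<open>w\<close> itself only. So each induction step
  raises the differentiability of \<open>w\<close> by one, and no formula for the inverse of \<open>L x\<close> is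
  needed.\<close>

lemma td_linear_solution:
  fixes L :: "'x::euclidean_space \<Rightarrow> 'a::euclidean_space \<Rightarrow> 'b::euclidean_space"
  assumes S: "open S" and lin: "\<And>x. x \<in> S \<Longrightarrow> linear (L x)" and inj: "\<And>x. x \<in> S \<Longrightarrow> inj (L x)"
    and eq: "\<And>x. x \<in> S \<Longrightarrow> L x (w x) = \<beta> x"
    and L: "\<And>a. td k S (\<lambda>x. L x a)" and \<beta>: "td k S \<beta>"
  shows "td k S w"
  using L \<beta> eq
proof (induction k arbitrary: w \<beta>)
  case 0
  have "isCont w x" if "x \<in> S" for x
    using 0 by (intro linear_solution_continuous[where L=L and w=w and \<beta>=\<beta>, OF S lin inj 0(3) that]) simp_all
  then show ?case
    by (simp add: continuous_at_imp_continuous_on)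
next
  case (Suc k)
  have Suc0: "td (Suc 0) S h" if "td (Suc k) S h" for h :: "'x \<Rightarrow> 'b"
    using that by (auto intro: td_continuous)
  have dw: "w differentiable (at x)" if "x \<in> S" for x
    by (rule linear_solution_differentiable[where L=L and w=w and \<beta>=\<beta>, OF S lin inj Suc.prems(3) that
        Suc0[OF Suc.prems(1)] Suc0[OF Suc.prems(2)]])
  have dL: "(\<lambda>x. L x a) differentiable (at x)" if "x \<in> S" for a x
    using Suc.prems(1) that by simp
  have w: "td k S w"
    by (rule Suc.IH[where w=w and \<beta>=\<beta>, OF td_SucD[OF Suc.prems(1)] td_SucD[OF Suc.prems(2)] Suc.prems(3)])
  have "td k S (\<partial> v w)" for v
  proof (rule Suc.IH[where w="\<partial> v w" and \<beta>="\<lambda>x. \<partial> v \<beta> x - \<partial> v (\<lambda>y. L y (w x)) x"])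
    show "td k S (\<lambda>x. L x a)" for a
      by (rule td_SucD[OF Suc.prems(1)])
    show "td k S (\<lambda>x. \<partial> v \<beta> x - \<partial> v (\<lambda>y. L y (w x)) x)"
    proof -
      have "td k S (\<lambda>x. \<partial> v (\<lambda>y. L y (w x)) x)"
      proof (rule td_linear_field[where L="\<lambda>x a. \<partial> v (\<lambda>y. L y a) x" and \<xi>=w, OF S _ _ w])
        show "td k S (\<lambda>x. \<partial> v (\<lambda>y. L y a) x)" for a
          using Suc.prems(1)[of a] by simp
        show "linear (\<lambda>a. \<partial> v (\<lambda>y. L y a) x)" if "x \<in> S" for x
        proof (rule linearI)
          show "\<partial> v (\<lambda>y. L y (a + b)) x = \<partial> v (\<lambda>y. L y a) x + \<partial> v (\<lambda>y. L y b) x" for a b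
            using pd_cong[OF S that, of "\<lambda>y. L y (a + b)" "\<lambda>y. L y a + L y b", where v=v]
              pd_add[OF dL[OF that, of a] dL[OF that, of b], where v=v] lin[OF that] lin by (simp add: linear_add)
          show "\<partial> v (\<lambda>y. L y (r *\<^sub>R a)) x = r *\<^sub>R \<partial> v (\<lambda>y. L y a) x" for r a
            using pd_cong[OF S that, of "\<lambda>y. L y (r *\<^sub>R a)" "\<lambda>y. r *\<^sub>R L y a", where v=v]
              pd_bounded_linear(1)[OF bounded_linear_scaleR_right[of r] dL[OF that, of a], where v=v] lin
            by (simp add: linear_scale)
        qed
      qed
      moreover have "td k S (\<partial> v \<beta>)"
        using Suc.prems(2) by simp
      moreover have "td k S (\<lambda>x. - h x)" if "td k S h" for h :: "'x \<Rightarrow> 'b"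
        by (rule td_bounded_linear[OF bounded_linear_minus[OF bounded_linear_ident] S that])
      ultimately show ?thesis
        using td_add[OF S, of k "\<partial> v \<beta>" "\<lambda>x. - \<partial> v (\<lambda>y. L y (w x)) x"] by simp
    qed
    show "L x (\<partial> v w x) = \<partial> v \<beta> x - \<partial> v (\<lambda>y. L y (w x)) x" if "x \<in> S" for x
      using pd_cong[OF S that Suc.prems(3), where v=v] pd_linear_field(1)[where L=L and \<xi>=w, OF S that lin dL[OF that] dw[OF that], where u=v]
      by simp
  qed
  then show ?case
    by (rule td_SucI[OF _ dw])
qed

lemma smooth_on_linear_solution:
  fixes L :: "'x::euclidean_space \<Rightarrow> 'a::euclidean_space \<Rightarrow> 'b::euclidean_space"
  assumes "open S" and "\<And>x. x \<in> S \<Longrightarrow> linear (L x)" and "\<And>x. x \<in> S \<Longrightarrow> inj (L x)"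
    and "\<And>x. x \<in> S \<Longrightarrow> L x (w x) = \<beta> x"
    and "\<And>a. smooth_on S (\<lambda>x. L x a)" and "smooth_on S \<beta>"
  shows "smooth_on S w"
  unfolding smooth_on_def
proof
  fix k
  show "td k S w"
  proof (rule td_linear_solution[where L=L and w=w and \<beta>=\<beta>, OF assms(1-4)])
    show "td k S (\<lambda>x. L x a)" for a
      using assms(5)[of a] unfolding smooth_on_def ..
    show "td k S \<beta>"
      using assms(6) unfolding smooth_on_def ..
  qed
qed


subsection \<open>Symmetry of second derivatives\<close>

lemma has_real_derivative_along_line:
  fixes f :: "'a::real_normed_vector \<Rightarrow> real"
  assumes "f differentiable (at (p + r *\<^sub>R u))"
  shows "((\<lambda>r. f (p + r *\<^sub>R u)) has_real_derivative \<partial> u f (p + r *\<^sub>R u)) (at r)"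
proof -
  have "((\<lambda>r. p + r *\<^sub>R u) has_derivative (\<lambda>h. h *\<^sub>R u)) (at r)"
    by (auto intro!: derivative_eq_intros)
  from diff_chain_at[OF this, of f, OF pd_has_derivative[OF assms]]
  have "((\<lambda>r. f (p + r *\<^sub>R u)) has_derivative (\<lambda>h. \<partial> (h *\<^sub>R u) f (p + r *\<^sub>R u))) (at r)"
    by (simp add: o_def)
  moreover have "(\<lambda>h. \<partial> (h *\<^sub>R u) f (p + r *\<^sub>R u)) = (*) (\<partial> u f (p + r *\<^sub>R u))"
    using pd_linear[OF assms] by (simp add: linear_scale fun_eq_iff)
  ultimately show ?thesis
    unfolding has_field_derivative_def by (simp only:)
qed

text \<open>The second difference over a parallelogram is, by two applications of the mean value theorem, a mixed
  second derivative at a nearby point. It is symmetric in \<open>u\<close> and \<open>v\<close>, whence so is the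
  limit.\<close>

lemma second_difference:
  fixes f :: "'a::real_normed_vector \<Rightarrow> real"
  assumes "0 < s" and e: "s * (norm u + norm v) < e"
    and f: "\<And>q. q \<in> ball x e \<Longrightarrow> f differentiable (at q)"
    and f': "\<And>q. q \<in> ball x e \<Longrightarrow> \<partial> u f differentiable (at q)"
  shows "\<exists>q. dist x q \<le> s * (norm u + norm v) \<and>
    f (x + s *\<^sub>R u + s *\<^sub>R v) - f (x + s *\<^sub>R u) - f (x + s *\<^sub>R v) + f x = s * (s * \<partial> v (\<partial> u f) q)"
proof -
  have dist: "dist x (x + r *\<^sub>R u + t *\<^sub>R v) \<le> s * (norm u + norm v)"
    if "0 \<le> r" "r \<le> s" "0 \<le> t" "t \<le> s" for r t
  proof -
    have "dist x (x + r *\<^sub>R u + t *\<^sub>R v) = norm (r *\<^sub>R u + t *\<^sub>R v)"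
      by (metis add.assoc add_diff_cancel_left' dist_commute dist_norm)
    also have "\<dots> \<le> r * norm u + t * norm v"
      using norm_triangle_ineq[of "r *\<^sub>R u" "t *\<^sub>R v"] that by simp
    also have "\<dots> \<le> s * norm u + s * norm v"
      using that by (intro add_mono mult_right_mono) auto
    finally show ?thesis by (simp add: algebra_simps)
  qed
  then have ball: "x + r *\<^sub>R u + t *\<^sub>R v \<in> ball x e"
    if "0 \<le> r" "r \<le> s" "0 \<le> t" "t \<le> s" for r t
    using order_le_less_trans[OF dist[OF that] e] by simp
  have ball0: "x + r *\<^sub>R u \<in> ball x e" if "0 \<le> r" "r \<le> s" for r
    using ball[of r 0] that assms(1) by simp
  define g where "g r = f ((x + s *\<^sub>R v) + r *\<^sub>R u) - f (x + r *\<^sub>R u)" for r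
  have "(g has_real_derivative (\<partial> u f ((x + s *\<^sub>R v) + r *\<^sub>R u) - \<partial> u f (x + r *\<^sub>R u))) (at r)"
    if "0 \<le> r" "r \<le> s" for r
    unfolding g_def using ball[OF that, of s] ball0[OF that] assms(1)
    by (intro DERIV_diff has_real_derivative_along_line f) (simp_all add: algebra_simps)
  from MVT2[OF assms(1) this] obtain \<xi> where \<xi>: "0 < \<xi>" "\<xi> < s"
    and g: "g s - g 0 = (s - 0) * (\<partial> u f ((x + s *\<^sub>R v) + \<xi> *\<^sub>R u) - \<partial> u f (x + \<xi> *\<^sub>R u))"
    by blast
  define k where "k t = \<partial> u f ((x + \<xi> *\<^sub>R u) + t *\<^sub>R v)" for t
  have "(k has_real_derivative \<partial> v (\<partial> u f) ((x + \<xi> *\<^sub>R u) + t *\<^sub>R v)) (at t)"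
    if "0 \<le> t" "t \<le> s" for t
    unfolding k_def using ball[of \<xi> t] that \<xi>
    by (intro has_real_derivative_along_line f') simp
  from MVT2[OF assms(1) this] obtain \<eta> where \<eta>: "0 < \<eta>" "\<eta> < s"
    and k: "k s - k 0 = (s - 0) * \<partial> v (\<partial> u f) ((x + \<xi> *\<^sub>R u) + \<eta> *\<^sub>R v)"
    by blast
  have swap: "x + \<xi> *\<^sub>R u + s *\<^sub>R v = (x + s *\<^sub>R v) + \<xi> *\<^sub>R u"
    "x + s *\<^sub>R u + s *\<^sub>R v = (x + s *\<^sub>R v) + s *\<^sub>R u"
    by (simp_all add: algebra_simps)
  have "f (x + s *\<^sub>R u + s *\<^sub>R v) - f (x + s *\<^sub>R u) - f (x + s *\<^sub>R v) + f x = g s - g 0"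
    by (simp add: g_def swap)
  also have "\<dots> = s * (k s - k 0)"
    unfolding g k_def by (simp add: swap)
  finally show ?thesis
    unfolding k using dist[of \<xi> \<eta>] \<xi> \<eta> by auto
qed

lemma pd_commute_real:
  fixes f :: "'a::euclidean_space \<Rightarrow> real"
  assumes "open S" "x \<in> S" "smooth_on S f"
  shows "\<partial> u (\<partial> v f) x = \<partial> v (\<partial> u f) x"
proof (rule ccontr)
  assume neq: "\<partial> u (\<partial> v f) x \<noteq> \<partial> v (\<partial> u f) x"
  define d where "d = \<bar>\<partial> u (\<partial> v f) x - \<partial> v (\<partial> u f) x\<bar> / 2"
  have "0 < d" using neq by (simp add: d_def)
  have cont: "isCont (\<partial> u (\<partial> v f)) x" for u v
    using smooth_onD(3)[OF smooth_onD(2)[OF smooth_onD(2)[OF assms(3)]]] assms(1,2)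
    by (simp add: continuous_on_eq_continuous_at)
  have near: "\<exists>e>0. \<forall>q. dist x q < e \<longrightarrow> \<bar>\<partial> u (\<partial> v f) q - \<partial> u (\<partial> v f) x\<bar> < d" for u v
    using cont[where u=u and v=v] \<open>0 < d\<close> unfolding continuous_at_eps_delta dist_real_def
    by (simp add: dist_commute)
  obtain e1 where e1: "0 < e1" "\<And>q. dist x q < e1 \<Longrightarrow> \<bar>\<partial> u (\<partial> v f) q - \<partial> u (\<partial> v f) x\<bar> < d"
    using near[where u=u and v=v] by blast
  obtain e2 where e2: "0 < e2" "\<And>q. dist x q < e2 \<Longrightarrow> \<bar>\<partial> v (\<partial> u f) q - \<partial> v (\<partial> u f) x\<bar> < d"
    using near[where u=v and v=u] by blast
  obtain e3 where e3: "0 < e3" "ball x e3 \<subseteq> S"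
    using assms(1,2) open_contains_ball by blast
  define e where "e = min e1 (min e2 e3)"
  have "0 < e" using e1 e2 e3 by (simp add: e_def)
  define s where "s = e / (2 * (norm u + norm v + 1))"
  have "0 < norm u + norm v + 1"
    using norm_ge_zero[of u] norm_ge_zero[of v] by linarith
  then have "0 < s" using \<open>0 < e\<close> by (simp add: s_def)
  have "s * (norm u + norm v) < s * (2 * (norm u + norm v + 1))"
  proof (rule mult_strict_left_mono[OF _ \<open>0 < s\<close>])
    have *: "0 \<le> c \<Longrightarrow> c < 2 * (c + 1)" for c :: real
      unfolding distrib_left by linarith
    show "norm u + norm v < 2 * (norm u + norm v + 1)"
      by (rule *) simp
  qed
  also have "\<dots> = e"
    using \<open>0 < norm u + norm v + 1\<close> by (simp add: s_def)
  finally have se: "s * (norm u + norm v) < e" .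
  have f: "f differentiable (at q)" "\<partial> w f differentiable (at q)" if "q \<in> ball x e" for q w
    using that e3(2) smooth_onD(1)[OF assms(3)] smooth_onD(1)[OF smooth_onD(2)[OF assms(3)]]
    by (auto simp: e_def)
  obtain q1 where q1: "dist x q1 \<le> s * (norm u + norm v)"
    "f (x + s *\<^sub>R u + s *\<^sub>R v) - f (x + s *\<^sub>R u) - f (x + s *\<^sub>R v) + f x = s * (s * \<partial> v (\<partial> u f) q1)"
    using second_difference[OF \<open>0 < s\<close> se f(1) f(2)[of _ u]] by blast
  have se': "s * (norm v + norm u) < e"
    using se by (simp add: add.commute)
  obtain q2 where q2: "dist x q2 \<le> s * (norm v + norm u)"
    "f (x + s *\<^sub>R v + s *\<^sub>R u) - f (x + s *\<^sub>R v) - f (x + s *\<^sub>R u) + f x = s * (s * \<partial> u (\<partial> v f) q2)"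
    using second_difference[OF \<open>0 < s\<close> se' f(1) f(2)[of _ v]] by blast
  have "s * (s * \<partial> v (\<partial> u f) q1) = s * (s * \<partial> u (\<partial> v f) q2)"
    unfolding q1(2)[symmetric] q2(2)[symmetric] by (simp add: add.commute add.left_commute)
  then have "\<partial> v (\<partial> u f) q1 = \<partial> u (\<partial> v f) q2"
    using \<open>0 < s\<close> by simp
  moreover have "\<bar>\<partial> u (\<partial> v f) q2 - \<partial> u (\<partial> v f) x\<bar> < d"
    by (rule e1(2)) (use order_le_less_trans[OF q2(1) se'] in \<open>simp add: e_def\<close>)
  moreover have "\<bar>\<partial> v (\<partial> u f) q1 - \<partial> v (\<partial> u f) x\<bar> < d"
    by (rule e2(2)) (use order_le_less_trans[OF q1(1) se] in \<open>simp add: e_def\<close>)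
  moreover have "\<not> (\<bar>p - a\<bar> < \<bar>a - b\<bar> / 2 \<and> \<bar>p - b\<bar> < \<bar>a - b\<bar> / 2)" for p a b :: real
    by (cases "a \<le> b") (auto simp: abs_if split: if_splits)
  ultimately show False
    unfolding d_def by metis
qed

lemma pd_commute:
  fixes f :: "'a::euclidean_space \<Rightarrow> 'b::euclidean_space"
  assumes "open S" "x \<in> S" "smooth_on S f"
  shows "\<partial> u (\<partial> v f) x = \<partial> v (\<partial> u f) x"
proof (rule euclidean_eqI)
  fix b :: 'b assume "b \<in> Basis"
  have L: "bounded_linear (\<lambda>y::'b. y \<bullet> b)"
    by (rule bounded_linear_inner_left)
  have sm: "smooth_on S (\<lambda>y. f y \<bullet> b)"
    by (rule smooth_on_bounded_linear[OF L assms(1,3)])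
  have 1: "\<partial> v (\<lambda>y. f y \<bullet> b) y = \<partial> v f y \<bullet> b" if "y \<in> S" for v y
    by (rule pd_bounded_linear(1)[OF L smooth_onD(1)[OF assms(3) that]])
  have 2: "\<partial> u (\<partial> v (\<lambda>y. f y \<bullet> b)) x = \<partial> u (\<partial> v f) x \<bullet> b" for u v
  proof -
    have "\<partial> u (\<partial> v (\<lambda>y. f y \<bullet> b)) x = \<partial> u (\<lambda>y. \<partial> v f y \<bullet> b) x"
      by (rule pd_cong[OF assms(1,2) 1])
    also have "\<dots> = \<partial> u (\<partial> v f) x \<bullet> b"
      by (rule pd_bounded_linear(1)[OF L smooth_onD(1)[OF smooth_onD(2)[OF assms(3)] assms(2)]])
    finally show ?thesis .
  qed
  show "\<partial> u (\<partial> v f) x \<bullet> b = \<partial> v (\<partial> u f) x \<bullet> b"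
    using pd_commute_real[OF assms(1,2) sm, where u=u and v=v] unfolding 2 .
qed

subsection \<open>Reciprocals, square roots and lifts through immersions\<close>

lemma smooth_on_inverse:
  fixes f :: "'a::euclidean_space \<Rightarrow> real"
  assumes "open S" "smooth_on S f" "\<And>x. x \<in> S \<Longrightarrow> f x \<noteq> 0"
  shows "smooth_on S (\<lambda>x. inverse (f x))"
proof (rule smooth_on_linear_solution[where L="\<lambda>x a. f x * a" and \<beta>="\<lambda>x. 1", OF assms(1)])
  show "linear (\<lambda>a. f x * a)" for x
    by (auto intro!: linearI simp: algebra_simps)
  show "inj (\<lambda>a. f x * a)" if "x \<in> S" for x
    using assms(3)[OF that] by (auto intro: injI)
  show "smooth_on S (\<lambda>x. f x * a)" for a
    by (rule smooth_on_mult[OF assms(1,2) smooth_on_const])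
  show "f x * inverse (f x) = 1" if "x \<in> S" for x
    using assms(3)[OF that] by simp
qed (rule smooth_on_const)

text \<open>The derivative of \<open>sqrt f\<close> solves the linear equation \<open>2 sqrt f * w = \<partial> v f\<close>, whose
  coefficient needs one derivative less than is to be proved.\<close>

lemma td_sqrt:
  fixes f :: "'a::euclidean_space \<Rightarrow> real"
  assumes S: "open S" and "td k S f" and pos: "\<And>x. x \<in> S \<Longrightarrow> 0 < f x"
  shows "td k S (\<lambda>x. sqrt (f x))"
  using assms(2)
proof (induction k)
  case 0
  then show ?case by (auto intro: continuous_on_real_sqrt)
next
  case (Suc k)
  have der: "((\<lambda>x. sqrt (f x)) has_derivative (\<lambda>v. \<partial> v f x * (inverse (sqrt (f x)) / 2))) (at x)"
    if "x \<in> S" for x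
  proof -
    have "f differentiable (at x)"
      using Suc.prems that by simp
    from has_derivative_real_sqrt[where g=f, OF pos[OF that] pd_has_derivative[OF this]]
    show ?thesis .
  qed
  have D: "(\<lambda>x. sqrt (f x)) differentiable (at x)" if "x \<in> S" for x
    using der[OF that] by (rule differentiableI)
  have sq: "td k S (\<lambda>x. sqrt (f x))"
    by (rule Suc.IH[OF td_SucD[OF Suc.prems]])
  have A: "td k S (\<partial> v (\<lambda>x. sqrt (f x)))" for v
  proof (rule td_linear_solution[where L="\<lambda>x a. (2 * sqrt (f x)) * a" and \<beta>="\<partial> v f", OF S])
    show "linear (\<lambda>a. (2 * sqrt (f x)) * a)" for x
      by (auto intro!: linearI simp: algebra_simps)
    show "inj (\<lambda>a. (2 * sqrt (f x)) * a)" if "x \<in> S" for x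
      using pos[OF that] by (auto intro: injI)
    show "td k S (\<lambda>x. (2 * sqrt (f x)) * a)" for a
      by (rule td_mult[OF S td_mult[OF S td_const sq] td_const])
    show "(2 * sqrt (f x)) * \<partial> v (\<lambda>x. sqrt (f x)) x = \<partial> v f x" if "x \<in> S" for x
      unfolding pd_eqI[OF der[OF that]] using pos[OF that] by simp
    show "td k S (\<partial> v f)"
      using Suc.prems by simp
  qed
  show ?case
    by (rule td_SucI; (rule A | rule D))
qed

lemma smooth_on_sqrt:
  fixes f :: "'a::euclidean_space \<Rightarrow> real"
  assumes "open S" "smooth_on S f" "\<And>x. x \<in> S \<Longrightarrow> 0 < f x"
  shows "smooth_on S (\<lambda>x. sqrt (f x))"
  using assms(2) td_sqrt[OF assms(1) _ assms(3)] unfolding smooth_on_def by simp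

text \<open>A map into a submanifold that is smooth as a map into the surrounding space is smooth in the
  coordinates of the submanifold. Let \<open>g\<close> be a left inverse of the derivative \<open>K\<close> of
  \<open>k\<close> at \<open>F x0\<close>. Then \<open>F x - F x0 = g (k (F x) - k (F x0)) - g (r x)\<close>, where the remainder
  \<open>r x\<close> is small compared with \<open>F x - F x0\<close>; absorbing it shows that \<open>F\<close> is Lipschitz at
  \<open>x0\<close>, and then that the remainder has derivative 0.\<close>

lemma differentiable_lift:
  fixes k :: "'d::euclidean_space \<Rightarrow> 'b::euclidean_space" and F :: "'x::euclidean_space \<Rightarrow> 'd"
  assumes k: "k differentiable (at (F x0))" and inj: "inj (\<lambda>v. \<partial> v k (F x0))"
    and F: "isCont F x0" and kF: "(\<lambda>x. k (F x)) differentiable (at x0)"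
  shows "F differentiable (at x0)"
proof -
  define K where "K v = \<partial> v k (F x0)" for v
  have K: "linear K" "inj K"
    using pd_linear[OF k] inj unfolding K_def by simp_all
  obtain g where g: "linear g" "g \<circ> K = id"
    using linear_injective_left_inverse[OF K] by blast
  have gK: "g (K v) = v" for v
    using g(2) by (simp add: o_def fun_eq_iff)
  obtain M where M: "0 < M" "\<And>x. norm (g x) \<le> M * norm x"
    using linear_bounded_pos[OF g(1)] by blast
  have lin: "linear (\<lambda>v. \<partial> v (\<lambda>x. k (F x)) x0)"
    by (rule pd_linear[OF kF])
  obtain N where N: "0 < N" "\<And>v. norm (\<partial> v (\<lambda>x. k (F x)) x0) \<le> N * norm v"
    using linear_bounded_pos[OF lin] by blast
  have alt: "\<exists>d>0. \<forall>y. norm (y - F x0) < d \<longrightarrow> norm (k y - k (F x0) - K (y - F x0)) \<le> e * norm (y - F x0)"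
    if "0 < e" for e
    using pd_has_derivative[OF k] that unfolding has_derivative_at_alt K_def by blast
  obtain d1 where d1: "0 < d1" "\<And>x. norm (x - x0) < d1 \<Longrightarrow>
      norm (k (F x) - k (F x0) - \<partial> (x - x0) (\<lambda>x. k (F x)) x0) \<le> 1 * norm (x - x0)"
    using pd_has_derivative[OF kF] unfolding has_derivative_at_alt by (meson zero_less_one)
  have lip: "norm (k (F x) - k (F x0)) \<le> (N + 1) * norm (x - x0)" if "norm (x - x0) < d1" for x
    using d1(2)[OF that] N(2)[of "x - x0"]
      norm_triangle_ineq[of "k (F x) - k (F x0) - \<partial> (x - x0) (\<lambda>x. k (F x)) x0" "\<partial> (x - x0) (\<lambda>x. k (F x)) x0"]
    by (simp add: algebra_simps)
  have near: "\<exists>d>0. \<forall>x. norm (x - x0) < d \<longrightarrow>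
      norm (k (F x) - k (F x0) - K (F x - F x0)) \<le> e * norm (F x - F x0)" if "0 < e" for e
  proof -
    obtain d where "0 < d" and d: "\<And>y. norm (y - F x0) < d \<Longrightarrow>
        norm (k y - k (F x0) - K (y - F x0)) \<le> e * norm (y - F x0)"
      using alt[OF \<open>0 < e\<close>] by blast
    obtain d' where "0 < d'" "\<And>x. norm (x - x0) < d' \<Longrightarrow> norm (F x - F x0) < d"
      using F \<open>0 < d\<close> unfolding continuous_at_eps_delta dist_norm by metis
    then show ?thesis using d by meson
  qed
  define r where "r x = k (F x) - k (F x0) - K (F x - F x0)" for x
  obtain d2 where d2: "0 < d2" "\<And>x. norm (x - x0) < d2 \<Longrightarrow> norm (r x) \<le> 1 / (2 * M) * norm (F x - F x0)"
    using near[of "1 / (2 * M)"] M(1) unfolding r_def by auto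
  have F_eq: "F x - F x0 = g (k (F x) - k (F x0)) - g (r x)" for x
    using g(1) gK by (simp add: r_def linear_diff)
  have Flip: "norm (F x - F x0) \<le> 2 * M * (N + 1) * norm (x - x0)" if "norm (x - x0) < min d1 d2" for x
  proof -
    have "norm (F x - F x0) \<le> norm (g (k (F x) - k (F x0))) + norm (g (r x))"
      unfolding F_eq[of x] by (rule norm_triangle_ineq4)
    also have "\<dots> \<le> M * ((N + 1) * norm (x - x0)) + M * (1 / (2 * M) * norm (F x - F x0))"
      using M(2)[of "k (F x) - k (F x0)"] M(2)[of "r x"] lip[of x] d2(2)[of x] that M(1)
      by (intro add_mono order_trans[OF M(2)] mult_left_mono) auto
    also have "\<dots> = M * ((N + 1) * norm (x - x0)) + norm (F x - F x0) / 2"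
      using M(1) by simp
    finally show ?thesis by (simp add: algebra_simps)
  qed
  have "((\<lambda>x. g (r x)) has_derivative (\<lambda>v. 0)) (at x0)"
    unfolding has_derivative_at_alt
  proof (intro conjI allI impI)
    fix e :: real assume "0 < e"
    define e' where "e' = e / (M * (2 * M * (N + 1)))"
    have "0 < e'" using \<open>0 < e\<close> M(1) N(1) by (simp add: e'_def)
    then obtain d3 where d3: "0 < d3" "\<And>x. norm (x - x0) < d3 \<Longrightarrow> norm (r x) \<le> e' * norm (F x - F x0)"
      using near[of e'] unfolding r_def by auto
    have "norm (g (r x) - g (r x0) - 0) \<le> e * norm (x - x0)" if "norm (x - x0) < min d3 (min d1 d2)" for x
    proof -
      have "r x0 = 0" "g 0 = 0"
        using K(1) g(1) by (simp_all add: r_def linear_0)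
      then have "norm (g (r x) - g (r x0) - 0) \<le> M * norm (r x)"
        using M(2) by simp
      also have "\<dots> \<le> M * (e' * (2 * M * (N + 1) * norm (x - x0)))"
        using d3(2)[of x] Flip[of x] that M(1) \<open>0 < e'\<close>
        by (intro mult_left_mono order_trans[OF d3(2)]) auto
      also have "\<dots> = e * norm (x - x0)"
      proof -
        have "M * (2 * M * (N + 1)) \<noteq> 0"
          using M(1) N(1) by simp
        then have "e' * (M * (2 * M * (N + 1))) = e"
          unfolding e'_def by (rule nonzero_eq_divide_eq[THEN iffD1, OF _ refl])
        then show ?thesis by (simp add: mult.assoc mult.left_commute)
      qed
      finally show ?thesis .
    qed
    then show "\<exists>d>0. \<forall>x. norm (x - x0) < d \<longrightarrow> norm (g (r x) - g (r x0) - 0) \<le> e * norm (x - x0)"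
      using d1(1) d2(1) d3(1) by (intro exI[of _ "min d3 (min d1 d2)"]) auto
  qed simp
  then have gr: "(\<lambda>x. g (r x)) differentiable (at x0)"
    by (rule differentiableI)
  have "bounded_linear g"
    using g(1) by (simp add: linear_conv_bounded_linear)
  moreover have "(\<lambda>x. k (F x) - k (F x0)) differentiable (at x0)"
    using kF by simp
  ultimately have "(\<lambda>x. g (k (F x) - k (F x0))) differentiable (at x0)"
    by (rule pd_bounded_linear(2))
  then have "(\<lambda>x. F x0 + (g (k (F x) - k (F x0)) - g (r x))) differentiable (at x0)"
    using gr by (intro differentiable_add differentiable_diff) simp_all
  moreover have "(\<lambda>x. F x0 + (g (k (F x) - k (F x0)) - g (r x))) = F"
    unfolding F_eq[symmetric] by simp
  ultimately show ?thesis by simp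
qed

text \<open>By the chain rule \<open>\<partial> v F\<close> solves a linear system whose operators are the injective derivatives
  of \<open>k\<close> along \<open>F\<close>, so that the regularity of \<open>F\<close> can be bootstrapped.\<close>

lemma smooth_on_lift:
  fixes k :: "'d::euclidean_space \<Rightarrow> 'b::euclidean_space" and F :: "'x::euclidean_space \<Rightarrow> 'd"
  assumes S: "open \<Omega>" and W: "open W" and FW: "\<And>x. x \<in> \<Omega> \<Longrightarrow> F x \<in> W" and F: "continuous_on \<Omega> F"
    and k: "smooth_on W k" and inj: "\<And>y. y \<in> W \<Longrightarrow> inj (\<lambda>v. \<partial> v k y)"
    and kF: "smooth_on \<Omega> (\<lambda>x. k (F x))"
  shows "smooth_on \<Omega> F"
proof -
  have D: "F differentiable (at x)" if "x \<in> \<Omega>" for x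
    by (rule differentiable_lift[of k])
      (use that S F in \<open>auto intro: smooth_onD(1)[OF k] smooth_onD(1)[OF kF] inj FW simp: continuous_on_eq_continuous_at\<close>)
  have "td n \<Omega> F" for n
  proof (induction n)
    case 0
    then show ?case using F by simp
  next
    case (Suc n)
    have A: "td n \<Omega> (\<partial> v F)" for v
    proof (rule td_linear_solution[where L="\<lambda>x a. \<partial> a k (F x)" and \<beta>="\<partial> v (\<lambda>x. k (F x))", OF S])
      show "linear (\<lambda>a. \<partial> a k (F x))" if "x \<in> \<Omega>" for x
        by (rule pd_linear[OF smooth_onD(1)[OF k FW[OF that]]])
      show "inj (\<lambda>a. \<partial> a k (F x))" if "x \<in> \<Omega>" for x
        by (rule inj[OF FW[OF that]])
      show "\<partial> (\<partial> v F x) k (F x) = \<partial> v (\<lambda>x. k (F x)) x" if "x \<in> \<Omega>" for x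
        by (rule pd_chain[OF D[OF that] smooth_onD(1)[OF k FW[OF that]], symmetric])
      show "td n \<Omega> (\<lambda>x. \<partial> a k (F x))" for a
      proof (rule td_compose[where f="\<partial> a k", OF S Suc])
        show "td n W (\<partial> a k)"
          using smooth_onD(2)[OF k, of a] unfolding smooth_on_def ..
      qed (rule FW)
      show "td n \<Omega> (\<partial> v (\<lambda>x. k (F x)))"
        using smooth_onD(2)[OF kF, of v] unfolding smooth_on_def ..
    qed
    show ?case
      by (rule td_SucI; (rule A | rule D))
  qed
  then show ?thesis
    unfolding smooth_on_def ..
qed


section \<open>Linear algebra of symmetric bilinear forms\<close>

definition sym_form :: "('e::real_vector \<Rightarrow> 'e \<Rightarrow> real) \<Rightarrow> bool" where
  "sym_form g \<longleftrightarrow> bilinear g \<and> (\<forall>u v. g u v = g v u)"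

definition nondegenerate :: "('e::real_vector \<Rightarrow> 'e \<Rightarrow> real) \<Rightarrow> bool" where
  "nondegenerate g \<longleftrightarrow> (\<forall>w. (\<forall>z. g w z = 0) \<longrightarrow> w = 0)"

definition pos_form :: "('e::real_vector \<Rightarrow> 'e \<Rightarrow> real) \<Rightarrow> bool" where
  "pos_form g \<longleftrightarrow> sym_form g \<and> (\<forall>u. u \<noteq> 0 \<longrightarrow> g u u > 0)"

lemma sym_form_simps:
  assumes "sym_form g"
  shows "g (x + y) z = g x z + g y z" "g z (x + y) = g z x + g z y"
    "g (x - y) z = g x z - g y z" "g z (x - y) = g z x - g z y"
    "g (c *\<^sub>R x) z = c * g x z" "g z (c *\<^sub>R x) = c * g z x"
    "g 0 z = 0" "g z 0 = 0" "g (- x) z = - g x z" "g z (- x) = - g z x"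
    "g (sum f A) z = (\<Sum>a\<in>A. g (f a) z)" "g z (sum f A) = (\<Sum>a\<in>A. g z (f a))"
proof -
  have b: "bilinear g"
    using assms unfolding sym_form_def by blast
  then have l: "linear (\<lambda>x. g x z)" "linear (g z)" for z
    unfolding bilinear_def by auto
  show "g (x + y) z = g x z + g y z" "g z (x + y) = g z x + g z y"
    "g (x - y) z = g x z - g y z" "g z (x - y) = g z x - g z y"
    "g (c *\<^sub>R x) z = c * g x z" "g z (c *\<^sub>R x) = c * g z x"
    "g 0 z = 0" "g z 0 = 0" "g (- x) z = - g x z" "g z (- x) = - g z x"
    using linear_add[OF l(1)] linear_add[OF l(2)] linear_diff[OF l(1)] linear_diff[OF l(2)]
      linear_scale[OF l(1)] linear_scale[OF l(2)] linear_0[OF l(1)] linear_0[OF l(2)]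
      linear_neg[OF l(1)] linear_neg[OF l(2)] by simp_all
  show "g (sum f A) z = (\<Sum>a\<in>A. g (f a) z)" "g z (sum f A) = (\<Sum>a\<in>A. g z (f a))"
    using linear_sum[OF l(1)] linear_sum[OF l(2)] by simp_all
qed

lemma sym_form_commute: "sym_form g \<Longrightarrow> g u v = g v u"
  unfolding sym_form_def by blast

lemma sym_form_linear:
  assumes "sym_form g"
  shows "linear (g u)" "linear (\<lambda>x. g x u)" "bilinear g"
  using assms unfolding sym_form_def bilinear_def by auto

lemma pos_formD:
  assumes "pos_form g"
  shows "sym_form g" "u \<noteq> 0 \<Longrightarrow> g u u > 0" "g u u \<ge> 0" "g u u = 0 \<longleftrightarrow> u = 0"
proof -
  show s: "sym_form g" and p: "u \<noteq> 0 \<Longrightarrow> g u u > 0" for u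
    using assms unfolding pos_form_def by auto
  show "g u u \<ge> 0" "g u u = 0 \<longleftrightarrow> u = 0"
    using p[of u] sym_form_simps(7)[OF s, of 0] by (cases "u = 0"; simp)+
qed

lemma pos_form_nondegenerate: "pos_form g \<Longrightarrow> nondegenerate g"
  unfolding nondegenerate_def using pos_formD(4) by blast

text \<open>The vector that represents a linear form, i.e. the musical isomorphism.\<close>

definition raise :: "('e::real_vector \<Rightarrow> 'e \<Rightarrow> real) \<Rightarrow> ('e \<Rightarrow> real) \<Rightarrow> 'e" where
  "raise g l = (THE w. \<forall>z. g w z = l z)"

lemma raise_unique:
  assumes "sym_form g" "nondegenerate g" "\<And>z. g w z = g w' z"
  shows "w = w'"
proof -
  have "g (w - w') z = 0" for z
    using assms(3) by (simp add: sym_form_simps(3)[OF assms(1)])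
  then show ?thesis
    using assms(2) unfolding nondegenerate_def by (metis eq_iff_diff_eq_0)
qed

text \<open>Injectivity of \<open>w \<mapsto> g w\<close> is nondegeneracy, and surjectivity follows by dimension.\<close>

lemma raise_ex:
  fixes g :: "'e::euclidean_space \<Rightarrow> 'e \<Rightarrow> real"
  assumes g: "sym_form g" "nondegenerate g" and l: "linear l"
  shows "\<exists>!w. \<forall>z. g w z = l z"
proof (rule ex_ex1I)
  define T where "T w = (\<Sum>b\<in>Basis. g w b *\<^sub>R b)" for w
  have T: "T w \<bullet> b = g w b" if "b \<in> Basis" for w b
    using that by (simp add: T_def inner_sum_left inner_Basis if_distrib sum.delta cong: if_cong)
  have lin: "linear T"
    unfolding T_def by (auto intro!: linearI simp: sym_form_simps[OF g(1)] algebra_simps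
        sum.distrib scaleR_sum_right)
  have ext: "g w z = l z" if "linear l" "\<And>b. b \<in> Basis \<Longrightarrow> g w b = l b" for w z l
  proof -
    have "g w (\<Sum>b\<in>Basis. (z \<bullet> b) *\<^sub>R b) = l (\<Sum>b\<in>Basis. (z \<bullet> b) *\<^sub>R b)"
      using that by (simp add: sym_form_simps[OF g(1)] linear_sum linear_scale)
    then show ?thesis by (simp add: euclidean_representation)
  qed
  have "w = 0" if "T w = 0" for w
  proof -
    have "g w b = 0" if "b \<in> Basis" for b
      using T[OF that, of w] \<open>T w = 0\<close> by simp
    then have "g w z = 0" for z
      using ext[of "\<lambda>_. 0" w z] by (simp add: linearI)
    then show ?thesis
      using g(2) unfolding nondegenerate_def by blast
  qed
  then have "inj T"
    using lin by (simp add: linear_injective_0)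
  then have "surj T"
    using lin by (simp add: linear_injective_imp_surjective)
  then obtain w where w: "T w = (\<Sum>b\<in>Basis. l b *\<^sub>R b)"
    by (metis surjD)
  have "g w b = l b" if "b \<in> Basis" for b
    using T[OF that, of w] that
    by (simp add: w inner_sum_left inner_Basis if_distrib sum.delta cong: if_cong)
  then show "\<exists>w. \<forall>z. g w z = l z"
    using ext[OF l] by blast
next
  show "w = w'" if "\<forall>z. g w z = l z" "\<forall>z. g w' z = l z" for w w'
    by (rule raise_unique[OF g]) (use that in simp)
qed

lemma raise_eq:
  fixes g :: "'e::euclidean_space \<Rightarrow> 'e \<Rightarrow> real"
  assumes "sym_form g" "nondegenerate g" "linear l"
  shows "g (raise g l) z = l z"
  using theI'[OF raise_ex[OF assms]] unfolding raise_def by blast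

text \<open>The basis that is \<open>g\<close>-dual to the coordinate basis, i.e. the rows of the inverse Gram matrix.\<close>

definition dual :: "('e::euclidean_space \<Rightarrow> 'e \<Rightarrow> real) \<Rightarrow> 'e \<Rightarrow> 'e" where
  "dual g i = raise g (\<lambda>v. v \<bullet> i)"

lemma dual_eq:
  assumes "pos_form g"
  shows "g (dual g i) v = v \<bullet> i"
  unfolding dual_def
  by (rule raise_eq[OF pos_formD(1)[OF assms] pos_form_nondegenerate[OF assms]])
    (simp add: bounded_linear_inner_left bounded_linear.linear)

text \<open>The inner product that \<open>g\<close> induces on bilinear forms. In a fixed basis it is
  \<open>g\<^sup>i\<^sup>k g\<^sup>j\<^sup>l P\<^sub>i\<^sub>j Q\<^sub>k\<^sub>l\<close>, which depends smoothly on \<open>g\<close>; in a \<open>g\<close>-orthonormal frame it is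
  the sum of the products of the entries. Both descriptions are needed: the first to differentiate, the
  second to estimate.\<close>

definition form_inner ::
    "('e::euclidean_space \<Rightarrow> 'e \<Rightarrow> real) \<Rightarrow> ('e \<Rightarrow> 'e \<Rightarrow> real) \<Rightarrow> ('e \<Rightarrow> 'e \<Rightarrow> real) \<Rightarrow> real" where
  "form_inner g P Q = (\<Sum>i\<in>Basis. \<Sum>j\<in>Basis. P i j * Q (dual g i) (dual g j))"

subsection \<open>Orthonormal frames and the spectral theorem\<close>

definition frame :: "('e::euclidean_space \<Rightarrow> 'e \<Rightarrow> real) \<Rightarrow> 'e set \<Rightarrow> bool" where
  "frame g E \<longleftrightarrow> finite E \<and> card E = DIM('e) \<and> (\<forall>a\<in>E. \<forall>b\<in>E. g a b = (if a = b then 1 else 0))"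

lemma orthonormal_independent:
  assumes "sym_form g" "finite E" "\<And>a b. a \<in> E \<Longrightarrow> b \<in> E \<Longrightarrow> g a b = (if a = b then 1 else 0)"
  shows "independent E"
proof (rule independent_if_scalars_zero[OF assms(2)])
  fix f x assume *: "(\<Sum>x\<in>E. f x *\<^sub>R x) = 0" and "x \<in> E"
  have "0 = g (\<Sum>a\<in>E. f a *\<^sub>R a) x"
    unfolding * by (simp add: sym_form_simps[OF assms(1)])
  also have "\<dots> = (\<Sum>a\<in>E. if a = x then f a else 0)"
    using assms(3) \<open>x \<in> E\<close> by (auto simp: sym_form_simps[OF assms(1)] intro!: sum.cong)
  finally show "f x = 0"
    using assms(2) \<open>x \<in> E\<close> by simp
qed

lemma frame_expand:
  fixes g :: "'e::euclidean_space \<Rightarrow> 'e \<Rightarrow> real"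
  assumes g: "sym_form g" and E: "frame g E"
  shows "v = (\<Sum>a\<in>E. g v a *\<^sub>R a)"
proof -
  have fin: "finite E" and on: "\<And>a b. a \<in> E \<Longrightarrow> b \<in> E \<Longrightarrow> g a b = (if a = b then 1 else 0)"
    and card: "card E = DIM('e)"
    using E unfolding frame_def by auto
  have "independent E"
    by (rule orthonormal_independent[OF g fin on])
  then have "UNIV \<subseteq> span E"
    using card by (intro card_ge_dim_independent) auto
  then have "v \<in> span E" by blast
  then obtain c where v: "v = (\<Sum>a\<in>E. c a *\<^sub>R a)"
    using span_finite[OF fin] by auto
  have "g v b = c b" if "b \<in> E" for b
  proof -
    have "g v b = (\<Sum>a\<in>E. if a = b then c a else 0)"
      unfolding v using on that by (auto simp: sym_form_simps[OF g] intro!: sum.cong)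
    then show ?thesis using fin that by simp
  qed
  then show ?thesis using v by simp
qed

lemma frame_linear_expand:
  assumes g: "sym_form g" and E: "frame g E" and "linear l"
  shows "(l v :: 'b::real_vector) = (\<Sum>a\<in>E. g v a *\<^sub>R l a)"
proof -
  have "l v = l (\<Sum>a\<in>E. g v a *\<^sub>R a)"
    using frame_expand[OF g E, of v] by simp
  then show ?thesis
    by (simp add: linear_sum[OF assms(3)] linear_scale[OF assms(3)])
qed

lemma sum_rotate:
  "(\<Sum>j\<in>J. \<Sum>a\<in>A. \<Sum>b\<in>B. f j a b) = (\<Sum>a\<in>A. \<Sum>b\<in>B. \<Sum>j\<in>J. f j a b)"
  by (subst sum.swap) (rule sum.cong[OF refl], rule sum.swap)

lemma form_inner_frame:
  assumes g: "pos_form g" and E: "frame g E" and P: "bilinear P" and Q: "bilinear Q"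
  shows "form_inner g P Q = (\<Sum>a\<in>E. \<Sum>b\<in>E. P a b * Q a b)"
proof -
  have s: "sym_form g" using pos_formD(1)[OF g] .
  have dual: "dual g i = (\<Sum>a\<in>E. (a \<bullet> i) *\<^sub>R a)" for i
    using frame_expand[OF s E, of "dual g i"] unfolding dual_eq[OF g] .
  have Qd: "Q (dual g i) (dual g j) = (\<Sum>a\<in>E. \<Sum>b\<in>E. (a \<bullet> i) * (b \<bullet> j) * Q a b)" for i j
    unfolding dual bilinear_sum[OF Q] sum.cartesian_product[symmetric]
    by (simp add: bilinear_lmul[OF Q] bilinear_rmul[OF Q] mult.assoc mult.left_commute)
  have "form_inner g P Q = (\<Sum>i\<in>Basis. \<Sum>j\<in>Basis. \<Sum>a\<in>E. \<Sum>b\<in>E. (a \<bullet> i) * (b \<bullet> j) * P i j * Q a b)"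
    unfolding form_inner_def Qd by (simp add: sum_distrib_left mult_ac)
  also have "\<dots> = (\<Sum>i\<in>Basis. \<Sum>a\<in>E. \<Sum>b\<in>E. \<Sum>j\<in>Basis. (a \<bullet> i) * (b \<bullet> j) * P i j * Q a b)"
    by (rule sum.cong[OF refl], rule sum_rotate)
  also have "\<dots> = (\<Sum>a\<in>E. \<Sum>b\<in>E. \<Sum>i\<in>Basis. \<Sum>j\<in>Basis. (a \<bullet> i) * (b \<bullet> j) * P i j * Q a b)"
    by (rule sum_rotate)
  also have "\<dots> = (\<Sum>a\<in>E. \<Sum>b\<in>E. P a b * Q a b)"
  proof (intro sum.cong refl)
    fix a b
    show "(\<Sum>i\<in>Basis. \<Sum>j\<in>Basis. (a \<bullet> i) * (b \<bullet> j) * P i j * Q a b) = P a b * Q a b"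
      unfolding bilinear_basis_expand[OF P, of a b]
      by (simp add: sum_distrib_left sum_distrib_right mult_ac)
  qed
  finally show ?thesis .
qed

lemma pos_form_lower_bound:
  fixes g :: "'e::euclidean_space \<Rightarrow> 'e \<Rightarrow> real"
  assumes "pos_form g"
  obtains m where "0 < m" "\<And>v. m * (norm v)\<^sup>2 \<le> g v v"
proof -
  have s: "sym_form g" using pos_formD(1)[OF assms] .
  have "bounded_bilinear g"
    using sym_form_linear(3)[OF s] by (simp add: bilinear_conv_bounded_bilinear)
  then have "continuous_on (sphere 0 1) (\<lambda>v. g v v)"
    by (rule bounded_bilinear.continuous_on) (rule continuous_on_id)+
  moreover have "sphere (0::'e) 1 \<noteq> {}"
    by simp
  ultimately obtain u where u: "u \<in> sphere 0 1" "\<And>v. v \<in> sphere 0 1 \<Longrightarrow> g u u \<le> g v v"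
    using continuous_attains_inf[of "sphere 0 1" "\<lambda>v. g v v"] by auto
  have "0 < g u u"
    using u(1) by (intro pos_formD(2)[OF assms]) auto
  moreover have "g u u * (norm v)\<^sup>2 \<le> g v v" for v
  proof (cases "v = 0")
    case False
    have "v = norm v *\<^sub>R (v /\<^sub>R norm v)"
      using False by simp
    then have "g v v = norm v * (norm v * g (v /\<^sub>R norm v) (v /\<^sub>R norm v))"
      by (metis sym_form_simps(5,6)[OF s])
    moreover have "g u u \<le> g (v /\<^sub>R norm v) (v /\<^sub>R norm v)"
      using False by (intro u(2)) simp
    ultimately show ?thesis
      by (simp add: power2_eq_square mult_left_mono mult.commute mult.left_commute)
  qed (simp add: sym_form_simps[OF s])
  ultimately show thesis by (rule that)
qed

text \<open>The spectral theorem for \<open>b\<close> relative to \<open>g\<close>, restricted to a subspace for the sake of the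
  induction. A maximum point \<open>v\<close> of \<open>b v v\<close> on the \<open>g\<close>-unit sphere satisfies
  \<open>b v w = 0\<close> for all \<open>w\<close> with \<open>g v w = 0\<close>, and the induction continues in the
  orthogonal complement of \<open>v\<close>.\<close>

lemma spectral_subspace:
  fixes g b :: "'e::euclidean_space \<Rightarrow> 'e \<Rightarrow> real"
  assumes g: "pos_form g" and b: "sym_form b" and "subspace V"
  shows "\<exists>E\<subseteq>V. finite E \<and> card E = dim V \<and> (\<forall>x\<in>E. \<forall>y\<in>E. g x y = (if x = y then 1 else 0))
    \<and> (\<forall>x\<in>E. \<forall>y\<in>E. x \<noteq> y \<longrightarrow> b x y = 0)"
  using assms(3)
proof (induction "dim V" arbitrary: V)
  case 0
  then show ?case by (intro exI[of _ "{}"]) auto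
next
  case (Suc n)
  have s: "sym_form g" using pos_formD(1)[OF g] .
  note gs = sym_form_simps[OF s] and bs = sym_form_simps[OF b]
  have bbg: "bounded_bilinear g" "bounded_bilinear b"
    using sym_form_linear(3)[OF s] sym_form_linear(3)[OF b] by (simp_all add: bilinear_conv_bounded_bilinear)
  have cont: "continuous_on UNIV (\<lambda>v. g v v)" "continuous_on UNIV (\<lambda>v. b v v)"
    by (rule bounded_bilinear.continuous_on[OF bbg(1)] bounded_bilinear.continuous_on[OF bbg(2)];
        rule continuous_on_id)+
  define S where "S = {v\<in>V. g v v = 1}"
  obtain m where m: "0 < m" "\<And>v. m * (norm v)\<^sup>2 \<le> g v v"
    using pos_form_lower_bound[OF g] by blast
  have "closed {v. g v v = 1}"
    by (rule closed_Collect_eq[OF cont(1) continuous_on_const])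
  then have "closed S"
    unfolding S_def using closed_subspace[OF Suc.prems] by (simp add: Collect_conj_eq closed_Int)
  moreover have "bounded S"
  proof (rule boundedI)
    fix v assume "v \<in> S"
    then have "(norm v)\<^sup>2 \<le> 1 / m"
      using m(2)[of v] m(1) by (simp add: S_def field_simps)
    then show "norm v \<le> sqrt (1 / m)"
      by (rule real_le_rsqrt)
  qed
  ultimately have "compact S"
    by (simp add: compact_eq_bounded_closed)
  have "\<not> V \<subseteq> {0}"
    using Suc.hyps(2) dim_eq_0 by (metis nat.distinct(1))
  then obtain v0 where "v0 \<in> V" "v0 \<noteq> 0" by blast
  then have "v0 /\<^sub>R sqrt (g v0 v0) \<in> S"
    using pos_formD(2)[OF g, of v0] Suc.prems unfolding S_def
    by (auto simp: gs subspace_scale field_simps)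
  then have "S \<noteq> {}" by blast
  then obtain v where v: "v \<in> S" and max: "\<And>w. w \<in> S \<Longrightarrow> b w w \<le> b v v"
    using continuous_attains_sup[OF \<open>compact S\<close> _ continuous_on_subset[OF cont(2) subset_UNIV]] by blast
  have vV: "v \<in> V" "g v v = 1"
    using v unfolding S_def by auto
  have max': "b w w \<le> b v v * g w w" if "w \<in> V" for w
  proof (cases "w = 0")
    case False
    then have pos: "0 < g w w" using pos_formD(2)[OF g] by blast
    have "w /\<^sub>R sqrt (g w w) \<in> S"
      using pos that Suc.prems unfolding S_def by (auto simp: gs subspace_scale field_simps)
    from max[OF this] show ?thesis
      using pos by (simp add: bs field_simps)
  qed (simp add: gs bs)
  have orth: "b v w = 0" if "w \<in> V" "g v w = 0" for w
  proof (rule ccontr)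
    assume "b v w \<noteq> 0"
    \<comment> \<open>Moving from \<open>v\<close> by \<open>t w\<close> changes the quotient \<open>b / g\<close> by \<open>2 t b v w\<close> up to
      a term that is at most \<open>C t\<^sup>2\<close>; at \<open>t = b v w / C\<close> the linear term wins.\<close>
    define C where "C = \<bar>b v v * g w w - b w w\<bar> + 1"
    have "0 < C" by (simp add: C_def)
    define t where "t = b v w / C"
    have "v + t *\<^sub>R w \<in> V"
      using vV(1) that(1) Suc.prems by (simp add: subspace_add subspace_scale)
    from max'[OF this] have "b v v + 2 * (t * b v w) + t * t * b w w \<le> b v v * (1 + t * t * g w w)"
      using that(2) vV(2) sym_form_commute[OF s, of w v] sym_form_commute[OF b, of w v]
      by (simp add: gs bs algebra_simps)
    then have "2 * (t * b v w) \<le> (t * t) * (b v v * g w w - b w w)"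
      by (simp add: algebra_simps)
    also have "\<dots> \<le> (t * t) * C"
      unfolding C_def by (intro mult_left_mono) auto
    also have "\<dots> = t * b v w"
      using \<open>0 < C\<close> by (simp add: t_def)
    finally have "t * b v w \<le> 0" by simp
    moreover have "0 < t * b v w"
      using \<open>b v w \<noteq> 0\<close> \<open>0 < C\<close> unfolding t_def
      by (metis divide_pos_pos not_real_square_gt_zero times_divide_eq_left)
    ultimately show False by simp
  qed
  define V' where "V' = {w\<in>V. g v w = 0}"
  have sub': "subspace V'"
    using Suc.prems unfolding subspace_def V'_def by (auto simp: gs)
  have "v \<notin> span V'"
  proof -
    have "span V' = V'"
      using sub' by (rule span_eq_iff[THEN iffD2])
    moreover have "v \<notin> V'"
      using vV(2) unfolding V'_def by auto
    ultimately show ?thesis by metis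
  qed
  have "V \<subseteq> span (insert v V')"
  proof
    fix w assume "w \<in> V"
    have "w - g v w *\<^sub>R v \<in> V'"
      using \<open>w \<in> V\<close> vV Suc.prems unfolding V'_def
      by (simp add: gs subspace_diff subspace_scale)
    then have "w - g v w *\<^sub>R v \<in> span (insert v V')"
      by (simp add: span_base)
    then show "w \<in> span (insert v V')"
      by (metis diff_add_cancel insertI1 span_add span_base span_scale)
  qed
  moreover have "insert v V' \<subseteq> V"
    using vV unfolding V'_def by auto
  ultimately have "dim V = dim (insert v V')"
    using dim_subset dim_span by (metis (no_types) dual_order.antisym)
  then have "dim V = Suc (dim V')"
    using \<open>v \<notin> span V'\<close> by (simp add: dim_insert)
  then have "n = dim V'"
    using Suc.hyps(2) by simp
  from Suc.hyps(1)[OF this sub'] obtain E where E: "E \<subseteq> V'" "finite E" "card E = dim V'"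
    "\<forall>x\<in>E. \<forall>y\<in>E. g x y = (if x = y then 1 else 0)" "\<forall>x\<in>E. \<forall>y\<in>E. x \<noteq> y \<longrightarrow> b x y = 0"
    by blast
  have "v \<notin> E"
    using E(1) \<open>v \<notin> span V'\<close> span_superset by blast
  have vE: "g v x = 0" "g x v = 0" "b v x = 0" "b x v = 0" if "x \<in> E" for x
    using that E(1) orth[of x] sym_form_commute[OF s, of x v] sym_form_commute[OF b, of x v]
    unfolding V'_def by auto
  show ?case
  proof (intro exI[of _ "insert v E"] conjI)
    show "insert v E \<subseteq> V"
      using vV(1) E(1) unfolding V'_def by auto
    show "card (insert v E) = dim V"
      using \<open>v \<notin> E\<close> E(2,3) \<open>dim V = Suc (dim V')\<close> by simp
    show "\<forall>x\<in>insert v E. \<forall>y\<in>insert v E. g x y = (if x = y then 1 else 0)"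
      using E(4) vE vV(2) \<open>v \<notin> E\<close> by auto
    show "\<forall>x\<in>insert v E. \<forall>y\<in>insert v E. x \<noteq> y \<longrightarrow> b x y = 0"
      using E(5) vE by auto
  qed (use E in simp)
qed

lemma eigenframe:
  fixes g b :: "'e::euclidean_space \<Rightarrow> 'e \<Rightarrow> real"
  assumes "pos_form g" and "sym_form b"
  obtains E where "frame g E" "\<And>x y. x \<in> E \<Longrightarrow> y \<in> E \<Longrightarrow> x \<noteq> y \<Longrightarrow> b x y = 0"
  using spectral_subspace[OF assms subspace_UNIV] unfolding frame_def by auto


subsection \<open>The algebra behind the Simons identity\<close>

text \<open>Here \<open>Q z w u v\<close> stands for the second covariant derivative \<open>(\<nabla>\<^sup>2 b)(z,w;u,v)\<close> of a
  Codazzi tensor \<open>b\<close> of constant trace, so that the conclusion says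
  \<open>\<langle>\<Delta>b, b\<rangle> \<ge> 0\<close>. In a frame of eigenvectors of \<open>b\<close>, with
  eigenvalues \<open>l a\<close>, the Codazzi symmetry turns \<open>Q a a c c\<close> into \<open>Q a c a c\<close>, the Ricci identity
  exchanges the first two slots at the price of \<open>(l c - l a) K(a,c)\<close>, where \<open>K\<close> is the sectional
  curvature, and the Codazzi symmetry then leads to \<open>Q c c a a\<close>, which vanishes after summation over
  \<open>a\<close>. What remains, once it is symmetrised in \<open>a\<close> and \<open>c\<close>, is
  \<open>1/2 \<Sum> (l c - l a)\<^sup>2 K(a,c)\<close>.\<close>

lemma simons_algebra:
  fixes g b :: "'e::euclidean_space \<Rightarrow> 'e \<Rightarrow> real" and Q :: "'e \<Rightarrow> 'e \<Rightarrow> 'e \<Rightarrow> 'e \<Rightarrow> real"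
    and R :: "'e \<Rightarrow> 'e \<Rightarrow> 'e \<Rightarrow> 'e"
  assumes g: "sym_form g" and b: "sym_form b" and E: "frame g E"
    and eigen: "\<And>x y. x \<in> E \<Longrightarrow> y \<in> E \<Longrightarrow> x \<noteq> y \<Longrightarrow> b x y = 0"
    and Q1: "\<And>z w u v. Q z w u v = Q z u w v" and Q2: "\<And>z w u v. Q z w u v = Q z w v u"
    and ricci: "\<And>z w u v. Q z w u v - Q w z u v = - b (R z w u) v - b u (R z w v)"
    and skew: "\<And>z w u v. g (R z w u) v = - g u (R z w v)"
    and R: "\<And>z w u. R z w u = - R w z u"
    and trace: "\<And>z w. (\<Sum>a\<in>E. Q z w a a) = 0"
    and sec: "\<And>u v. u \<in> E \<Longrightarrow> v \<in> E \<Longrightarrow> u \<noteq> v \<Longrightarrow> g (R u v v) u \<ge> 0"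
  shows "(\<Sum>a\<in>E. \<Sum>x\<in>E. \<Sum>y\<in>E. Q a a x y * b x y) \<ge> 0"
proof -
  define l where "l a = b a a" for a
  define K where "K a c = g (R a c c) a" for a c
  have fin: "finite E" using E unfolding frame_def by simp
  have bx: "b u c = l c * g u c" if "c \<in> E" for u c
  proof -
    have "b u c = (\<Sum>a\<in>E. g u a * b a c)"
      using frame_linear_expand[OF g E sym_form_linear(2)[OF b], of u c] by simp
    also have "\<dots> = (\<Sum>a\<in>E. if a = c then g u a * l c else 0)"
      using eigen[OF _ that] by (intro sum.cong) (auto simp: l_def)
    finally show ?thesis using fin that by (simp add: mult.commute)
  qed
  have K_sym: "K a c = K c a" for a c
    using skew[of c a a c] R[of c a c] sym_form_commute[OF g]
    by (simp add: K_def sym_form_simps[OF g])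
  have key: "Q a a c c = Q c c a a + (l c - l a) * K a c" if "a \<in> E" "c \<in> E" for a c
  proof -
    have "Q a a c c = Q a c a c" by (rule Q1)
    also have "\<dots> = Q c a a c - b (R a c a) c - b a (R a c c)"
      using ricci[of a c a c] by simp
    also have "Q c a a c = Q c c a a"
      using Q2[of c a a c] Q1[of c a c a] by simp
    also have "b (R a c a) c = - (l c * K a c)"
      using bx[OF that(2), of "R a c a"] skew[of a c a c] sym_form_commute[OF g, of a "R a c c"]
      by (simp add: K_def)
    also have "b a (R a c c) = l a * K a c"
      using bx[OF that(1), of "R a c c"] sym_form_commute[OF b, of a "R a c c"] by (simp add: K_def)
    finally show ?thesis by (simp add: algebra_simps)
  qed
  have "(\<Sum>a\<in>E. \<Sum>x\<in>E. \<Sum>y\<in>E. Q a a x y * b x y) = (\<Sum>a\<in>E. \<Sum>c\<in>E. Q a a c c * l c)"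
  proof (intro sum.cong refl)
    fix a x assume "x \<in> E"
    have "(\<Sum>y\<in>E. Q a a x y * b x y) = (\<Sum>y\<in>E. if y = x then Q a a x x * l x else 0)"
      using eigen[OF \<open>x \<in> E\<close>] by (intro sum.cong) (auto simp: l_def)
    then show "(\<Sum>y\<in>E. Q a a x y * b x y) = Q a a x x * l x"
      using fin \<open>x \<in> E\<close> by simp
  qed
  also have "\<dots> = (\<Sum>a\<in>E. \<Sum>c\<in>E. Q c c a a * l c) + (\<Sum>a\<in>E. \<Sum>c\<in>E. l c * (l c - l a) * K a c)"
    unfolding sum.distrib[symmetric]
  proof (intro sum.cong refl)
    fix a c assume "a \<in> E" "c \<in> E"
    then show "Q a a c c * l c = Q c c a a * l c + l c * (l c - l a) * K a c"
      unfolding key[OF \<open>a \<in> E\<close> \<open>c \<in> E\<close>] by (simp add: distrib_right distrib_left mult_ac)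
  qed
  also have "(\<Sum>a\<in>E. \<Sum>c\<in>E. Q c c a a * l c) = 0"
    by (subst sum.swap) (simp add: sum_distrib_right[symmetric] trace)
  also have "0 + (\<Sum>a\<in>E. \<Sum>c\<in>E. l c * (l c - l a) * K a c) =
      (\<Sum>a\<in>E. \<Sum>c\<in>E. (l c - l a)\<^sup>2 * K a c) / 2"
  proof -
    have "(\<Sum>a\<in>E. \<Sum>c\<in>E. l c * (l c - l a) * K a c) = (\<Sum>a\<in>E. \<Sum>c\<in>E. l a * (l a - l c) * K a c)"
    proof (subst sum.swap, intro sum.cong refl)
      show "l a * (l a - l c) * K c a = l a * (l a - l c) * K a c" for a c
        unfolding K_sym[of c a] ..
    qed
    then have "2 * (\<Sum>a\<in>E. \<Sum>c\<in>E. l c * (l c - l a) * K a c) =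
        (\<Sum>a\<in>E. \<Sum>c\<in>E. l c * (l c - l a) * K a c) + (\<Sum>a\<in>E. \<Sum>c\<in>E. l a * (l a - l c) * K a c)"
      by simp
    also have "\<dots> = (\<Sum>a\<in>E. \<Sum>c\<in>E. (l c - l a)\<^sup>2 * K a c)"
      unfolding sum.distrib[symmetric]
      by (intro sum.cong refl) (simp add: algebra_simps power2_eq_square)
    finally show ?thesis by simp
  qed
  also have "\<dots> \<ge> 0"
  proof (intro divide_nonneg_nonneg sum_nonneg)
    show "0 \<le> (l c - l a)\<^sup>2 * K a c" if "a \<in> E" "c \<in> E" for a c
      using sec[OF that] by (cases "a = c") (simp_all add: K_def)
  qed simp
  finally show ?thesis .
qed

subsection \<open>Algebraic curvature tensors\<close>

text \<open>Milnor's octahedron: four instances of the Bianchi identity, one for every other face, combine to twice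
  the claim.\<close>

lemma curvature_pair_symmetry:
  fixes T :: "'d \<Rightarrow> 'd \<Rightarrow> 'd \<Rightarrow> 'd \<Rightarrow> real"
  assumes s1: "\<And>u v w z. T u v w z = - T v u w z" and s2: "\<And>u v w z. T u v w z = - T u v z w"
    and bianchi: "\<And>u v w z. T u v w z + T v w u z + T w u v z = 0"
  shows "T u v w z = T w z u v"
proof -
  have "T u v w z + T v w u z + T w u v z = 0"
    by (rule bianchi)
  moreover have "T v w u z + T w z u v + T v z w u = 0"
    using bianchi[of v w z u] s2[of v w z u] s2[of w z v u] s1[of z v w u] by linarith
  moreover have "T w z u v + T u z v w + T w u v z = 0"
    using bianchi[of w z u v] s1[of z u w v] s2[of u z w v] s1[of u w z v] s2[of w u z v] by linarith
  moreover have "T u v w z + T u z v w + T v z w u = 0"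
    using bianchi[of z u v w] s1[of z u v w] s2[of u v z w] s2[of v z u w] by linarith
  ultimately show ?thesis by linarith
qed

text \<open>This will be applied to \<open>T = R - \<kappa> R\<^sub>0\<close>, the curvature tensor minus the one that a space of
  constant curvature \<open>\<kappa>\<close> should have; its conclusion is the part of \<open>R = \<kappa> R\<^sub>0\<close> that the
  Codazzi equation needs. Only nondegenerate planes are known to be flat for \<open>T\<close>, which restricts
  polarisation: for \<open>X\<close> orthogonal to \<open>W\<close>, both in the spacelike \<open>V\<close>, the planes spanned by
  \<open>X\<close> and \<open>W \<plusminus> t \<nu>\<close> are nondegenerate for suitable \<open>t > 0\<close>, and the difference of the two
  resulting equations gives \<open>T X W \<nu> X = 0\<close>. Polarisation in \<open>X\<close> and the Bianchi identity do the
  rest.\<close>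

lemma curvature_annihilates_normal:
  fixes g :: "'d::euclidean_space \<Rightarrow> 'd \<Rightarrow> real" and T :: "'d \<Rightarrow> 'd \<Rightarrow> 'd \<Rightarrow> 'd \<Rightarrow> real"
  assumes g: "sym_form g"
    and lin: "\<And>u v w. linear (\<lambda>z. T u v w z)" "\<And>u v z. linear (\<lambda>w. T u v w z)"
      "\<And>u w z. linear (\<lambda>v. T u v w z)" "\<And>v w z. linear (\<lambda>u. T u v w z)"
    and s1: "\<And>u v w z. T u v w z = - T v u w z" and s2: "\<And>u v w z. T u v w z = - T u v z w"
    and bianchi: "\<And>u v w z. T u v w z + T v w u z + T w u v z = 0"
    and sec: "\<And>u v. g u u * g v v - (g u v)\<^sup>2 \<noteq> 0 \<Longrightarrow> T u v v u = 0"
    and V: "subspace V" and pos: "\<And>x. x \<in> V \<Longrightarrow> x \<noteq> 0 \<Longrightarrow> g x x > 0"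
    and normal: "\<And>x. x \<in> V \<Longrightarrow> g \<nu> x = 0"
    and XYZ: "X \<in> V" "Y \<in> V" "Z \<in> V"
  shows "T X Y \<nu> Z = 0"
proof -
  note gs = sym_form_simps[OF g]
  have add: "T u v w (z + z') = T u v w z + T u v w z'" "T u v (w + w') z = T u v w z + T u v w' z"
    "T u (v + v') w z = T u v w z + T u v' w z" "T (u + u') v w z = T u v w z + T u' v w z"
    for u v w z u' v' w' z'
    using linear_add[OF lin(1)] linear_add[OF lin(2)] linear_add[OF lin(3)] linear_add[OF lin(4)]
    by simp_all
  have scale: "T u v w (r *\<^sub>R z) = r * T u v w z" "T u v (r *\<^sub>R w) z = r * T u v w z"
    "T u (r *\<^sub>R v) w z = r * T u v w z" "T (r *\<^sub>R u) v w z = r * T u v w z" for u v w z r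
    using linear_scale[OF lin(1)] linear_scale[OF lin(2)] linear_scale[OF lin(3)] linear_scale[OF lin(4)]
    by simp_all
  have T0: "T 0 v w z = 0" for v w z
    using scale(4)[of 0] by simp
  have pair: "T u v w z = T w z u v" for u v w z
    by (rule curvature_pair_symmetry[where T=T, OF s1 s2 bianchi])
  have diag: "T X Z \<nu> X = 0" if "X \<in> V" "Z \<in> V" for X Z
  proof (cases "X = 0")
    case True
    then show ?thesis by (simp add: T0)
  next
    case False
    then have "0 < g X X" using pos that by blast
    define s where "s = g X Z / g X X"
    define W where "W = Z - s *\<^sub>R X"
    have "W \<in> V"
      using V that unfolding W_def by (simp add: subspace_diff subspace_scale)
    have XW: "g X W = 0"
      using \<open>0 < g X X\<close> by (simp add: W_def gs s_def)
    have TW: "T X Z \<nu> X = T X W \<nu> X"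
    proof -
      have "Z = W + s *\<^sub>R X" by (simp add: W_def)
      moreover have "T X X \<nu> X = 0" using s1[of X X \<nu> X] by simp
      ultimately show ?thesis by (simp add: add scale)
    qed
    show ?thesis
    proof (cases "W = 0")
      case True
      then show ?thesis
        unfolding TW using s1[of X 0 \<nu> X] by (simp add: T0)
    next
      case False
      then have "0 < g W W" using pos \<open>W \<in> V\<close> by blast
      \<comment> \<open>If \<open>\<nu>\<close> is timelike, then a small \<open>t\<close> keeps \<open>W \<plusminus> t \<nu>\<close> spacelike.\<close>
      have "\<exists>t::real. 0 < t \<and> 0 < g W W + t * t * g \<nu> \<nu>"
      proof (cases "0 \<le> g \<nu> \<nu>")
        case True
        then show ?thesis using \<open>0 < g W W\<close> by (intro exI[of _ 1]) simp
      next
        case False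
        define t where "t = sqrt (g W W / (2 * - g \<nu> \<nu>))"
        have "0 < t" using False \<open>0 < g W W\<close> unfolding t_def by (simp add: divide_pos_neg)
        have "0 \<le> g W W / (2 * - g \<nu> \<nu>)"
          using False \<open>0 < g W W\<close> by (intro divide_nonneg_pos) auto
        then have "t * t = g W W / (2 * - g \<nu> \<nu>)"
          unfolding t_def by (rule real_sqrt_mult_self[THEN trans, OF abs_of_nonneg])
        then have "t * t * g \<nu> \<nu> = - g W W / 2"
          using False by simp
        then show ?thesis
          using \<open>0 < t\<close> \<open>0 < g W W\<close> by (intro exI[of _ t]) simp
      qed
      then obtain t :: real where t: "0 < t" "0 < g W W + t * t * g \<nu> \<nu>" by blast
      have nX: "g \<nu> X = 0" "g X \<nu> = 0" and nW: "g \<nu> W = 0" "g W \<nu> = 0"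
        using normal that(1) \<open>W \<in> V\<close> sym_form_commute[OF g] by metis+
      have flat: "T X (W + r *\<^sub>R \<nu>) (W + r *\<^sub>R \<nu>) X = 0" if "r * r = t * t" for r
      proof (rule sec)
        have "g (W + r *\<^sub>R \<nu>) (W + r *\<^sub>R \<nu>) = g W W + t * t * g \<nu> \<nu>"
          unfolding that[symmetric] by (simp add: gs nW)
        then show "g X X * g (W + r *\<^sub>R \<nu>) (W + r *\<^sub>R \<nu>) - (g X (W + r *\<^sub>R \<nu>))\<^sup>2 \<noteq> 0"
          using t(2) \<open>0 < g X X\<close> XW nX by (simp add: gs)
      qed
      have "T X \<nu> W X = T X W \<nu> X"
        using pair[of X \<nu> W X] s1[of W X X \<nu>] s2[of X W X \<nu>] by simp
      moreover have "t * (T X \<nu> W X + T X W \<nu> X) = 0"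
      proof -
        define S where "S = T X \<nu> W X + T X W \<nu> X"
        have "T X W W X + r * S + r * r * T X \<nu> \<nu> X = 0" if "r * r = t * t" for r
          using flat[OF that] unfolding S_def by (simp add: add scale algebra_simps)
        from this[of t] this[of "- t"] have "t * S = 0"
          unfolding minus_mult_minus mult_minus_left by linarith
        then show ?thesis unfolding S_def .
      qed
      ultimately show ?thesis
        unfolding TW using t(1) by simp
    qed
  qed
  have polar: "T X Z \<nu> Y = - T Y Z \<nu> X" if "X \<in> V" "Y \<in> V" "Z \<in> V" for X Y Z
  proof -
    have "T (X + Y) Z \<nu> (X + Y) = 0"
      using that V by (intro diag) (auto simp: subspace_add)
    then show ?thesis
      using diag[OF that(1,3)] diag[OF that(2,3)] unfolding add by linarith
  qed
  have "T X Y \<nu> Z + T Y Z \<nu> X + T Z X \<nu> Y = 0"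
    using bianchi[of X Y Z \<nu>] s2[of X Y Z \<nu>] s2[of Y Z X \<nu>] s2[of Z X Y \<nu>] by linarith
  moreover have "T Y Z \<nu> X = T X Y \<nu> Z"
    using polar[OF XYZ(2,1,3)] polar[OF XYZ(1,3,2)] s1[of X Z \<nu> Y] s1[of Z Y \<nu> X] by linarith
  moreover have "T Z X \<nu> Y = T X Y \<nu> Z"
    using polar[OF XYZ(3,2,1)] s1[of X Y \<nu> Z] by linarith
  ultimately show ?thesis by linarith
qed

subsection \<open>Eigenspaces\<close>

definition eigenspace ::
    "('e \<Rightarrow> 'e \<Rightarrow> real) \<Rightarrow> ('e \<Rightarrow> 'e \<Rightarrow> real) \<Rightarrow> real \<Rightarrow> 'e::euclidean_space set" where
  "eigenspace g b \<mu> = {u. \<forall>v. b u v = \<mu> * g u v}"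

text \<open>The geometric multiplicity of an eigenvalue is the number of its occurrences on the diagonal of an
  eigenframe, so that multiplicities can be recovered from traces of powers.\<close>

lemma dim_eigenspace:
  assumes g: "pos_form g" and b: "sym_form b" and E: "frame g E"
    and eigen: "\<And>x y. x \<in> E \<Longrightarrow> y \<in> E \<Longrightarrow> x \<noteq> y \<Longrightarrow> b x y = 0"
  shows "dim (eigenspace g b \<mu>) = card {a\<in>E. b a a = \<mu>}"
proof (rule dim_unique)
  have s: "sym_form g" using pos_formD(1)[OF g] .
  have fin: "finite E" and on: "\<And>a b. a \<in> E \<Longrightarrow> b \<in> E \<Longrightarrow> g a b = (if a = b then 1 else 0)"
    using E unfolding frame_def by auto
  have bE: "b a v = b a a * g a v" if "a \<in> E" for a v
  proof -
    have "b a v = (\<Sum>c\<in>E. g v c * b a c)"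
      using frame_linear_expand[OF s E sym_form_linear(1)[OF b], of a v] by simp
    also have "\<dots> = (\<Sum>c\<in>E. if c = a then g v a * b a a else 0)"
      using eigen[OF that] by (intro sum.cong) auto
    finally show ?thesis
      using fin that sym_form_commute[OF s, of a v] by (simp add: mult.commute)
  qed
  show "{a\<in>E. b a a = \<mu>} \<subseteq> eigenspace g b \<mu>"
    unfolding eigenspace_def using bE by auto
  show "independent {a\<in>E. b a a = \<mu>}"
    by (rule independent_mono[OF orthonormal_independent[OF s fin on]]) auto
  show "eigenspace g b \<mu> \<subseteq> span {a\<in>E. b a a = \<mu>}"
  proof
    fix u assume u: "u \<in> eigenspace g b \<mu>"
    have "g u a = 0" if "a \<in> E" "b a a \<noteq> \<mu>" for a
    proof -
      have "\<mu> * g u a = b a a * g u a"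
        using u bE[OF that(1), of u] sym_form_commute[OF s, of a u] sym_form_commute[OF b, of a u]
        unfolding eigenspace_def by simp
      then show ?thesis using that(2) by simp
    qed
    then have "u = (\<Sum>a\<in>{a\<in>E. b a a = \<mu>}. g u a *\<^sub>R a)"
      using frame_expand[OF s E, of u] fin
      by (simp add: sum.mono_neutral_left[where S="{a\<in>E. b a a = \<mu>}" and T=E] sum.mono_neutral_cong_right)
    then show "u \<in> span {a\<in>E. b a a = \<mu>}"
      by (metis (no_types, lifting) span_base span_scale span_sum)
  qed
qed simp

text \<open>Equal power sums mean equal sums of any polynomial over the two families; take the polynomial that
  vanishes at all occurring values except \<open>\<mu>\<close>.\<close>

lemma power_sums_determine_multiplicities:
  fixes x :: "'a \<Rightarrow> real" and y :: "'b \<Rightarrow> real"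
  assumes "finite A" "finite B" and eq: "\<And>k. (\<Sum>a\<in>A. x a ^ k) = (\<Sum>b\<in>B. y b ^ k)"
  shows "card {a\<in>A. x a = \<mu>} = card {b\<in>B. y b = \<mu>}"
proof -
  define S where "S = (x ` A \<union> y ` B) - {\<mu>}"
  have "finite S" using assms unfolding S_def by simp
  define p where "p = (\<Prod>s\<in>S. [:- s, 1:])"
  have p: "poly p t = (\<Prod>s\<in>S. t - s)" for t
    by (simp add: p_def poly_prod)
  have p0: "poly p t = 0" if "t \<in> S" for t
    unfolding p using that \<open>finite S\<close> by auto
  have p\<mu>: "poly p \<mu> \<noteq> 0"
    unfolding p using \<open>finite S\<close> by (auto simp: S_def)
  have "(\<Sum>a\<in>A. poly p (x a)) = (\<Sum>b\<in>B. poly p (y b))"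
    unfolding poly_altdef by (subst (1 2) sum.swap) (simp add: sum_distrib_left[symmetric] eq)
  moreover have "(\<Sum>a\<in>A. poly p (x a)) = real (card {a\<in>A. x a = \<mu>}) * poly p \<mu>"
  proof -
    have "(\<Sum>a\<in>A. poly p (x a)) = (\<Sum>a\<in>A. if x a = \<mu> then poly p \<mu> else 0)"
      using p0 by (intro sum.cong) (auto simp: S_def)
    then show ?thesis
      using assms(1) by (simp add: sum.If_cases Int_def)
  qed
  moreover have "(\<Sum>b\<in>B. poly p (y b)) = real (card {b\<in>B. y b = \<mu>}) * poly p \<mu>"
  proof -
    have "(\<Sum>b\<in>B. poly p (y b)) = (\<Sum>b\<in>B. if y b = \<mu> then poly p \<mu> else 0)"
      using p0 by (intro sum.cong) (auto simp: S_def)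
    then show ?thesis
      using assms(2) by (simp add: sum.If_cases Int_def)
  qed
  ultimately show ?thesis using p\<mu> by simp
qed


section \<open>Levi-Civita calculus in a chart\<close>

lemma bilinear_pd_field:
  fixes B :: "'x::real_normed_vector \<Rightarrow> 'a::real_vector \<Rightarrow> 'b::real_vector \<Rightarrow> 'c::real_normed_vector"
  assumes "open S" "x \<in> S" and bil: "\<And>y. y \<in> S \<Longrightarrow> bilinear (B y)"
    and B: "\<And>a b. (\<lambda>y. B y a b) differentiable (at x)"
  shows "bilinear (\<lambda>u v. \<partial> w (\<lambda>y. B y u v) x)"
proof -
  have cong: "\<partial> w (\<lambda>y. B y u v) x = \<partial> w (\<lambda>y. F y) x" if "\<And>y. y \<in> S \<Longrightarrow> B y u v = F y" for F u v
    by (rule pd_cong[OF assms(1,2) that])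
  have "\<partial> w (\<lambda>y. B y (u + u') v) x = \<partial> w (\<lambda>y. B y u v) x + \<partial> w (\<lambda>y. B y u' v) x" for u u' v
    using cong[OF bilinear_ladd[OF bil], of u u' v] pd_add[OF B[of u v] B[of u' v], of w] by simp
  moreover have "\<partial> w (\<lambda>y. B y u (v + v')) x = \<partial> w (\<lambda>y. B y u v) x + \<partial> w (\<lambda>y. B y u v') x" for u v v'
    using cong[OF bilinear_radd[OF bil], of u v v'] pd_add[OF B[of u v] B[of u v'], of w] by simp
  moreover have "\<partial> w (\<lambda>y. B y (r *\<^sub>R u) v) x = r *\<^sub>R \<partial> w (\<lambda>y. B y u v) x" for r u v
    using cong[OF bilinear_lmul[OF bil], of r u v]
      pd_bounded_linear(1)[OF bounded_linear_scaleR_right[of r] B[of u v], of w] by simp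
  moreover have "\<partial> w (\<lambda>y. B y u (r *\<^sub>R v)) x = r *\<^sub>R \<partial> w (\<lambda>y. B y u v) x" for r u v
    using cong[OF bilinear_rmul[OF bil], of u r v]
      pd_bounded_linear(1)[OF bounded_linear_scaleR_right[of r] B[of u v], of w] by simp
  ultimately show ?thesis
    unfolding bilinear_def by (intro conjI allI linearI)
qed

text \<open>Vector fields given by an equation \<open>G x (w x) z = l x z\<close>, such as the Christoffel symbols, gradients,
  dual bases and normals, are smooth because they solve a linear system with smooth coefficients.\<close>

lemma smooth_on_form_solution:
  fixes G :: "'x::euclidean_space \<Rightarrow> 'e::euclidean_space \<Rightarrow> 'e \<Rightarrow> real"
  assumes S: "open S" and G: "\<And>x. x \<in> S \<Longrightarrow> sym_form (G x)" "\<And>x. x \<in> S \<Longrightarrow> nondegenerate (G x)"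
    and sG: "\<And>u v. smooth_on S (\<lambda>x. G x u v)"
    and eq: "\<And>x z. x \<in> S \<Longrightarrow> G x (w x) z = l x z" and sl: "\<And>z. smooth_on S (\<lambda>x. l x z)"
  shows "smooth_on S w"
proof (rule smooth_on_linear_solution[where L="\<lambda>x a. \<Sum>b\<in>Basis. G x a b *\<^sub>R b" and
      \<beta>="\<lambda>x. \<Sum>b\<in>Basis. l x b *\<^sub>R b", OF S])
  show lin: "linear (\<lambda>a. \<Sum>b\<in>Basis. G x a b *\<^sub>R b)" if "x \<in> S" for x
    by (auto intro!: linearI simp: sym_form_simps[OF G(1)[OF that]] algebra_simps sum.distrib scaleR_sum_right)
  show "inj (\<lambda>a. \<Sum>b\<in>Basis. G x a b *\<^sub>R b)" if "x \<in> S" for x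
    unfolding linear_injective_0[OF lin[OF that]]
  proof (intro allI impI)
    fix a assume *: "(\<Sum>b\<in>Basis. G x a b *\<^sub>R b) = 0"
    have "G x a b = 0" if "b \<in> Basis" for b
    proof -
      have "G x a b = (\<Sum>b\<in>Basis. G x a b *\<^sub>R b) \<bullet> b"
        using that by (simp add: inner_sum_left inner_Basis if_distrib sum.delta cong: if_cong)
      then show ?thesis unfolding * by simp
    qed
    then have "G x a (\<Sum>b\<in>Basis. (z \<bullet> b) *\<^sub>R b) = 0" for z
      by (simp add: sym_form_simps[OF G(1)[OF that]])
    then have "G x a z = 0" for z
      by (simp add: euclidean_representation)
    then show "a = 0"
      using G(2)[OF that] unfolding nondegenerate_def by blast
  qed
  show "(\<Sum>b\<in>Basis. G x (w x) b *\<^sub>R b) = (\<Sum>b\<in>Basis. l x b *\<^sub>R b)" if "x \<in> S" for x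
    using eq[OF that] by simp
  show "smooth_on S (\<lambda>x. \<Sum>b\<in>Basis. G x a b *\<^sub>R b)" for a
    by (rule smooth_on_sum[OF S], rule smooth_on_scaleR[OF S sG smooth_on_const])
  show "smooth_on S (\<lambda>x. \<Sum>b\<in>Basis. l x b *\<^sub>R b)"
    by (rule smooth_on_sum[OF S], rule smooth_on_scaleR[OF S sl smooth_on_const])
qed

text \<open>A semi-Riemannian metric in the coordinates of a chart.\<close>

locale metric_field =
  fixes S :: "'e::euclidean_space set" and g :: "'e \<Rightarrow> 'e \<Rightarrow> 'e \<Rightarrow> real"
  assumes open_S: "open S"
    and sym: "x \<in> S \<Longrightarrow> sym_form (g x)"
    and nondeg: "x \<in> S \<Longrightarrow> nondegenerate (g x)"
    and smooth: "smooth_on S (\<lambda>x. g x u v)"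
begin

abbreviation "\<Gamma> \<equiv> christoffel g"
abbreviation "R \<equiv> curvature g"

lemmas gs = sym_form_simps[OF sym]

lemma diff_g: "x \<in> S \<Longrightarrow> (\<lambda>y. g y u v) differentiable (at x)"
  by (rule smooth_onD(1)[OF smooth])

lemma pd_g_bilinear: "x \<in> S \<Longrightarrow> bilinear (\<lambda>u v. \<partial> w (\<lambda>y. g y u v) x)"
  by (rule bilinear_pd_field[OF open_S]) (auto intro: sym_form_linear(3) sym diff_g)

lemma pd_g_linear: "x \<in> S \<Longrightarrow> linear (\<lambda>w. \<partial> w (\<lambda>y. g y u v) x)"
  by (rule pd_linear[OF diff_g])

lemma pd_g_sym: "x \<in> S \<Longrightarrow> \<partial> w (\<lambda>y. g y u v) x = \<partial> w (\<lambda>y. g y v u) x"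
  by (rule pd_cong[OF open_S]) (auto intro: sym_form_commute sym)

lemma koszul:
  assumes x: "x \<in> S"
  shows "2 * g x (\<Gamma> x u v) z = \<partial> u (\<lambda>y. g y v z) x + \<partial> v (\<lambda>y. g y u z) x - \<partial> z (\<lambda>y. g y u v) x"
proof -
  define l where "l z = (\<partial> u (\<lambda>y. g y v z) x + \<partial> v (\<lambda>y. g y u z) x - \<partial> z (\<lambda>y. g y u v) x) / 2" for z
  have lin: "linear (\<lambda>z. \<partial> w (\<lambda>y. g y v z) x)" for w v
    using pd_g_bilinear[OF x] unfolding bilinear_def by blast
  have "linear l"
    unfolding l_def
    using linear_add[OF lin] linear_add[OF pd_g_linear[OF x]] linear_scale[OF lin] linear_scale[OF pd_g_linear[OF x]]
    by (intro linearI) (simp_all add: algebra_simps add_divide_distrib diff_divide_distrib)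
  from raise_ex[OF sym[OF x] nondeg[OF x] this]
  have "\<exists>!w. \<forall>z. 2 * g x w z = \<partial> u (\<lambda>y. g y v z) x + \<partial> v (\<lambda>y. g y u z) x - \<partial> z (\<lambda>y. g y u v) x"
    by (simp add: l_def eq_divide_eq mult.commute)
  from theI'[OF this] show ?thesis
    unfolding christoffel_def by blast
qed

lemma christoffel_unique:
  assumes "x \<in> S"
    and "\<And>z. 2 * g x w z = \<partial> u (\<lambda>y. g y v z) x + \<partial> v (\<lambda>y. g y u z) x - \<partial> z (\<lambda>y. g y u v) x"
  shows "\<Gamma> x u v = w"
proof (rule raise_unique[OF sym[OF assms(1)] nondeg[OF assms(1)]])
  show "g x (\<Gamma> x u v) z = g x w z" for z
    using assms(2)[of z] koszul[OF assms(1), of u v z] by linarith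
qed

lemma christoffel_sym: "x \<in> S \<Longrightarrow> \<Gamma> x u v = \<Gamma> x v u"
  by (rule christoffel_unique) (simp_all add: koszul[of x v u] pd_g_sym[where u=v and v=u])

lemma christoffel_linear: 
  assumes x: "x \<in> S"
  shows "linear (\<Gamma> x u)"
proof (rule linearI)
  show "\<Gamma> x u (v + v') = \<Gamma> x u v + \<Gamma> x u v'" for v v'
    by (rule christoffel_unique[OF x])
      (simp add: gs[OF x] distrib_left koszul[OF x] linear_add[OF pd_g_linear[OF x]]
        bilinear_ladd[OF pd_g_bilinear[OF x]] bilinear_radd[OF pd_g_bilinear[OF x]])
  show "\<Gamma> x u (r *\<^sub>R v) = r *\<^sub>R \<Gamma> x u v" for r v
    by (rule christoffel_unique[OF x])
      (simp add: gs[OF x] mult.left_commute[of 2 r] koszul[OF x] linear_scale[OF pd_g_linear[OF x]]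
        bilinear_lmul[OF pd_g_bilinear[OF x]] bilinear_rmul[OF pd_g_bilinear[OF x]]
        right_diff_distrib distrib_left)
qed

lemma christoffel_bilinear: 
  assumes x: "x \<in> S"
  shows "bilinear (\<Gamma> x)"
proof -
  have "linear (\<lambda>u. \<Gamma> x u v)" for v
    using christoffel_linear[OF x, of v] unfolding christoffel_sym[OF x, of _ v] by simp
  then show ?thesis
    using christoffel_linear[OF x] unfolding bilinear_def by blast
qed

lemma christoffel_smooth: "smooth_on S (\<lambda>x. \<Gamma> x u v)"
proof (rule smooth_on_form_solution[OF open_S sym nondeg smooth])
  show "g x (\<Gamma> x u v) z = (\<partial> u (\<lambda>y. g y v z) x + \<partial> v (\<lambda>y. g y u z) x - \<partial> z (\<lambda>y. g y u v) x) * (1 / 2)"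
    if "x \<in> S" for x z
    using koszul[OF that, of u v z] by simp
  show "smooth_on S (\<lambda>x. (\<partial> u (\<lambda>y. g y v z) x + \<partial> v (\<lambda>y. g y u z) x - \<partial> z (\<lambda>y. g y u v) x) * (1 / 2))" for z
    by (rule smooth_on_mult[OF open_S smooth_on_diff[OF open_S
            smooth_on_add[OF open_S smooth_onD(2)[OF smooth] smooth_onD(2)[OF smooth]]
            smooth_onD(2)[OF smooth]] smooth_on_const])
qed

text \<open>Summation of two instances of the Koszul formula.\<close>

lemma metric_compatible:
  assumes "x \<in> S"
  shows "\<partial> w (\<lambda>y. g y u v) x = g x (\<Gamma> x w u) v + g x u (\<Gamma> x w v)"
  using koszul[OF assms, of w u v] koszul[OF assms, of w v u] pd_g_sym[OF assms, of w u v]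
    pd_g_sym[OF assms, of v u w] pd_g_sym[OF assms, of u w v] pd_g_sym[OF assms, of v w u]
    sym_form_commute[OF sym[OF assms], of "\<Gamma> x w v" u]
  by linarith

end

subsection \<open>Covariant differentiation along a map\<close>

text \<open>The covariant derivative, in the direction \<open>u\<close>, of a vector field \<open>\<xi>\<close> along the map
  \<open>F\<close>.\<close>

definition cov ::
    "('d::euclidean_space \<Rightarrow> 'd \<Rightarrow> 'd \<Rightarrow> real) \<Rightarrow> ('e::euclidean_space \<Rightarrow> 'd) \<Rightarrow> 'e \<Rightarrow> ('e \<Rightarrow> 'd) \<Rightarrow> 'e \<Rightarrow> 'd" where
  "cov g F u \<xi> x = \<partial> u \<xi> x + christoffel g (F x) (\<partial> u F x) (\<xi> x)"

locale map_into_metric = metric_field S g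
  for S :: "'d::euclidean_space set" and g :: "'d \<Rightarrow> 'd \<Rightarrow> 'd \<Rightarrow> real" +
  fixes \<Omega> :: "'e::euclidean_space set" and F :: "'e \<Rightarrow> 'd"
  assumes open_\<Omega>: "open \<Omega>" and smooth_F: "smooth_on \<Omega> F" and maps: "x \<in> \<Omega> \<Longrightarrow> F x \<in> S"
begin

abbreviation "D \<equiv> cov g F"

lemma diff_F: "x \<in> \<Omega> \<Longrightarrow> F differentiable (at x)"
  by (rule smooth_onD(1)[OF smooth_F])

lemma smooth_g_along: "smooth_on \<Omega> (\<lambda>x. g (F x) u v)"
  by (rule smooth_on_compose[where f="\<lambda>y. g y u v", OF open_\<Omega> smooth_F smooth maps])

lemma smooth_christoffel_along: "smooth_on \<Omega> (\<lambda>x. \<Gamma> (F x) u v)"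
  by (rule smooth_on_compose[where f="\<lambda>y. \<Gamma> y u v", OF open_\<Omega> smooth_F christoffel_smooth maps])

lemma smooth_inner_along:
  assumes "smooth_on \<Omega> \<xi>" "smooth_on \<Omega> \<eta>"
  shows "smooth_on \<Omega> (\<lambda>x. g (F x) (\<xi> x) (\<eta> x))"
  by (rule smooth_on_bilinear_field[where B="\<lambda>x. g (F x)", OF open_\<Omega> sym_form_linear(3)[OF sym[OF maps]]
        smooth_g_along assms])

lemma cov_smooth:
  assumes "smooth_on \<Omega> \<xi>"
  shows "smooth_on \<Omega> (D u \<xi>)"
proof -
  have "smooth_on \<Omega> (\<lambda>x. \<partial> u \<xi> x + \<Gamma> (F x) (\<partial> u F x) (\<xi> x))"
    by (rule smooth_on_add[OF open_\<Omega> smooth_onD(2)[OF assms]], rule smooth_on_bilinear_field[where B="\<lambda>x. \<Gamma> (F x)",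
          OF open_\<Omega> christoffel_bilinear[OF maps] smooth_christoffel_along smooth_onD(2)[OF smooth_F] assms])
  then show ?thesis unfolding cov_def .
qed

lemma cov_metric:
  assumes x: "x \<in> \<Omega>" and \<xi>: "smooth_on \<Omega> \<xi>" and \<eta>: "smooth_on \<Omega> \<eta>"
  shows "\<partial> u (\<lambda>x. g (F x) (\<xi> x) (\<eta> x)) x = g (F x) (D u \<xi> x) (\<eta> x) + g (F x) (\<xi> x) (D u \<eta> x)"
proof -
  have "\<partial> u (\<lambda>y. g (F y) (\<xi> x) (\<eta> x)) x = \<partial> (\<partial> u F x) (\<lambda>y. g y (\<xi> x) (\<eta> x)) (F x)"
    by (rule pd_chain[where f="\<lambda>y. g y (\<xi> x) (\<eta> x)", OF diff_F[OF x] diff_g[OF maps[OF x]]])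
  then show ?thesis
    using pd_bilinear_field(1)[where B="\<lambda>x. g (F x)" and \<xi>=\<xi> and \<eta>=\<eta>, OF open_\<Omega> x
        sym_form_linear(3)[OF sym[OF maps]] smooth_onD(1)[OF smooth_g_along x] smooth_onD(1)[OF \<xi> x]
        smooth_onD(1)[OF \<eta> x], of u]
    by (simp add: cov_def metric_compatible[OF maps[OF x]] gs[OF maps[OF x]])
qed

lemma cov_torsion_free:
  assumes x: "x \<in> \<Omega>"
  shows "D u (\<partial> v F) x = D v (\<partial> u F) x"
  unfolding cov_def pd_commute[OF open_\<Omega> x smooth_F, where u=u and v=v]
    christoffel_sym[OF maps[OF x], of "\<partial> u F x"] ..

text \<open>Both sides agree for coordinate fields by definition of the curvature; the point is that all terms that
  contain derivatives of \<open>\<xi>\<close> or second derivatives of \<open>F\<close> are symmetric in \<open>u\<close> and \<open>v\<close>.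
  For the identity map this is the usual definition of the curvature, for an immersion it yields the Gauss
  and Codazzi equations.\<close>

lemma cov_curvature:
  assumes x: "x \<in> \<Omega>" and \<xi>: "smooth_on \<Omega> \<xi>"
  shows "D u (D v \<xi>) x - D v (D u \<xi>) x = R (F x) (\<partial> u F x) (\<partial> v F x) (\<xi> x)"
proof -
  note bl = bilinear_ladd[OF christoffel_bilinear[OF maps[OF x]]] bilinear_radd[OF christoffel_bilinear[OF maps[OF x]]]
  have DD: "D u (D v \<xi>) x = \<partial> u (\<partial> v \<xi>) x + \<partial> (\<partial> u F x) (\<lambda>y. \<Gamma> y (\<partial> v F x) (\<xi> x)) (F x)
      + \<Gamma> (F x) (\<partial> u (\<partial> v F) x) (\<xi> x) + \<Gamma> (F x) (\<partial> v F x) (\<partial> u \<xi> x)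
      + \<Gamma> (F x) (\<partial> u F x) (\<partial> v \<xi> x) + \<Gamma> (F x) (\<partial> u F x) (\<Gamma> (F x) (\<partial> v F x) (\<xi> x))" for u v
  proof -
    have 1: "\<partial> u (\<lambda>y. \<Gamma> (F y) (\<partial> v F x) (\<xi> x)) x = \<partial> (\<partial> u F x) (\<lambda>y. \<Gamma> y (\<partial> v F x) (\<xi> x)) (F x)"
      by (rule pd_chain[where f="\<lambda>y. \<Gamma> y (\<partial> v F x) (\<xi> x)", OF diff_F[OF x]
            smooth_onD(1)[OF christoffel_smooth maps[OF x]]])
    note field = pd_bilinear_field[where B="\<lambda>x. \<Gamma> (F x)" and \<xi>="\<partial> v F" and \<eta>=\<xi>, OF open_\<Omega> x
        christoffel_bilinear[OF maps] smooth_onD(1)[OF smooth_christoffel_along x]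
        smooth_onD(1)[OF smooth_onD(2)[OF smooth_F] x] smooth_onD(1)[OF \<xi> x]]
    have 2: "\<partial> u (\<lambda>y. \<Gamma> (F y) (\<partial> v F y) (\<xi> y)) x = \<partial> u (\<lambda>y. \<Gamma> (F y) (\<partial> v F x) (\<xi> x)) x
        + \<Gamma> (F x) (\<partial> u (\<partial> v F) x) (\<xi> x) + \<Gamma> (F x) (\<partial> v F x) (\<partial> u \<xi> x)"
      by (rule field(1))
    have 3: "(\<lambda>y. \<Gamma> (F y) (\<partial> v F y) (\<xi> y)) differentiable (at x)"
      by (rule field(2))
    have "\<partial> u (D v \<xi>) x = \<partial> u (\<partial> v \<xi>) x + \<partial> u (\<lambda>y. \<Gamma> (F y) (\<partial> v F y) (\<xi> y)) x"
      using pd_add[OF smooth_onD(1)[OF smooth_onD(2)[OF \<xi>] x] 3, where v=u] unfolding cov_def .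
    then show ?thesis
      unfolding cov_def[where u=u] 2 1 by (simp add: cov_def bl)
  qed
  show ?thesis
    unfolding DD curvature_def
    using pd_commute[OF open_\<Omega> x \<xi>, where u=u and v=v] pd_commute[OF open_\<Omega> x smooth_F, where u=u and v=v]
    by simp
qed

end


subsection \<open>Symmetries of the curvature tensor\<close>

context metric_field
begin

lemma identity_map: "map_into_metric S g S (\<lambda>x. x)"
  by unfold_locales (auto simp: open_S smooth_on_id)

lemmas nabla_metric = map_into_metric.cov_metric[OF identity_map]
  and nabla_curvature = map_into_metric.cov_curvature[OF identity_map]
  and nabla_smooth = map_into_metric.cov_smooth[OF identity_map]

lemma curvature_swap: "R x u v w = - R x v u w"
  unfolding curvature_def by simp

text \<open>Mixed second derivatives of the function \<open>g y w z\<close> commute; expanding them by metric compatibility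
  leaves the two curvature terms.\<close>

lemma curvature_skew:
  assumes x: "x \<in> S"
  shows "g x (R x u v w) z = - g x w (R x u v z)"
proof -
  let ?N = "\<lambda>u. cov g (\<lambda>x. x) u"
  have c: "smooth_on S (\<lambda>x. w)" for w :: 'e
    by (rule smooth_on_const)
  have first: "\<partial> v (\<lambda>y. g y w z) y = g y (?N v (\<lambda>x. w) y) z + g y w (?N v (\<lambda>x. z) y)" if "y \<in> S" for y v
    by (rule nabla_metric[OF that c c])
  have second: "\<partial> u (\<partial> v (\<lambda>y. g y w z)) x =
      g x (?N u (?N v (\<lambda>x. w)) x) z + g x (?N v (\<lambda>x. w) x) (?N u (\<lambda>x. z) x)
      + (g x (?N u (\<lambda>x. w) x) (?N v (\<lambda>x. z) x) + g x w (?N u (?N v (\<lambda>x. z)) x))" for u v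
  proof -
    note m1 = nabla_metric[OF x nabla_smooth[OF c[of w], of v] c[of z], of u]
      and m2 = nabla_metric[OF x c[of w] nabla_smooth[OF c[of z], of v], of u]
    have d: "(\<lambda>y. g y (\<xi> y) (\<eta> y)) differentiable (at x)" if "smooth_on S \<xi>" "smooth_on S \<eta>" for \<xi> \<eta>
      by (rule smooth_onD(1)[OF map_into_metric.smooth_inner_along[OF identity_map that] x])
    have "\<partial> u (\<partial> v (\<lambda>y. g y w z)) x = \<partial> u (\<lambda>y. g y (?N v (\<lambda>x. w) y) z + g y w (?N v (\<lambda>x. z) y)) x"
      by (rule pd_cong[OF open_S x first])
    also have "\<dots> = \<partial> u (\<lambda>y. g y (?N v (\<lambda>x. w) y) z) x + \<partial> u (\<lambda>y. g y w (?N v (\<lambda>x. z) y)) x"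
      by (rule pd_add[OF d[where \<xi>="?N v (\<lambda>x. w)" and \<eta>="\<lambda>x. z", OF nabla_smooth[OF c] c]
              d[where \<xi>="\<lambda>x. w" and \<eta>="?N v (\<lambda>x. z)", OF c nabla_smooth[OF c]]])
    finally show ?thesis unfolding m1 m2 .
  qed
  have R_eq: "R x u v w = ?N u (?N v (\<lambda>x. w)) x - ?N v (?N u (\<lambda>x. w)) x" for w
    using nabla_curvature[OF x c[of w], of u v] by simp
  show ?thesis
    unfolding R_eq gs[OF x]
    using second[of u v] second[of v u] pd_commute[OF open_S x smooth, where u=u and v=v]
    by (simp add: gs[OF x])
qed

text \<open>In coordinates the terms cancel by the symmetry of the Christoffel symbols.\<close>

lemma curvature_bianchi:
  assumes x: "x \<in> S"
  shows "R x u v w + R x v w u + R x w u v = 0"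
proof -
  have "\<partial> a (\<lambda>y. \<Gamma> y b c) x = \<partial> a (\<lambda>y. \<Gamma> y c b) x" for a b c
    by (rule pd_cong[OF open_S x christoffel_sym])
  from this[of u v w] this[of v w u] this[of w u v] show ?thesis
    unfolding curvature_def christoffel_sym[OF x, of w v] christoffel_sym[OF x, of v u]
      christoffel_sym[OF x, of u w] by simp
qed

lemma curvature_linear:
  assumes x: "x \<in> S"
  shows "linear (\<lambda>w. R x u v w)" "linear (\<lambda>v. R x u v w)" "linear (\<lambda>u. R x u v w)"
proof -
  have b: "bilinear (\<lambda>u v. \<partial> w (\<lambda>y. \<Gamma> y u v) x)" for w
    by (rule bilinear_pd_field[OF open_S x christoffel_bilinear smooth_onD(1)[OF christoffel_smooth x]])
  have p: "linear (\<lambda>w. \<partial> w (\<lambda>y. \<Gamma> y u v) x)" for u v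
    by (rule pd_linear[OF smooth_onD(1)[OF christoffel_smooth x]])
  note c = christoffel_bilinear[OF x]
  note simps = bilinear_ladd[OF b] bilinear_radd[OF b] bilinear_lmul[OF b] bilinear_rmul[OF b]
    linear_add[OF p] linear_scale[OF p]
    bilinear_ladd[OF c] bilinear_radd[OF c] bilinear_lmul[OF c] bilinear_rmul[OF c] scaleR_diff_right scaleR_add_right
  show "linear (\<lambda>w. R x u v w)" "linear (\<lambda>v. R x u v w)" "linear (\<lambda>u. R x u v w)"
    unfolding curvature_def by (rule linearI; simp add: simps)+
qed

end

subsection \<open>Covariant derivatives of bilinear forms\<close>

definition form_field :: "'e::euclidean_space set \<Rightarrow> ('e \<Rightarrow> 'e \<Rightarrow> 'e \<Rightarrow> real) \<Rightarrow> bool" where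
  "form_field S P \<longleftrightarrow> (\<forall>x\<in>S. bilinear (P x)) \<and> (\<forall>u v. smooth_on S (\<lambda>x. P x u v))"

definition nabla ::
    "('e::euclidean_space \<Rightarrow> 'e \<Rightarrow> 'e \<Rightarrow> real) \<Rightarrow> 'e \<Rightarrow> ('e \<Rightarrow> 'e \<Rightarrow> 'e \<Rightarrow> real) \<Rightarrow> 'e \<Rightarrow> 'e \<Rightarrow> 'e \<Rightarrow> real" where
  "nabla g w P x u v =
     \<partial> w (\<lambda>y. P y u v) x - P x (christoffel g x w u) v - P x u (christoffel g x w v)"

lemma form_fieldD:
  assumes "form_field S P"
  shows "x \<in> S \<Longrightarrow> bilinear (P x)" "smooth_on S (\<lambda>x. P x u v)"
    "x \<in> S \<Longrightarrow> (\<lambda>x. P x u v) differentiable (at x)"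
proof -
  show "x \<in> S \<Longrightarrow> bilinear (P x)" and s: "smooth_on S (\<lambda>x. P x u v)"
    using assms unfolding form_field_def by simp_all
  show "x \<in> S \<Longrightarrow> (\<lambda>x. P x u v) differentiable (at x)"
    by (rule smooth_onD(1)[OF s])
qed

context metric_field
begin

abbreviation nabla_g ("\<nabla>") where "\<nabla> \<equiv> nabla g"

lemma form_field_g: "form_field S g"
  unfolding form_field_def using sym_form_linear(3)[OF sym] smooth by simp

lemma nabla_g: "x \<in> S \<Longrightarrow> \<nabla> w g x u v = 0"
  unfolding nabla_def by (simp add: metric_compatible)

lemma smooth_form_along:
  assumes P: "form_field S P" and "smooth_on S \<xi>" "smooth_on S \<eta>"
  shows "smooth_on S (\<lambda>x. P x (\<xi> x) (\<eta> x))"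
  by (rule smooth_on_bilinear_field[where B=P, OF open_S form_fieldD(1)[OF P] form_fieldD(2)[OF P] assms(2,3)])

lemma pd_form_along:
  assumes P: "form_field S P" and x: "x \<in> S" and \<xi>: "smooth_on S \<xi>" and \<eta>: "smooth_on S \<eta>"
  shows "\<partial> w (\<lambda>y. P y (\<xi> y) (\<eta> y)) x =
    \<partial> w (\<lambda>y. P y (\<xi> x) (\<eta> x)) x + P x (\<partial> w \<xi> x) (\<eta> x) + P x (\<xi> x) (\<partial> w \<eta> x)"
  by (rule pd_bilinear_field(1)[where B=P and \<xi>=\<xi> and \<eta>=\<eta>, OF open_S x form_fieldD(1)[OF P]
        form_fieldD(3)[OF P x] smooth_onD(1)[OF \<xi> x] smooth_onD(1)[OF \<eta> x]])

lemma form_field_nabla: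
  assumes P: "form_field S P"
  shows "form_field S (\<nabla> w P)"
  unfolding form_field_def
proof (intro conjI ballI allI)
  fix x assume x: "x \<in> S"
  have b: "bilinear (\<lambda>u v. \<partial> w (\<lambda>y. P y u v) x)"
    by (rule bilinear_pd_field[OF open_S x form_fieldD(1)[OF P] form_fieldD(3)[OF P x]])
  note bP = form_fieldD(1)[OF P x] and c = christoffel_bilinear[OF x]
  note simps = bilinear_ladd[OF b] bilinear_radd[OF b] bilinear_lmul[OF b] bilinear_rmul[OF b]
    bilinear_ladd[OF bP] bilinear_radd[OF bP] bilinear_lmul[OF bP] bilinear_rmul[OF bP]
    bilinear_radd[OF c] bilinear_rmul[OF c] right_diff_distrib distrib_left
  show "bilinear (\<nabla> w P x)"
    unfolding bilinear_def nabla_def by (intro conjI allI; rule linearI; simp add: simps)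
next
  fix u v
  show "smooth_on S (\<lambda>x. \<nabla> w P x u v)"
    unfolding nabla_def
    by (rule smooth_on_diff[OF open_S smooth_on_diff[OF open_S]];
        rule smooth_onD(2)[OF form_fieldD(2)[OF P]]
          smooth_form_along[OF P christoffel_smooth smooth_on_const]
          smooth_form_along[OF P smooth_on_const christoffel_smooth])
qed

text \<open>The commutator of covariant derivatives in fixed coordinate directions acts on a bilinear form
  through the curvature in each of its arguments.\<close>

lemma ricci_identity:
  assumes P: "form_field S P" and x: "x \<in> S"
  shows "\<nabla> z (\<nabla> w P) x u v - \<nabla> w (\<nabla> z P) x u v = - P x (R x z w u) v - P x u (R x z w v)"
proof -
  note bP = form_fieldD(1)[OF P x]
  have main: "\<nabla> z (\<nabla> w P) x u v = \<partial> z (\<partial> w (\<lambda>y. P y u v)) x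
     - (\<partial> z (\<lambda>y. P y (\<Gamma> x w u) v) x + P x (\<partial> z (\<lambda>y. \<Gamma> y w u) x) v)
     - (\<partial> z (\<lambda>y. P y u (\<Gamma> x w v)) x + P x u (\<partial> z (\<lambda>y. \<Gamma> y w v) x))
     - (\<partial> w (\<lambda>y. P y (\<Gamma> x z u) v) x - P x (\<Gamma> x w (\<Gamma> x z u)) v - P x (\<Gamma> x z u) (\<Gamma> x w v))
     - (\<partial> w (\<lambda>y. P y u (\<Gamma> x z v)) x - P x (\<Gamma> x w u) (\<Gamma> x z v) - P x u (\<Gamma> x w (\<Gamma> x z v)))" for z w
  proof -
    have s1: "smooth_on S (\<lambda>y. P y (\<Gamma> y w u) v)" and s2: "smooth_on S (\<lambda>y. P y u (\<Gamma> y w v))"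
      by (rule smooth_form_along[OF P christoffel_smooth smooth_on_const]
          smooth_form_along[OF P smooth_on_const christoffel_smooth])+
    have s0: "smooth_on S (\<partial> w (\<lambda>y. P y u v))"
      by (rule smooth_onD(2)[OF form_fieldD(2)[OF P]])
    have "\<partial> z (\<lambda>y. \<nabla> w P y u v) x = \<partial> z (\<partial> w (\<lambda>y. P y u v)) x
        - \<partial> z (\<lambda>y. P y (\<Gamma> y w u) v) x - \<partial> z (\<lambda>y. P y u (\<Gamma> y w v)) x"
      unfolding nabla_def
      using pd_diff[OF smooth_onD(1)[OF smooth_on_diff[OF open_S s0 s1] x] smooth_onD(1)[OF s2 x], where v=z]
        pd_diff[OF smooth_onD(1)[OF s0 x] smooth_onD(1)[OF s1 x], where v=z] by simp
    moreover have "\<partial> z (\<lambda>y. P y (\<Gamma> y w u) v) x = \<partial> z (\<lambda>y. P y (\<Gamma> x w u) v) x + P x (\<partial> z (\<lambda>y. \<Gamma> y w u) x) v"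
      using pd_form_along[OF P x christoffel_smooth[of w u] smooth_on_const[of S v], of z]
      by (simp add: bilinear_rzero[OF bP])
    moreover have "\<partial> z (\<lambda>y. P y u (\<Gamma> y w v)) x = \<partial> z (\<lambda>y. P y u (\<Gamma> x w v)) x + P x u (\<partial> z (\<lambda>y. \<Gamma> y w v) x)"
      using pd_form_along[OF P x smooth_on_const[of S u] christoffel_smooth[of w v], of z]
      by (simp add: bilinear_lzero[OF bP])
    ultimately show ?thesis
      unfolding nabla_def[of g z "nabla g w P"] by (simp only: nabla_def[of g w P x])
  qed
  show ?thesis
    unfolding main curvature_def pd_commute[OF open_S x form_fieldD(2)[OF P, of u v], where u=z and v=w]
    by (simp add: bilinear_ladd[OF bP] bilinear_radd[OF bP] bilinear_lsub[OF bP] bilinear_rsub[OF bP])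
qed

end

lemma bilinear_sums:
  assumes "bilinear h"
  shows "h (sum f A) z = (\<Sum>a\<in>A. h (f a) z)" "h z (sum f A) = (\<Sum>a\<in>A. h z (f a))"
proof -
  have l: "linear (\<lambda>x. h x z)" "linear (h z)"
    using assms unfolding bilinear_def by auto
  show "h (sum f A) z = (\<Sum>a\<in>A. h (f a) z)" "h z (sum f A) = (\<Sum>a\<in>A. h z (f a))"
    by (rule linear_sum[OF l(1)], rule linear_sum[OF l(2)])
qed

locale riemannian_field = metric_field S g for S :: "'e::euclidean_space set" and g +
  assumes pos: "x \<in> S \<Longrightarrow> pos_form (g x)"
begin

lemma dual_smooth: "smooth_on S (\<lambda>x. dual (g x) i)"
  by (rule smooth_on_form_solution[where G=g and l="\<lambda>x z. z \<bullet> i", OF open_S sym nondeg smooth dual_eq[OF pos] smooth_on_const])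

text \<open>Covariantly, the dual basis moves by minus the transpose of the connection form.\<close>

lemma pd_dual:
  assumes x: "x \<in> S"
  shows "\<partial> w (\<lambda>y. dual (g y) i) x =
    - \<Gamma> x w (dual (g x) i) - (\<Sum>k\<in>Basis. (\<Gamma> x w k \<bullet> i) *\<^sub>R dual (g x) k)"
proof (rule raise_unique[OF sym[OF x] nondeg[OF x]])
  fix v
  have "\<partial> w (\<lambda>y. g y (dual (g y) i) v) x = \<partial> w (\<lambda>y. v \<bullet> i) x"
    by (rule pd_cong[OF open_S x]) (rule dual_eq[OF pos])
  then have "0 = g x (\<partial> w (\<lambda>y. dual (g y) i) x + \<Gamma> x w (dual (g x) i)) v + g x (dual (g x) i) (\<Gamma> x w v)"
    using nabla_metric[OF x dual_smooth[of i] smooth_on_const[of S v], of w] by (simp add: cov_def)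
  moreover have "g x (\<Sum>k\<in>Basis. (\<Gamma> x w k \<bullet> i) *\<^sub>R dual (g x) k) v = \<Gamma> x w v \<bullet> i"
  proof -
    have "\<Gamma> x w (\<Sum>k\<in>Basis. (v \<bullet> k) *\<^sub>R k) = (\<Sum>k\<in>Basis. (v \<bullet> k) *\<^sub>R \<Gamma> x w k)"
      using christoffel_linear[OF x, of w] by (simp add: linear_sum linear_scale)
    then have "\<Gamma> x w v = (\<Sum>k\<in>Basis. (v \<bullet> k) *\<^sub>R \<Gamma> x w k)"
      by (simp add: euclidean_representation)
    then show ?thesis
      by (simp add: gs[OF x] dual_eq[OF pos[OF x]] inner_sum_left mult.commute)
  qed
  ultimately show "g x (\<partial> w (\<lambda>y. dual (g y) i) x) v =
      g x (- \<Gamma> x w (dual (g x) i) - (\<Sum>k\<in>Basis. (\<Gamma> x w k \<bullet> i) *\<^sub>R dual (g x) k)) v"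
    by (simp only: gs(1,3,9)[OF x] dual_eq[OF pos[OF x]])
qed

lemma form_inner_smooth:
  assumes P: "form_field S P" and Q: "form_field S Q"
  shows "smooth_on S (\<lambda>x. form_inner (g x) (P x) (Q x))"
  unfolding form_inner_def
  by (intro smooth_on_sum[OF open_S] smooth_on_mult[OF open_S form_fieldD(2)[OF P]
        smooth_form_along[OF Q dual_smooth dual_smooth]])

text \<open>The inner product on bilinear forms is parallel because \<open>g\<close> is. In the basis expansion of the inner
  product, one of the two Christoffel terms in the derivative of each dual vector completes the covariant
  derivative of \<open>Q\<close>, and the other one, after transposition of the sums, that of \<open>P\<close>.\<close>

lemma pd_form_inner:
  assumes P: "form_field S P" and Q: "form_field S Q" and x: "x \<in> S"
  shows "\<partial> w (\<lambda>x. form_inner (g x) (P x) (Q x)) x =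
    form_inner (g x) (\<nabla> w P x) (Q x) + form_inner (g x) (P x) (\<nabla> w Q x)"
proof -
  note bP = form_fieldD(1)[OF P x] and bQ = form_fieldD(1)[OF Q x]
  define d where "d i = dual (g x) i" for i
  define C where "C i = (\<Sum>k\<in>Basis. (\<Gamma> x w k \<bullet> i) *\<^sub>R d k)" for i
  have dd: "\<partial> w (\<lambda>y. dual (g y) i) x = - \<Gamma> x w (d i) - C i" for i
    unfolding d_def C_def by (rule pd_dual[OF x])
  have smooth_ij: "smooth_on S (\<lambda>x. P x i j)" "smooth_on S (\<lambda>x. Q x (dual (g x) i) (dual (g x) j))" for i j
    by (rule form_fieldD(2)[OF P], rule smooth_form_along[OF Q dual_smooth dual_smooth])
  note prod = smooth_on_mult[OF open_S smooth_ij]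
  have "\<partial> w (\<lambda>x. form_inner (g x) (P x) (Q x)) x =
      (\<Sum>i\<in>Basis. \<Sum>j\<in>Basis. \<partial> w (\<lambda>x. P x i j * Q x (dual (g x) i) (dual (g x) j)) x)"
    unfolding form_inner_def
    by (subst pd_sum[OF smooth_onD(1)[OF smooth_on_sum[OF open_S prod] x]],
        rule sum.cong[OF refl], rule pd_sum[OF smooth_onD(1)[OF prod x]])
  also have "\<dots> = (\<Sum>i\<in>Basis. \<Sum>j\<in>Basis. \<partial> w (\<lambda>y. P y i j) x * Q x (d i) (d j)
      + P x i j * (\<partial> w (\<lambda>y. Q y (d i) (d j)) x - Q x (\<Gamma> x w (d i)) (d j) - Q x (d i) (\<Gamma> x w (d j)))
      - P x i j * Q x (C i) (d j) - P x i j * Q x (d i) (C j))"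
  proof (intro sum.cong refl)
    fix i j :: 'e
    show "\<partial> w (\<lambda>x. P x i j * Q x (dual (g x) i) (dual (g x) j)) x =
      \<partial> w (\<lambda>y. P y i j) x * Q x (d i) (d j)
      + P x i j * (\<partial> w (\<lambda>y. Q y (d i) (d j)) x - Q x (\<Gamma> x w (d i)) (d j) - Q x (d i) (\<Gamma> x w (d j)))
      - P x i j * Q x (C i) (d j) - P x i j * Q x (d i) (C j)"
      unfolding pd_mult[OF smooth_onD(1)[OF smooth_ij(1) x] smooth_onD(1)[OF smooth_ij(2) x]]
        pd_form_along[OF Q x dual_smooth dual_smooth] dd d_def[symmetric]
      by (simp add: bilinear_lsub[OF bQ] bilinear_rsub[OF bQ] bilinear_lneg[OF bQ] bilinear_rneg[OF bQ]
          algebra_simps)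
  qed
  also have "\<dots> = (\<Sum>i\<in>Basis. \<Sum>j\<in>Basis. \<partial> w (\<lambda>y. P y i j) x * Q x (d i) (d j))
      + form_inner (g x) (P x) (\<nabla> w Q x)
      - (\<Sum>i\<in>Basis. \<Sum>j\<in>Basis. P x i j * Q x (C i) (d j)) - (\<Sum>i\<in>Basis. \<Sum>j\<in>Basis. P x i j * Q x (d i) (C j))"
    by (simp add: form_inner_def nabla_def d_def sum.distrib sum_subtractf)
  also have "(\<Sum>i\<in>Basis. \<Sum>j\<in>Basis. P x i j * Q x (C i) (d j)) =
      (\<Sum>i\<in>Basis. \<Sum>j\<in>Basis. P x (\<Gamma> x w i) j * Q x (d i) (d j))"
  proof -
    have 1: "P x (\<Gamma> x w k) j = (\<Sum>i\<in>Basis. (\<Gamma> x w k \<bullet> i) * P x i j)" for k j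
    proof -
      have "P x (\<Sum>i\<in>Basis. (\<Gamma> x w k \<bullet> i) *\<^sub>R i) j = (\<Sum>i\<in>Basis. (\<Gamma> x w k \<bullet> i) * P x i j)"
        by (simp add: bilinear_sums[OF bP] bilinear_lmul[OF bP] bilinear_rmul[OF bP])
      then show ?thesis by (simp add: euclidean_representation)
    qed
    have 2: "Q x (C i) z = (\<Sum>k\<in>Basis. (\<Gamma> x w k \<bullet> i) * Q x (d k) z)" for i z
      unfolding C_def by (simp add: bilinear_sums[OF bQ] bilinear_lmul[OF bQ] bilinear_rmul[OF bQ])
    have "(\<Sum>i\<in>Basis. \<Sum>j\<in>Basis. P x i j * Q x (C i) (d j)) =
      (\<Sum>i\<in>Basis. \<Sum>j\<in>Basis. \<Sum>k\<in>Basis. (\<Gamma> x w k \<bullet> i) * P x i j * Q x (d k) (d j))"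
      unfolding 2 by (simp add: sum_distrib_left mult_ac)
    also have "\<dots> = (\<Sum>j\<in>Basis. \<Sum>k\<in>Basis. \<Sum>i\<in>Basis. (\<Gamma> x w k \<bullet> i) * P x i j * Q x (d k) (d j))"
      by (rule sum_rotate)
    also have "\<dots> = (\<Sum>j\<in>Basis. \<Sum>k\<in>Basis. P x (\<Gamma> x w k) j * Q x (d k) (d j))"
      unfolding 1 by (simp add: sum_distrib_right)
    also have "\<dots> = (\<Sum>k\<in>Basis. \<Sum>j\<in>Basis. P x (\<Gamma> x w k) j * Q x (d k) (d j))"
      by (rule sum.swap)
    finally show ?thesis .
  qed
  also have "(\<Sum>i\<in>Basis. \<Sum>j\<in>Basis. P x i j * Q x (d i) (C j)) =
      (\<Sum>i\<in>Basis. \<Sum>j\<in>Basis. P x i (\<Gamma> x w j) * Q x (d i) (d j))"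
  proof (rule sum.cong[OF refl])
    fix i :: 'e
    have 1: "P x i (\<Gamma> x w k) = (\<Sum>j\<in>Basis. (\<Gamma> x w k \<bullet> j) * P x i j)" for k
    proof -
      have "P x i (\<Sum>j\<in>Basis. (\<Gamma> x w k \<bullet> j) *\<^sub>R j) = (\<Sum>j\<in>Basis. (\<Gamma> x w k \<bullet> j) * P x i j)"
        by (simp add: bilinear_sums[OF bP] bilinear_lmul[OF bP] bilinear_rmul[OF bP])
      then show ?thesis by (simp add: euclidean_representation)
    qed
    have 2: "Q x z (C j) = (\<Sum>k\<in>Basis. (\<Gamma> x w k \<bullet> j) * Q x z (d k))" for j z
      unfolding C_def by (simp add: bilinear_sums[OF bQ] bilinear_lmul[OF bQ] bilinear_rmul[OF bQ])
    have "(\<Sum>j\<in>Basis. P x i j * Q x (d i) (C j)) =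
      (\<Sum>j\<in>Basis. \<Sum>k\<in>Basis. (\<Gamma> x w k \<bullet> j) * P x i j * Q x (d i) (d k))"
      unfolding 2 by (simp add: sum_distrib_left mult_ac)
    also have "\<dots> = (\<Sum>k\<in>Basis. \<Sum>j\<in>Basis. (\<Gamma> x w k \<bullet> j) * P x i j * Q x (d i) (d k))"
      by (rule sum.swap)
    also have "\<dots> = (\<Sum>k\<in>Basis. P x i (\<Gamma> x w k) * Q x (d i) (d k))"
      unfolding 1 by (simp add: sum_distrib_right)
    finally show "(\<Sum>j\<in>Basis. P x i j * Q x (d i) (C j)) = (\<Sum>j\<in>Basis. P x i (\<Gamma> x w j) * Q x (d i) (d j))" .
  qed
  also have "(\<Sum>i\<in>Basis. \<Sum>j\<in>Basis. \<partial> w (\<lambda>y. P y i j) x * Q x (d i) (d j))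
      + form_inner (g x) (P x) (\<nabla> w Q x)
      - (\<Sum>i\<in>Basis. \<Sum>j\<in>Basis. P x (\<Gamma> x w i) j * Q x (d i) (d j))
      - (\<Sum>i\<in>Basis. \<Sum>j\<in>Basis. P x i (\<Gamma> x w j) * Q x (d i) (d j)) =
      form_inner (g x) (\<nabla> w P x) (Q x) + form_inner (g x) (P x) (\<nabla> w Q x)"
    by (simp add: form_inner_def[of _ "nabla g w P x"] nabla_def d_def left_diff_distrib sum_subtractf)
  finally show ?thesis .
qed

end


section \<open>Codazzi fields and the Simons inequality\<close>

lemma form_inner_commute:
  assumes g: "pos_form g" and P: "bilinear P" and Q: "bilinear Q"
  shows "form_inner g P Q = form_inner g Q P"
proof -
  obtain E where E: "frame g E"
    by (rule eigenframe[OF g pos_formD(1)[OF g]])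
  show ?thesis
    unfolding form_inner_frame[OF g E P Q] form_inner_frame[OF g E Q P] by (simp add: mult.commute)
qed

lemma form_inner_diff: "form_inner g (\<lambda>u v. P u v - P' u v) Q = form_inner g P Q - form_inner g P' Q"
  unfolding form_inner_def by (simp add: left_diff_distrib sum_subtractf)

lemma form_inner_nonneg:
  assumes g: "pos_form g" and P: "bilinear P"
  shows "form_inner g P P \<ge> 0"
    and "form_inner g P P = 0 \<Longrightarrow> P u v = 0"
proof -
  obtain E where E: "frame g E"
    by (rule eigenframe[OF g pos_formD(1)[OF g]])
  have fin: "finite E" using E unfolding frame_def by simp
  note eq = form_inner_frame[OF g E P P]
  show "form_inner g P P \<ge> 0"
    unfolding eq by (intro sum_nonneg) simp
  assume "form_inner g P P = 0"
  then have "P a c = 0" if "a \<in> E" "c \<in> E" for a c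
    unfolding eq using fin that by (simp add: sum_nonneg_eq_0_iff sum_nonneg)
  moreover have "P u v = (\<Sum>a\<in>E. \<Sum>c\<in>E. g u a * (g v c * P a c))"
  proof -
    have l: "linear (P a)" "linear (\<lambda>u. P u v)" for a
      using P unfolding bilinear_def by auto
    show ?thesis
      using frame_linear_expand[OF pos_formD(1)[OF g] E l(2), of u] frame_linear_expand[OF pos_formD(1)[OF g] E l(1), of _ v]
      by (simp add: sum_distrib_left)
  qed
  ultimately show "P u v = 0" by simp
qed

text \<open>Bilinear forms with totally symmetric covariant derivative. The second fundamental form of a
  hypersurface in a space of constant curvature is the example of interest, but the inequality below does
  not refer to any surrounding space.\<close>

locale codazzi_field = riemannian_field S g for S :: "'e::euclidean_space set" and g +
  fixes b :: "'e \<Rightarrow> 'e \<Rightarrow> 'e \<Rightarrow> real"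
  assumes form_b: "form_field S b"
    and sym_b: "x \<in> S \<Longrightarrow> b x u v = b x v u"
    and codazzi: "x \<in> S \<Longrightarrow> nabla g w b x u v = nabla g u b x w v"
begin

lemma sym_form_b: "x \<in> S \<Longrightarrow> sym_form (b x)"
  unfolding sym_form_def using form_fieldD(1)[OF form_b] sym_b by blast

abbreviation "norm2 x \<equiv> form_inner (g x) (b x) (b x)"

lemma norm2_smooth: "smooth_on S (\<lambda>x. norm2 x)"
  by (rule form_inner_smooth[OF form_b form_b])

lemma pd_norm2:
  assumes x: "x \<in> S"
  shows "\<partial> w (\<lambda>x. norm2 x) x = 2 * form_inner (g x) (\<nabla> w b x) (b x)"
  unfolding pd_form_inner[OF form_b form_b x]
  using form_inner_commute[OF pos[OF x] form_fieldD(1)[OF form_b x] form_fieldD(1)[OF form_field_nabla[OF form_b] x], of w]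
  by simp

text \<open>The second covariant derivative of \<open>b\<close>. Iterating \<open>\<nabla>\<close> in fixed coordinate directions
  ignores that the direction \<open>w\<close> itself is differentiated by the connection, whence the correction.\<close>

definition hess_b :: "'e \<Rightarrow> 'e \<Rightarrow> 'e \<Rightarrow> 'e \<Rightarrow> 'e \<Rightarrow> real" where
  "hess_b x z w u v = \<nabla> z (\<nabla> w b) x u v - \<nabla> (\<Gamma> x z w) b x u v"

lemma bilinear_hess_b:
  assumes x: "x \<in> S"
  shows "bilinear (hess_b x z w)"
proof -
  note b1 = form_fieldD(1)[OF form_field_nabla[OF form_field_nabla[OF form_b]] x, of z w]
    and b2 = form_fieldD(1)[OF form_field_nabla[OF form_b] x, of "\<Gamma> x z w"]
  show ?thesis
    unfolding hess_b_def bilinear_def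
    by (intro conjI allI; rule linearI;
      simp add: bilinear_ladd[OF b1] bilinear_ladd[OF b2] bilinear_radd[OF b1] bilinear_radd[OF b2]
        bilinear_lmul[OF b1] bilinear_lmul[OF b2] bilinear_rmul[OF b1] bilinear_rmul[OF b2] right_diff_distrib)
qed

lemma hessian_norm2:
  assumes x: "x \<in> S"
  shows "\<partial> z (\<partial> w (\<lambda>x. norm2 x)) x - \<partial> (\<Gamma> x z w) (\<lambda>x. norm2 x) x =
    2 * form_inner (g x) (hess_b x z w) (b x) + 2 * form_inner (g x) (\<nabla> w b x) (\<nabla> z b x)"
proof -
  note sm = form_inner_smooth[OF form_field_nabla[OF form_b] form_b, of w]
  have "\<partial> z (\<partial> w (\<lambda>x. norm2 x)) x = \<partial> z (\<lambda>x. 2 * form_inner (g x) (\<nabla> w b x) (b x)) x"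
    by (rule pd_cong[OF open_S x pd_norm2])
  also have "\<dots> = 2 * \<partial> z (\<lambda>x. form_inner (g x) (\<nabla> w b x) (b x)) x"
    by (rule pd_bounded_linear(1)[OF bounded_linear_mult_right smooth_onD(1)[OF sm x]])
  finally show ?thesis
    unfolding pd_form_inner[OF form_field_nabla[OF form_b] form_b x] pd_norm2[OF x] hess_b_def[abs_def] form_inner_diff
    by (simp add: algebra_simps)
qed

lemma nabla_b_sym:
  assumes x: "x \<in> S"
  shows "\<nabla> w b x u v = \<nabla> w b x v u"
proof -
  have "\<partial> w (\<lambda>y. b y u v) x = \<partial> w (\<lambda>y. b y v u) x"
    by (rule pd_cong[OF open_S x sym_b])
  then show ?thesis
    unfolding nabla_def by (simp add: sym_b[OF x])
qed

lemma hess_b_sym1: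
  assumes x: "x \<in> S"
  shows "hess_b x z w u v = hess_b x z u w v"
proof -
  have "\<partial> z (\<lambda>y. \<nabla> w b y u v) x = \<partial> z (\<lambda>y. \<nabla> u b y w v) x"
    by (rule pd_cong[OF open_S x codazzi])
  then show ?thesis
    unfolding hess_b_def nabla_def[of g z]
    using codazzi[OF x, of w "\<Gamma> x z u" v] codazzi[OF x, of w u "\<Gamma> x z v"] codazzi[OF x, of u "\<Gamma> x z w" v]
    by simp
qed

lemma hess_b_sym2:
  assumes x: "x \<in> S"
  shows "hess_b x z w u v = hess_b x z w v u"
proof -
  have "\<partial> z (\<lambda>y. \<nabla> w b y u v) x = \<partial> z (\<lambda>y. \<nabla> w b y v u) x"
    by (rule pd_cong[OF open_S x nabla_b_sym])
  then show ?thesis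
    unfolding hess_b_def nabla_def[of g z]
    using nabla_b_sym[OF x, of w "\<Gamma> x z u" v] nabla_b_sym[OF x, of w u "\<Gamma> x z v"]
      nabla_b_sym[OF x, of "\<Gamma> x z w" u v] by simp
qed

lemma hess_b_ricci:
  assumes x: "x \<in> S"
  shows "hess_b x z w u v - hess_b x w z u v = - b x (R x z w u) v - b x u (R x z w v)"
  unfolding hess_b_def christoffel_sym[OF x, of z w] using ricci_identity[OF form_b x, of z w u v] by simp

text \<open>The trace with respect to \<open>g\<close> commutes with covariant differentiation, so that \<open>b\<close> of
  constant trace has trace-free covariant derivatives.\<close>

lemma hess_b_trace:
  assumes x: "x \<in> S" and tr: "\<And>y w. y \<in> S \<Longrightarrow> \<partial> w (\<lambda>y. form_inner (g y) (b y) (g y)) y = 0"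
    and E: "frame (g x) E"
  shows "(\<Sum>a\<in>E. hess_b x z w a a) = 0"
proof -
  have nabla_g0: "form_inner (g y) P (\<nabla> w g y) = 0" if "y \<in> S" for y w P
    unfolding form_inner_def using nabla_g[OF that] by simp
  have tr1: "form_inner (g y) (\<nabla> w b y) (g y) = 0" if "y \<in> S" for y w
    using tr[OF that, of w] unfolding pd_form_inner[OF form_b form_field_g that] nabla_g0[OF that] by simp
  have "\<partial> z (\<lambda>y. form_inner (g y) (\<nabla> w b y) (g y)) x = \<partial> z (\<lambda>y. 0) x"
    by (rule pd_cong[OF open_S x tr1])
  then have "form_inner (g x) (\<nabla> z (\<nabla> w b) x) (g x) = 0"
    unfolding pd_form_inner[OF form_field_nabla[OF form_b] form_field_g x] nabla_g0[OF x] by simp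
  then have "form_inner (g x) (hess_b x z w) (g x) = 0"
    unfolding hess_b_def[abs_def] form_inner_diff using tr1[OF x] by simp
  moreover have "form_inner (g x) (hess_b x z w) (g x) = (\<Sum>a\<in>E. \<Sum>c\<in>E. if c = a then hess_b x z w a a else 0)"
    unfolding form_inner_frame[OF pos[OF x] E bilinear_hess_b[OF x] sym_form_linear(3)[OF sym[OF x]]]
    using E unfolding frame_def by (intro sum.cong) auto
  ultimately show ?thesis
    using E unfolding frame_def by simp
qed

text \<open>The right-hand side is the Laplacian of \<open>|b|\<^sup>2\<close>, whose Hessian consists of
  \<open>2 \<langle>\<nabla>\<^sup>2 b, b\<rangle>\<close> and \<open>2 |\<nabla>b|\<^sup>2\<close>. So \<open>|b|\<^sup>2\<close> is subharmonic, and \<open>b\<close> is parallel wherever it is constant.\<close>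

theorem simons_inequality:
  assumes x: "x \<in> S" and tr: "\<And>y w. y \<in> S \<Longrightarrow> \<partial> w (\<lambda>y. form_inner (g y) (b y) (g y)) y = 0"
    and sec: "\<And>u v. nondegenerate_plane g x u v \<Longrightarrow> sectional_curvature g x u v \<ge> 0"
  obtains E where "frame (g x) E"
    "2 * (\<Sum>a\<in>E. form_inner (g x) (\<nabla> a b x) (\<nabla> a b x)) \<le>
      (\<Sum>a\<in>E. \<partial> a (\<partial> a (\<lambda>x. norm2 x)) x) - \<partial> (\<Sum>a\<in>E. \<Gamma> x a a) (\<lambda>x. norm2 x) x"
proof -
  obtain E where E: "frame (g x) E" and eigen: "\<And>y z. y \<in> E \<Longrightarrow> z \<in> E \<Longrightarrow> y \<noteq> z \<Longrightarrow> b x y z = 0"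
    using eigenframe[OF pos[OF x] sym_form_b[OF x]] by blast
  have on: "g x u v = (if u = v then 1 else 0)" if "u \<in> E" "v \<in> E" for u v
    using E that unfolding frame_def by simp
  have "(\<Sum>a\<in>E. \<Sum>u\<in>E. \<Sum>v\<in>E. hess_b x a a u v * b x u v) \<ge> 0"
  proof (rule simons_algebra[where R="R x", OF sym[OF x] sym_form_b[OF x] E eigen hess_b_sym1[OF x]
        hess_b_sym2[OF x] hess_b_ricci[OF x] curvature_skew[OF x] curvature_swap hess_b_trace[OF x tr E]])
    show "0 \<le> g x (R x u v v) u" if "u \<in> E" "v \<in> E" "u \<noteq> v" for u v
      using sec[of u v] on[OF that(1,2)] on[OF that(1,1)] on[OF that(2,2)] that(3)
      unfolding nondegenerate_plane_def sectional_curvature_def by simp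
  qed
  then have pos_hess: "(\<Sum>a\<in>E. form_inner (g x) (hess_b x a a) (b x)) \<ge> 0"
    using form_inner_frame[OF pos[OF x] E bilinear_hess_b[OF x] sym_form_linear(3)[OF sym_form_b[OF x]]]
    by simp
  have lin: "linear (\<lambda>w. \<partial> w (\<lambda>x. norm2 x) x)"
    by (rule pd_linear[OF smooth_onD(1)[OF norm2_smooth x]])
  have "(\<Sum>a\<in>E. \<partial> a (\<partial> a (\<lambda>x. norm2 x)) x) - \<partial> (\<Sum>a\<in>E. \<Gamma> x a a) (\<lambda>x. norm2 x) x =
      (\<Sum>a\<in>E. \<partial> a (\<partial> a (\<lambda>x. norm2 x)) x - \<partial> (\<Gamma> x a a) (\<lambda>x. norm2 x) x)"
    unfolding sum_subtractf by (simp only: linear_sum[OF lin])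
  also have "\<dots> = 2 * (\<Sum>a\<in>E. form_inner (g x) (hess_b x a a) (b x)) +
      2 * (\<Sum>a\<in>E. form_inner (g x) (\<nabla> a b x) (\<nabla> a b x))"
    unfolding hessian_norm2[OF x] by (simp add: sum.distrib sum_distrib_left)
  finally show thesis
    using pos_hess by (intro that[OF E]) simp
qed

lemma parallel_if_norm_constant:
  assumes x: "x \<in> S" and tr: "\<And>y w. y \<in> S \<Longrightarrow> \<partial> w (\<lambda>y. form_inner (g y) (b y) (g y)) y = 0"
    and sec: "\<And>u v. nondegenerate_plane g x u v \<Longrightarrow> sectional_curvature g x u v \<ge> 0"
    and const: "\<And>y. y \<in> S \<Longrightarrow> norm2 y = C"
  shows "\<nabla> w b x u v = 0"
proof -
  obtain E where E: "frame (g x) E" and ineq: "2 * (\<Sum>a\<in>E. form_inner (g x) (\<nabla> a b x) (\<nabla> a b x)) \<le>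
      (\<Sum>a\<in>E. \<partial> a (\<partial> a (\<lambda>x. norm2 x)) x) - \<partial> (\<Sum>a\<in>E. \<Gamma> x a a) (\<lambda>x. norm2 x) x"
    using simons_inequality[OF x tr sec] by blast
  have d0: "\<partial> w (\<lambda>x. norm2 x) y = 0" if "y \<in> S" for y w
    using pd_cong[OF open_S that const, where v=w] by simp
  have "\<partial> a (\<partial> a (\<lambda>x. norm2 x)) x = 0" for a
    using pd_cong[OF open_S x d0, where v=a] by simp
  then have "(\<Sum>a\<in>E. form_inner (g x) (\<nabla> a b x) (\<nabla> a b x)) \<le> 0"
    using ineq d0[OF x] by simp
  moreover note nn = form_inner_nonneg[OF pos[OF x] form_fieldD(1)[OF form_field_nabla[OF form_b] x]]
  ultimately have "form_inner (g x) (\<nabla> a b x) (\<nabla> a b x) = 0" if "a \<in> E" for a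
    using that E sum_nonneg_leq_bound[of E "\<lambda>a. form_inner (g x) (\<nabla> a b x) (\<nabla> a b x)" 0 a] nn(1)[of a]
    unfolding frame_def by (simp add: antisym nn(1) sum_nonneg)
  then have z: "\<nabla> a b x u v = 0" if "a \<in> E" for a
    using nn(2) that by blast
  have "linear (\<lambda>w. \<nabla> w b x u v)"
    using form_fieldD(1)[OF form_field_nabla[OF form_b] x, of u] unfolding codazzi[OF x, of _ u v] bilinear_def by blast
  from frame_linear_expand[OF sym[OF x] E this] z show ?thesis by simp
qed

subsection \<open>Parallel fields have constant eigenvalues\<close>

text \<open>Eigenvalues need not depend smoothly on the point, but the traces of the powers of the shape operator
  do. If \<open>b\<close> is parallel, then so are the shape operator and its powers, and the traces are constant.\<close>

definition shape :: "'e \<Rightarrow> 'e \<Rightarrow> 'e" where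
  "shape x u = raise (g x) (b x u)"

lemma shape_eq: "x \<in> S \<Longrightarrow> g x (shape x u) v = b x u v"
  unfolding shape_def by (rule raise_eq[OF sym nondeg sym_form_linear(1)[OF sym_form_b]])

lemma shape_smooth: "smooth_on S (\<lambda>x. shape x u)"
  by (rule smooth_on_form_solution[where G=g and l="\<lambda>x. b x u", OF open_S sym nondeg smooth shape_eq form_fieldD(2)[OF form_b]])

lemma shape_linear:
  assumes x: "x \<in> S"
  shows "linear (shape x)"
proof -
  note bs = sym_form_simps[OF sym_form_b[OF x]]
  show ?thesis
    by (rule linearI; rule raise_unique[OF sym[OF x] nondeg[OF x]])
      (simp_all add: gs[OF x] shape_eq[OF x] bs)
qed

primrec shape_power :: "nat \<Rightarrow> 'e \<Rightarrow> 'e \<Rightarrow> 'e \<Rightarrow> real" where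
  "shape_power 0 x u v = g x u v"
| "shape_power (Suc k) x u v = shape_power k x u (shape x v)"

lemma form_field_shape_power: "form_field S (shape_power k)"
proof (induction k)
  case 0
  have "shape_power 0 = g"
    by (simp add: fun_eq_iff)
  then show ?case using form_field_g by simp
next
  case (Suc k)
  show ?case
    unfolding form_field_def
  proof (intro conjI ballI allI)
    fix x assume x: "x \<in> S"
    note bk = form_fieldD(1)[OF Suc x] and l = shape_linear[OF x]
    show "bilinear (shape_power (Suc k) x)"
      unfolding bilinear_def
      by (intro conjI allI; rule linearI; simp add: bilinear_ladd[OF bk] bilinear_radd[OF bk]
        bilinear_lmul[OF bk] bilinear_rmul[OF bk] linear_add[OF l] linear_scale[OF l])
  next
    fix u v
    show "smooth_on S (\<lambda>x. shape_power (Suc k) x u v)"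
      unfolding shape_power.simps by (rule smooth_form_along[OF Suc smooth_on_const shape_smooth])
  qed
qed

text \<open>That is, the shape operator is parallel; it is the image of \<open>b\<close> under the parallel operation of raising
  an index.\<close>

lemma pd_shape:
  assumes x: "x \<in> S" and par: "\<And>u v. \<nabla> w b x u v = 0"
  shows "\<partial> w (\<lambda>y. shape y v) x + \<Gamma> x w (shape x v) = shape x (\<Gamma> x w v)"
proof (rule raise_unique[OF sym[OF x] nondeg[OF x]])
  fix z
  have "\<partial> w (\<lambda>y. b y v z) x = \<partial> w (\<lambda>y. g y (shape y v) z) x"
    by (rule pd_cong[OF open_S x]) (simp add: shape_eq)
  also have "\<dots> = g x (\<partial> w (\<lambda>y. shape y v) x + \<Gamma> x w (shape x v)) z + g x (shape x v) (\<Gamma> x w z)"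
    using nabla_metric[OF x shape_smooth[of v] smooth_on_const[of S z], of w] by (simp add: cov_def)
  finally show "g x (\<partial> w (\<lambda>y. shape y v) x + \<Gamma> x w (shape x v)) z = g x (shape x (\<Gamma> x w v)) z"
    using par[of v z] unfolding nabla_def by (simp add: shape_eq[OF x])
qed

lemma nabla_shape_power:
  assumes x: "x \<in> S" and par: "\<And>u v. \<nabla> w b x u v = 0"
  shows "\<nabla> w (shape_power k) x u v = 0"
proof (induction k arbitrary: u v)
  case 0
  show ?case using nabla_g[OF x, of w u v] unfolding nabla_def by simp
next
  case (Suc k)
  note bk = form_fieldD(1)[OF form_field_shape_power[of k] x]
  have "\<partial> w (\<lambda>y. shape_power k y u (shape y v)) x =
      \<partial> w (\<lambda>y. shape_power k y u (shape x v)) x + shape_power k x u (\<partial> w (\<lambda>y. shape y v) x)"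
    using pd_form_along[OF form_field_shape_power[of k] x smooth_on_const[of S u] shape_smooth[of v], of w]
    by (simp add: bilinear_lzero[OF bk])
  moreover have "\<partial> w (\<lambda>y. shape_power k y u (shape x v)) x =
      shape_power k x (\<Gamma> x w u) (shape x v) + shape_power k x u (\<Gamma> x w (shape x v))"
    using Suc[of u "shape x v"] unfolding nabla_def by simp
  ultimately show ?case
    unfolding nabla_def shape_power.simps pd_shape[OF x par, symmetric]
    by (simp add: bilinear_radd[OF bk])
qed

lemma shape_power_eigenframe:
  assumes x: "x \<in> S" and E: "frame (g x) E"
    and eigen: "\<And>y z. y \<in> E \<Longrightarrow> z \<in> E \<Longrightarrow> y \<noteq> z \<Longrightarrow> b x y z = 0"
  shows "form_inner (g x) (shape_power k x) (g x) = (\<Sum>a\<in>E. b x a a ^ k)"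
proof -
  have fin: "finite E" and on: "\<And>u v. u \<in> E \<Longrightarrow> v \<in> E \<Longrightarrow> g x u v = (if u = v then 1 else 0)"
    using E unfolding frame_def by auto
  have sh: "shape x a = b x a a *\<^sub>R a" if "a \<in> E" for a
  proof -
    have "shape x a = (\<Sum>c\<in>E. b x a c *\<^sub>R c)"
      using frame_expand[OF sym[OF x] E, of "shape x a"] unfolding shape_eq[OF x] .
    also have "\<dots> = (\<Sum>c\<in>E. if c = a then b x a a *\<^sub>R a else 0)"
      using eigen[OF that] by (intro sum.cong) auto
    finally show ?thesis using fin that by simp
  qed
  have pw: "shape_power k x a a = b x a a ^ k" if "a \<in> E" for a
  proof (induction k)
    case 0
    then show ?case using on that by simp
  next
    case (Suc k)
    then show ?case
      using bilinear_rmul[OF form_fieldD(1)[OF form_field_shape_power[of k] x]] by (simp add: sh[OF that])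
  qed
  have "form_inner (g x) (shape_power k x) (g x) = (\<Sum>a\<in>E. \<Sum>c\<in>E. if c = a then shape_power k x a a else 0)"
    unfolding form_inner_frame[OF pos[OF x] E form_fieldD(1)[OF form_field_shape_power x] sym_form_linear(3)[OF sym[OF x]]]
    using on by (intro sum.cong) auto
  then show ?thesis
    using fin pw by simp
qed

theorem parallel_constant_multiplicities:
  assumes par: "\<And>y w u v. y \<in> S \<Longrightarrow> \<nabla> w b y u v = 0" and "convex S" and xy: "x \<in> S" "y \<in> S"
  shows "dim (eigenspace (g x) (b x) \<mu>) = dim (eigenspace (g y) (b y) \<mu>)"
proof -
  have const: "form_inner (g x) (shape_power k x) (g x) = form_inner (g y) (shape_power k y) (g y)" for k
  proof -
    let ?f = "\<lambda>x. form_inner (g x) (shape_power k x) (g x)"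
    have "(?f has_derivative (\<lambda>w. 0)) (at z within S)" if z: "z \<in> S" for z
    proof -
      have "?f differentiable (at z)"
        by (rule smooth_onD(1)[OF form_inner_smooth[OF form_field_shape_power form_field_g] z])
      moreover have "\<partial> w ?f z = 0" for w
        unfolding pd_form_inner[OF form_field_shape_power form_field_g z]
        by (simp add: form_inner_def nabla_shape_power[OF z par[OF z]] nabla_g[OF z])
      ultimately show ?thesis
        using pd_has_derivative[of ?f z] by (simp add: has_derivative_at_withinI)
    qed
    from has_derivative_zero_constant[OF \<open>convex S\<close> this] xy show ?thesis by auto
  qed
  obtain E where E: "frame (g x) E" "\<And>u v. u \<in> E \<Longrightarrow> v \<in> E \<Longrightarrow> u \<noteq> v \<Longrightarrow> b x u v = 0"
    using eigenframe[OF pos[OF xy(1)] sym_form_b[OF xy(1)]] by blast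
  obtain E' where E': "frame (g y) E'" "\<And>u v. u \<in> E' \<Longrightarrow> v \<in> E' \<Longrightarrow> u \<noteq> v \<Longrightarrow> b y u v = 0"
    using eigenframe[OF pos[OF xy(2)] sym_form_b[OF xy(2)]] by blast
  have fin: "finite E" "finite E'"
    using E(1) E'(1) unfolding frame_def by simp_all
  have "card {a\<in>E. b x a a = \<mu>} = card {a\<in>E'. b y a a = \<mu>}"
    by (rule power_sums_determine_multiplicities[where x="\<lambda>a. b x a a" and y="\<lambda>a. b y a a", OF fin])
      (use const shape_power_eigenframe[OF xy(1) E] shape_power_eigenframe[OF xy(2) E'] in simp)
  then show ?thesis
    using dim_eigenspace[OF pos[OF xy(1)] sym_form_b[OF xy(1)] E, of \<mu>]
      dim_eigenspace[OF pos[OF xy(2)] sym_form_b[OF xy(2)] E', of \<mu>] by simp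
qed

end


section \<open>The strong maximum principle\<close>

lemma td_exp:
  fixes f :: "'a::euclidean_space \<Rightarrow> real"
  assumes S: "open S" and "td k S f"
  shows "td k S (\<lambda>x. exp (f x))"
  using assms(2)
proof (induction k)
  case 0
  then show ?case by (simp add: continuous_on_exp)
next
  case (Suc k)
  have der: "((\<lambda>x. exp (f x)) has_derivative (\<lambda>v. \<partial> v f x * exp (f x))) (at x)" if "x \<in> S" for x
  proof -
    have "f differentiable (at x)"
      using Suc.prems that by simp
    from has_derivative_exp[where g=f, OF pd_has_derivative[OF this]] show ?thesis .
  qed
  have D: "(\<lambda>x. exp (f x)) differentiable (at x)" if "x \<in> S" for x
    using der[OF that] by (rule differentiableI)
  have A: "td k S (\<partial> v (\<lambda>x. exp (f x)))" for v
  proof (rule td_cong[OF S, of "\<lambda>x. \<partial> v f x * exp (f x)"])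
    show "\<partial> v f x * exp (f x) = \<partial> v (\<lambda>x. exp (f x)) x" if "x \<in> S" for x
      by (rule pd_eqI[OF der[OF that], symmetric])
    show "td k S (\<lambda>x. \<partial> v f x * exp (f x))"
      by (rule td_mult[OF S _ Suc.IH[OF td_SucD[OF Suc.prems]]]) (use Suc.prems in simp)
  qed
  show ?case
    by (rule td_SucI; (rule A | rule D))
qed

lemma second_derivative_test:
  fixes \<psi> :: "'e::euclidean_space \<Rightarrow> real"
  assumes S: "open S" and \<psi>: "smooth_on S \<psi>" and z: "z \<in> S"
    and max: "\<And>x. x \<in> S \<Longrightarrow> \<psi> x \<le> \<psi> z"
  shows "\<partial> a \<psi> z = 0" and "\<partial> a (\<partial> a \<psi>) z \<le> 0"
proof -
  have "open ((\<lambda>t::real. z + t *\<^sub>R a) -` S)"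
    by (rule open_vimage[OF S]) (intro continuous_intros)
  moreover have "0 \<in> (\<lambda>t::real. z + t *\<^sub>R a) -` S" using z by simp
  ultimately obtain d where "0 < d" and d: "ball 0 d \<subseteq> (\<lambda>t::real. z + t *\<^sub>R a) -` S"
    using open_contains_ball by blast
  have line: "z + t *\<^sub>R a \<in> S" if "\<bar>t\<bar> < d" for t
    using d that by (auto simp: dist_real_def)
  define h where "h t = \<psi> (z + t *\<^sub>R a)" for t
  define h' where "h' t = \<partial> a \<psi> (z + t *\<^sub>R a)" for t
  have dh: "(h has_real_derivative h' t) (at t)" if "\<bar>t\<bar> < d" for t
    unfolding h_def h'_def by (rule has_real_derivative_along_line[OF smooth_onD(1)[OF \<psi> line[OF that]]])
  have dh': "(h' has_real_derivative \<partial> a (\<partial> a \<psi>) z) (at 0)"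
    using has_real_derivative_along_line[OF smooth_onD(1)[OF smooth_onD(2)[OF \<psi>]], of z 0 a a] z
    unfolding h'_def by simp
  have "h' 0 = 0"
    by (rule DERIV_local_max[OF dh[of 0] \<open>0 < d\<close>]) (use \<open>0 < d\<close> max line in \<open>auto simp: h_def\<close>)
  then show "\<partial> a \<psi> z = 0" by (simp add: h'_def)
  show "\<partial> a (\<partial> a \<psi>) z \<le> 0"
  proof (rule ccontr)
    assume "\<not> \<partial> a (\<partial> a \<psi>) z \<le> 0"
    then obtain e where "0 < e" and e: "\<And>t. 0 < t \<Longrightarrow> t < e \<Longrightarrow> h' 0 < h' (0 + t)"
      using DERIV_pos_inc_right[OF dh'] by auto
    define t where "t = min d e / 2"
    have t: "0 < t" "t < d" "t < e" using \<open>0 < d\<close> \<open>0 < e\<close> by (auto simp: t_def)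
    have "(h has_real_derivative h' s) (at s)" if "0 \<le> s" "s \<le> t" for s
      using dh[of s] that t by simp
    from MVT2[OF t(1) this] obtain s where s: "0 < s" "s < t" "h t - h 0 = (t - 0) * h' s"
      by blast
    have "0 < h' s"
      using e[of s] s t \<open>h' 0 = 0\<close> by simp
    then have "h 0 < h t"
      using s(3) mult_pos_pos[OF t(1), of "h' s"] unfolding diff_zero by linarith
    then show False
      using max[OF line[of t]] t by (simp add: h_def)
  qed
qed

text \<open>The comparison function of the Hopf lemma.\<close>

lemma gaussian:
  fixes y :: "'e::euclidean_space" and \<alpha> :: real
  assumes e_def: "e = (\<lambda>x. exp (- \<alpha> * ((x - y) \<bullet> (x - y))))"
  shows "smooth_on S e"
    and "\<partial> a e x = - 2 * \<alpha> * (a \<bullet> (x - y)) * e x"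
    and "\<partial> a (\<partial> a e) x = (4 * \<alpha>\<^sup>2 * (a \<bullet> (x - y))\<^sup>2 - 2 * \<alpha> * (norm a)\<^sup>2) * e x"
proof -
  have "smooth_on UNIV (\<lambda>x. x - y)"
    by (rule smooth_on_diff[OF open_UNIV smooth_on_id smooth_on_const])
  from smooth_on_mult[OF open_UNIV smooth_on_const smooth_on_inner[OF open_UNIV this this], of "- \<alpha>"]
  have "smooth_on UNIV e"
    unfolding e_def smooth_on_def by (intro allI td_exp[OF open_UNIV]) simp
  then show "smooth_on S e"
    by (rule smooth_on_subset) simp
  have der: "(e has_derivative (\<lambda>v. - 2 * \<alpha> * (v \<bullet> (x - y)) * e x)) (at x)" for x
    unfolding e_def by (auto intro!: derivative_eq_intros simp: inner_commute algebra_simps)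
  show 1: "\<partial> a e x = - 2 * \<alpha> * (a \<bullet> (x - y)) * e x" for x a
    by (rule pd_eqI[OF der])
  have "((\<lambda>x. - 2 * \<alpha> * (a \<bullet> (x - y)) * e x) has_derivative
      (\<lambda>v. - 2 * \<alpha> * (a \<bullet> (x - y)) * (- 2 * \<alpha> * (v \<bullet> (x - y)) * e x) + - 2 * \<alpha> * (a \<bullet> v) * e x)) (at x)"
    by (auto intro!: derivative_eq_intros der)
  then have "\<partial> a (\<lambda>x. - 2 * \<alpha> * (a \<bullet> (x - y)) * e x) x =
      - 2 * \<alpha> * (a \<bullet> (x - y)) * (- 2 * \<alpha> * (a \<bullet> (x - y)) * e x) + - 2 * \<alpha> * (a \<bullet> a) * e x"
    by (rule pd_eqI)
  then show "\<partial> a (\<partial> a e) x = (4 * \<alpha>\<^sup>2 * (a \<bullet> (x - y))\<^sup>2 - 2 * \<alpha> * (norm a)\<^sup>2) * e x"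
    unfolding 1 by (simp add: algebra_simps power2_eq_square power2_norm_eq_inner[symmetric])
qed

text \<open>Around a point near \<open>x1\<close> with value below the maximum \<open>c\<close>, the largest ball without maximum points
  touches the closed set of maximum points. A ball of half the radius inside it touches that set in
  a single point \<open>x0\<close>.\<close>

lemma touching_ball:
  fixes \<phi> :: "'e::euclidean_space \<Rightarrow> real"
  assumes cont: "continuous_on (ball x1 (4 * r)) \<phi>" and max: "\<forall>x\<in>ball x1 (4 * r). \<phi> x \<le> c"
    and x1: "\<phi> x1 = c" and y0: "dist x1 y0 < r" "\<phi> y0 < c"
  obtains y x0 \<rho> where "0 < \<rho>" "dist y x0 = \<rho>" "\<phi> x0 = c" "ball x0 \<rho> \<subseteq> ball x1 (4 * r)"
    "\<And>x. x \<in> cball y \<rho> \<Longrightarrow> x \<noteq> x0 \<Longrightarrow> \<phi> x < c"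
proof -
  have "0 < r" using y0(1) zero_le_dist[of x1 y0] by linarith
  define K where "K = {x \<in> cball x1 (2 * r). \<phi> x = c}"
  have sub: "cball x1 (2 * r) \<subseteq> ball x1 (4 * r)"
    using \<open>0 < r\<close> by auto
  have "closed K"
    unfolding K_def using continuous_closed_preimage_constant[OF continuous_on_subset[OF cont sub] closed_cball, of c]
    by simp
  moreover have "x1 \<in> K" using x1 \<open>0 < r\<close> by (simp add: K_def)
  ultimately obtain x0 where x0: "x0 \<in> K" and inf: "\<And>x. x \<in> K \<Longrightarrow> dist y0 x0 \<le> dist y0 x"
    using distance_attains_inf[of K y0] by blast
  define \<rho> where "\<rho> = dist y0 x0 / 2"
  have "\<phi> x0 = c" using x0 by (simp add: K_def)
  have "0 < \<rho>" using \<open>\<phi> x0 = c\<close> y0(2) unfolding \<rho>_def by auto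
  have \<rho>r: "2 * \<rho> < r"
    using inf[OF \<open>x1 \<in> K\<close>] y0(1) by (simp add: \<rho>_def dist_commute)
  have less: "\<phi> x < c" if "dist y0 x < 2 * \<rho>" for x
  proof -
    have "dist x1 x < 2 * r"
      using dist_triangle[of x1 x y0] y0(1) that \<rho>r by linarith
    then have "x \<in> cball x1 (2 * r)" by simp
    moreover have "x \<notin> K"
      using inf[of x] that by (auto simp: \<rho>_def)
    ultimately show ?thesis
      using max sub unfolding K_def by force
  qed
  \<comment> \<open>Inner tangency at \<open>x0\<close>: by the parallelogram law, \<open>x0\<close> is the only point of the smaller closed
    ball at distance \<open>2 \<rho>\<close> from \<open>y0\<close>.\<close>
  define y where "y = (1 / 2) *\<^sub>R (y0 + x0)"
  have yx0: "x0 - y = (1 / 2) *\<^sub>R (x0 - y0)" and yy0: "y - y0 = (1 / 2) *\<^sub>R (x0 - y0)"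
    by (simp_all add: y_def algebra_simps) (simp_all add: scaleR_left_distrib[symmetric] flip: scaleR_2)
  have dyx0: "dist y x0 = \<rho>"
    unfolding \<rho>_def dist_norm using arg_cong[OF yx0, of norm] by (simp add: norm_minus_commute)
  have dyy0: "norm (y - y0) = \<rho>"
    unfolding \<rho>_def dist_norm using arg_cong[OF yy0, of norm] by (simp add: norm_minus_commute)
  have inside: "\<phi> x < c" if "x \<in> cball y \<rho>" "x \<noteq> x0" for x
  proof (rule less, rule ccontr)
    assume "\<not> dist y0 x < 2 * \<rho>"
    then have "2 * \<rho> \<le> norm ((x - y) + (y - y0))"
      by (simp add: dist_norm norm_minus_commute)
    then have "(2 * \<rho>)\<^sup>2 \<le> (norm ((x - y) + (y - y0)))\<^sup>2"
      using \<open>0 < \<rho>\<close> by (intro power_mono) auto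
    moreover have "(norm ((x - y) + (y - y0)))\<^sup>2 + (norm ((x - y) - (y - y0)))\<^sup>2
        = 2 * (norm (x - y))\<^sup>2 + 2 * (norm (y - y0))\<^sup>2"
      unfolding power2_norm_eq_inner by (simp add: inner_add_left inner_add_right inner_diff_left inner_diff_right inner_commute)
    moreover have "(norm (x - y))\<^sup>2 \<le> \<rho>\<^sup>2"
      using that(1) \<open>0 < \<rho>\<close> by (intro power_mono) (auto simp: dist_norm norm_minus_commute)
    moreover have "(2 * \<rho>)\<^sup>2 = 4 * \<rho>\<^sup>2"
      by (simp add: power_mult_distrib)
    ultimately have "(norm ((x - y) - (y - y0)))\<^sup>2 \<le> 0"
      unfolding dyy0 by linarith
    then have "x - y = y - y0" by simp
    then have "x = x0" using yx0 yy0 by (metis diff_add_cancel)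
    then show False using that(2) by simp
  qed
  have "ball x0 \<rho> \<subseteq> ball x1 (4 * r)"
  proof
    fix x assume "x \<in> ball x0 \<rho>"
    then have "dist x1 x < 2 * r + \<rho>"
      using dist_triangle[of x1 x x0] x0 unfolding K_def by auto
    then show "x \<in> ball x1 (4 * r)" using \<rho>r \<open>0 < \<rho>\<close> by simp
  qed
  then show thesis
    using that[OF \<open>0 < \<rho>\<close> dyx0 \<open>\<phi> x0 = c\<close>] inside by blast
qed

text \<open>Hopf's argument for the operator \<open>L = \<Sum> \<partial>\<^sub>a\<^sup>2 + \<partial>\<^sub>\<beta>\<close>. The second-order
  part is given by a frame \<open>E x\<close> that may jump with \<open>x\<close>, so that an eigenframe chosen separately at each
  point is admissible. If the set where \<open>\<phi>\<close> attains its
  maximum were not open, a ball would touch it from outside at a point \<open>x0\<close>. Near \<open>x0\<close> a steep Gaussian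
  \<open>v\<close> centred in that ball, normalised to 0 on its boundary, has \<open>L v > 0\<close>. Then
  \<open>\<phi> + \<eta> v\<close> has, for small \<open>\<eta> > 0\<close>, an interior maximum close to \<open>x0\<close>, at which
  \<open>L (\<phi> + \<eta> v) > 0\<close> contradicts the second derivative test.\<close>

theorem strong_maximum_principle:
  fixes \<phi> :: "'e::euclidean_space \<Rightarrow> real" and E :: "'e \<Rightarrow> 'e set" and \<beta> :: "'e \<Rightarrow> 'e"
  assumes S: "open S" and \<phi>: "smooth_on S \<phi>"
    and "0 < m" and lower: "\<And>x \<xi>. x \<in> S \<Longrightarrow> m * (norm \<xi>)\<^sup>2 \<le> (\<Sum>a\<in>E x. (a \<bullet> \<xi>)\<^sup>2)"
    and upper: "\<And>x. x \<in> S \<Longrightarrow> (\<Sum>a\<in>E x. (norm a)\<^sup>2) \<le> M"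
    and drift: "\<And>x. x \<in> S \<Longrightarrow> norm (\<beta> x) \<le> K"
    and sub: "\<And>x. x \<in> S \<Longrightarrow> 0 \<le> (\<Sum>a\<in>E x. \<partial> a (\<partial> a \<phi>) x) + \<partial> (\<beta> x) \<phi> x"
    and max: "\<And>x. x \<in> S \<Longrightarrow> \<phi> x \<le> c"
  shows "open {x\<in>S. \<phi> x = c}"
proof (rule openI)
  fix x1 assume "x1 \<in> {x\<in>S. \<phi> x = c}"
  then have x1: "x1 \<in> S" "\<phi> x1 = c" by auto
  obtain r' where "0 < r'" "ball x1 r' \<subseteq> S"
    using S x1 open_contains_ball by blast
  define r where "r = r' / 4"
  have "0 < r" and r: "ball x1 (4 * r) \<subseteq> S"
    using \<open>0 < r'\<close> \<open>ball x1 r' \<subseteq> S\<close> by (simp_all add: r_def)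
  have "\<phi> y0 = c" if y0: "dist x1 y0 < r" for y0
  proof (rule ccontr)
    assume "\<phi> y0 \<noteq> c"
    moreover have "y0 \<in> S" using r y0 \<open>0 < r\<close> by auto
    ultimately have "\<phi> y0 < c" using max[of y0] by simp
    have cont: "continuous_on S \<phi>"
      by (rule smooth_onD(3)[OF \<phi>])
    have maxb: "\<forall>x\<in>ball x1 (4 * r). \<phi> x \<le> c"
      using max r by blast
    obtain \<rho> y x0 where "0 < \<rho>" and yx0: "dist y x0 = \<rho>" and x0: "\<phi> x0 = c" "ball x0 \<rho> \<subseteq> ball x1 (4 * r)"
      and inside: "\<And>x. x \<in> cball y \<rho> \<Longrightarrow> x \<noteq> x0 \<Longrightarrow> \<phi> x < c"
      by (rule touching_ball[OF continuous_on_subset[OF cont r] maxb x1(2) y0 \<open>\<phi> y0 < c\<close>])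
        (rule that; blast)
    define \<delta> where "\<delta> = \<rho> / 2"
    have "0 < \<delta>" "\<delta> < \<rho>" using \<open>0 < \<rho>\<close> by (simp_all add: \<delta>_def)
    have KS: "cball x0 \<delta> \<subseteq> S"
      using x0(2) r \<open>\<delta> < \<rho>\<close> by force
    have ann: "\<rho> / 2 \<le> norm (x - y)" "norm (x - y) \<le> 2 * \<rho>" if "x \<in> cball x0 \<delta>" for x
      using dist_triangle[of y x0 x] dist_triangle[of y x x0] that yx0 \<open>0 < \<rho>\<close>
      by (simp_all add: \<delta>_def dist_norm norm_minus_commute)
    have "0 \<le> M"
      using upper[OF x1(1)] sum_nonneg[of "E x1" "\<lambda>a. (norm a)\<^sup>2"] by simp
    have "0 \<le> K"
      using drift[OF x1(1)] norm_ge_zero[of "\<beta> x1"] by linarith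
    \<comment> \<open>The second-order term of \<open>L e\<close> grows like \<open>\<alpha>\<^sup>2 m (\<rho>/2)\<^sup>2\<close>, the others are
      bounded by \<open>\<alpha> N\<close>.\<close>
    define N where "N = M + K * (2 * \<rho>)"
    define \<alpha> where "\<alpha> = (N + 1) / (m * (\<rho> / 2)\<^sup>2)"
    have "0 \<le> N" using \<open>0 \<le> M\<close> \<open>0 \<le> K\<close> \<open>0 < \<rho>\<close> by (simp add: N_def)
    have mr: "0 < m * (\<rho> / 2)\<^sup>2" using \<open>0 < m\<close> \<open>0 < \<rho>\<close> by simp
    then have "0 < \<alpha>" using \<open>0 \<le> N\<close> by (simp add: \<alpha>_def)
    have \<alpha>: "\<alpha> * (m * (\<rho> / 2)\<^sup>2) = N + 1"
      unfolding \<alpha>_def by (rule nonzero_eq_divide_eq[THEN iffD1, OF _ refl]) (use mr in linarith)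
    define e where "e = (\<lambda>x. exp (- \<alpha> * ((x - y) \<bullet> (x - y))))"
    note e = gaussian[OF e_def]
    have e_pos: "0 < e x" for x by (simp add: e_def)
    have L_e: "0 < (\<Sum>a\<in>E x. \<partial> a (\<partial> a e) x) + \<partial> (\<beta> x) e x" if x: "x \<in> cball x0 \<delta>" for x
    proof -
      have xS: "x \<in> S" using KS x by blast
      have "m * (\<rho> / 2)\<^sup>2 \<le> m * (norm (x - y))\<^sup>2"
        using ann(1)[OF x] \<open>0 < m\<close> \<open>0 < \<rho>\<close> by (intro mult_left_mono power_mono) auto
      also have "\<dots> \<le> (\<Sum>a\<in>E x. (a \<bullet> (x - y))\<^sup>2)"
        by (rule lower[OF xS])
      finally have "N + 1 \<le> \<alpha> * (\<Sum>a\<in>E x. (a \<bullet> (x - y))\<^sup>2)"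
        unfolding \<alpha>[symmetric] using \<open>0 < \<alpha>\<close> by (intro mult_left_mono) auto
      moreover have "\<beta> x \<bullet> (x - y) \<le> K * (2 * \<rho>)"
      proof -
        have "\<beta> x \<bullet> (x - y) \<le> norm (\<beta> x) * norm (x - y)"
          by (rule norm_cauchy_schwarz)
        also have "\<dots> \<le> K * (2 * \<rho>)"
          using drift[OF xS] ann(2)[OF x] \<open>0 \<le> K\<close> by (intro mult_mono) auto
        finally show ?thesis .
      qed
      ultimately have "0 < 2 * (\<alpha> * (\<Sum>a\<in>E x. (a \<bullet> (x - y))\<^sup>2)) - (\<Sum>a\<in>E x. (norm a)\<^sup>2) - \<beta> x \<bullet> (x - y)"
        using upper[OF xS] \<open>0 \<le> N\<close> unfolding N_def by linarith
      then have "0 < (2 * \<alpha> * e x) * (2 * (\<alpha> * (\<Sum>a\<in>E x. (a \<bullet> (x - y))\<^sup>2)) - (\<Sum>a\<in>E x. (norm a)\<^sup>2) - \<beta> x \<bullet> (x - y))"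
        using \<open>0 < \<alpha>\<close> e_pos[of x] by (intro mult_pos_pos) auto
      also have "\<dots> = (\<Sum>a\<in>E x. \<partial> a (\<partial> a e) x) + \<partial> (\<beta> x) e x"
      proof -
        define P where "P = (\<Sum>a\<in>E x. (a \<bullet> (x - y))\<^sup>2)"
        define Q where "Q = (\<Sum>a\<in>E x. (norm a)\<^sup>2)"
        define B where "B = \<beta> x \<bullet> (x - y)"
        have "(\<Sum>a\<in>E x. \<partial> a (\<partial> a e) x) = (4 * \<alpha>\<^sup>2 * P - 2 * \<alpha> * Q) * e x"
          unfolding e(3) P_def Q_def by (simp add: sum_distrib_left sum_distrib_right sum_subtractf left_diff_distrib)
        then show ?thesis
          unfolding e(2) P_def[symmetric] Q_def[symmetric] B_def[symmetric]
          by (simp add: algebra_simps power2_eq_square)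
      qed
      finally show ?thesis .
    qed
    define v where "v x = e x - exp (- \<alpha> * \<rho>\<^sup>2)" for x
    have v_neg: "v x < 0" if "x \<notin> cball y \<rho>" for x
    proof -
      have "\<rho>\<^sup>2 < (norm (x - y))\<^sup>2"
        using that \<open>0 < \<rho>\<close> by (intro power_strict_mono) (auto simp: dist_norm norm_minus_commute)
      then show ?thesis
        using \<open>0 < \<alpha>\<close> unfolding v_def e_def by (simp add: power2_norm_eq_inner)
    qed
    have v_le: "v x \<le> 1" for x
    proof -
      have "e x \<le> 1" unfolding e_def using \<open>0 < \<alpha>\<close> by simp
      then show ?thesis unfolding v_def by (smt (verit) exp_gt_zero)
    qed
    have v0: "v x0 = 0"
      using yx0 unfolding v_def e_def by (simp add: power2_norm_eq_inner[symmetric] dist_norm norm_minus_commute)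
    \<comment> \<open>On the sphere around \<open>x0\<close>, outside the touching ball \<open>v\<close> is negative, and inside it \<open>\<phi>\<close> is
      bounded away from \<open>c\<close> by compactness.\<close>
    obtain \<eta> where "0 < \<eta>" and \<eta>: "\<And>x. x \<in> sphere x0 \<delta> \<Longrightarrow> \<phi> x + \<eta> * v x < c"
    proof -
      define A where "A = sphere x0 \<delta> \<inter> cball y \<rho>"
      have "\<exists>\<mu>>0. \<forall>x\<in>A. \<phi> x \<le> c - \<mu>"
      proof (cases "A = {}")
        case False
        have "compact A" unfolding A_def by (simp add: compact_Int)
        moreover have "continuous_on A \<phi>"
          by (rule continuous_on_subset[OF cont]) (use KS in \<open>auto simp: A_def\<close>)
        ultimately obtain p where p: "p \<in> A" "\<And>x. x \<in> A \<Longrightarrow> \<phi> x \<le> \<phi> p"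
          using continuous_attains_sup[OF _ False] by blast
        have "p \<noteq> x0" using p(1) \<open>0 < \<delta>\<close> by (auto simp: A_def)
        then have "\<phi> p < c" using inside p(1) by (simp add: A_def)
        then show ?thesis using p(2) by (intro exI[of _ "c - \<phi> p"]) auto
      qed (auto intro: exI[of _ 1])
      then obtain \<mu> where \<mu>: "0 < \<mu>" "\<And>x. x \<in> A \<Longrightarrow> \<phi> x \<le> c - \<mu>" by blast
      have "\<phi> x + \<mu> / 2 * v x < c" if x: "x \<in> sphere x0 \<delta>" for x
      proof (cases "x \<in> cball y \<rho>")
        case True
        then have "\<phi> x \<le> c - \<mu>" using \<mu>(2) x by (simp add: A_def)
        moreover have "\<mu> / 2 * v x \<le> \<mu> / 2 * 1"
          using v_le \<mu>(1) by (intro mult_left_mono) auto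
        ultimately show ?thesis using \<mu>(1) by linarith
      next
        case False
        have "\<mu> / 2 * v x < 0"
          using v_neg[OF False] \<mu>(1) by (simp add: mult_pos_neg)
        moreover have "\<phi> x \<le> c" using max KS x by force
        ultimately show ?thesis by linarith
      qed
      then show thesis using \<mu>(1) that[of "\<mu> / 2"] by simp
    qed
    define \<psi> where "\<psi> x = \<phi> x + \<eta> * v x" for x
    have sm_v: "smooth_on S v"
      unfolding v_def by (rule smooth_on_diff[OF S e(1) smooth_on_const])
    have sm_\<eta>v: "smooth_on S (\<lambda>x. \<eta> * v x)"
      by (rule smooth_on_mult[OF S smooth_on_const sm_v])
    have sm_\<psi>: "smooth_on S \<psi>"
      unfolding \<psi>_def by (rule smooth_on_add[OF S \<phi> sm_\<eta>v])
    have "continuous_on (cball x0 \<delta>) \<psi>"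
      by (rule continuous_on_subset[OF smooth_onD(3)[OF sm_\<psi>] KS])
    then obtain z where z: "z \<in> cball x0 \<delta>" and zmax: "\<And>x. x \<in> cball x0 \<delta> \<Longrightarrow> \<psi> x \<le> \<psi> z"
      using continuous_attains_sup[of "cball x0 \<delta>" \<psi>] \<open>0 < \<delta>\<close> by auto
    have "c \<le> \<psi> z"
      using zmax[of x0] x0(1) v0 \<open>0 < \<delta>\<close> by (simp add: \<psi>_def)
    then have "z \<notin> sphere x0 \<delta>"
      using \<eta>[of z] by (auto simp: \<psi>_def)
    then have zb: "z \<in> ball x0 \<delta>" using z by auto
    have zS: "z \<in> S" using KS z by blast
    have sm_b: "smooth_on (ball x0 \<delta>) \<psi>"
      by (rule smooth_on_subset[OF sm_\<psi>]) (use KS in auto)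
    note test = second_derivative_test[OF open_ball sm_b zb zmax[OF subsetD[OF ball_subset_cball]]]
    have pd_v: "\<partial> a v x = \<partial> a e x" for a x
      unfolding v_def using pd_diff[OF smooth_onD(1)[OF e(1)[of UNIV]] differentiable_const, where v=a] by simp
    have pd_\<psi>: "\<partial> a \<psi> x = \<partial> a \<phi> x + \<eta> * \<partial> a e x" if "x \<in> S" for a x
      unfolding \<psi>_def pd_add[OF smooth_onD(1)[OF \<phi> that] smooth_onD(1)[OF sm_\<eta>v that]]
        pd_bounded_linear(1)[OF bounded_linear_mult_right smooth_onD(1)[OF sm_v that]] pd_v ..
    have pd2_\<psi>: "\<partial> a (\<partial> a \<psi>) z = \<partial> a (\<partial> a \<phi>) z + \<eta> * \<partial> a (\<partial> a e) z" for a
    proof -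
      have 1: "(\<lambda>x. \<eta> * \<partial> a e x) differentiable (at z)"
        by (rule pd_bounded_linear(2)[OF bounded_linear_mult_right smooth_onD(1)[OF smooth_onD(2)[OF e(1)] zS]])
      have "\<partial> a (\<partial> a \<psi>) z = \<partial> a (\<lambda>x. \<partial> a \<phi> x + \<eta> * \<partial> a e x) z"
        by (rule pd_cong[OF S zS pd_\<psi>])
      also have "\<dots> = \<partial> a (\<partial> a \<phi>) z + \<partial> a (\<lambda>x. \<eta> * \<partial> a e x) z"
        by (rule pd_add[OF smooth_onD(1)[OF smooth_onD(2)[OF \<phi>] zS] 1])
      also have "\<partial> a (\<lambda>x. \<eta> * \<partial> a e x) z = \<eta> * \<partial> a (\<partial> a e) z"
        by (rule pd_bounded_linear(1)[OF bounded_linear_mult_right smooth_onD(1)[OF smooth_onD(2)[OF e(1)] zS]])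
      finally show ?thesis .
    qed
    have "(\<Sum>a\<in>E z. \<partial> a (\<partial> a \<psi>) z) + \<partial> (\<beta> z) \<psi> z \<le> 0"
      using test by (simp add: sum_nonpos)
    moreover have "(\<Sum>a\<in>E z. \<partial> a (\<partial> a \<psi>) z) + \<partial> (\<beta> z) \<psi> z =
        ((\<Sum>a\<in>E z. \<partial> a (\<partial> a \<phi>) z) + \<partial> (\<beta> z) \<phi> z) + \<eta> * ((\<Sum>a\<in>E z. \<partial> a (\<partial> a e) z) + \<partial> (\<beta> z) e z)"
      unfolding pd2_\<psi> pd_\<psi>[OF zS] by (simp add: sum.distrib sum_distrib_left algebra_simps)
    moreover have "0 < \<eta> * ((\<Sum>a\<in>E z. \<partial> a (\<partial> a e) z) + \<partial> (\<beta> z) e z)"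
      using L_e[OF z] \<open>0 < \<eta>\<close> by simp
    ultimately show False
      using sub[OF zS] by linarith
  qed
  then show "\<exists>T>0. ball x1 T \<subseteq> {x\<in>S. \<phi> x = c}"
    using r \<open>0 < r\<close> by (intro exI[of _ r]) auto
qed


section \<open>Spacelike hypersurfaces in a chart of constant curvature\<close>

locale spacelike_map = map_into_metric S g \<Omega> F
  for S :: "'d::euclidean_space set" and g and \<Omega> :: "'e::euclidean_space set" and F :: "'e \<Rightarrow> 'd" +
  assumes codim: "DIM('d) = DIM('e) + 1"
    and spacelike: "x \<in> \<Omega> \<Longrightarrow> u \<noteq> 0 \<Longrightarrow> g (F x) (\<partial> u F x) (\<partial> u F x) > 0"
begin

definition ind :: "'e \<Rightarrow> 'e \<Rightarrow> 'e \<Rightarrow> real" where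
  "ind x u v = g (F x) (\<partial> u F x) (\<partial> v F x)"

lemma smooth_dF: "smooth_on \<Omega> (\<partial> v F)"
  by (rule smooth_onD(2)[OF smooth_F])

lemma dF_linear: "x \<in> \<Omega> \<Longrightarrow> linear (\<lambda>v. \<partial> v F x)"
  by (rule pd_linear[OF diff_F])

lemmas gF = sym_form_simps[OF sym[OF maps]]

lemma gF_commute: "x \<in> \<Omega> \<Longrightarrow> g (F x) u v = g (F x) v u"
  by (rule sym_form_commute[OF sym[OF maps]])

lemma ind_pos_form:
  assumes x: "x \<in> \<Omega>"
  shows "pos_form (ind x)"
proof -
  note l = dF_linear[OF x]
  have "bilinear (ind x)"
    unfolding bilinear_def ind_def
    by (intro conjI allI; rule linearI; simp add: linear_add[OF l] linear_scale[OF l] gF[OF x])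
  then show ?thesis
    unfolding pos_form_def sym_form_def ind_def using gF_commute[OF x] spacelike[OF x] by blast
qed

lemma ind_smooth: "smooth_on \<Omega> (\<lambda>x. ind x u v)"
  unfolding ind_def by (rule smooth_inner_along[OF smooth_dF smooth_dF])

lemma ind_riemannian: "riemannian_field \<Omega> ind"
  by unfold_locales
    (auto simp: open_\<Omega> ind_smooth intro: ind_pos_form pos_formD(1)[OF ind_pos_form] pos_form_nondegenerate[OF ind_pos_form])

lemma range_dF:
  assumes x: "x \<in> \<Omega>"
  shows "subspace (range (\<lambda>v. \<partial> v F x))" "dim (range (\<lambda>v. \<partial> v F x)) = DIM('e)"
proof -
  have inj: "inj (\<lambda>v. \<partial> v F x)"
    unfolding linear_injective_0[OF dF_linear[OF x]]
    using spacelike[OF x] by (metis gF(7)[OF x] less_irrefl)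
  show "subspace (range (\<lambda>v. \<partial> v F x))"
    by (rule linear_subspace_image[OF dF_linear[OF x] subspace_UNIV])
  show "dim (range (\<lambda>v. \<partial> v F x)) = DIM('e)"
    using dim_image_eq[OF dF_linear[OF x], of UNIV] inj by simp
qed

text \<open>In codimension one, a transversal vector and the tangent space span everything.\<close>

lemma decomposition:
  assumes x: "x \<in> \<Omega>" and n: "n \<notin> range (\<lambda>v. \<partial> v F x)"
  obtains w c where "y = \<partial> w F x + c *\<^sub>R n"
proof -
  define V where "V = range (\<lambda>v. \<partial> v F x)"
  have V: "subspace V" "dim V = DIM('e)"
    unfolding V_def by (rule range_dF[OF x])+
  have span: "span V = V"
    by (rule span_eq_iff[THEN iffD2, OF V(1)])
  then have "dim (insert n V) = DIM('d)"
    using codim n V(2) unfolding V_def[symmetric] by (simp add: dim_insert span)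
  then have "span (insert n V) = UNIV"
    by (simp add: dim_eq_full)
  then have "y \<in> span (insert n V)" by simp
  then obtain c where "y - c *\<^sub>R n \<in> V"
    using span_breakdown_eq[of y n V] unfolding span by blast
  then obtain w where "y - c *\<^sub>R n = \<partial> w F x"
    unfolding V_def by auto
  then have "y = \<partial> w F x + c *\<^sub>R n" by (simp add: algebra_simps)
  then show thesis by (rule that)
qed

text \<open>Subtracting from a transversal vector its tangential part gives a normal field, which is not
  null because the ambient metric is nondegenerate.\<close>

lemma local_unit_normal:
  assumes x0: "x0 \<in> \<Omega>"
  obtains r \<nu> \<sigma> where "0 < r" "ball x0 r \<subseteq> \<Omega>" "smooth_on (ball x0 r) \<nu>" "\<sigma> * \<sigma> = 1"
    "\<And>x u. x \<in> ball x0 r \<Longrightarrow> g (F x) (\<nu> x) (\<partial> u F x) = 0"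
    "\<And>x. x \<in> ball x0 r \<Longrightarrow> g (F x) (\<nu> x) (\<nu> x) = \<sigma>"
proof -
  have "range (\<lambda>v. \<partial> v F x0) \<noteq> UNIV"
    using range_dF(2)[OF x0] codim by auto
  then obtain z0 where z0: "z0 \<notin> range (\<lambda>v. \<partial> v F x0)" by blast
  define w where "w x = raise (ind x) (\<lambda>v. g (F x) z0 (\<partial> v F x))" for x
  have w: "ind x (w x) v = g (F x) z0 (\<partial> v F x)" if x: "x \<in> \<Omega>" for x v
    unfolding w_def
  proof (rule raise_eq[OF pos_formD(1)[OF ind_pos_form[OF x]] pos_form_nondegenerate[OF ind_pos_form[OF x]]])
    show "linear (\<lambda>v. g (F x) z0 (\<partial> v F x))"
      by (rule linearI) (simp_all add: linear_add[OF dF_linear[OF x]] linear_scale[OF dF_linear[OF x]] gF[OF x])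
  qed
  have sm_w: "smooth_on \<Omega> w"
    by (rule smooth_on_form_solution[where G=ind and l="\<lambda>x v. g (F x) z0 (\<partial> v F x)", OF open_\<Omega>
          pos_formD(1)[OF ind_pos_form] pos_form_nondegenerate[OF ind_pos_form] ind_smooth w
          smooth_inner_along[OF smooth_on_const smooth_dF]])
  define n where "n x = z0 - \<partial> (w x) F x" for x
  have sm_n: "smooth_on \<Omega> n"
    unfolding n_def
    by (rule smooth_on_diff[OF open_\<Omega> smooth_on_const smooth_on_linear_field[where L="\<lambda>x v. \<partial> v F x",
            OF open_\<Omega> dF_linear smooth_dF sm_w]])
  have n_normal: "g (F x) (n x) (\<partial> u F x) = 0" if x: "x \<in> \<Omega>" for x u
    using w[OF x, of u] unfolding n_def ind_def by (simp add: gF[OF x])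
  define q where "q x = g (F x) (n x) (n x)" for x
  have sm_q: "smooth_on \<Omega> q"
    unfolding q_def by (rule smooth_inner_along[OF sm_n sm_n])
  have "n x0 \<notin> range (\<lambda>v. \<partial> v F x0)"
  proof
    assume "n x0 \<in> range (\<lambda>v. \<partial> v F x0)"
    then have "n x0 + \<partial> (w x0) F x0 \<in> range (\<lambda>v. \<partial> v F x0)"
      using range_dF(1)[OF x0] by (simp add: subspace_add)
    then show False using z0 unfolding n_def by simp
  qed
  note dec = decomposition[OF x0 this]
  have "q x0 \<noteq> 0"
  proof
    assume q0: "q x0 = 0"
    have "g (F x0) (n x0) y = 0" for y
    proof -
      obtain w' c where y: "y = \<partial> w' F x0 + c *\<^sub>R n x0"
        by (rule dec)
      show ?thesis
        unfolding y using q0 n_normal[OF x0, of w'] unfolding q_def by (simp add: gF[OF x0])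
    qed
    then have "n x0 = 0"
      using nondeg[OF maps[OF x0]] unfolding nondegenerate_def by blast
    then show False
      using \<open>n x0 \<notin> range (\<lambda>v. \<partial> v F x0)\<close> range_dF(1)[OF x0] by (simp add: subspace_0)
  qed
  \<comment> \<open>The surrounding metric may be indefinite, so that the normal can be spacelike or timelike. Its length is
    normalised near \<open>x0\<close>, where \<open>q\<close> keeps its sign.\<close>
  define \<sigma> where "\<sigma> = sgn (q x0)"
  have \<sigma>: "\<sigma> * \<sigma> = 1" "0 < \<sigma> * q x0"
    using \<open>q x0 \<noteq> 0\<close> by (auto simp: \<sigma>_def sgn_if)
  have sm_\<sigma>q: "smooth_on \<Omega> (\<lambda>x. \<sigma> * q x)"
    by (rule smooth_on_mult[OF open_\<Omega> smooth_on_const sm_q])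
  have "isCont (\<lambda>x. \<sigma> * q x) x0"
    using smooth_onD(3)[OF sm_\<sigma>q] open_\<Omega> x0 by (simp add: continuous_on_eq_continuous_at)
  then have "((\<lambda>x. \<sigma> * q x) \<longlongrightarrow> \<sigma> * q x0) (nhds x0)"
    unfolding isCont_def by (rule tendsto_at_iff_tendsto_nhds[where g="\<lambda>x. \<sigma> * q x", THEN iffD1])
  then have "\<forall>\<^sub>F x in nhds x0. 0 < \<sigma> * q x"
    using \<sigma>(2) by (rule order_tendstoD)
  moreover have "\<forall>\<^sub>F x in nhds x0. x \<in> \<Omega>"
    using open_\<Omega> x0 by (rule eventually_nhds_in_open)
  ultimately have "\<forall>\<^sub>F x in nhds x0. x \<in> \<Omega> \<and> 0 < \<sigma> * q x"
    by eventually_elim simp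
  then obtain r where "0 < r" and r: "\<And>x. dist x x0 < r \<Longrightarrow> x \<in> \<Omega> \<and> 0 < \<sigma> * q x"
    unfolding eventually_nhds_metric by blast
  have ball: "x \<in> \<Omega>" "0 < \<sigma> * q x" if "x \<in> ball x0 r" for x
    using r[of x] that by (simp_all add: dist_commute)
  define s where "s x = inverse (sqrt (\<sigma> * q x))" for x
  have sub: "ball x0 r \<subseteq> \<Omega>" using ball(1) by blast
  have sqrt_ne: "sqrt (\<sigma> * q x) \<noteq> 0" if "x \<in> ball x0 r" for x
    using real_sqrt_gt_zero[OF ball(2)[OF that]] by linarith
  have sm_s: "smooth_on (ball x0 r) s"
    unfolding s_def
    by (rule smooth_on_inverse[OF open_ball smooth_on_sqrt[OF open_ball smooth_on_subset[OF sm_\<sigma>q sub] ball(2)] sqrt_ne])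
  define \<nu> where "\<nu> x = s x *\<^sub>R n x" for x
  have ss: "s x * s x * (\<sigma> * q x) = 1" if "x \<in> ball x0 r" for x
  proof -
    have "sqrt (\<sigma> * q x) * sqrt (\<sigma> * q x) = \<sigma> * q x" "sqrt (\<sigma> * q x) \<noteq> 0"
      using ball(2)[OF that] by auto
    then show ?thesis unfolding s_def by (metis (no_types, opaque_lifting) left_inverse mult.assoc mult.left_commute mult_1)
  qed
  show thesis
  proof (rule that[OF \<open>0 < r\<close> sub _ \<sigma>(1)])
    show "smooth_on (ball x0 r) \<nu>"
      unfolding \<nu>_def by (rule smooth_on_scaleR[OF open_ball sm_s smooth_on_subset[OF sm_n sub]])
    show "g (F x) (\<nu> x) (\<partial> u F x) = 0" if "x \<in> ball x0 r" for x u
      using n_normal[OF ball(1)[OF that], of u] by (simp add: \<nu>_def gF[OF ball(1)[OF that]])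
    show "g (F x) (\<nu> x) (\<nu> x) = \<sigma>" if "x \<in> ball x0 r" for x
    proof -
      have "g (F x) (\<nu> x) (\<nu> x) = (\<sigma> * \<sigma>) * (s x * s x * q x)"
        unfolding \<sigma>(1) by (simp add: \<nu>_def q_def gF[OF ball(1)[OF that]])
      also have "\<dots> = \<sigma> * (s x * s x * (\<sigma> * q x))"
        by (simp add: mult_ac)
      finally show ?thesis unfolding ss[OF that] by simp
    qed
  qed
qed

end

text \<open>A spacelike hypersurface with unit normal \<open>\<nu>\<close> of causal character \<open>\<delta>\<close>, in coordinates of a
  space of constant curvature \<open>\<kappa>\<close>.\<close>

locale hypersurface = spacelike_map S g \<Omega> F
  for S :: "'d::euclidean_space set" and g and \<Omega> :: "'e::euclidean_space set" and F :: "'e \<Rightarrow> 'd" +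
  fixes \<nu> :: "'e \<Rightarrow> 'd" and \<delta> \<kappa> :: real
  assumes smooth_\<nu>: "smooth_on \<Omega> \<nu>"
    and normal: "x \<in> \<Omega> \<Longrightarrow> g (F x) (\<nu> x) (\<partial> u F x) = 0"
    and unit: "x \<in> \<Omega> \<Longrightarrow> g (F x) (\<nu> x) (\<nu> x) = \<delta>"
    and \<delta>: "\<delta> * \<delta> = 1"
    and const_curv: "y \<in> S \<Longrightarrow> nondegenerate_plane g y a b \<Longrightarrow> sectional_curvature g y a b = \<kappa>"
begin

text \<open>The scalar second fundamental form. The vector-valued one is \<open>\<delta> sff \<nu>\<close>, since the coefficient of a
  vector along \<open>\<nu>\<close> is \<open>\<delta>\<close> times its inner product with \<open>\<nu>\<close>.\<close>

definition sff :: "'e \<Rightarrow> 'e \<Rightarrow> 'e \<Rightarrow> real" where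
  "sff x u v = g (F x) (D u (\<partial> v F) x) (\<nu> x)"

lemma \<nu>_transversal:
  assumes x: "x \<in> \<Omega>"
  shows "\<nu> x \<notin> range (\<lambda>v. \<partial> v F x)"
  using unit[OF x] normal[OF x] \<delta> by (metis image_iff mult_zero_left zero_neq_one)

lemma unit_normal_unique:
  assumes x: "x \<in> \<Omega>" and n: "\<And>w. g (F x) n (\<partial> w F x) = 0" "\<bar>g (F x) n n\<bar> = 1"
  shows "n = \<nu> x \<or> n = - \<nu> x"
proof -
  obtain w c where w: "n = \<partial> w F x + c *\<^sub>R \<nu> x"
    by (rule decomposition[OF x \<nu>_transversal[OF x]])
  have "g (F x) (\<partial> w F x) (\<partial> w F x) = 0"
    using n(1)[of w] normal[OF x, of w] unfolding w by (simp add: gF[OF x])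
  then have "w = 0" using spacelike[OF x, of w] by (metis less_irrefl)
  then have n': "n = c *\<^sub>R \<nu> x" using w linear_0[OF dF_linear[OF x]] by simp
  have "\<bar>\<delta>\<bar> = 1" using \<delta> by (auto simp: square_eq_1_iff)
  then have "\<bar>c * c\<bar> = 1"
    using n(2) unit[OF x] unfolding n' by (simp add: gF[OF x] abs_mult)
  then have "c = 1 \<or> c = -1"
    by (simp add: square_eq_1_iff)
  then show ?thesis using n' by auto
qed

text \<open>The left-hand side is the normal part of \<open>y\<close> by its defining property.\<close>

lemma normal_component:
  assumes x: "x \<in> \<Omega>"
  shows "(THE n. (\<forall>w. g (F x) n (\<partial> w F x) = 0) \<and> (\<exists>w. y = \<partial> w F x + n)) = (\<delta> * g (F x) y (\<nu> x)) *\<^sub>R \<nu> x"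
proof (rule the_equality)
  obtain w c where y: "y = \<partial> w F x + c *\<^sub>R \<nu> x"
    by (rule decomposition[OF x \<nu>_transversal[OF x]])
  have "g (F x) y (\<nu> x) = c * \<delta>"
    unfolding y using normal[OF x, of w] gF_commute[OF x, of "\<partial> w F x" "\<nu> x"] unit[OF x] by (simp add: gF[OF x])
  then have c: "\<delta> * g (F x) y (\<nu> x) = c"
    using \<delta> by (simp add: mult.left_commute)
  show "(\<forall>w. g (F x) ((\<delta> * g (F x) y (\<nu> x)) *\<^sub>R \<nu> x) (\<partial> w F x) = 0) \<and>
      (\<exists>w. y = \<partial> w F x + (\<delta> * g (F x) y (\<nu> x)) *\<^sub>R \<nu> x)"
    unfolding c using y normal[OF x] by (auto simp: gF[OF x])
  fix n assume n: "(\<forall>w. g (F x) n (\<partial> w F x) = 0) \<and> (\<exists>w. y = \<partial> w F x + n)"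
  then obtain w' where w': "y = \<partial> w' F x + n" by blast
  have d: "\<partial> (w' - w) F x = c *\<^sub>R \<nu> x - n"
    unfolding linear_diff[OF dF_linear[OF x]] using y w' by (simp add: algebra_simps)
  have "g (F x) (\<partial> (w' - w) F x) (\<partial> (w' - w) F x) = 0"
    unfolding d[symmetric] using n normal[OF x]
    by (subst (1) d) (simp add: gF[OF x])
  then have "w' - w = 0"
    using spacelike[OF x, of "w' - w"] by (metis less_irrefl)
  then show "n = (\<delta> * g (F x) y (\<nu> x)) *\<^sub>R \<nu> x"
    unfolding c using d linear_0[OF dF_linear[OF x]] by simp
qed

lemma sff_sym: "x \<in> \<Omega> \<Longrightarrow> sff x u v = sff x v u"
  unfolding sff_def by (simp only: cov_torsion_free[of x u v])

lemma sff_bilinear: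
  assumes x: "x \<in> \<Omega>"
  shows "bilinear (sff x)"
proof -
  have "linear (\<lambda>u. sff x u v)" for v
  proof -
    note l1 = dF_linear[OF x] and l2 = pd_linear[OF smooth_onD(1)[OF smooth_dF[of v] x]]
      and c = christoffel_bilinear[OF maps[OF x]]
    show ?thesis
      unfolding sff_def cov_def
      by (rule linearI; simp add: linear_add[OF l1] linear_add[OF l2] linear_scale[OF l1] linear_scale[OF l2]
          bilinear_ladd[OF c] bilinear_lmul[OF c] gF[OF x] algebra_simps)
  qed
  moreover from this have "linear (sff x u)" for u
    unfolding sff_sym[OF x, of u, abs_def] .
  ultimately show ?thesis
    unfolding bilinear_def by blast
qed

lemma sff_smooth: "smooth_on \<Omega> (\<lambda>x. sff x u v)"
  unfolding sff_def by (rule smooth_inner_along[OF cov_smooth[OF smooth_dF] smooth_\<nu>])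

text \<open>The tangential part of the derivative of a coordinate field is the derivative with respect to
  the Levi-Civita connection of the induced metric.\<close>

lemma tangential_part:
  assumes x: "x \<in> \<Omega>"
  shows "g (F x) (D w (\<partial> v F) x) (\<partial> z F x) = ind x (christoffel ind x w v) z"
proof -
  interpret ind: riemannian_field \<Omega> ind by (rule ind_riemannian)
  have m: "\<partial> w (\<lambda>y. ind y u v) x = g (F x) (D w (\<partial> u F) x) (\<partial> v F x) + g (F x) (\<partial> u F x) (D w (\<partial> v F) x)" for w u v
    unfolding ind_def by (rule cov_metric[OF x smooth_dF smooth_dF])
  show ?thesis
    using ind.koszul[OF x, of w v z] unfolding m
    using cov_torsion_free[OF x, of w v] cov_torsion_free[OF x, of z w] cov_torsion_free[OF x, of z v]
      gF_commute[OF x, of "\<partial> v F x"] gF_commute[OF x, of "\<partial> w F x"]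
    by simp
qed

text \<open>Differentiating \<open>\<langle>\<nu>, \<partial>\<^sub>v F\<rangle> = 0\<close> and \<open>\<langle>\<nu>, \<nu>\<rangle> = \<delta>\<close>.\<close>

lemma weingarten:
  assumes x: "x \<in> \<Omega>"
  shows "sff x u v = - g (F x) (\<partial> v F x) (D u \<nu> x)"
    and "\<exists>w. D u \<nu> x = \<partial> w F x"
proof -
  have "\<partial> u (\<lambda>y. g (F y) (\<partial> v F y) (\<nu> y)) x = \<partial> u (\<lambda>y. 0) x"
    by (rule pd_cong[OF open_\<Omega> x]) (simp add: gF_commute[of _ _ "\<nu> _"] normal)
  then show "sff x u v = - g (F x) (\<partial> v F x) (D u \<nu> x)"
    unfolding cov_metric[OF x smooth_dF smooth_\<nu>] sff_def by simp
  have "\<partial> u (\<lambda>y. g (F y) (\<nu> y) (\<nu> y)) x = \<partial> u (\<lambda>y. \<delta>) x"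
    by (rule pd_cong[OF open_\<Omega> x]) (simp add: unit)
  then have orth: "g (F x) (D u \<nu> x) (\<nu> x) = 0"
    unfolding cov_metric[OF x smooth_\<nu> smooth_\<nu>] using gF_commute[OF x, of "\<nu> x"] by simp
  obtain w c where w: "D u \<nu> x = \<partial> w F x + c *\<^sub>R \<nu> x"
    by (rule decomposition[OF x \<nu>_transversal[OF x]])
  have "c * \<delta> = 0"
    using orth normal[OF x, of w] gF_commute[OF x, of "\<partial> w F x" "\<nu> x"] unit[OF x] unfolding w by (simp add: gF[OF x])
  then have "c = 0" using \<delta> by auto
  then show "\<exists>w. D u \<nu> x = \<partial> w F x" using w by auto
qed

lemma curvature_normal:
  assumes x: "x \<in> \<Omega>"
  shows "g (F x) (R (F x) (\<partial> u F x) (\<partial> v F x) (\<nu> x)) (\<partial> w F x) = 0"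
proof -
  let ?y = "F x"
  have y: "?y \<in> S" by (rule maps[OF x])
  note gs' = gs[OF y] and comm = sym_form_commute[OF sym[OF y]]
  define T where "T a b c z = g ?y (R ?y a b c) z - \<kappa> * (g ?y b c * g ?y a z - g ?y a c * g ?y b z)" for a b c z
  note R_lin = curvature_linear[OF y]
  have "T (\<partial> u F x) (\<partial> v F x) (\<nu> x) (\<partial> w F x) = 0"
  proof (rule curvature_annihilates_normal[where T=T and V="range (\<lambda>v. \<partial> v F x)", OF sym[OF y]])
    show "linear (T a b c)" "linear (\<lambda>c. T a b c z)" "linear (\<lambda>b. T a b c z)" "linear (\<lambda>a. T a b c z)" for a b c z
      unfolding T_def
      by (rule linearI; simp add: linear_add[OF R_lin(1)] linear_add[OF R_lin(2)] linear_add[OF R_lin(3)]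
        linear_scale[OF R_lin(1)] linear_scale[OF R_lin(2)] linear_scale[OF R_lin(3)] gs' algebra_simps)+
    show "T a b c z = - T b a c z" for a b c z
      unfolding T_def curvature_swap[of ?y a b] by (simp add: gs' algebra_simps)
    show "T a b c z = - T a b z c" for a b c z
      unfolding T_def curvature_skew[OF y, of a b c z] using comm[of c "R ?y a b z"] by (simp add: algebra_simps)
    show "T a b c z + T b c a z + T c a b z = 0" for a b c z
    proof -
      have "g ?y (R ?y a b c + R ?y b c a + R ?y c a b) z = 0"
        unfolding curvature_bianchi[OF y] by (simp add: gs')
      then show ?thesis
        unfolding T_def using comm[of b c] comm[of a c] comm[of a b] by (simp add: gs' algebra_simps)
    qed
    show "T a b b a = 0" if "g ?y a a * g ?y b b - (g ?y a b)\<^sup>2 \<noteq> 0" for a b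
    proof -
      have "sectional_curvature g ?y a b = \<kappa>"
        using const_curv[OF y] that unfolding nondegenerate_plane_def by blast
      then have "g ?y (R ?y a b b) a = \<kappa> * (g ?y a a * g ?y b b - (g ?y a b)\<^sup>2)"
        unfolding sectional_curvature_def using that by (simp add: divide_eq_eq)
      then show ?thesis
        unfolding T_def using comm[of b a] by (simp add: power2_eq_square algebra_simps)
    qed
    show "subspace (range (\<lambda>v. \<partial> v F x))"
      by (rule linear_subspace_image[OF dF_linear[OF x] subspace_UNIV])
    show "0 < g ?y X X" if "X \<in> range (\<lambda>v. \<partial> v F x)" "X \<noteq> 0" for X
    proof -
      from that(1) obtain v where X: "X = \<partial> v F x" by blast
      then have "v \<noteq> 0" using that(2) linear_0[OF dF_linear[OF x]] by auto
      then show ?thesis unfolding X by (rule spacelike[OF x])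
    qed
    show "g ?y (\<nu> x) X = 0" if "X \<in> range (\<lambda>v. \<partial> v F x)" for X
      using that normal[OF x] by blast
  qed auto
  then show ?thesis
    unfolding T_def using normal[OF x] comm[of "\<partial> u F x" "\<nu> x"] comm[of "\<partial> v F x" "\<nu> x"] by simp
qed

text \<open>Differentiating the Weingarten formula once more and antisymmetrising, the Christoffel terms of the
  induced metric complete the covariant derivatives, and what remains is the normal component of the
  surrounding curvature, which vanishes for constant curvature.\<close>

lemma codazzi_equation:
  assumes x: "x \<in> \<Omega>"
  shows "nabla ind w sff x u v = nabla ind u sff x w v"
proof -
  interpret ind: riemannian_field \<Omega> ind by (rule ind_riemannian)
  have smD: "smooth_on \<Omega> (D u \<nu>)" for u
    by (rule cov_smooth[OF smooth_\<nu>])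
  have tang: "g (F x) (D w (\<partial> v F) x) (D u \<nu> x) = - sff x u (christoffel ind x w v)" for w u v
  proof -
    obtain z where z: "D u \<nu> x = \<partial> z F x"
      using weingarten(2)[OF x] by blast
    have "g (F x) (D w (\<partial> v F) x) (\<partial> z F x) = g (F x) (\<partial> (christoffel ind x w v) F x) (D u \<nu> x)"
      unfolding tangential_part[OF x] unfolding ind_def z ..
    then show ?thesis
      unfolding weingarten(1)[OF x, of u] z by simp
  qed
  have der: "\<partial> w (\<lambda>y. sff y u v) x = sff x u (christoffel ind x w v) - g (F x) (\<partial> v F x) (D w (D u \<nu>) x)" for w u
  proof -
    have "\<partial> w (\<lambda>y. sff y u v) x = \<partial> w (\<lambda>y. - g (F y) (\<partial> v F y) (D u \<nu> y)) x"
      by (rule pd_cong[OF open_\<Omega> x weingarten(1)])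
    also have "\<dots> = - \<partial> w (\<lambda>y. g (F y) (\<partial> v F y) (D u \<nu> y)) x"
      by (rule pd_bounded_linear(1)[OF bounded_linear_minus[OF bounded_linear_ident]
            smooth_onD(1)[OF smooth_inner_along[OF smooth_dF smD] x]])
    finally show ?thesis
      unfolding cov_metric[OF x smooth_dF smD] tang by simp
  qed
  have "g (F x) (\<partial> v F x) (D w (D u \<nu>) x) - g (F x) (\<partial> v F x) (D u (D w \<nu>) x) = 0"
    using curvature_normal[OF x, of w u v] gF_commute[OF x, of "\<partial> v F x"]
    unfolding cov_curvature[OF x smooth_\<nu>, symmetric] by (simp add: gF[OF x])
  then show ?thesis
    unfolding nabla_def der ind.christoffel_sym[OF x, of u w] by simp
qed

lemma sff_codazzi_field: "codazzi_field \<Omega> ind sff"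
proof -
  interpret ind: riemannian_field \<Omega> ind by (rule ind_riemannian)
  show ?thesis
    by unfold_locales
      (auto simp: form_field_def sff_bilinear sff_smooth intro: sff_sym codazzi_equation)
qed

text \<open>A normal field of the form \<open>\<theta> \<nu>\<close> is parallel in the normal connection only if \<open>\<theta>\<close> is
  constant; this turns the assumption on the mean curvature vector into one about a function.\<close>

lemma normal_derivative:
  assumes x: "x \<in> \<Omega>" and \<theta>: "smooth_on \<Omega> \<theta>"
  shows "g (F x) (D u (\<lambda>y. \<theta> y *\<^sub>R \<nu> y) x) (\<nu> x) = \<delta> * \<partial> u \<theta> x"
proof -
  have "\<partial> u (\<lambda>y. \<theta> y *\<^sub>R \<nu> y) x = \<theta> x *\<^sub>R \<partial> u \<nu> x + \<partial> u \<theta> x *\<^sub>R \<nu> x"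
    by (rule pd_bounded_bilinear(1)[OF bounded_bilinear_scaleR smooth_onD(1)[OF \<theta> x] smooth_onD(1)[OF smooth_\<nu> x]])
  then have "D u (\<lambda>y. \<theta> y *\<^sub>R \<nu> y) x = \<theta> x *\<^sub>R D u \<nu> x + \<partial> u \<theta> x *\<^sub>R \<nu> x"
    unfolding cov_def bilinear_rmul[OF christoffel_bilinear[OF maps[OF x]]] by (simp add: algebra_simps)
  moreover obtain w where "D u \<nu> x = \<partial> w F x"
    using weingarten(2)[OF x] by blast
  ultimately show ?thesis
    using normal[OF x] gF_commute[OF x, of "\<partial> w F x"] unit[OF x] by (simp add: gF[OF x] mult.commute)
qed

end


section \<open>Charts and pulled back metrics\<close>

lemma chart_facts:
  assumes "is_chart Y C"
  shows "fst C \<subseteq> topspace Y" "openin Y (fst C)" "open (chart_image C)"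
    and "y \<in> chart_image C \<Longrightarrow> chart_inv C y \<in> fst C"
    and "y \<in> chart_image C \<Longrightarrow> snd C (chart_inv C y) = y"
    and "p \<in> fst C \<Longrightarrow> chart_inv C (snd C p) = p"
    and "continuous_map (subtopology Y (fst C)) (top_of_set (chart_image C)) (snd C)"
    and "continuous_map (top_of_set (chart_image C)) (subtopology Y (fst C)) (chart_inv C)"
proof -
  have hom: "homeomorphic_map (subtopology Y (fst C)) (top_of_set (chart_image C)) (snd C)"
    and op: "openin Y (fst C)" and im: "open (chart_image C)"
    using assms unfolding is_chart_def by auto
  show sub: "fst C \<subseteq> topspace Y" and "openin Y (fst C)" and "open (chart_image C)"
    using op im openin_subset by auto
  have top: "topspace (subtopology Y (fst C)) = fst C"
    using sub by auto
  have inj: "inj_on (snd C) (fst C)"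
    using homeomorphic_imp_injective_map[OF hom] unfolding top .
  show r1: "y \<in> chart_image C \<Longrightarrow> chart_inv C y \<in> fst C" for y
    unfolding chart_inv_def by (rule inv_into_into)
  show r2: "y \<in> chart_image C \<Longrightarrow> snd C (chart_inv C y) = y" for y
    unfolding chart_inv_def by (rule f_inv_into_f)
  show r3: "p \<in> fst C \<Longrightarrow> chart_inv C (snd C p) = p" for p
    unfolding chart_inv_def by (rule inv_into_f_f[OF inj])
  show "continuous_map (subtopology Y (fst C)) (top_of_set (chart_image C)) (snd C)"
    by (rule homeomorphic_imp_continuous_map[OF hom])
  obtain k where k: "homeomorphic_maps (subtopology Y (fst C)) (top_of_set (chart_image C)) (snd C) k"
    using hom unfolding homeomorphic_map_maps by blast
  then have kc: "continuous_map (top_of_set (chart_image C)) (subtopology Y (fst C)) k"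
    and kf: "\<And>p. p \<in> fst C \<Longrightarrow> k (snd C p) = p"
    unfolding homeomorphic_maps_def top by auto
  show "continuous_map (top_of_set (chart_image C)) (subtopology Y (fst C)) (chart_inv C)"
    by (rule continuous_map_eq[OF kc]) (use kf r3 in auto)
qed

text \<open>Twice the Christoffel symbol of the first kind.\<close>

definition first_kind ::
    "('b::real_normed_vector \<Rightarrow> 'b \<Rightarrow> 'b \<Rightarrow> real) \<Rightarrow> 'b \<Rightarrow> 'b \<Rightarrow> 'b \<Rightarrow> 'b \<Rightarrow> real" where
  "first_kind h p a b z = \<partial> a (\<lambda>q. h q b z) p + \<partial> b (\<lambda>q. h q a z) p - \<partial> z (\<lambda>q. h q a b) p"

text \<open>The second fundamental form of \<open>\<phi>\<close> in the direction of a normal vector \<open>n\<close>, computed in the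
  Euclidean space that contains the target manifold. No chart of the target enters, so that independence
  of that chart is automatic and only changes of chart on the hypersurface remain to be studied. Christoffel
  symbols of the first kind are used because \<open>h\<close> may be degenerate on the Euclidean space.\<close>

definition ext_sff ::
    "('b::euclidean_space \<Rightarrow> 'b \<Rightarrow> 'b \<Rightarrow> real) \<Rightarrow> ('e::euclidean_space \<Rightarrow> 'b) \<Rightarrow> 'e \<Rightarrow> 'b \<Rightarrow> 'e \<Rightarrow> 'e \<Rightarrow> real" where
  "ext_sff h \<phi> x n u v =
     h (\<phi> x) (\<partial> u (\<partial> v \<phi>) x) n + first_kind h (\<phi> x) (\<partial> u \<phi> x) (\<partial> v \<phi> x) n / 2"

lemma pd_differential_along:
  fixes k :: "'d::euclidean_space \<Rightarrow> 'b::euclidean_space" and F :: "'e::euclidean_space \<Rightarrow> 'd"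
  assumes \<Omega>: "open \<Omega>" and x: "x \<in> \<Omega>" and F: "smooth_on \<Omega> F" and FW: "\<And>x. x \<in> \<Omega> \<Longrightarrow> F x \<in> W"
    and k: "smooth_on W k" and \<xi>: "smooth_on \<Omega> \<xi>"
  shows "\<partial> u (\<lambda>y. \<partial> (\<xi> y) k (F y)) x = \<partial> (\<partial> u F x) (\<partial> (\<xi> x) k) (F x) + \<partial> (\<partial> u \<xi> x) k (F x)"
proof -
  have Fd: "F differentiable (at x)" by (rule smooth_onD(1)[OF F x])
  have lin: "linear (\<lambda>a. \<partial> a k (F y))" if "y \<in> \<Omega>" for y
    by (rule pd_linear[OF smooth_onD(1)[OF k FW[OF that]]])
  have sm: "smooth_on \<Omega> (\<lambda>y. \<partial> a k (F y))" for a
    by (rule smooth_on_compose[where f="\<partial> a k", OF \<Omega> F smooth_onD(2)[OF k] FW])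
  have "\<partial> u (\<lambda>y. \<partial> (\<xi> y) k (F y)) x = \<partial> u (\<lambda>y. \<partial> (\<xi> x) k (F y)) x + \<partial> (\<partial> u \<xi> x) k (F x)"
    by (rule pd_linear_field(1)[where L="\<lambda>y a. \<partial> a k (F y)" and \<xi>=\<xi>, OF \<Omega> x lin smooth_onD(1)[OF sm x] smooth_onD(1)[OF \<xi> x]])
  also have "\<partial> u (\<lambda>y. \<partial> (\<xi> x) k (F y)) x = \<partial> (\<partial> u F x) (\<partial> (\<xi> x) k) (F x)"
    by (rule pd_chain[where f="\<partial> (\<xi> x) k", OF Fd smooth_onD(1)[OF smooth_onD(2)[OF k] FW[OF x]]])
  finally show ?thesis .
qed

lemma second_derivative_composition:
  fixes k :: "'d::euclidean_space \<Rightarrow> 'b::euclidean_space" and F :: "'e::euclidean_space \<Rightarrow> 'd"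
  assumes \<Omega>: "open \<Omega>" and x: "x \<in> \<Omega>" and F: "smooth_on \<Omega> F" and FW: "\<And>x. x \<in> \<Omega> \<Longrightarrow> F x \<in> W"
    and k: "smooth_on W k" and \<phi>: "\<And>x. x \<in> \<Omega> \<Longrightarrow> \<phi> x = k (F x)"
  shows "\<partial> v \<phi> x = \<partial> (\<partial> v F x) k (F x)"
    and "\<partial> u (\<partial> v \<phi>) x = \<partial> (\<partial> u F x) (\<partial> (\<partial> v F x) k) (F x) + \<partial> (\<partial> u (\<partial> v F) x) k (F x)"
proof -
  have 1: "\<partial> v \<phi> y = \<partial> (\<partial> v F y) k (F y)" if y: "y \<in> \<Omega>" for y
    using pd_cong[OF \<Omega> y \<phi>, where v=v] pd_chain[OF smooth_onD(1)[OF F y] smooth_onD(1)[OF k FW[OF y]], where v=v] by simp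
  then show "\<partial> v \<phi> x = \<partial> (\<partial> v F x) k (F x)" using x .
  have "\<partial> u (\<partial> v \<phi>) x = \<partial> u (\<lambda>y. \<partial> (\<partial> v F y) k (F y)) x"
    by (rule pd_cong[OF \<Omega> x 1])
  also have "\<dots> = \<partial> (\<partial> u F x) (\<partial> (\<partial> v F x) k) (F x) + \<partial> (\<partial> u (\<partial> v F) x) k (F x)"
    by (rule pd_differential_along[where \<xi>="\<partial> v F", OF \<Omega> x F FW k smooth_onD(2)[OF F]])
  finally show "\<partial> u (\<partial> v \<phi>) x = \<partial> (\<partial> u F x) (\<partial> (\<partial> v F x) k) (F x) + \<partial> (\<partial> u (\<partial> v F) x) k (F x)" .
qed

text \<open>The form \<open>h\<close> is defined on an open set around the manifold but matters on tangent vectors only, where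
  it is the metric.\<close>

locale form_on_open =
  fixes Q :: "'b::euclidean_space set" and h :: "'b \<Rightarrow> 'b \<Rightarrow> 'b \<Rightarrow> real"
  assumes open_Q: "open Q" and h_sym: "p \<in> Q \<Longrightarrow> sym_form (h p)" and h_smooth: "smooth_on Q (\<lambda>p. h p u v)"
begin

lemmas hs = sym_form_simps[OF h_sym]

lemma pullback_smooth:
  assumes W: "open W" and k: "smooth_on W k" and kQ: "\<And>y. y \<in> W \<Longrightarrow> k y \<in> Q"
  shows "smooth_on W (\<lambda>y. pullback_metric h k y u v)"
  unfolding pullback_metric_def
  by (rule smooth_on_bilinear_field[where B="\<lambda>y. h (k y)", OF W sym_form_linear(3)[OF h_sym[OF kQ]]
    smooth_on_compose[where f="\<lambda>p. h p _ _", OF W k h_smooth kQ] smooth_onD(2)[OF k] smooth_onD(2)[OF k]])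

lemma pullback_sym_form:
  assumes k: "k differentiable (at y)" and kQ: "k y \<in> Q"
  shows "sym_form (pullback_metric h k y)"
proof -
  note l = pd_linear[OF k]
  show ?thesis
    unfolding sym_form_def bilinear_def pullback_metric_def
    by (intro conjI allI; (rule linearI; simp add: linear_add[OF l] linear_scale[OF l] hs[OF kQ])?)
      (rule sym_form_commute[OF h_sym[OF kQ]])
qed

text \<open>The classical transformation law of the Christoffel symbols of the first kind.\<close>

lemma first_kind_pullback:
  assumes W: "open W" and y: "y \<in> W" and k: "smooth_on W k" and kQ: "\<And>y. y \<in> W \<Longrightarrow> k y \<in> Q"
  shows "first_kind (pullback_metric h k) y a b z =
    first_kind h (k y) (\<partial> a k y) (\<partial> b k y) (\<partial> z k y) + 2 * h (k y) (\<partial> a (\<partial> b k) y) (\<partial> z k y)"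
proof -
  have smh: "smooth_on W (\<lambda>y. h (k y) u v)" for u v
    by (rule smooth_on_compose[where f="\<lambda>p. h p u v", OF W k h_smooth kQ])
  have "\<partial> w (\<lambda>y. pullback_metric h k y u v) y =
      \<partial> (\<partial> w k y) (\<lambda>p. h p (\<partial> u k y) (\<partial> v k y)) (k y) +
      h (k y) (\<partial> w (\<partial> u k) y) (\<partial> v k y) + h (k y) (\<partial> u k y) (\<partial> w (\<partial> v k) y)" for w u v
  proof -
    have "\<partial> w (\<lambda>y. h (k y) (\<partial> u k y) (\<partial> v k y)) y = \<partial> w (\<lambda>x. h (k x) (\<partial> u k y) (\<partial> v k y)) y +
      h (k y) (\<partial> w (\<partial> u k) y) (\<partial> v k y) + h (k y) (\<partial> u k y) (\<partial> w (\<partial> v k) y)"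
      by (rule pd_bilinear_field(1)[where B="\<lambda>y. h (k y)" and \<xi>="\<partial> u k" and \<eta>="\<partial> v k", OF W y
            sym_form_linear(3)[OF h_sym[OF kQ]] smooth_onD(1)[OF smh y] smooth_onD(1)[OF smooth_onD(2)[OF k] y]
            smooth_onD(1)[OF smooth_onD(2)[OF k] y]])
    also have "\<partial> w (\<lambda>x. h (k x) (\<partial> u k y) (\<partial> v k y)) y = \<partial> (\<partial> w k y) (\<lambda>p. h p (\<partial> u k y) (\<partial> v k y)) (k y)"
      by (rule pd_chain[where f="\<lambda>p. h p (\<partial> u k y) (\<partial> v k y)", OF smooth_onD(1)[OF k y] smooth_onD(1)[OF h_smooth kQ[OF y]]])
    finally show ?thesis unfolding pullback_metric_def .
  qed
  note der = this
  show ?thesis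
    unfolding first_kind_def der
    using pd_commute[OF W y k, where u=b and v=a] pd_commute[OF W y k, where u=z and v=a]
      pd_commute[OF W y k, where u=z and v=b] sym_form_commute[OF h_sym[OF kQ[OF y]]]
    by simp
qed

text \<open>By the transformation law, the Levi-Civita derivative in a chart \<open>k\<close> has the same inner products with
  tangent vectors as the expression in the surrounding Euclidean space.\<close>

lemma ext_sff_chart:
  assumes W: "open W" and k: "smooth_on W k" and kQ: "\<And>y. y \<in> W \<Longrightarrow> k y \<in> Q"
    and met: "metric_field W (pullback_metric h k)"
    and \<Omega>: "open \<Omega>" and x: "x \<in> \<Omega>" and F: "smooth_on \<Omega> F" and FW: "\<And>x. x \<in> \<Omega> \<Longrightarrow> F x \<in> W"
    and \<phi>: "\<And>x. x \<in> \<Omega> \<Longrightarrow> \<phi> x = k (F x)"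
  shows "pullback_metric h k (F x) (cov (pullback_metric h k) F u (\<partial> v F) x) z =
    ext_sff h \<phi> x (\<partial> z k (F x)) u v"
proof -
  interpret m: metric_field W "pullback_metric h k" by (rule met)
  let ?g = "pullback_metric h k"
  have y: "F x \<in> W" by (rule FW[OF x])
  have comp: "\<partial> v \<phi> x = \<partial> (\<partial> v F x) k (F x)"
    "\<partial> u (\<partial> v \<phi>) x = \<partial> (\<partial> u F x) (\<partial> (\<partial> v F x) k) (F x) + \<partial> (\<partial> u (\<partial> v F) x) k (F x)" for u v
    by (rule second_derivative_composition[where k=k and F=F and \<phi>=\<phi>, OF \<Omega> x F FW k \<phi>]; assumption)+
  have "2 * ?g (F x) (christoffel ?g (F x) (\<partial> u F x) (\<partial> v F x)) z =
      first_kind h (k (F x)) (\<partial> (\<partial> u F x) k (F x)) (\<partial> (\<partial> v F x) k (F x)) (\<partial> z k (F x)) +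
      2 * h (k (F x)) (\<partial> (\<partial> u F x) (\<partial> (\<partial> v F x) k) (F x)) (\<partial> z k (F x))"
    unfolding m.koszul[OF y] first_kind_def[symmetric] by (rule first_kind_pullback[OF W y k kQ])
  moreover have "?g (F x) (\<partial> u (\<partial> v F) x) z = h (k (F x)) (\<partial> (\<partial> u (\<partial> v F) x) k (F x)) (\<partial> z k (F x))"
    unfolding pullback_metric_def ..
  ultimately show ?thesis
    unfolding cov_def ext_sff_def comp \<phi>[OF x] m.gs(1)[OF y] hs(1)[OF kQ[OF y]] by simp
qed

text \<open>Both the induced metric and the second fundamental form are tensors on the parameter domain;
  the non-tensorial part of the second derivative is tangential, hence orthogonal to \<open>n\<close>.\<close>

lemma ext_sff_reparametrize:
  fixes \<tau> :: "'e::euclidean_space \<Rightarrow> 'e" and \<phi> \<phi>' :: "'e \<Rightarrow> 'b"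
  assumes \<Omega>: "open \<Omega>" and x: "x \<in> \<Omega>" and \<tau>: "smooth_on \<Omega> \<tau>" and \<tau>W: "\<And>x. x \<in> \<Omega> \<Longrightarrow> \<tau> x \<in> W"
    and \<phi>: "smooth_on W \<phi>" and \<phi>': "\<And>x. x \<in> \<Omega> \<Longrightarrow> \<phi>' x = \<phi> (\<tau> x)"
    and Q: "\<phi> (\<tau> x) \<in> Q" and n: "\<And>w. h (\<phi> (\<tau> x)) n (\<partial> w \<phi> (\<tau> x)) = 0"
  shows "pullback_metric h \<phi>' x u v = pullback_metric h \<phi> (\<tau> x) (\<partial> u \<tau> x) (\<partial> v \<tau> x)"
    and "ext_sff h \<phi>' x n u v = ext_sff h \<phi> (\<tau> x) n (\<partial> u \<tau> x) (\<partial> v \<tau> x)"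
proof -
  have comp: "\<partial> v \<phi>' x = \<partial> (\<partial> v \<tau> x) \<phi> (\<tau> x)"
    "\<partial> u (\<partial> v \<phi>') x = \<partial> (\<partial> u \<tau> x) (\<partial> (\<partial> v \<tau> x) \<phi>) (\<tau> x) + \<partial> (\<partial> u (\<partial> v \<tau>) x) \<phi> (\<tau> x)" for u v
    by (rule second_derivative_composition[where k=\<phi> and F=\<tau> and \<phi>=\<phi>', OF \<Omega> x \<tau> \<tau>W \<phi> \<phi>']; assumption)+
  show "pullback_metric h \<phi>' x u v = pullback_metric h \<phi> (\<tau> x) (\<partial> u \<tau> x) (\<partial> v \<tau> x)"
    unfolding pullback_metric_def comp \<phi>'[OF x] ..
  have "h (\<phi> (\<tau> x)) (\<partial> w \<phi> (\<tau> x)) n = 0" for w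
    using n[of w] sym_form_commute[OF h_sym[OF Q], of n] by simp
  then show "ext_sff h \<phi>' x n u v = ext_sff h \<phi> (\<tau> x) n (\<partial> u \<tau> x) (\<partial> v \<tau> x)"
    unfolding ext_sff_def comp \<phi>'[OF x] hs(1)[OF Q] by simp
qed

end

subsection \<open>The surrounding manifold\<close>

text \<open>An embedded manifold of constant curvature \<open>\<kappa>\<close>. The tangent spaces \<open>T p\<close> are given as
  explicit subspaces, which decouples them from the choice of a chart.\<close>

locale ambient = form_on_open Q h
  for Q :: "'b::euclidean_space set" and h :: "'b \<Rightarrow> 'b \<Rightarrow> 'b \<Rightarrow> real" +
  fixes M :: "'b set" and T :: "'b \<Rightarrow> 'b set" and charts :: "('b, 'd::euclidean_space) chart set" and \<kappa> :: real
  assumes sub: "M \<subseteq> Q" and charts: "charts = submanifold_charts M"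
    and tangent: "B \<in> charts \<Longrightarrow> y \<in> chart_image B \<Longrightarrow> range (\<lambda>v. \<partial> v (chart_inv B) y) = T (chart_inv B y)"
    and nondeg_T: "p \<in> M \<Longrightarrow> u \<in> T p \<Longrightarrow> (\<And>v. v \<in> T p \<Longrightarrow> h p u v = 0) \<Longrightarrow> u = 0"
    and cover: "p \<in> M \<Longrightarrow> \<exists>B\<in>charts. p \<in> fst B"
    and curv: "B \<in> charts \<Longrightarrow> y \<in> chart_image B \<Longrightarrow>
      nondegenerate_plane (pullback_metric h (chart_inv B)) y a b \<Longrightarrow>
      sectional_curvature (pullback_metric h (chart_inv B)) y a b = \<kappa>"
begin

lemma chartD:
  assumes "B \<in> charts"
  shows "is_chart (top_of_set M) B" "smooth_on (chart_image B) (chart_inv B)"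
    "y \<in> chart_image B \<Longrightarrow> inj (\<lambda>v. \<partial> v (chart_inv B) y)"
    "open (chart_image B)" "fst B \<subseteq> M"
    "y \<in> chart_image B \<Longrightarrow> chart_inv B y \<in> Q" "y \<in> chart_image B \<Longrightarrow> chart_inv B y \<in> M"
proof -
  show c: "is_chart (top_of_set M) B" and "smooth_on (chart_image B) (chart_inv B)"
    and "y \<in> chart_image B \<Longrightarrow> inj (\<lambda>v. \<partial> v (chart_inv B) y)"
    using assms unfolding charts submanifold_charts_def by auto
  show "open (chart_image B)" and f: "fst B \<subseteq> M"
    using chart_facts(1,3)[OF c] by auto
  show "y \<in> chart_image B \<Longrightarrow> chart_inv B y \<in> Q" "y \<in> chart_image B \<Longrightarrow> chart_inv B y \<in> M"
    using chart_facts(4)[OF c, of y] f sub by auto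
qed

lemma chart_metric_field:
  assumes B: "B \<in> charts"
  shows "metric_field (chart_image B) (pullback_metric h (chart_inv B))"
proof
  show "open (chart_image B)" by (rule chartD(4)[OF B])
  show "smooth_on (chart_image B) (\<lambda>x. pullback_metric h (chart_inv B) x u v)" for u v
    by (rule pullback_smooth[OF chartD(4)[OF B] chartD(2)[OF B] chartD(6)[OF B]])
  fix y assume y: "y \<in> chart_image B"
  show "sym_form (pullback_metric h (chart_inv B) y)"
    by (rule pullback_sym_form[OF smooth_onD(1)[OF chartD(2)[OF B] y] chartD(6)[OF B y]])
  show "nondegenerate (pullback_metric h (chart_inv B) y)"
    unfolding nondegenerate_def
  proof (intro allI impI)
    fix w assume w: "\<forall>z. pullback_metric h (chart_inv B) y w z = 0"
    have "\<partial> w (chart_inv B) y = 0"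
    proof (rule nondeg_T[OF chartD(7)[OF B y]])
      show "\<partial> w (chart_inv B) y \<in> T (chart_inv B y)"
        unfolding tangent[OF B y, symmetric] by (rule rangeI)
      show "h (chart_inv B y) (\<partial> w (chart_inv B) y) v = 0" if "v \<in> T (chart_inv B y)" for v
        using that w unfolding tangent[OF B y, symmetric] pullback_metric_def by auto
    qed
    then show "w = 0"
      using chartD(3)[OF B y] pd_linear[OF smooth_onD(1)[OF chartD(2)[OF B] y]]
      by (simp add: linear_injective_0)
  qed
qed

end


section \<open>Immersed spacelike hypersurfaces\<close>

lemma christoffel_cong:
  assumes "open S" "x \<in> S" "\<And>y. y \<in> S \<Longrightarrow> g y = g' y"
  shows "christoffel g x u v = christoffel g' x u v"
proof -
  have pd: "\<partial> w (\<lambda>y. g y a b) x = \<partial> w (\<lambda>y. g' y a b) x" for w a b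
    by (rule pd_cong[OF assms(1,2)]) (simp add: assms(3))
  show ?thesis
    unfolding christoffel_def pd assms(3)[OF assms(2)] ..
qed

lemma nabla_cong:
  assumes "open S" "x \<in> S" "\<And>y. y \<in> S \<Longrightarrow> g y = g' y" "\<And>y. y \<in> S \<Longrightarrow> b y = b' y"
  shows "nabla g w b x u v = nabla g' w b' x u v"
proof -
  have "\<partial> w (\<lambda>y. b y u v) x = \<partial> w (\<lambda>y. b' y u v) x"
    by (rule pd_cong[OF assms(1,2)]) (simp add: assms(4))
  then show ?thesis
    unfolding nabla_def assms(4)[OF assms(2)]
    using christoffel_cong[where g=g and g'=g', OF assms(1-3), where u=w and v=u]
      christoffel_cong[where g=g and g'=g', OF assms(1-3), where u=w and v=v] by simp
qed

text \<open>The induced metric and its second fundamental form in a chart of the target agree with those computed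
  outside only on the open set at hand, so that the notions have to be transferred from there.\<close>

lemma codazzi_field_cong:
  assumes "codazzi_field S g b" and g: "\<And>x. x \<in> S \<Longrightarrow> g x = g' x" and b: "\<And>x. x \<in> S \<Longrightarrow> b x = b' x"
  shows "codazzi_field S g' b'"
proof -
  interpret c: codazzi_field S g b by (rule assms(1))
  have sm: "smooth_on S (\<lambda>x. g' x u v)" "smooth_on S (\<lambda>x. b' x u v)" for u v
    by (rule smooth_on_cong[OF c.open_S _ c.smooth], simp add: g,
        rule smooth_on_cong[OF c.open_S _ form_fieldD(2)[OF c.form_b]], simp add: b)
  show ?thesis
  proof
    show "nabla g' w b' x u v = nabla g' u b' x w v" if x: "x \<in> S" for x u v w
      using c.codazzi[OF x, of w u v] nabla_cong[where g=g and g'=g' and b=b and b'=b', OF c.open_S x g b, where w=w and u=u and v=v]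
        nabla_cong[where g=g and g'=g' and b=b and b'=b', OF c.open_S x g b, where w=u and u=w and v=v]
      by simp
    show "form_field S b'"
      unfolding form_field_def using sm(2) form_fieldD(1)[OF c.form_b] b by simp
    show "b' x u v = b' x v u" if "x \<in> S" for x u v
      using c.sym_b[OF that, of u v] b[OF that] by simp
  qed (use c.open_S c.sym c.nondeg c.pos g sm(1) in auto)
qed

lemma sym_form_uminus: "sym_form b \<Longrightarrow> sym_form (\<lambda>u v. - b u v)"
  unfolding sym_form_def bilinear_def by (auto intro!: linearI simp: linear_add linear_scale)

locale immersed_hypersurface = ambient Q h M T charts \<kappa>
  for Q :: "'b::euclidean_space set" and h and M and T and charts :: "('b, 'd::euclidean_space) chart set" and \<kappa> +
  fixes X :: "'m topology" and A :: "('m, real^'n) chart set" and f :: "'m \<Rightarrow> 'b"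
  assumes codim: "DIM('d) = CARD('n) + 1"
    and manifold: "smooth_manifold X A" and immersion: "immersion A M f" and spacelike: "spacelike A h f"
begin

abbreviation "\<phi> C \<equiv> f \<circ> chart_inv C"
abbreviation "G C \<equiv> induced_metric h f C"
abbreviation "k B \<equiv> chart_inv B"
abbreviation "gB B \<equiv> pullback_metric h (chart_inv B)"
abbreviation "F C B \<equiv> local_rep f C B"

lemma sourceD:
  assumes "C \<in> A"
  shows "is_chart X C" "smooth_on (chart_image C) (\<phi> C)" "x \<in> chart_image C \<Longrightarrow> \<phi> C x \<in> M"
    "open (chart_image C)" "x \<in> chart_image C \<Longrightarrow> \<phi> C x \<in> Q"
proof -
  show c: "is_chart X C"
    using manifold assms unfolding smooth_manifold_def by blast
  show "smooth_on (chart_image C) (\<phi> C)"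
    using immersion assms unfolding immersion_def by blast
  have "f ` fst C \<subseteq> M"
    using immersion assms unfolding immersion_def by blast
  then show "x \<in> chart_image C \<Longrightarrow> \<phi> C x \<in> M"
    using chart_facts(4)[OF c, of x] by auto
  then show "x \<in> chart_image C \<Longrightarrow> \<phi> C x \<in> Q" using sub by blast
  show "open (chart_image C)" by (rule chart_facts(3)[OF c])
qed

lemma G_eq: "G C x u v = h (\<phi> C x) (\<partial> u (\<phi> C) x) (\<partial> v (\<phi> C) x)"
  unfolding induced_metric_def pullback_metric_def ..

lemma rep_domain_eq:
  assumes C: "C \<in> A"
  shows "rep_domain f C B = {x \<in> chart_image C. \<phi> C x \<in> fst B}"
proof
  note c = chart_facts[OF sourceD(1)[OF C]]
  show "rep_domain f C B \<subseteq> {x \<in> chart_image C. \<phi> C x \<in> fst B}"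
    unfolding rep_domain_def using c(6) by auto
  show "{x \<in> chart_image C. \<phi> C x \<in> fst B} \<subseteq> rep_domain f C B"
  proof
    fix x assume x: "x \<in> {x \<in> chart_image C. \<phi> C x \<in> fst B}"
    then have "x = snd C (chart_inv C x)" "chart_inv C x \<in> fst C \<inter> f -` fst B"
      using c(4,5)[of x] by simp_all
    then show "x \<in> rep_domain f C B"
      unfolding rep_domain_def by (rule image_eqI)
  qed
qed

lemma rep_domain_open:
  assumes C: "C \<in> A" and B: "B \<in> charts"
  shows "open (rep_domain f C B)"
proof -
  have "openin (top_of_set M) (fst B)"
    using chart_facts(2)[OF chartD(1)[OF B]] .
  then have "openin (top_of_set (chart_image C)) (chart_image C \<inter> \<phi> C -` fst B)"
    by (rule continuous_openin_preimage[OF smooth_onD(3)[OF sourceD(2)[OF C]], rotated])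
      (use sourceD(3)[OF C] in auto)
  then have "open (chart_image C \<inter> \<phi> C -` fst B)"
    using sourceD(4)[OF C] by (simp add: openin_open_eq)
  moreover have "chart_image C \<inter> \<phi> C -` fst B = rep_domain f C B"
    unfolding rep_domain_eq[OF C] by auto
  ultimately show ?thesis by simp
qed

text \<open>The representation of \<open>f\<close> in charts is smooth because its composition with the immersion
  \<open>k B\<close> is.\<close>

lemma local_rep:
  assumes C: "C \<in> A" and B: "B \<in> charts"
  shows "x \<in> rep_domain f C B \<Longrightarrow> F C B x \<in> chart_image B"
    and "x \<in> rep_domain f C B \<Longrightarrow> k B (F C B x) = \<phi> C x"
    and "smooth_on (rep_domain f C B) (F C B)"
proof -
  note b = chart_facts[OF chartD(1)[OF B]]
  show r1: "F C B x \<in> chart_image B" and r2: "k B (F C B x) = \<phi> C x" if "x \<in> rep_domain f C B" for x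
    using that b(6)[of "\<phi> C x"] unfolding rep_domain_eq[OF C] local_rep_def by auto
  have sub_im: "rep_domain f C B \<subseteq> chart_image C"
    unfolding rep_domain_eq[OF C] by auto
  have cont_phi: "continuous_on (rep_domain f C B) (\<phi> C)"
    by (rule continuous_on_subset[OF smooth_onD(3)[OF sourceD(2)[OF C]] sub_im])
  have "continuous_on (fst B) (snd B)"
  proof -
    have "continuous_map (top_of_set (fst B)) (top_of_set (chart_image B)) (snd B)"
      using b(7) chartD(5)[OF B] by (simp add: subtopology_subtopology Int_absorb1)
    then show ?thesis by simp
  qed
  then have "continuous_on (rep_domain f C B) (\<lambda>x. snd B (\<phi> C x))"
    by (rule continuous_on_compose2[OF _ cont_phi]) (auto simp: rep_domain_eq[OF C])
  then have cF: "continuous_on (rep_domain f C B) (F C B)"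
    unfolding local_rep_def by (simp add: o_def)
  show "smooth_on (rep_domain f C B) (F C B)"
  proof (rule smooth_on_lift[OF rep_domain_open[OF C B] chartD(4)[OF B] r1 cF chartD(2)[OF B] chartD(3)[OF B]])
    show "smooth_on (rep_domain f C B) (\<lambda>x. k B (F C B x))"
      by (rule smooth_on_cong[OF rep_domain_open[OF C B] r2[symmetric] smooth_on_subset[OF sourceD(2)[OF C] sub_im]])
  qed
qed

lemma spacelike_chart:
  assumes C: "C \<in> A" and B: "B \<in> charts" and \<Omega>: "open \<Omega>" "\<Omega> \<subseteq> rep_domain f C B"
  shows "spacelike_map (chart_image B) (gB B) \<Omega> (F C B)"
    and "x \<in> \<Omega> \<Longrightarrow> spacelike_map.ind (gB B) (F C B) x = G C x"
    and "x \<in> \<Omega> \<Longrightarrow> \<partial> u (\<phi> C) x = \<partial> (\<partial> u (F C B) x) (k B) (F C B x)"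
proof -
  interpret m: metric_field "chart_image B" "gB B" by (rule chart_metric_field[OF B])
  have FW: "F C B x \<in> chart_image B" if "x \<in> \<Omega>" for x
    using local_rep(1)[OF C B] \<Omega>(2) that by blast
  have smF: "smooth_on \<Omega> (F C B)"
    by (rule smooth_on_subset[OF local_rep(3)[OF C B] \<Omega>(2)])
  have kF: "\<phi> C x = k B (F C B x)" if "x \<in> \<Omega>" for x
    using local_rep(2)[OF C B, of x] \<Omega>(2) that by auto
  show dphi: "\<partial> u (\<phi> C) x = \<partial> (\<partial> u (F C B) x) (k B) (F C B x)" if x: "x \<in> \<Omega>" for x u
    by (rule second_derivative_composition(1)[where k="k B" and F="F C B" and \<phi>="\<phi> C", OF \<Omega>(1) x smF FW chartD(2)[OF B] kF])
  have G: "gB B (F C B x) (\<partial> u (F C B) x) (\<partial> v (F C B) x) = G C x u v" if x: "x \<in> \<Omega>" for x u v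
    unfolding G_eq dphi[OF x] kF[OF x] pullback_metric_def ..
  show sp: "spacelike_map (chart_image B) (gB B) \<Omega> (F C B)"
  proof
    show "open \<Omega>" by (rule \<Omega>(1))
    show "smooth_on \<Omega> (F C B)" by (rule smF)
    show "F C B x \<in> chart_image B" if "x \<in> \<Omega>" for x by (rule FW[OF that])
    show "DIM('d) = DIM(real^'n) + 1" using codim by simp
    show "0 < gB B (F C B x) (\<partial> u (F C B) x) (\<partial> u (F C B) x)" if x: "x \<in> \<Omega>" "u \<noteq> 0" for x u
    proof -
      have "x \<in> chart_image C" using x(1) \<Omega>(2) unfolding rep_domain_eq[OF C] by auto
      then show ?thesis
        unfolding G[OF x(1)] using spacelike C x(2) unfolding spacelike_def by blast
    qed
  qed
  show "spacelike_map.ind (gB B) (F C B) x = G C x" if "x \<in> \<Omega>"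
    unfolding spacelike_map.ind_def[OF sp, abs_def] using G[OF that] by (simp add: fun_eq_iff)
qed

text \<open>Unit normals as vectors of the Euclidean space around the target.\<close>

definition normal_at :: "('m, real^'n) chart \<Rightarrow> real^'n \<Rightarrow> 'b \<Rightarrow> bool" where
  "normal_at C x n \<longleftrightarrow> n \<in> T (\<phi> C x) \<and> \<bar>h (\<phi> C x) n n\<bar> = 1 \<and> (\<forall>w. h (\<phi> C x) n (\<partial> w (\<phi> C) x) = 0)"

text \<open>A smooth unit normal field of the immersion, valued in the surrounding Euclidean space,
  corresponds to one in the coordinates of a chart of the target; its causal character is constant
  on a ball.\<close>

lemma normal_in_chart:
  assumes C: "C \<in> A" and B: "B \<in> charts" and r: "ball x0 r \<subseteq> rep_domain f C B"
    and N: "smooth_on (ball x0 r) N" "\<And>x. x \<in> ball x0 r \<Longrightarrow> normal_at C x (N x)"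
  obtains \<nu> \<delta> where "hypersurface (chart_image B) (gB B) (ball x0 r) (F C B) \<nu> \<delta> \<kappa>"
    "\<forall>x\<in>ball x0 r. \<partial> (\<nu> x) (k B) (F C B x) = N x \<and> h (\<phi> C x) (N x) (N x) = \<delta>"
proof -
  let ?\<Omega> = "ball x0 r" and ?g = "gB B" and ?F = "F C B"
  interpret sp: spacelike_map "chart_image B" ?g ?\<Omega> ?F
    by (rule spacelike_chart(1)[OF C B open_ball r])
  have kF: "k B (?F x) = \<phi> C x" if "x \<in> ?\<Omega>" for x
    using local_rep(2)[OF C B, of x] r that by auto
  have Q: "\<phi> C x \<in> Q" if "x \<in> ?\<Omega>" for x
    using chartD(6)[OF B sp.maps[OF that]] kF[OF that] by simp
  have lin_k: "linear (\<lambda>z. \<partial> z (k B) (?F x))" if "x \<in> ?\<Omega>" for x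
    by (rule pd_linear[OF smooth_onD(1)[OF chartD(2)[OF B] sp.maps[OF that]]])
  define l where "l x z = h (\<phi> C x) (N x) (\<partial> z (k B) (?F x))" for x z
  define \<nu> where "\<nu> x = raise (?g (?F x)) (l x)" for x
  have \<nu>: "?g (?F x) (\<nu> x) z = l x z" if x: "x \<in> ?\<Omega>" for x z
    unfolding \<nu>_def
  proof (rule raise_eq[OF sp.sym[OF sp.maps[OF x]] sp.nondeg[OF sp.maps[OF x]]])
    show "linear (l x)"
      unfolding l_def
      by (rule linearI) (simp_all add: linear_add[OF lin_k[OF x]] linear_scale[OF lin_k[OF x]] hs[OF Q[OF x]] del: o_apply)
  qed
  have in_range: "T (\<phi> C x) = range (\<lambda>z. \<partial> z (k B) (?F x))" if "x \<in> ?\<Omega>" for x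
    using tangent[OF B sp.maps[OF that]] kF[OF that] by simp
  have kN: "\<partial> (\<nu> x) (k B) (?F x) = N x" if x: "x \<in> ?\<Omega>" for x
  proof -
    obtain n where n: "N x = \<partial> n (k B) (?F x)"
      using N(2)[OF x] in_range[OF x] unfolding normal_at_def by auto
    have "?g (?F x) n z = l x z" for z
      unfolding l_def n pullback_metric_def kF[OF x] ..
    then have "\<nu> x = n"
      using \<nu>[OF x] by (intro raise_unique[OF sp.sym[OF sp.maps[OF x]] sp.nondeg[OF sp.maps[OF x]]]) simp
    then show ?thesis using n by simp
  qed
  have sm_phi: "smooth_on ?\<Omega> (\<phi> C)"
    by (rule smooth_on_subset[OF sourceD(2)[OF C]]) (use r in \<open>unfold rep_domain_eq[OF C], blast\<close>)
  have sm_h: "smooth_on ?\<Omega> (\<lambda>x. h (\<phi> C x) u v)" for u v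
    by (rule smooth_on_compose[where f="\<lambda>p. h p u v", OF open_ball sm_phi h_smooth Q])
  have sm_l: "smooth_on ?\<Omega> (\<lambda>x. l x z)" for z
    unfolding l_def
    by (rule smooth_on_bilinear_field[where B="\<lambda>x. h (\<phi> C x)", OF open_ball sym_form_linear(3)[OF h_sym[OF Q]] sm_h N(1)
          smooth_on_compose[where f="\<partial> z (k B)", OF open_ball sp.smooth_F smooth_onD(2)[OF chartD(2)[OF B]] sp.maps]])
  have sm_\<nu>: "smooth_on ?\<Omega> \<nu>"
    by (rule smooth_on_form_solution[where G="\<lambda>x. ?g (?F x)" and l=l, OF open_ball sp.sym[OF sp.maps]
        sp.nondeg[OF sp.maps] sp.smooth_g_along \<nu> sm_l])
  define q where "q x = h (\<phi> C x) (N x) (N x)" for x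
  have sm_q: "smooth_on ?\<Omega> q"
    unfolding q_def
    by (rule smooth_on_bilinear_field[where B="\<lambda>x. h (\<phi> C x)", OF open_ball sym_form_linear(3)[OF h_sym[OF Q]] sm_h N(1) N(1)])
  have "q ` ?\<Omega> \<subseteq> {-1, 1}"
    using N(2) unfolding normal_at_def q_def by fastforce
  then have "finite (q ` ?\<Omega>)" by (rule finite_subset) simp
  then obtain \<delta>' where \<delta>': "\<And>x. x \<in> ?\<Omega> \<Longrightarrow> q x = \<delta>'"
    using continuous_finite_range_constant[OF connected_ball smooth_onD(3)[OF sm_q]]
    unfolding constant_on_def by blast
  \<comment> \<open>For nonpositive \<open>r\<close> the ball is empty, and any sign will do.\<close>
  define \<delta> where "\<delta> = (if ?\<Omega> = {} then 1 else \<delta>')"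
  have \<delta>: "q x = \<delta>" if "x \<in> ?\<Omega>" for x
  proof -
    have "?\<Omega> \<noteq> {}" using that by blast
    then show ?thesis unfolding \<delta>_def using \<delta>'[OF that] by (simp only: if_False)
  qed
  have \<delta>2: "\<delta> * \<delta> = 1"
  proof (cases "?\<Omega> = {}")
    case False
    then obtain x where "x \<in> ?\<Omega>" by blast
    then have "\<bar>\<delta>\<bar> = 1"
      using N(2)[of x] \<delta>[of x] unfolding normal_at_def q_def by simp
    then show ?thesis by (metis abs_mult_self_eq mult_1)
  qed (simp add: \<delta>_def)
  have "hypersurface (chart_image B) ?g ?\<Omega> ?F \<nu> \<delta> \<kappa>"
  proof
    show "smooth_on ?\<Omega> \<nu>" by (rule sm_\<nu>)
    show "?g (?F x) (\<nu> x) (\<partial> u ?F x) = 0" if x: "x \<in> ?\<Omega>" for x u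
      using N(2)[OF x] unfolding \<nu>[OF x] l_def spacelike_chart(3)[OF C B open_ball r x, symmetric] normal_at_def by blast
    show "?g (?F x) (\<nu> x) (\<nu> x) = \<delta>" if x: "x \<in> ?\<Omega>" for x
      unfolding \<nu>[OF x] l_def kN[OF x] using \<delta>[OF x] unfolding q_def .
    show "\<delta> * \<delta> = 1" by (rule \<delta>2)
    show "sectional_curvature ?g y a b = \<kappa>" if "y \<in> chart_image B" "nondegenerate_plane ?g y a b" for y a b
      by (rule curv[OF B that])
  qed
  then show thesis
    using that kN \<delta> unfolding q_def by blast
qed

lemma sff_eq_ext_sff:
  assumes C: "C \<in> A" and B: "B \<in> charts" and r: "ball x0 r \<subseteq> rep_domain f C B"
    and hyp: "hypersurface (chart_image B) (gB B) (ball x0 r) (F C B) \<nu> \<delta> \<kappa>"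
    and kN: "\<partial> (\<nu> x) (k B) (F C B x) = n" and x: "x \<in> ball x0 r"
  shows "hypersurface.sff (gB B) (F C B) \<nu> x u v = ext_sff h (\<phi> C) x n u v"
proof -
  interpret hyp: hypersurface "chart_image B" "gB B" "ball x0 r" "F C B" \<nu> \<delta> \<kappa> by (rule hyp)
  have kF: "\<phi> C x = k B (F C B x)" if "x \<in> ball x0 r" for x
    using local_rep(2)[OF C B, of x] r that by auto
  show ?thesis
    unfolding hyp.sff_def kN[symmetric]
    by (rule ext_sff_chart[where \<Omega>="ball x0 r" and k="k B" and F="F C B", OF chartD(4)[OF B] chartD(2)[OF B]
          chartD(6)[OF B] chart_metric_field[OF B] open_ball x hyp.smooth_F hyp.maps kF])
qed

text \<open>Codazzi's equation, freed from the chart \<open>B\<close> in which it was derived.\<close>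

lemma codazzi_in_chart:
  assumes C: "C \<in> A" and B: "B \<in> charts" and r: "ball x0 r \<subseteq> rep_domain f C B"
    and N: "smooth_on (ball x0 r) N" "\<And>x. x \<in> ball x0 r \<Longrightarrow> normal_at C x (N x)"
  shows "codazzi_field (ball x0 r) (G C) (\<lambda>x. ext_sff h (\<phi> C) x (N x))"
proof -
  obtain \<nu> \<delta> where hyp: "hypersurface (chart_image B) (gB B) (ball x0 r) (F C B) \<nu> \<delta> \<kappa>"
    and kN: "\<forall>x\<in>ball x0 r. \<partial> (\<nu> x) (k B) (F C B x) = N x \<and> h (\<phi> C x) (N x) (N x) = \<delta>"
    by (rule normal_in_chart[OF C B r N])
  interpret hyp: hypersurface "chart_image B" "gB B" "ball x0 r" "F C B" \<nu> \<delta> \<kappa> by (rule hyp)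
  show ?thesis
  proof (rule codazzi_field_cong[OF hyp.sff_codazzi_field])
    show "hyp.ind x = G C x" if "x \<in> ball x0 r" for x
      by (rule spacelike_chart(2)[OF C B open_ball r that])
    show "hyp.sff x = ext_sff h (\<phi> C) x (N x)" if "x \<in> ball x0 r" for x
      using sff_eq_ext_sff[OF C B r hyp conjunct1[OF bspec[OF kN that]] that] by (simp add: fun_eq_iff)
  qed
qed

end


section \<open>Ellipticity of the Laplacian\<close>

lemma bilinear_norm_bound:
  fixes P :: "'a::euclidean_space \<Rightarrow> 'b::euclidean_space \<Rightarrow> 'c::real_normed_vector"
  assumes "bilinear P"
  shows "norm (P u v) \<le> (\<Sum>i\<in>Basis. \<Sum>j\<in>Basis. norm (P i j)) * (norm u * norm v)"
proof -
  have "norm (P u v) \<le> (\<Sum>i\<in>Basis. \<Sum>j\<in>Basis. norm u * norm v * norm (P i j))"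
    unfolding bilinear_basis_expand[OF assms, of u v]
  proof (intro sum_norm_le)
    fix i :: 'a and j :: 'b assume ij: "i \<in> Basis" "j \<in> Basis"
    have "\<bar>u \<bullet> i\<bar> * \<bar>v \<bullet> j\<bar> \<le> norm u * norm v"
      using Basis_le_norm[OF ij(1)] Basis_le_norm[OF ij(2)] by (intro mult_mono) auto
    then show "norm ((u \<bullet> i * (v \<bullet> j)) *\<^sub>R P i j) \<le> norm u * norm v * norm (P i j)"
      by (simp add: abs_mult mult_right_mono)
  qed
  also have "\<dots> = (\<Sum>i\<in>Basis. \<Sum>j\<in>Basis. norm (P i j)) * (norm u * norm v)"
    by (simp add: sum_distrib_left mult_ac)
  finally show ?thesis .
qed

lemma frame_parseval:
  assumes g: "sym_form g" and E: "frame g E"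
  shows "(\<Sum>a\<in>E. (g w a)\<^sup>2) = g w w"
  using frame_linear_expand[OF g E sym_form_linear(1)[OF g], of w w]
  by (simp add: power2_eq_square)

text \<open>The trace of the inverse Gram matrix: it does not depend on the frame and is continuous in \<open>g\<close>, and so
  bounds the lengths of all orthonormal frames over a compact set.\<close>

lemma frame_norm_sum:
  fixes g :: "'e::euclidean_space \<Rightarrow> 'e \<Rightarrow> real"
  assumes g: "pos_form g" and E: "frame g E"
  shows "(\<Sum>a\<in>E. (norm a)\<^sup>2) = (\<Sum>i\<in>Basis. dual g i \<bullet> i)"
proof -
  have "(\<Sum>a\<in>E. (norm a)\<^sup>2) = (\<Sum>a\<in>E. \<Sum>i\<in>Basis. (a \<bullet> i)\<^sup>2)"
    unfolding power2_norm_eq_inner by (subst euclidean_inner) (simp add: power2_eq_square)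
  also have "\<dots> = (\<Sum>i\<in>Basis. \<Sum>a\<in>E. (g (dual g i) a)\<^sup>2)"
    by (simp only: dual_eq[OF g], rule sum.swap)
  also have "\<dots> = (\<Sum>i\<in>Basis. dual g i \<bullet> i)"
    unfolding frame_parseval[OF pos_formD(1)[OF g] E] by (simp only: dual_eq[OF g])
  finally show ?thesis .
qed

text \<open>Cauchy--Schwarz for \<open>|\<xi>|\<^sup>2 = \<Sum> g(\<xi>,a) (a \<bullet> \<xi>)\<close> with Parseval's identity
  for \<open>g\<close>. This is uniform ellipticity of \<open>\<Sum> \<partial>\<^sub>a\<^sup>2\<close>.\<close>

lemma frame_coercive:
  fixes g :: "'e::euclidean_space \<Rightarrow> 'e \<Rightarrow> real"
  assumes g: "pos_form g" and E: "frame g E" and L: "g \<xi> \<xi> \<le> L * (norm \<xi>)\<^sup>2" and "0 < L"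
  shows "(1 / L) * (norm \<xi>)\<^sup>2 \<le> (\<Sum>a\<in>E. (a \<bullet> \<xi>)\<^sup>2)"
proof (cases "\<xi> = 0")
  case False
  have "(norm \<xi>)\<^sup>2 = (\<Sum>a\<in>E. g \<xi> a * (a \<bullet> \<xi>))"
    using frame_linear_expand[OF pos_formD(1)[OF g] E, of "\<lambda>x. x \<bullet> \<xi>" \<xi>]
    by (simp add: power2_norm_eq_inner bounded_linear_inner_left bounded_linear.linear)
  then have "((norm \<xi>)\<^sup>2)\<^sup>2 \<le> (\<Sum>a\<in>E. (g \<xi> a)\<^sup>2) * (\<Sum>a\<in>E. (a \<bullet> \<xi>)\<^sup>2)"
    by (simp add: Cauchy_Schwarz_ineq_sum)
  also have "\<dots> \<le> (L * (norm \<xi>)\<^sup>2) * (\<Sum>a\<in>E. (a \<bullet> \<xi>)\<^sup>2)"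
    unfolding frame_parseval[OF pos_formD(1)[OF g] E] using L by (intro mult_right_mono sum_nonneg) auto
  finally have "(norm \<xi>)\<^sup>2 * (norm \<xi>)\<^sup>2 \<le> (norm \<xi>)\<^sup>2 * (L * (\<Sum>a\<in>E. (a \<bullet> \<xi>)\<^sup>2))"
    by (simp add: power2_eq_square mult_ac)
  then have "(norm \<xi>)\<^sup>2 \<le> L * (\<Sum>a\<in>E. (a \<bullet> \<xi>)\<^sup>2)"
    by (rule mult_left_le_imp_le) (use False in simp)
  then show ?thesis
    using \<open>0 < L\<close> by (simp add: divide_le_eq mult.commute)
qed (simp add: sum_nonneg)

lemma bounded_on_cball:
  fixes F :: "'e::euclidean_space \<Rightarrow> real"
  assumes "continuous_on S F" "cball x0 r \<subseteq> S"
  obtains K where "0 < K" "\<forall>x\<in>cball x0 r. F x \<le> K"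
proof -
  have "compact (F ` cball x0 r)"
    by (rule compact_continuous_image[OF continuous_on_subset[OF assms] compact_cball])
  then obtain a where "\<forall>y\<in>F ` cball x0 r. norm y \<le> a"
    using compact_imp_bounded bounded_iff by metis
  then have "\<forall>x\<in>cball x0 r. F x \<le> max a 1"
    by (auto simp: le_max_iff_disj)
  then show thesis by (rule that[rotated]) simp
qed

context codazzi_field
begin

text \<open>The strong maximum principle applies to the Simons inequality: in the eigenframes chosen there, the
  Laplacian has coefficients that are bounded on compact balls.\<close>

lemma norm2_max_set_open:
  assumes r: "cball x0 r \<subseteq> S" and tr: "\<And>y w. y \<in> S \<Longrightarrow> \<partial> w (\<lambda>y. form_inner (g y) (b y) (g y)) y = 0"
    and sec: "\<And>x u v. x \<in> S \<Longrightarrow> nondegenerate_plane g x u v \<Longrightarrow> sectional_curvature g x u v \<ge> 0"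
    and max: "\<And>x. x \<in> ball x0 r \<Longrightarrow> norm2 x \<le> c"
  shows "open {x \<in> ball x0 r. norm2 x = c}"
proof -
  have sub: "ball x0 r \<subseteq> cball x0 r" "ball x0 r \<subseteq> S" using r by auto
  have sum_cont: "continuous_on S (\<lambda>x. \<Sum>i\<in>Basis. \<Sum>j\<in>Basis. norm (P x i j))"
    if "\<And>u v. smooth_on S (\<lambda>x. P x u v)" for P :: "'e \<Rightarrow> 'e \<Rightarrow> 'e \<Rightarrow> 'c::real_normed_vector"
    by (intro continuous_on_sum continuous_on_norm smooth_onD(3)[OF that])
  obtain L where L: "0 < L" "\<forall>x\<in>cball x0 r. (\<Sum>i\<in>Basis. \<Sum>j\<in>Basis. norm (g x i j)) \<le> L"
    by (rule bounded_on_cball[OF sum_cont[OF smooth] r])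
  obtain D where D: "0 < D" "\<forall>x\<in>cball x0 r. (\<Sum>i\<in>Basis. \<Sum>j\<in>Basis. norm (\<Gamma> x i j)) \<le> D"
    by (rule bounded_on_cball[OF sum_cont[OF christoffel_smooth] r])
  have "continuous_on S (\<lambda>x. \<Sum>i\<in>Basis. dual (g x) i \<bullet> i)"
    by (intro continuous_on_sum continuous_on_inner smooth_onD(3)[OF dual_smooth] continuous_on_const)
  then obtain K where K: "0 < K" "\<forall>x\<in>cball x0 r. (\<Sum>i\<in>Basis. dual (g x) i \<bullet> i) \<le> K"
    by (rule bounded_on_cball[OF _ r])
  have "\<exists>E. frame (g x) E \<and> 2 * (\<Sum>a\<in>E. form_inner (g x) (\<nabla> a b x) (\<nabla> a b x)) \<le>
      (\<Sum>a\<in>E. \<partial> a (\<partial> a (\<lambda>x. norm2 x)) x) - \<partial> (\<Sum>a\<in>E. \<Gamma> x a a) (\<lambda>x. norm2 x) x" if x: "x \<in> S" for x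
  proof -
    obtain E where "frame (g x) E" "2 * (\<Sum>a\<in>E. form_inner (g x) (\<nabla> a b x) (\<nabla> a b x)) \<le>
      (\<Sum>a\<in>E. \<partial> a (\<partial> a (\<lambda>x. norm2 x)) x) - \<partial> (\<Sum>a\<in>E. \<Gamma> x a a) (\<lambda>x. norm2 x) x"
      by (rule simons_inequality[OF x tr sec[OF x]])
    then show ?thesis by blast
  qed
  then have "\<forall>x\<in>S. \<exists>E. frame (g x) E \<and> 2 * (\<Sum>a\<in>E. form_inner (g x) (\<nabla> a b x) (\<nabla> a b x)) \<le>
      (\<Sum>a\<in>E. \<partial> a (\<partial> a (\<lambda>x. norm2 x)) x) - \<partial> (\<Sum>a\<in>E. \<Gamma> x a a) (\<lambda>x. norm2 x) x"
    by blast
  from bchoice[OF this] obtain E where "\<forall>x\<in>S. frame (g x) (E x) \<and>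
      2 * (\<Sum>a\<in>E x. form_inner (g x) (\<nabla> a b x) (\<nabla> a b x)) \<le>
      (\<Sum>a\<in>E x. \<partial> a (\<partial> a (\<lambda>x. norm2 x)) x) - \<partial> (\<Sum>a\<in>E x. \<Gamma> x a a) (\<lambda>x. norm2 x) x" ..
  then have E: "\<And>x. x \<in> S \<Longrightarrow> frame (g x) (E x)"
    and ineq: "\<And>x. x \<in> S \<Longrightarrow> 2 * (\<Sum>a\<in>E x. form_inner (g x) (\<nabla> a b x) (\<nabla> a b x)) \<le>
      (\<Sum>a\<in>E x. \<partial> a (\<partial> a (\<lambda>x. norm2 x)) x) - \<partial> (\<Sum>a\<in>E x. \<Gamma> x a a) (\<lambda>x. norm2 x) x"
    by simp_all
  define \<beta> where "\<beta> x = - (\<Sum>a\<in>E x. \<Gamma> x a a)" for x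
  have upper: "(\<Sum>a\<in>E x. (norm a)\<^sup>2) \<le> K" if x: "x \<in> ball x0 r" for x
  proof -
    have "x \<in> S" using x sub by blast
    then show ?thesis
      unfolding frame_norm_sum[OF pos[OF \<open>x \<in> S\<close>] E[OF \<open>x \<in> S\<close>]] using K(2) x by simp
  qed
  show ?thesis
  proof (rule strong_maximum_principle[where E=E and \<beta>=\<beta> and m="1 / L" and M=K and K="D * K", OF open_ball
        smooth_on_subset[OF norm2_smooth sub(2)]])
    show "0 < 1 / L" using L(1) by simp
    fix x assume x: "x \<in> ball x0 r"
    then have xS: "x \<in> S" and xc: "x \<in> cball x0 r" using sub by auto
    show "(1 / L) * (norm \<xi>)\<^sup>2 \<le> (\<Sum>a\<in>E x. (a \<bullet> \<xi>)\<^sup>2)" for \<xi>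
    proof (rule frame_coercive[OF pos[OF xS] E[OF xS] _ L(1)])
      have "g x \<xi> \<xi> \<le> (\<Sum>i\<in>Basis. \<Sum>j\<in>Basis. norm (g x i j)) * (norm \<xi> * norm \<xi>)"
        using bilinear_norm_bound[OF sym_form_linear(3)[OF sym[OF xS]], of \<xi> \<xi>] by simp
      also have "\<dots> \<le> L * (norm \<xi> * norm \<xi>)"
        using L(2) xc by (intro mult_right_mono) auto
      finally show "g x \<xi> \<xi> \<le> L * (norm \<xi>)\<^sup>2" by (simp add: power2_eq_square)
    qed
    show "(\<Sum>a\<in>E x. (norm a)\<^sup>2) \<le> K" by (rule upper[OF x])
    show "norm (\<beta> x) \<le> D * K"
    proof -
      have "norm (\<beta> x) \<le> (\<Sum>a\<in>E x. D * (norm a)\<^sup>2)"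
        unfolding \<beta>_def norm_minus_cancel
      proof (rule sum_norm_le)
        fix a assume "a \<in> E x"
        have "norm (\<Gamma> x a a) \<le> (\<Sum>i\<in>Basis. \<Sum>j\<in>Basis. norm (\<Gamma> x i j)) * (norm a * norm a)"
          by (rule bilinear_norm_bound[OF christoffel_bilinear[OF xS]])
        also have "\<dots> \<le> D * (norm a * norm a)"
          using D(2) xc by (intro mult_right_mono) auto
        finally show "norm (\<Gamma> x a a) \<le> D * (norm a)\<^sup>2" by (simp add: power2_eq_square)
      qed
      also have "\<dots> \<le> D * K"
        using upper[OF x] D(1) by (simp add: sum_distrib_left[symmetric])
      finally show ?thesis .
    qed
    have "\<partial> (\<beta> x) (\<lambda>x. norm2 x) x = - \<partial> (\<Sum>a\<in>E x. \<Gamma> x a a) (\<lambda>x. norm2 x) x"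
      unfolding \<beta>_def by (rule linear_neg[OF pd_linear[OF smooth_onD(1)[OF norm2_smooth xS]]])
    moreover have "0 \<le> (\<Sum>a\<in>E x. form_inner (g x) (\<nabla> a b x) (\<nabla> a b x))"
      by (intro sum_nonneg form_inner_nonneg(1)[OF pos[OF xS] form_fieldD(1)[OF form_field_nabla[OF form_b] xS]])
    ultimately show "0 \<le> (\<Sum>a\<in>E x. \<partial> a (\<partial> a (\<lambda>x. norm2 x)) x) + \<partial> (\<beta> x) (\<lambda>x. norm2 x) x"
      using ineq[OF xS] by linarith
    show "norm2 x \<le> c" by (rule max[OF x])
  qed
qed

end

section \<open>Independence of the coordinates\<close>

lemma frame_image:
  fixes g g' :: "'e::euclidean_space \<Rightarrow> 'e \<Rightarrow> real"
  assumes L: "linear L" "inj L" and g: "\<And>u v. g u v = g' (L u) (L v)" and E: "frame g E"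
  shows "frame g' (L ` E)"
proof -
  have "inj_on L E" using L(2) by (rule inj_on_subset) simp
  then show ?thesis
    using E unfolding frame_def by (auto simp: card_image g[symmetric] inj_eq[OF L(2)])
qed

text \<open>An isometry maps orthonormal frames to orthonormal frames.\<close>

lemma form_inner_invariant:
  fixes g g' :: "'e::euclidean_space \<Rightarrow> 'e \<Rightarrow> real"
  assumes L: "linear L" "inj L" and g: "\<And>u v. g u v = g' (L u) (L v)" and b: "\<And>u v. b u v = b' (L u) (L v)"
    and pos: "pos_form g" "pos_form g'" and sym: "sym_form b" "sym_form b'"
  shows "form_inner g b b = form_inner g' b' b'"
proof -
  obtain E where E: "frame g E"
    by (rule eigenframe[OF pos(1) sym(1)])
  note E' = frame_image[OF L g E]
  have inj: "inj_on L E" using L(2) by (rule inj_on_subset) simp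
  show ?thesis
    unfolding form_inner_frame[OF pos(1) E sym_form_linear(3)[OF sym(1)] sym_form_linear(3)[OF sym(1)]]
      form_inner_frame[OF pos(2) E' sym_form_linear(3)[OF sym(2)] sym_form_linear(3)[OF sym(2)]]
    by (simp add: sum.reindex[OF inj] b)
qed

lemma dim_eigenspace_invariant:
  fixes g g' :: "'e::euclidean_space \<Rightarrow> 'e \<Rightarrow> real"
  assumes L: "linear L" "inj L" and g: "\<And>u v. g u v = g' (L u) (L v)" and b: "\<And>u v. b u v = b' (L u) (L v)"
  shows "dim (eigenspace g b \<mu>) = dim (eigenspace g' b' \<mu>)"
proof -
  have surj: "surj L" using L by (simp add: linear_injective_imp_surjective)
  have "eigenspace g' b' \<mu> = L ` eigenspace g b \<mu>"
  proof
    show "L ` eigenspace g b \<mu> \<subseteq> eigenspace g' b' \<mu>"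
    proof
      fix u' assume "u' \<in> L ` eigenspace g b \<mu>"
      then obtain u where u: "u' = L u" "u \<in> eigenspace g b \<mu>" by blast
      have "b' u' v' = \<mu> * g' u' v'" for v'
      proof -
        obtain v where "v' = L v" using surj by (metis surjD)
        then show ?thesis using u unfolding eigenspace_def by (simp add: g b)
      qed
      then show "u' \<in> eigenspace g' b' \<mu>" unfolding eigenspace_def by blast
    qed
    show "eigenspace g' b' \<mu> \<subseteq> L ` eigenspace g b \<mu>"
    proof
      fix u' assume u': "u' \<in> eigenspace g' b' \<mu>"
      obtain u where u: "u' = L u" using surj by (metis surjD)
      then have "u \<in> eigenspace g b \<mu>" using u' unfolding eigenspace_def by (simp add: g b)
      then show "u' \<in> L ` eigenspace g b \<mu>" using u by blast
    qed
  qed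
  moreover have "dim (L ` eigenspace g b \<mu>) = dim (eigenspace g b \<mu>)"
    by (rule dim_image_eq[OF L(1)]) (use L(2) in \<open>auto intro: inj_on_subset\<close>)
  ultimately show ?thesis by simp
qed

lemma form_inner_minus: "form_inner g (\<lambda>u v. - P u v) (\<lambda>u v. - P u v) = form_inner g P P"
  unfolding form_inner_def by simp

subsection \<open>Traces in terms of the inverse Gram matrix\<close>

text \<open>The mean curvature is defined by the inverse Gram matrix, whose entries are those of the dual basis.\<close>

lemma trace_inverse_matrix:
  fixes g b :: "real^'n \<Rightarrow> real^'n \<Rightarrow> real"
  assumes g: "pos_form g"
  defines "Gm \<equiv> (\<chi> i j. g (axis i 1) (axis j 1)) :: real^'n^'n"
  shows "(\<Sum>i\<in>UNIV. \<Sum>j\<in>UNIV. matrix_inv Gm $ i $ j * b (axis i 1) (axis j 1)) = form_inner g b g"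
proof -
  have s: "sym_form g" by (rule pos_formD(1)[OF g])
  note gs = sym_form_simps[OF s]
  have expand: "(\<Sum>j\<in>UNIV. (x $ j) *\<^sub>R axis j 1) = x" for x :: "real^'n"
    using basis_expansion[of x] by (simp add: scalar_mult_eq_scaleR)
  have "x = 0" if "Gm *v x = 0" for x
  proof -
    have "g (axis i 1) x = 0" for i
    proof -
      have "g (axis i 1) (\<Sum>j\<in>UNIV. (x $ j) *\<^sub>R axis j 1) = (Gm *v x) $ i"
        by (simp add: gs Gm_def matrix_vector_mult_def mult.commute)
      then show ?thesis using that by (simp add: expand)
    qed
    then have "g (\<Sum>i\<in>UNIV. (x $ i) *\<^sub>R axis i 1) x = 0"
      by (simp add: gs)
    then show "x = 0" using pos_formD(4)[OF g] by (simp add: expand)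
  qed
  then have "invertible Gm"
    unfolding invertible_left_inverse matrix_left_invertible_ker by blast
  then have inv: "matrix_inv Gm ** Gm = mat 1"
    unfolding invertible_def matrix_inv_def by (rule someI_ex[THEN conjunct2])
  have dual: "dual g (axis i 1) = (\<Sum>j\<in>UNIV. (matrix_inv Gm $ i $ j) *\<^sub>R axis j 1)" for i
  proof (rule raise_unique[OF s pos_form_nondegenerate[OF g]])
    fix v
    have "g (\<Sum>j\<in>UNIV. (matrix_inv Gm $ i $ j) *\<^sub>R axis j 1) (\<Sum>k\<in>UNIV. (v $ k) *\<^sub>R axis k 1)
        = (\<Sum>k\<in>UNIV. \<Sum>j\<in>UNIV. v $ k * (matrix_inv Gm $ i $ j * Gm $ j $ k))"
      by (simp add: gs Gm_def sum_distrib_left)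
    also have "\<dots> = (\<Sum>k\<in>UNIV. v $ k * (matrix_inv Gm ** Gm) $ i $ k)"
      by (simp add: matrix_matrix_mult_def sum_distrib_left)
    also have "\<dots> = v $ i"
      unfolding inv mat_def by (simp add: if_distrib cong: if_cong)
    finally show "g (dual g (axis i 1)) v = g (\<Sum>j\<in>UNIV. (matrix_inv Gm $ i $ j) *\<^sub>R axis j 1) v"
      unfolding dual_eq[OF g] expand by (simp add: inner_axis)
  qed
  have gd: "g (dual g (axis i 1)) (dual g (axis j 1)) = matrix_inv Gm $ i $ j" for i j
  proof -
    have "g (dual g (axis i 1)) (dual g (axis j 1)) = dual g (axis i 1) \<bullet> axis j 1"
      using sym_form_commute[OF s, of "dual g (axis i 1)"] dual_eq[OF g] by simp
    also have "\<dots> = dual g (axis i 1) $ j" by (simp add: inner_axis)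
    also have "\<dots> = matrix_inv Gm $ i $ j"
      unfolding dual by (simp add: axis_def if_distrib cong: if_cong)
    finally show ?thesis .
  qed
  have basis: "(Basis :: (real^'n) set) = (\<lambda>i. axis i 1) ` UNIV"
    by (auto simp: Basis_vec_def)
  have inj: "inj (\<lambda>i::'n. axis i (1::real))"
    by (auto simp: inj_on_def axis_eq_axis)
  show ?thesis
    unfolding form_inner_def basis sum.reindex[OF inj] o_def gd by (simp add: mult.commute)
qed


section \<open>Shape operator and mean curvature\<close>

lemma chart_image_open:
  assumes C: "is_chart Y C" and U: "openin Y U"
  shows "open (snd C ` (fst C \<inter> U))"
proof -
  have hom: "homeomorphic_map (subtopology Y (fst C)) (top_of_set (chart_image C)) (snd C)"
    using C unfolding is_chart_def by blast
  have "openin (subtopology Y (fst C)) (fst C \<inter> U)"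
    using openin_subtopology_Int2[OF U, of "fst C"] .
  then have "openin (top_of_set (chart_image C)) (snd C ` (fst C \<inter> U))"
    using homeomorphic_imp_open_map[OF hom] unfolding open_map_def by blast
  then show ?thesis
    using chart_facts(3)[OF C] by (simp add: openin_open_eq)
qed

lemma chart_preimage_open:
  assumes C: "is_chart Y C" and W: "open W"
  shows "openin Y {p \<in> fst C. snd C p \<in> W}"
proof -
  note c = chart_facts[OF C]
  have "openin (top_of_set (chart_image C)) (chart_image C \<inter> W)"
    using W by (rule openin_open_Int)
  then have "openin (subtopology Y (fst C)) {p \<in> topspace (subtopology Y (fst C)). snd C p \<in> chart_image C \<inter> W}"
    by (rule openin_continuous_map_preimage[OF c(7)])
  moreover have "{p \<in> topspace (subtopology Y (fst C)). snd C p \<in> chart_image C \<inter> W} = {p \<in> fst C. snd C p \<in> W}"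
    using c(1) by auto
  ultimately show ?thesis
    using openin_trans_full c(2) by metis
qed

context immersed_hypersurface
begin

lemma normal_part_in_chart:
  assumes "hypersurface (chart_image B) (gB B) \<Omega> (F C B) \<nu> \<delta> \<kappa>" and "x \<in> \<Omega>"
  shows "normal_part h f C B x y = (\<delta> * gB B (F C B x) y (\<nu> x)) *\<^sub>R \<nu> x"
  unfolding normal_part_def Let_def by (rule hypersurface.normal_component[OF assms])

lemma cov_deriv_along_eq: "cov_deriv_along h f C B \<xi> x u = cov (gB B) (F C B) u \<xi> x"
  unfolding cov_deriv_along_def Let_def cov_def ..

lemma second_fundamental_form_in_chart:
  assumes hyp: "hypersurface (chart_image B) (gB B) \<Omega> (F C B) \<nu> \<delta> \<kappa>" and x: "x \<in> \<Omega>"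
  shows "second_fundamental_form h f C B x u v = (\<delta> * hypersurface.sff (gB B) (F C B) \<nu> x u v) *\<^sub>R \<nu> x"
  unfolding second_fundamental_form_def normal_part_in_chart[OF assms] cov_deriv_along_eq
    hypersurface.sff_def[OF hyp] ..

text \<open>The signs \<open>\<delta>\<close> of the normal from the second fundamental form and from the inner product with the
  normal cancel.\<close>

lemma shape_operator_eq:
  assumes C: "C \<in> A" and B: "B \<in> charts" and r: "ball x0 r \<subseteq> rep_domain f C B"
    and N: "smooth_on (ball x0 r) (\<lambda>x. N' (chart_inv C x))"
      "\<And>x. x \<in> ball x0 r \<Longrightarrow> normal_at C x (N' (chart_inv C x))"
    and x: "x \<in> ball x0 r"
  shows "shape_operator h f C B N' x u = raise (G C x) (ext_sff h (\<phi> C) x (N' (chart_inv C x)) u)"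
proof -
  obtain \<nu> \<delta> where hyp: "hypersurface (chart_image B) (gB B) (ball x0 r) (F C B) \<nu> \<delta> \<kappa>"
    and kN: "\<forall>x\<in>ball x0 r. \<partial> (\<nu> x) (k B) (F C B x) = N' (chart_inv C x) \<and>
      h (\<phi> C x) (N' (chart_inv C x)) (N' (chart_inv C x)) = \<delta>"
    by (rule normal_in_chart[OF C B r N])
  interpret hyp: hypersurface "chart_image B" "gB B" "ball x0 r" "F C B" \<nu> \<delta> \<kappa> by (rule hyp)
  have xC: "x \<in> chart_image C" using x r unfolding rep_domain_eq[OF C] by blast
  let ?n = "N' (chart_inv C x)"
  have n: "\<partial> (\<nu> x) (k B) (F C B x) = ?n" "h (\<phi> C x) ?n ?n = \<delta>" using kN x by auto
  have lin: "linear (\<lambda>z. \<partial> z (k B) (F C B x))"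
    by (rule pd_linear[OF smooth_onD(1)[OF chartD(2)[OF B] hyp.maps[OF x]]])
  have "h (f (chart_inv C x)) (\<partial> (second_fundamental_form h f C B x u v) (k B) (F C B x)) ?n =
      ext_sff h (\<phi> C) x ?n u v" for v
  proof -
    have "\<partial> (second_fundamental_form h f C B x u v) (k B) (F C B x) = (\<delta> * hyp.sff x u v) *\<^sub>R ?n"
      unfolding second_fundamental_form_in_chart[OF hyp x] linear_scale[OF lin] n(1) ..
    then have "h (\<phi> C x) (\<partial> (second_fundamental_form h f C B x u v) (k B) (F C B x)) ?n = (\<delta> * hyp.sff x u v) * \<delta>"
      using hs(5)[OF sourceD(5)[OF C xC]] n(2) by (simp only:)
    then show ?thesis
      using hyp.\<delta> sff_eq_ext_sff[OF C B r hyp n(1) x, of u v] by (simp add: mult_ac)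
  qed
  then show ?thesis
    unfolding shape_operator_def raise_def by simp
qed

text \<open>In a chart the mean curvature vector is \<open>\<theta> \<nu>\<close> with \<open>\<theta> = \<delta>/n tr\<close>, and it is parallel
  in the normal connection.\<close>

lemma mean_curvature_constant:
  assumes pmc: "pmc A charts h f"
    and C: "C \<in> A" and B: "B \<in> charts" and r: "ball x0 r \<subseteq> rep_domain f C B"
    and N: "smooth_on (ball x0 r) N" "\<And>x. x \<in> ball x0 r \<Longrightarrow> normal_at C x (N x)" and x: "x \<in> ball x0 r"
  shows "\<partial> w (\<lambda>x. form_inner (G C x) (ext_sff h (\<phi> C) x (N x)) (G C x)) x = 0"
proof -
  let ?b = "\<lambda>x. ext_sff h (\<phi> C) x (N x)"
  obtain \<nu> \<delta> where hyp: "hypersurface (chart_image B) (gB B) (ball x0 r) (F C B) \<nu> \<delta> \<kappa>"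
    and kN: "\<forall>x\<in>ball x0 r. \<partial> (\<nu> x) (k B) (F C B x) = N x \<and> h (\<phi> C x) (N x) (N x) = \<delta>"
    by (rule normal_in_chart[OF C B r N])
  interpret hyp: hypersurface "chart_image B" "gB B" "ball x0 r" "F C B" \<nu> \<delta> \<kappa> by (rule hyp)
  interpret cod: codazzi_field "ball x0 r" "G C" ?b by (rule codazzi_in_chart[OF C B r N])
  define tr where "tr x = form_inner (G C x) (?b x) (G C x)" for x
  have sm_tr: "smooth_on (ball x0 r) tr"
    unfolding tr_def by (rule cod.form_inner_smooth[OF cod.form_b cod.form_field_g])
  define c where "c = \<delta> / real CARD('n)"
  have "c \<noteq> 0" using hyp.\<delta> by (auto simp: c_def)
  define \<theta> where "\<theta> x = c * tr x" for x
  have sm_\<theta>: "smooth_on (ball x0 r) \<theta>"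
    unfolding \<theta>_def by (rule smooth_on_mult[OF open_ball smooth_on_const sm_tr])
  have H: "mean_curvature_vector h f C B y = \<theta> y *\<^sub>R \<nu> y" if y: "y \<in> ball x0 r" for y
  proof -
    define Gi where "Gi = matrix_inv ((\<chi> i j. G C y (axis i 1) (axis j 1)) :: real^'n^'n)"
    have kNy: "\<partial> (\<nu> y) (k B) (F C B y) = N y" using kN y by blast
    have II: "second_fundamental_form h f C B y u v = (\<delta> * ?b y u v) *\<^sub>R \<nu> y" for u v
      unfolding second_fundamental_form_in_chart[OF hyp y] sff_eq_ext_sff[OF C B r hyp kNy y] ..
    have "(\<Sum>i\<in>UNIV. \<Sum>j\<in>UNIV. (Gi $ i $ j) *\<^sub>R ((\<delta> * ?b y (axis i 1) (axis j 1)) *\<^sub>R \<nu> y)) =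
        (\<delta> * (\<Sum>i\<in>UNIV. \<Sum>j\<in>UNIV. Gi $ i $ j * ?b y (axis i 1) (axis j 1))) *\<^sub>R \<nu> y"
      by (simp add: scaleR_sum_left sum_distrib_left mult_ac)
    also have "\<dots> = (\<delta> * tr y) *\<^sub>R \<nu> y"
      unfolding Gi_def trace_inverse_matrix[OF cod.pos[OF y]] tr_def ..
    finally show ?thesis
      unfolding mean_curvature_vector_def Let_def II Gi_def[symmetric] by (simp add: \<theta>_def c_def)
  qed
  have xr: "x \<in> rep_domain f C B" using x r by blast
  have "normal_connection h f C B (mean_curvature_vector h f C B) x w = 0"
    using pmc C B xr unfolding pmc_def by blast
  moreover have "cov (gB B) (F C B) w (mean_curvature_vector h f C B) x = cov (gB B) (F C B) w (\<lambda>y. \<theta> y *\<^sub>R \<nu> y) x"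
    unfolding cov_def H[OF x] using pd_cong[OF open_ball x H, where v=w] by simp
  ultimately have "(\<delta> * (\<delta> * \<partial> w \<theta> x)) *\<^sub>R \<nu> x = 0"
    unfolding normal_connection_def normal_part_in_chart[OF hyp x] cov_deriv_along_eq
    using hyp.normal_derivative[OF x sm_\<theta>, of w] by simp
  moreover have "\<nu> x \<noteq> 0" "\<delta> \<noteq> 0"
    using hyp.\<nu>_transversal[OF x] hyp.range_dF(1)[OF x] hyp.\<delta> by (auto simp: subspace_0)
  ultimately have "\<partial> w \<theta> x = 0" by simp
  moreover have "\<partial> w \<theta> x = c * \<partial> w tr x"
    unfolding \<theta>_def by (rule pd_bounded_linear(1)[OF bounded_linear_mult_right smooth_onD(1)[OF sm_tr x]])
  ultimately show ?thesis
    using \<open>c \<noteq> 0\<close> unfolding tr_def by simp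
qed

subsection \<open>Unit normals and change of charts\<close>

text \<open>The unit normal found in a chart of the target, viewed as a Euclidean vector.\<close>

lemma local_normal:
  assumes C: "C \<in> A" and x0: "x0 \<in> chart_image C"
  obtains B r N where "B \<in> charts" "0 < r" "ball x0 r \<subseteq> rep_domain f C B"
    "smooth_on (ball x0 r) N" "\<forall>x\<in>ball x0 r. normal_at C x (N x)"
proof -
  obtain B where B: "B \<in> charts" "\<phi> C x0 \<in> fst B"
    using cover[OF sourceD(3)[OF C x0]] by blast
  have x0r: "x0 \<in> rep_domain f C B"
    unfolding rep_domain_eq[OF C] using x0 B(2) by blast
  interpret sp: spacelike_map "chart_image B" "gB B" "rep_domain f C B" "F C B"
    by (rule spacelike_chart(1)[OF C B(1) rep_domain_open[OF C B(1)] order_refl])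
  obtain r \<nu> \<sigma> where r: "0 < r" "ball x0 r \<subseteq> rep_domain f C B" and \<nu>: "smooth_on (ball x0 r) \<nu>"
    and \<sigma>: "\<sigma> * \<sigma> = 1"
    and n1: "\<And>x u. x \<in> ball x0 r \<Longrightarrow> gB B (F C B x) (\<nu> x) (\<partial> u (F C B) x) = 0"
    and n2: "\<And>x. x \<in> ball x0 r \<Longrightarrow> gB B (F C B x) (\<nu> x) (\<nu> x) = \<sigma>"
    using sp.local_unit_normal[OF x0r] by metis
  define N where "N x = \<partial> (\<nu> x) (k B) (F C B x)" for x
  have maps: "F C B x \<in> chart_image B" if "x \<in> ball x0 r" for x
    using sp.maps r(2) that by blast
  have "smooth_on (ball x0 r) N"
    unfolding N_def
  proof (rule smooth_on_linear_field[where L="\<lambda>x z. \<partial> z (k B) (F C B x)", OF open_ball _ _ \<nu>])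
    show "linear (\<lambda>z. \<partial> z (k B) (F C B x))" if "x \<in> ball x0 r" for x
      by (rule pd_linear[OF smooth_onD(1)[OF chartD(2)[OF B(1)] maps[OF that]]])
    show "smooth_on (ball x0 r) (\<lambda>x. \<partial> z (k B) (F C B x))" for z
      by (rule smooth_on_compose[where f="\<partial> z (k B)", OF open_ball smooth_on_subset[OF sp.smooth_F r(2)]
            smooth_onD(2)[OF chartD(2)[OF B(1)]] maps])
  qed
  moreover have "normal_at C x (N x)" if x: "x \<in> ball x0 r" for x
  proof -
    have xr: "x \<in> rep_domain f C B" using x r(2) by blast
    have kF: "k B (F C B x) = \<phi> C x" by (rule local_rep(2)[OF C B(1) xr])
    have 1: "h (\<phi> C x) (N x) (N x) = \<sigma>"
      using n2[OF x] unfolding N_def pullback_metric_def kF .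
    have 2: "h (\<phi> C x) (N x) (\<partial> w (\<phi> C) x) = 0" for w
      using n1[OF x, of w] unfolding N_def pullback_metric_def kF
        spacelike_chart(3)[OF C B(1) rep_domain_open[OF C B(1)] order_refl xr] .
    have 3: "N x \<in> T (\<phi> C x)"
      unfolding N_def kF[symmetric] tangent[OF B(1) maps[OF x], symmetric] by (rule rangeI)
    have "\<bar>\<sigma>\<bar> = 1" using \<sigma> by (auto simp: square_eq_1_iff)
    then show ?thesis unfolding normal_at_def using 1 2 3 by simp
  qed
  ultimately show thesis
    using that[OF B(1) r] by blast
qed

lemma normal_unique:
  assumes C: "C \<in> A" and x: "x \<in> chart_image C" and n: "normal_at C x n" and n': "normal_at C x n'"
  shows "n' = n \<or> n' = - n"
proof -
  obtain B r N where B: "B \<in> charts" and "0 < r" and r: "ball x r \<subseteq> rep_domain f C B"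
    and N: "smooth_on (ball x r) N" "\<forall>y\<in>ball x r. normal_at C y (N y)"
    by (rule local_normal[OF C x])
  have xb: "x \<in> ball x r" using \<open>0 < r\<close> by simp
  obtain \<nu> \<delta> where hyp: "hypersurface (chart_image B) (gB B) (ball x r) (F C B) \<nu> \<delta> \<kappa>"
    and kN: "\<forall>x\<in>ball x r. \<partial> (\<nu> x) (k B) (F C B x) = N x \<and> h (\<phi> C x) (N x) (N x) = \<delta>"
    by (rule normal_in_chart[OF C B r N(1) N(2)[rule_format]])
  interpret hyp: hypersurface "chart_image B" "gB B" "ball x r" "F C B" \<nu> \<delta> \<kappa> by (rule hyp)
  have kF: "k B (F C B x) = \<phi> C x" using local_rep(2)[OF C B] r xb by blast
  have lin: "linear (\<lambda>z. \<partial> z (k B) (F C B x))"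
    by (rule pd_linear[OF smooth_onD(1)[OF chartD(2)[OF B] hyp.maps[OF xb]]])
  have "m = N x \<or> m = - N x" if m: "normal_at C x m" for m
  proof -
    obtain z where z: "m = \<partial> z (k B) (F C B x)"
      using m tangent[OF B hyp.maps[OF xb]] unfolding normal_at_def kF by blast
    have "gB B (F C B x) z (\<partial> w (F C B) x) = 0" for w
      using m unfolding normal_at_def z spacelike_chart(3)[OF C B open_ball r xb] pullback_metric_def kF by blast
    moreover have "\<bar>gB B (F C B x) z z\<bar> = 1"
      using m unfolding normal_at_def z pullback_metric_def kF by blast
    ultimately have "z = \<nu> x \<or> z = - \<nu> x"
      by (rule hyp.unit_normal_unique[OF xb])
    then show ?thesis
      using kN xb linear_neg[OF lin] unfolding z by auto
  qed
  from this[OF n] this[OF n'] show ?thesis by auto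
qed

lemma ext_sff_minus:
  assumes C: "C \<in> A" and x: "x \<in> chart_image C"
  shows "ext_sff h (\<phi> C) x (- n) u v = - ext_sff h (\<phi> C) x n u v"
proof -
  let ?p = "\<phi> C x"
  have p: "?p \<in> Q" by (rule sourceD(5)[OF C x])
  have b: "bilinear (\<lambda>u v. \<partial> w (\<lambda>q. h q u v) ?p)" for w
    by (rule bilinear_pd_field[OF open_Q p sym_form_linear(3)[OF h_sym] smooth_onD(1)[OF h_smooth p]])
  have l: "linear (\<lambda>w. \<partial> w (\<lambda>q. h q u v) ?p)" for u v
    by (rule pd_linear[OF smooth_onD(1)[OF h_smooth p]])
  show ?thesis
    unfolding ext_sff_def first_kind_def
    by (simp add: bilinear_rneg[OF b] linear_neg[OF l] hs[OF p] diff_divide_distrib add_divide_distrib del: o_apply)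
qed

lemma sym_form_ext_sff:
  assumes C: "C \<in> A" and x: "x \<in> chart_image C" and n: "normal_at C x n"
  shows "sym_form (ext_sff h (\<phi> C) x n)" and "pos_form (G C x)"
proof -
  obtain B r N where B: "B \<in> charts" and "0 < r" and r: "ball x r \<subseteq> rep_domain f C B"
    and N: "smooth_on (ball x r) N" "\<forall>y\<in>ball x r. normal_at C y (N y)"
    by (rule local_normal[OF C x])
  have xb: "x \<in> ball x r" using \<open>0 < r\<close> by simp
  interpret cod: codazzi_field "ball x r" "G C" "\<lambda>x. ext_sff h (\<phi> C) x (N x)"
    by (rule codazzi_in_chart[OF C B r N(1) N(2)[rule_format]])
  show "pos_form (G C x)" by (rule cod.pos[OF xb])
  have "n = N x \<or> n = - N x"
    by (rule normal_unique[OF C x _ n]) (use N(2) xb in blast)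
  moreover have "ext_sff h (\<phi> C) x (- N x) = (\<lambda>u v. - ext_sff h (\<phi> C) x (N x) u v)"
    using ext_sff_minus[OF C x] by (simp add: fun_eq_iff)
  ultimately show "sym_form (ext_sff h (\<phi> C) x n)"
    using cod.sym_form_b[OF xb] sym_form_uminus[OF cod.sym_form_b[OF xb]] by auto
qed

text \<open>A change of charts acts on the first and second fundamental forms by its derivative \<open>L\<close>.\<close>

lemma chart_change:
  assumes C: "C \<in> A" and D: "D \<in> A" and p: "p \<in> fst C" "p \<in> fst D" and n: "normal_at C (snd C p) n"
  obtains L where "linear L" "inj L" "\<And>u v. G C (snd C p) u v = G D (snd D p) (L u) (L v)"
    "\<And>u v. ext_sff h (\<phi> C) (snd C p) n u v = ext_sff h (\<phi> D) (snd D p) n (L u) (L v)"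
    "normal_at D (snd D p) n"
proof -
  note c = chart_facts[OF sourceD(1)[OF C]] and d = chart_facts[OF sourceD(1)[OF D]]
  define \<Omega> where "\<Omega> = snd C ` (fst C \<inter> fst D)"
  define \<tau> where "\<tau> = snd D \<circ> chart_inv C"
  define x where "x = snd C p"
  have \<Omega>: "open \<Omega>"
    unfolding \<Omega>_def by (rule chart_image_open[OF sourceD(1)[OF C] d(2)])
  have x: "x \<in> \<Omega>" unfolding \<Omega>_def x_def using p by blast
  have \<tau>: "smooth_on \<Omega> \<tau>"
    using manifold C D unfolding smooth_manifold_def \<Omega>_def \<tau>_def by blast
  have \<tau>W: "\<tau> y \<in> chart_image D" and \<phi>: "\<phi> C y = \<phi> D (\<tau> y)" if "y \<in> \<Omega>" for y
  proof -
    obtain q where q: "q \<in> fst C" "q \<in> fst D" "y = snd C q" using \<open>y \<in> \<Omega>\<close> unfolding \<Omega>_def by blast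
    then have "\<tau> y = snd D q" unfolding \<tau>_def by (simp add: c(6))
    then show "\<tau> y \<in> chart_image D" "\<phi> C y = \<phi> D (\<tau> y)"
      using q by (simp_all add: c(6) d(6))
  qed
  have \<tau>x: "\<tau> x = snd D p" unfolding \<tau>_def x_def using p by (simp add: c(6))
  have xC: "x \<in> chart_image C" unfolding x_def using p by blast
  define L where "L u = \<partial> u \<tau> x" for u
  have lin: "linear L" unfolding L_def by (rule pd_linear[OF smooth_onD(1)[OF \<tau> x]])
  have dphi: "\<partial> w (\<phi> C) x = \<partial> (L w) (\<phi> D) (\<tau> x)" for w
    unfolding L_def
    by (rule second_derivative_composition(1)[where k="\<phi> D" and F=\<tau> and \<phi>="\<phi> C", OF \<Omega> x \<tau> \<tau>W sourceD(2)[OF D] \<phi>])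
  have Gpb: "G C x u v = G D (\<tau> x) (L u) (L v)" for u v
    unfolding G_eq dphi \<phi>[OF x] ..
  have "L u = 0 \<Longrightarrow> u = 0" for u
  proof -
    assume "L u = 0"
    have "G D (\<tau> x) 0 0 = 0"
      unfolding G_eq using hs(7)[OF sourceD(5)[OF D \<tau>W[OF x]]] pd_linear[OF smooth_onD(1)[OF sourceD(2)[OF D] \<tau>W[OF x]]]
      by (simp add: linear_0 del: o_apply)
    then have "G C x u u = 0"
      using Gpb[of u u] \<open>L u = 0\<close> by simp
    then show "u = 0" using spacelike C xC unfolding spacelike_def by (metis less_irrefl)
  qed
  then have inj: "inj L" using lin by (simp add: linear_injective_0)
  then have surj: "surj L" using lin by (simp add: linear_injective_imp_surjective)
  have nD: "h (\<phi> D (\<tau> x)) n (\<partial> w (\<phi> D) (\<tau> x)) = 0" for w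
  proof -
    obtain w' where "w = L w'" using surj by (metis surjD)
    then show ?thesis
      using n unfolding normal_at_def x_def[symmetric] dphi \<phi>[OF x] by blast
  qed
  have normD: "normal_at D (snd D p) n"
    using n nD unfolding normal_at_def x_def[symmetric] \<tau>x[symmetric] \<phi>[OF x] by blast
  have ext: "ext_sff h (\<phi> C) x n u v = ext_sff h (\<phi> D) (\<tau> x) n (L u) (L v)" for u v
    unfolding L_def
    by (rule ext_sff_reparametrize(2)[where \<tau>=\<tau> and \<phi>="\<phi> D" and \<phi>'="\<phi> C", OF \<Omega> x \<tau> \<tau>W sourceD(2)[OF D] \<phi>
          sourceD(5)[OF D \<tau>W[OF x]] nD])
  show thesis
    by (rule that[OF lin inj _ _ normD]; unfold x_def[symmetric] \<tau>x[symmetric]; rule Gpb ext)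
qed

end


section \<open>The global argument\<close>

context immersed_hypersurface
begin

lemma atlas_cover:
  assumes "p \<in> topspace X"
  obtains C where "C \<in> A" "p \<in> fst C"
  using manifold assms unfolding smooth_manifold_def by blast

lemma openin_by_charts:
  assumes "Z \<subseteq> topspace X"
    and "\<And>p. p \<in> Z \<Longrightarrow> \<exists>C\<in>A. \<exists>V. open V \<and> p \<in> fst C \<and> snd C p \<in> V \<and> (\<forall>q\<in>fst C. snd C q \<in> V \<longrightarrow> q \<in> Z)"
  shows "openin X Z"
proof (subst openin_subopen, intro ballI)
  fix p assume "p \<in> Z"
  from assms(2)[OF this] obtain C V where C: "C \<in> A" and V: "open V" "p \<in> fst C" "snd C p \<in> V"
    and Z: "\<forall>q\<in>fst C. snd C q \<in> V \<longrightarrow> q \<in> Z"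
    by blast
  have "openin X {q \<in> fst C. snd C q \<in> V}"
    by (rule chart_preimage_open[OF sourceD(1)[OF C] V(1)])
  then show "\<exists>T. openin X T \<and> p \<in> T \<and> T \<subseteq> Z"
    using V Z by (intro exI[of _ "{q \<in> fst C. snd C q \<in> V}"]) auto
qed

abbreviation "chart_norm2 C x n \<equiv> form_inner (G C x) (ext_sff h (\<phi> C) x n) (ext_sff h (\<phi> C) x n)"

text \<open>The squared length of the second fundamental form does not change when the normal is reversed,
  so it is a function on the whole manifold even if the normal bundle is not trivial.\<close>

definition sqnorm :: "'m \<Rightarrow> real" where
  "sqnorm p = (SOME s. \<exists>C n. C \<in> A \<and> p \<in> fst C \<and> normal_at C (snd C p) n \<and> s = chart_norm2 C (snd C p) n)"

text \<open>Two choices of a chart and a normal differ by an isometry and a sign.\<close>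

lemma sqnorm_eq:
  assumes C: "C \<in> A" and p: "p \<in> fst C" and n: "normal_at C (snd C p) n"
  shows "sqnorm p = chart_norm2 C (snd C p) n"
  unfolding sqnorm_def
proof (rule some_equality)
  show "\<exists>D m. D \<in> A \<and> p \<in> fst D \<and> normal_at D (snd D p) m \<and> chart_norm2 C (snd C p) n = chart_norm2 D (snd D p) m"
    using assms by blast
next
  fix s assume "\<exists>D m. D \<in> A \<and> p \<in> fst D \<and> normal_at D (snd D p) m \<and> s = chart_norm2 D (snd D p) m"
  then obtain D m where D: "D \<in> A" "p \<in> fst D" and m: "normal_at D (snd D p) m"
    and s: "s = chart_norm2 D (snd D p) m"
    by blast
  have xC: "snd C p \<in> chart_image C" and xD: "snd D p \<in> chart_image D" using p D(2) by blast+
  obtain L where L: "linear L" "inj L" and g: "\<And>u v. G C (snd C p) u v = G D (snd D p) (L u) (L v)"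
    and b: "\<And>u v. ext_sff h (\<phi> C) (snd C p) n u v = ext_sff h (\<phi> D) (snd D p) n (L u) (L v)"
    and nD: "normal_at D (snd D p) n"
    using chart_change[OF C D(1) p D(2) n] by metis
  have "chart_norm2 C (snd C p) n = chart_norm2 D (snd D p) n"
    by (rule form_inner_invariant[OF L g b sym_form_ext_sff(2)[OF C xC n] sym_form_ext_sff(2)[OF D(1) xD nD]
          sym_form_ext_sff(1)[OF C xC n] sym_form_ext_sff(1)[OF D(1) xD nD]])
  also have "chart_norm2 D (snd D p) n = chart_norm2 D (snd D p) m"
    using normal_unique[OF D(1) xD nD m]
  proof
    assume m': "m = - n"
    have "ext_sff h (\<phi> D) (snd D p) m = (\<lambda>u v. - ext_sff h (\<phi> D) (snd D p) n u v)"
      unfolding m' using ext_sff_minus[OF D(1) xD] by (simp add: fun_eq_iff)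
    then show ?thesis by (simp only: form_inner_minus)
  qed simp
  finally show "s = chart_norm2 C (snd C p) n" using s by simp
qed

lemma sqnorm_in_chart:
  assumes C: "C \<in> A" and N: "\<forall>x\<in>ball x0 r. normal_at C x (N x)" and q: "q \<in> fst C" "snd C q \<in> ball x0 r"
  shows "sqnorm q = chart_norm2 C (snd C q) (N (snd C q))"
  by (rule sqnorm_eq[OF C q(1)]) (use N q(2) in blast)

lemma sqnorm_preimage_open:
  assumes W: "open W"
  shows "openin X {p \<in> topspace X. sqnorm p \<in> W}"
proof (rule openin_by_charts)
  fix p assume "p \<in> {p \<in> topspace X. sqnorm p \<in> W}"
  then have p: "p \<in> topspace X" "sqnorm p \<in> W" by auto
  obtain C where C: "C \<in> A" "p \<in> fst C" by (rule atlas_cover[OF p(1)])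
  have x0: "snd C p \<in> chart_image C" using C(2) by blast
  obtain B r N where B: "B \<in> charts" and "0 < r" and r: "ball (snd C p) r \<subseteq> rep_domain f C B"
    and N: "smooth_on (ball (snd C p) r) N" "\<forall>x\<in>ball (snd C p) r. normal_at C x (N x)"
    by (rule local_normal[OF C(1) x0])
  interpret cod: codazzi_field "ball (snd C p) r" "G C" "\<lambda>x. ext_sff h (\<phi> C) x (N x)"
    by (rule codazzi_in_chart[OF C(1) B r N(1) N(2)[rule_format]])
  define V where "V = ball (snd C p) r \<inter> cod.norm2 -` W"
  have "open V"
    unfolding V_def by (rule continuous_open_preimage[OF smooth_onD(3)[OF cod.norm2_smooth] open_ball W])
  moreover have "snd C p \<in> V"
    using p(2) \<open>0 < r\<close> sqnorm_in_chart[OF C(1) N(2) C(2)] by (simp add: V_def)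
  moreover have "q \<in> {p \<in> topspace X. sqnorm p \<in> W}" if "q \<in> fst C" "snd C q \<in> V" for q
    using that sqnorm_in_chart[OF C(1) N(2) that(1)] chart_facts(1)[OF sourceD(1)[OF C(1)]] by (auto simp: V_def)
  ultimately show "\<exists>C\<in>A. \<exists>V. open V \<and> p \<in> fst C \<and> snd C p \<in> V \<and>
      (\<forall>q\<in>fst C. snd C q \<in> V \<longrightarrow> q \<in> {p \<in> topspace X. sqnorm p \<in> W})"
    using C by blast
qed auto

lemma nonneg_curvature_in_chart:
  assumes "nonneg_sectional_curvature A h f" "C \<in> A" "ball x0 r \<subseteq> rep_domain f C B" "x \<in> ball x0 r"
    "nondegenerate_plane (G C) x u v"
  shows "sectional_curvature (G C) x u v \<ge> 0"
proof -
  have "x \<in> chart_image C" using assms(3,4) unfolding rep_domain_eq[OF assms(2)] by blast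
  then show ?thesis using assms unfolding nonneg_sectional_curvature_def by blast
qed

text \<open>The set where \<open>sqnorm\<close> attains its maximum is nonempty by compactness, closed by continuity, and open by
  the strong maximum principle.\<close>

lemma sqnorm_constant:
  assumes comp: "compact_space X" and conn: "connected_space X"
    and nonneg: "nonneg_sectional_curvature A h f" and pmc: "pmc A charts h f"
  obtains c where "\<And>p. p \<in> topspace X \<Longrightarrow> sqnorm p = c"
proof (cases "topspace X = {}")
  case True
  then show thesis using that by blast
next
  case False
  have "continuous_map X euclideanreal sqnorm"
    unfolding continuous_map_def using sqnorm_preimage_open by simp
  then have "compact (sqnorm ` topspace X)"
    using comp image_compactin unfolding compact_space_def by fastforce
  then obtain p0 where p0: "p0 \<in> topspace X" and max: "\<And>p. p \<in> topspace X \<Longrightarrow> sqnorm p \<le> sqnorm p0"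
    using compact_attains_sup[of "sqnorm ` topspace X"] False by auto
  define c where "c = sqnorm p0"
  define Z where "Z = {p \<in> topspace X. sqnorm p = c}"
  have "openin X Z"
  proof (rule openin_by_charts)
    fix p assume "p \<in> Z"
    then have p: "p \<in> topspace X" "sqnorm p = c" by (auto simp: Z_def)
    obtain C where C: "C \<in> A" "p \<in> fst C" by (rule atlas_cover[OF p(1)])
    have x0: "snd C p \<in> chart_image C" using C(2) by blast
    obtain B r N where B: "B \<in> charts" and "0 < r" and r: "ball (snd C p) r \<subseteq> rep_domain f C B"
      and N: "smooth_on (ball (snd C p) r) N" "\<forall>x\<in>ball (snd C p) r. normal_at C x (N x)"
      by (rule local_normal[OF C(1) x0])
    interpret cod: codazzi_field "ball (snd C p) r" "G C" "\<lambda>x. ext_sff h (\<phi> C) x (N x)"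
      by (rule codazzi_in_chart[OF C(1) B r N(1) N(2)[rule_format]])
    note c' = chart_facts[OF sourceD(1)[OF C(1)]]
    have sq: "sqnorm q = cod.norm2 (snd C q)" if "q \<in> fst C" "snd C q \<in> ball (snd C p) r" for q
      by (rule sqnorm_in_chart[OF C(1) N(2) that])
    define V where "V = {x \<in> ball (snd C p) (r / 2). cod.norm2 x = c}"
    have "open V"
      unfolding V_def
    proof (rule cod.norm2_max_set_open)
      show "cball (snd C p) (r / 2) \<subseteq> ball (snd C p) r" using \<open>0 < r\<close> by auto
      show "\<partial> w (\<lambda>y. form_inner (G C y) (ext_sff h (\<phi> C) y (N y)) (G C y)) y = 0"
        if "y \<in> ball (snd C p) r" for y w
        by (rule mean_curvature_constant[OF pmc C(1) B r N(1) N(2)[rule_format] that])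
      show "0 \<le> sectional_curvature (G C) x u v"
        if "x \<in> ball (snd C p) r" "nondegenerate_plane (G C) x u v" for x u v
        by (rule nonneg_curvature_in_chart[OF nonneg C(1) r that])
      fix x assume x: "x \<in> ball (snd C p) (r / 2)"
      then have xr: "x \<in> ball (snd C p) r" using \<open>0 < r\<close> by simp
      then have xC: "x \<in> chart_image C" using r unfolding rep_domain_eq[OF C(1)] by blast
      have "cod.norm2 x = sqnorm (chart_inv C x)"
        using sq[of "chart_inv C x"] c'(4,5)[OF xC] xr by simp
      then show "cod.norm2 x \<le> c"
        using max[of "chart_inv C x"] c'(1) c'(4)[of x] xC unfolding c_def by auto
    qed
    moreover have "snd C p \<in> V"
      using p(2) \<open>0 < r\<close> sq[OF C(2)] by (simp add: V_def)
    moreover have "q \<in> Z" if "q \<in> fst C" "snd C q \<in> V" for q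
      using that sq[OF that(1)] c'(1) \<open>0 < r\<close> by (auto simp: V_def Z_def)
    ultimately show "\<exists>C\<in>A. \<exists>V. open V \<and> p \<in> fst C \<and> snd C p \<in> V \<and> (\<forall>q\<in>fst C. snd C q \<in> V \<longrightarrow> q \<in> Z)"
      using C by blast
  qed (auto simp: Z_def)
  moreover have "closedin X Z"
  proof -
    have "topspace X - Z = {p \<in> topspace X. sqnorm p \<in> - {c}}"
      by (auto simp: Z_def)
    then have "openin X (topspace X - Z)"
      using sqnorm_preimage_open[of "- {c}"] by (simp add: open_Compl)
    then show ?thesis
      unfolding closedin_def by (auto simp: Z_def)
  qed
  moreover have "p0 \<in> Z" using p0 by (simp add: Z_def c_def)
  ultimately have "Z = topspace X"
    using conn unfolding connected_space_clopen_in by blast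
  then show thesis using that unfolding Z_def by blast
qed

subsection \<open>Constancy of the eigenvalue multiplicities\<close>

lemma unit_normal_field_normal_at:
  assumes N: "unit_normal_field A charts h f U N" and p: "p \<in> U" and C: "C \<in> A" "p \<in> fst C"
  shows "normal_at C (snd C p) (N p)"
proof -
  have inv: "chart_inv C (snd C p) = p" by (rule chart_facts(6)[OF sourceD(1)[OF C(1)] C(2)])
  have "snd C p \<in> chart_image C" using C(2) by blast
  from sourceD(3)[OF C(1) this] have "f p \<in> M" using inv by simp
  from cover[OF this] obtain B where B: "B \<in> charts" "f p \<in> fst B" by blast
  note b = chart_facts[OF chartD(1)[OF B(1)]]
  have "N p \<in> range (\<lambda>v. \<partial> v (chart_inv B) (snd B (f p)))"
    using N p B unfolding unit_normal_field_def by blast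
  moreover have "snd B (f p) \<in> chart_image B" "chart_inv B (snd B (f p)) = f p"
    using B(2) b(6) by auto
  ultimately have "N p \<in> T (f p)" using tangent[OF B(1), of "snd B (f p)"] by simp
  moreover have "\<bar>h (f p) (N p) (N p)\<bar> = 1"
    using N p unfolding unit_normal_field_def by blast
  moreover have "\<forall>w. h (f p) (N p) (\<partial> w (\<phi> C) (snd C p)) = 0"
    using N p C unfolding unit_normal_field_def by blast
  ultimately show ?thesis
    unfolding normal_at_def using inv by simp
qed

lemma normal_field_ball:
  assumes U: "openin X U" and N: "unit_normal_field A charts h f U N" and p: "p \<in> U"
    and C: "C \<in> A" "p \<in> fst C" and B: "B \<in> charts" "f p \<in> fst B"
  obtains r where "0 < r" "ball (snd C p) r \<subseteq> rep_domain f C B" "ball (snd C p) r \<subseteq> snd C ` (fst C \<inter> U)"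
    "smooth_on (ball (snd C p) r) (\<lambda>x. N (chart_inv C x))"
    "\<forall>x\<in>ball (snd C p) r. normal_at C x (N (chart_inv C x))"
proof -
  note c = chart_facts[OF sourceD(1)[OF C(1)]]
  define V where "V = snd C ` (fst C \<inter> U) \<inter> rep_domain f C B"
  have "open V"
    unfolding V_def by (intro open_Int chart_image_open[OF sourceD(1)[OF C(1)] U] rep_domain_open[OF C(1) B(1)])
  moreover have "snd C p \<in> V"
    unfolding V_def rep_domain_def using p C B by blast
  ultimately obtain r where "0 < r" and r: "ball (snd C p) r \<subseteq> V"
    using open_contains_ball by blast
  have rU: "ball (snd C p) r \<subseteq> snd C ` (fst C \<inter> U)" using r unfolding V_def by blast
  show thesis
  proof (rule that[OF \<open>0 < r\<close> _ rU])
    show "ball (snd C p) r \<subseteq> rep_domain f C B" using r unfolding V_def by blast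
    have "smooth_on (snd C ` (fst C \<inter> U)) (N \<circ> chart_inv C)"
      using N C(1) unfolding unit_normal_field_def by blast
    from smooth_on_subset[OF this rU] show "smooth_on (ball (snd C p) r) (\<lambda>x. N (chart_inv C x))"
      by (simp add: o_def)
    show "\<forall>x\<in>ball (snd C p) r. normal_at C x (N (chart_inv C x))"
    proof
      fix x assume "x \<in> ball (snd C p) r"
      then obtain q where q: "q \<in> fst C" "q \<in> U" "x = snd C q" using rU by blast
      then show "normal_at C x (N (chart_inv C x))"
        using unit_normal_field_normal_at[OF N q(2) C(1) q(1)] c(6)[OF q(1)] by simp
    qed
  qed
qed

text \<open>As \<open>sqnorm\<close> is constant, equality holds in the Simons inequality and the second fundamental form is
  parallel. Hence the multiplicity function of its eigenvalues is locally constant on \<open>U\<close>, in every chart,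
  and constant since \<open>U\<close> is connected.\<close>

theorem isoparametric_if_pmc:
  assumes comp: "compact_space X" and conn: "connected_space X"
    and nonneg: "nonneg_sectional_curvature A h f" and pmc: "pmc A charts h f"
  shows "isoparametric X A charts h f"
  unfolding isoparametric_def
proof (intro allI impI)
  fix U N assume "openin X U \<and> connectedin X U \<and> unit_normal_field A charts h f U N"
  then have U: "openin X U" and conU: "connectedin X U" and N: "unit_normal_field A charts h f U N" by auto
  obtain c where c: "\<And>p. p \<in> topspace X \<Longrightarrow> sqnorm p = c"
    using sqnorm_constant[OF assms] by metis
  define mult where "mult C p \<mu> = dim (eigenspace (G C (snd C p)) (ext_sff h (\<phi> C) (snd C p) (N p)) \<mu>)"
    for C :: "('m, real^'n) chart" and p \<mu>
  \<comment> \<open>The multiplicities do not depend on the chart.\<close>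
  have mult_chart: "mult C p = mult D p" if p: "p \<in> U" and C: "C \<in> A" "p \<in> fst C" and D: "D \<in> A" "p \<in> fst D" for C D p
  proof
    fix \<mu>
    obtain L where L: "linear L" "inj L" and g: "\<And>u v. G C (snd C p) u v = G D (snd D p) (L u) (L v)"
      and b: "\<And>u v. ext_sff h (\<phi> C) (snd C p) (N p) u v = ext_sff h (\<phi> D) (snd D p) (N p) (L u) (L v)"
      using chart_change[OF C(1) D(1) C(2) D(2) unit_normal_field_normal_at[OF N p C]] by metis
    show "mult C p \<mu> = mult D p \<mu>"
      unfolding mult_def
      by (rule dim_eigenspace_invariant[where g="G C (snd C p)" and g'="G D (snd D p)"
          and b="ext_sff h (\<phi> C) (snd C p) (N p)" and b'="ext_sff h (\<phi> D) (snd D p) (N p)", OF L]; rule g b)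
  qed
  have locally_constant: "\<exists>C\<in>A. \<exists>V. open V \<and> p \<in> fst C \<and> snd C p \<in> V \<and>
      (\<forall>q\<in>fst C. snd C q \<in> V \<longrightarrow> q \<in> U \<and> mult C q = mult C p)" if p: "p \<in> U" for p
  proof -
    have "p \<in> topspace X" using p U openin_subset by blast
    then obtain C where C: "C \<in> A" "p \<in> fst C" by (rule atlas_cover)
    note cf = chart_facts[OF sourceD(1)[OF C(1)]]
    have "f p \<in> M"
      using sourceD(3)[OF C(1), of "snd C p"] C(2) cf(6)[OF C(2)] by auto
    then obtain B where B: "B \<in> charts" "f p \<in> fst B" using cover by blast
    obtain r where "0 < r" and r: "ball (snd C p) r \<subseteq> rep_domain f C B" "ball (snd C p) r \<subseteq> snd C ` (fst C \<inter> U)"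
      and sm: "smooth_on (ball (snd C p) r) (\<lambda>x. N (chart_inv C x))"
      and norm: "\<forall>x\<in>ball (snd C p) r. normal_at C x (N (chart_inv C x))"
      by (rule normal_field_ball[OF U N p C B])
    let ?\<Omega> = "ball (snd C p) r"
    interpret cod: codazzi_field ?\<Omega> "G C" "\<lambda>x. ext_sff h (\<phi> C) x (N (chart_inv C x))"
      by (rule codazzi_in_chart[OF C(1) B(1) r(1) sm norm[rule_format]])
    have const: "cod.norm2 x = c" if x: "x \<in> ?\<Omega>" for x
    proof -
      obtain q where q: "q \<in> fst C" "x = snd C q" using r(2) x by blast
      have "sqnorm q = chart_norm2 C x (N q)"
      proof -
        have "normal_at C (snd C q) (N q)"
          using bspec[OF norm x] unfolding q(2) cf(6)[OF q(1)] .
        from sqnorm_eq[OF C(1) q(1) this] show ?thesis unfolding q(2) .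
      qed
      then show ?thesis using c[of q] cf(1) q cf(6)[OF q(1)] by auto
    qed
    have par: "cod.nabla_g w (\<lambda>x. ext_sff h (\<phi> C) x (N (chart_inv C x))) x u v = 0" if x: "x \<in> ?\<Omega>" for x w u v
    proof (rule cod.parallel_if_norm_constant[OF x _ _ const])
      show "\<partial> w (\<lambda>y. form_inner (G C y) (ext_sff h (\<phi> C) y (N (chart_inv C y))) (G C y)) y = 0"
        if "y \<in> ?\<Omega>" for y w
        by (rule mean_curvature_constant[OF pmc C(1) B(1) r(1) sm norm[rule_format] that])
      show "0 \<le> sectional_curvature (G C) x u v" if "nondegenerate_plane (G C) x u v" for u v
        by (rule nonneg_curvature_in_chart[OF nonneg C(1) r(1) x that])
    qed
    have loc: "q \<in> U \<and> mult C q = mult C p" if q: "q \<in> fst C" "snd C q \<in> ?\<Omega>" for q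
    proof
      obtain q' where "q' \<in> fst C" "q' \<in> U" "snd C q = snd C q'" using r(2) q(2) by blast
      then show "q \<in> U" using cf(6) q(1) by metis
      show "mult C q = mult C p"
      proof
        fix \<mu>
        have "snd C p \<in> ?\<Omega>" using \<open>0 < r\<close> by simp
        from cod.parallel_constant_multiplicities[OF par convex_ball q(2) this, of \<mu>]
        show "mult C q \<mu> = mult C p \<mu>"
          unfolding mult_def cf(6)[OF q(1)] cf(6)[OF C(2)] .
      qed
    qed
    have "snd C p \<in> ?\<Omega>" using \<open>0 < r\<close> by simp
    with loc have "open ?\<Omega> \<and> p \<in> fst C \<and> snd C p \<in> ?\<Omega> \<and> (\<forall>q\<in>fst C. snd C q \<in> ?\<Omega> \<longrightarrow> q \<in> U \<and> mult C q = mult C p)"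
      using C(2) by (intro conjI open_ball ballI impI) blast+
    then show ?thesis
      by (rule bexI[OF exI[of _ ?\<Omega>] C(1)])
  qed
  \<comment> \<open>Choosing a chart at each point turns the multiplicities into a function on \<open>U\<close>. The choice may jump, but
    the function is locally constant because the multiplicities do not depend on the chart.\<close>
  define chart_at where "chart_at p = (SOME C. C \<in> A \<and> p \<in> fst C)" for p
  have chart_at: "chart_at p \<in> A" "p \<in> fst (chart_at p)" if "p \<in> U" for p
  proof -
    have "p \<in> topspace X" using that U openin_subset by blast
    then obtain C where "C \<in> A" "p \<in> fst C" by (rule atlas_cover)
    then have "\<exists>C. C \<in> A \<and> p \<in> fst C" by blast
    from someI_ex[OF this] show "chart_at p \<in> A" "p \<in> fst (chart_at p)"
      unfolding chart_at_def by auto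
  qed
  define m where "m p = mult (chart_at p) p" for p
  have level_open: "openin X {p \<in> U. P (m p)}" for P
  proof (rule openin_by_charts)
    fix p assume "p \<in> {p \<in> U. P (m p)}"
    then have p: "p \<in> U" "P (m p)" by auto
    from locally_constant[OF p(1)] obtain C V where C: "C \<in> A" "open V" "p \<in> fst C" "snd C p \<in> V"
      and V: "\<forall>q\<in>fst C. snd C q \<in> V \<longrightarrow> q \<in> U \<and> mult C q = mult C p"
      by blast
    have mC: "m q = mult C q" if "q \<in> U" "q \<in> fst C" for q
      unfolding m_def by (rule mult_chart[OF that(1) chart_at[OF that(1)] C(1) that(2)])
    show "\<exists>C\<in>A. \<exists>V. open V \<and> p \<in> fst C \<and> snd C p \<in> V \<and> (\<forall>q\<in>fst C. snd C q \<in> V \<longrightarrow> q \<in> {p \<in> U. P (m p)})"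
    proof (rule bexI[OF exI[of _ V] C(1)], intro conjI ballI impI)
      show "open V" "p \<in> fst C" "snd C p \<in> V" using C by auto
      fix q assume q: "q \<in> fst C" "snd C q \<in> V"
      then have "q \<in> U" "mult C q = mult C p" using V by blast+
      then have "m q = m p" using mC[of q] mC[of p] q(1) p(1) C(3) by simp
      then show "q \<in> {p \<in> U. P (m p)}" using \<open>q \<in> U\<close> p(2) by simp
    qed
  qed (use U openin_subset in blast)
  have m_const: "m p = m q" if "p \<in> U" "q \<in> U" for p q
  proof (rule ccontr)
    assume "m p \<noteq> m q"
    have "openin X {r \<in> U. m r = m p}" "openin X {r \<in> U. m r \<noteq> m p}"
      using level_open[of "\<lambda>x. x = m p"] level_open[of "\<lambda>x. x \<noteq> m p"] by auto
    moreover have "U \<subseteq> {r \<in> U. m r = m p} \<union> {r \<in> U. m r \<noteq> m p}"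
      "{r \<in> U. m r = m p} \<inter> {r \<in> U. m r \<noteq> m p} \<inter> U = {}" by auto
    moreover have "{r \<in> U. m r = m p} \<inter> U \<noteq> {}" "{r \<in> U. m r \<noteq> m p} \<inter> U \<noteq> {}"
      using that \<open>m p \<noteq> m q\<close> by auto
    ultimately show False
      using conU unfolding connectedin by blast
  qed
  show "\<exists>m. \<forall>C\<in>A. \<forall>B\<in>charts. \<forall>p\<in>U \<inter> fst C \<inter> f -` fst B. \<forall>\<mu>.
      dim {u. shape_operator h f C B N (snd C p) u = \<mu> *\<^sub>R u} = m \<mu>"
  proof (cases "U = {}")
    case False
    then obtain p0 where p0: "p0 \<in> U" by blast
    show ?thesis
    proof (intro exI[of _ "m p0"] ballI allI)
      fix C B p \<mu> assume C: "C \<in> A" and B: "B \<in> charts" and "p \<in> U \<inter> fst C \<inter> f -` fst B"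
      then have p: "p \<in> U" "p \<in> fst C" "f p \<in> fst B" by auto
      obtain r where "0 < r" and r: "ball (snd C p) r \<subseteq> rep_domain f C B"
        and sm: "smooth_on (ball (snd C p) r) (\<lambda>x. N (chart_inv C x))"
        and norm: "\<forall>x\<in>ball (snd C p) r. normal_at C x (N (chart_inv C x))"
        by (rule normal_field_ball[OF U N p(1) C p(2) B p(3)])
      have xb: "snd C p \<in> ball (snd C p) r" using \<open>0 < r\<close> by simp
      have inv: "chart_inv C (snd C p) = p" by (rule chart_facts(6)[OF sourceD(1)[OF C] p(2)])
      have xC: "snd C p \<in> chart_image C" using p(2) by blast
      let ?g = "G C (snd C p)" and ?b = "ext_sff h (\<phi> C) (snd C p) (N p)"
      have n: "normal_at C (snd C p) (N p)" by (rule unit_normal_field_normal_at[OF N p(1) C p(2)])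
      note g = sym_form_ext_sff(2)[OF C xC n] and b = sym_form_ext_sff(1)[OF C xC n]
      have shape: "shape_operator h f C B N (snd C p) u = raise ?g (?b u)" for u
        using shape_operator_eq[OF C B r sm norm[rule_format] xb, of u] unfolding inv .
      have "shape_operator h f C B N (snd C p) u = \<mu> *\<^sub>R u \<longleftrightarrow> u \<in> eigenspace ?g ?b \<mu>" for u
      proof -
        have "raise ?g (?b u) = \<mu> *\<^sub>R u \<longleftrightarrow> (\<forall>v. ?g (raise ?g (?b u)) v = ?g (\<mu> *\<^sub>R u) v)"
          using raise_unique[OF pos_formD(1)[OF g] pos_form_nondegenerate[OF g]] by metis
        then show ?thesis
          unfolding shape eigenspace_def
          by (simp add: raise_eq[OF pos_formD(1)[OF g] pos_form_nondegenerate[OF g] sym_form_linear(1)[OF b]]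
              sym_form_simps[OF pos_formD(1)[OF g]])
      qed
      then have "dim {u. shape_operator h f C B N (snd C p) u = \<mu> *\<^sub>R u} = mult C p \<mu>"
        unfolding mult_def by simp
      also have "mult C p = m p"
        unfolding m_def by (rule mult_chart[OF p(1) C p(2) chart_at[OF p(1)]])
      also have "m p = m p0" by (rule m_const[OF p(1) p0])
      finally show "dim {u. shape_operator h f C B N (snd C p) u = \<mu> *\<^sub>R u} = m p0 \<mu>" .
    qed
  qed simp
qed

end


section \<open>Warped products with a space form\<close>

lemma flat_form_bilinear: "bilinear (flat_form s c :: real \<times> (real^'n) \<Rightarrow> _)"
  unfolding bilinear_def flat_form_def
  by (auto intro!: linearI simp: algebra_simps sum.distrib sum_distrib_left)

lemma flat_form_sym_form: "sym_form (flat_form s c :: real \<times> (real^'n) \<Rightarrow> _)"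
  unfolding sym_form_def using flat_form_bilinear[of s c]
  by (auto simp: flat_form_def mult_ac)

lemmas flat_form_simps = sym_form_simps[OF flat_form_sym_form]

lemma flat_form_nondegenerate:
  fixes x :: "real \<times> (real^'n)"
  assumes "\<And>w. flat_form s c x w = 0"
  shows "x = 0"
proof -
  have "fst x = 0"
    using assms[of "(1, 0)"] by (auto simp: flat_form_def split: if_splits)
  moreover have "snd x $ i = 0" for i
  proof -
    have "flat_form s c x (0, axis i 1) = (\<Sum>j\<in>UNIV. if j = i then (if i \<in> neg_axes s then -1 else 1) * snd x $ i else 0)"
    proof -
      have *: "(if j \<in> neg_axes s then - 1 else 1) * snd x $ j * axis i (1::real) $ j =
          (if j = i then (if i \<in> neg_axes s then - 1 else 1) * snd x $ i else 0)" for j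
        by (simp add: axis_def)
      show ?thesis unfolding flat_form_def snd_conv fst_conv * by simp
    qed
    then show ?thesis
      using assms[of "(0, axis i 1)"] by (auto split: if_splits)
  qed
  ultimately show ?thesis by (simp add: prod_eq_iff vec_eq_iff)
qed

lemma warped_metric_sym_form: "sym_form (warped_metric \<epsilon> a s c p)"
  unfolding sym_form_def bilinear_def
proof (intro conjI allI linearI)
  show "warped_metric \<epsilon> a s c p u v = warped_metric \<epsilon> a s c p v u" for u v
    using sym_form_commute[OF flat_form_sym_form, of s c "snd u" "snd v"] by (simp add: warped_metric_def)
qed (simp_all add: warped_metric_def flat_form_simps algebra_simps)

lemma warped_metric_smooth:
  assumes "open I" "smooth_on I a"
  shows "smooth_on (I \<times> UNIV) (\<lambda>p. warped_metric \<epsilon> a s c p u v)"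
proof -
  have Q: "open (I \<times> (UNIV :: (real \<times> (real^'n)) set))"
    using assms(1) by (simp add: open_Times)
  have a: "smooth_on (I \<times> (UNIV :: (real \<times> (real^'n)) set)) (\<lambda>p. a (fst p))"
    by (rule smooth_on_compose[OF Q smooth_on_bounded_linear[OF bounded_linear_fst Q smooth_on_id] assms(2)]) auto
  show ?thesis
    unfolding warped_metric_def power2_eq_square
    by (rule smooth_on_add[OF Q smooth_on_const smooth_on_mult[OF Q smooth_on_mult[OF Q a a] smooth_on_const]])
qed

text \<open>The kernel of the differential of the defining equation of the space form. It leaves the first
  coordinate, the direction of the interval, free.\<close>

definition warped_tangent :: "nat \<Rightarrow> real \<Rightarrow> real \<times> real \<times> (real^'n) \<Rightarrow> (real \<times> real \<times> (real^'n)) set" where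
  "warped_tangent s c p = {v. if c = 0 then fst (snd v) = 0 else flat_form s c (snd p) (snd v) = 0}"

text \<open>On the hyperquadric \<open>\<langle>x,x\<rangle> = 1/c \<noteq> 0\<close>, so that the flat space is the orthogonal sum of the
  line of \<open>x\<close> and the tangent space; as the flat form is nondegenerate, so is its restriction to the tangent
  space.\<close>

lemma warped_tangent_nondegenerate:
  fixes p u :: "real \<times> real \<times> (real^'n)"
  assumes p: "p \<in> warped_product I s c" and a: "a (fst p) > 0" and \<epsilon>: "\<epsilon> \<in> {-1, 1}"
    and u: "u \<in> warped_tangent s c p"
    and orth: "\<And>v. v \<in> warped_tangent s c p \<Longrightarrow> warped_metric \<epsilon> a s c p u v = 0"
  shows "u = 0"
proof -
  have "(1, 0) \<in> warped_tangent s c p" by (simp add: warped_tangent_def flat_form_simps)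
  from orth[OF this] have u0: "fst u = 0"
    using \<epsilon> by (auto simp: warped_metric_def flat_form_simps)
  have base: "flat_form s c (snd u) w = 0" if "(0, w) \<in> warped_tangent s c p" for w
    using orth[OF that] a by (simp add: warped_metric_def u0)
  have "flat_form s c (snd u) w = 0" for w
  proof (cases "c = 0")
    case True
    have "flat_form s c (snd u) w = flat_form s c (snd u) (0, snd w)"
      using u True by (simp add: flat_form_def warped_tangent_def)
    also have "\<dots> = 0" by (rule base) (simp add: warped_tangent_def True)
    finally show ?thesis .
  next
    case False
    let ?x = "snd p" and ?l = "c * flat_form s c (snd p) w"
    have xx: "flat_form s c ?x ?x = 1 / c"
      using p False unfolding warped_product_def space_form_def by auto
    have ux: "flat_form s c (snd u) ?x = 0"
      using u False sym_form_commute[OF flat_form_sym_form, of s c "snd u"] by (simp add: warped_tangent_def)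
    have "flat_form s c (snd u) (w - ?l *\<^sub>R ?x) = 0"
      by (rule base) (simp add: warped_tangent_def False flat_form_simps xx)
    then show ?thesis by (simp add: flat_form_simps ux)
  qed
  then have "snd u = 0" by (rule flat_form_nondegenerate)
  then show ?thesis using u0 by (simp add: prod_eq_iff)
qed

lemma warped_tangent_subspace:
  fixes p :: "real \<times> real \<times> (real^'n)"
  assumes p: "p \<in> warped_product I s c"
  shows "subspace (warped_tangent s c p)" and "dim (warped_tangent s c p) \<le> CARD('n) + 1"
proof -
  show sub: "subspace (warped_tangent s c p)"
    unfolding subspace_def
  proof (intro conjI ballI allI)
    show "0 \<in> warped_tangent s c p" by (simp add: warped_tangent_def flat_form_simps)
  next
    fix u v assume "u \<in> warped_tangent s c p" "v \<in> warped_tangent s c p"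
    then show "u + v \<in> warped_tangent s c p"
      by (cases "c = 0") (simp_all add: warped_tangent_def flat_form_simps)
  next
    fix r :: real and u assume "u \<in> warped_tangent s c p"
    then show "r *\<^sub>R u \<in> warped_tangent s c p"
      by (cases "c = 0") (simp_all add: warped_tangent_def flat_form_simps)
  qed
  have "warped_tangent s c p \<noteq> UNIV"
  proof (cases "c = 0")
    case True
    then have "(0, 1, 0) \<notin> warped_tangent s c p" by (simp add: warped_tangent_def)
    then show ?thesis by blast
  next
    case False
    then have "(0, snd p) \<notin> warped_tangent s c p"
      using p unfolding warped_product_def space_form_def warped_tangent_def by auto
    then show ?thesis by blast
  qed
  moreover have "span (warped_tangent s c p) = warped_tangent s c p"
    by (rule span_eq_iff[THEN iffD2, OF sub])
  ultimately have "span (warped_tangent s c p) \<noteq> UNIV" by metis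
  then have "dim (warped_tangent s c p) \<noteq> DIM(real \<times> real \<times> (real^'n))"
    using dim_eq_full by blast
  moreover have "dim (warped_tangent s c p) \<le> DIM(real \<times> real \<times> (real^'n))"
    by (rule dim_subset_UNIV)
  ultimately show "dim (warped_tangent s c p) \<le> CARD('n) + 1" by simp
qed

text \<open>Differentiating the defining equation along a chart gives one inclusion, and the dimensions agree.\<close>

lemma warped_chart_tangent:
  fixes B :: "(real \<times> real \<times> (real^'n), real \<times> (real^'n)) chart"
  assumes B: "B \<in> warped_charts I s c" and y: "y \<in> chart_image B"
  shows "range (\<lambda>v. \<partial> v (chart_inv B) y) = warped_tangent s c (chart_inv B y)"
proof -
  let ?k = "chart_inv B" and ?W = "chart_image B" and ?p = "chart_inv B y"
  have ch: "is_chart (top_of_set (warped_product I s c)) B" and sm: "smooth_on ?W ?k"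
    and inj: "inj (\<lambda>v. \<partial> v ?k y)"
    using B y unfolding warped_charts_def submanifold_charts_def by auto
  have W: "open ?W" by (rule chart_facts(3)[OF ch])
  have kM: "?k z \<in> warped_product I s c" if "z \<in> ?W" for z
    using chart_facts(1)[OF ch] chart_facts(4)[OF ch that] by (simp add: subset_eq)
  have con: "fst (snd (?k z)) = 0" if "c = 0" "z \<in> ?W" for z
    using kM[OF that(2)] that(1) unfolding warped_product_def space_form_def by auto
  have con': "flat_form s c (snd (?k z)) (snd (?k z)) = 1 / c" if "c \<noteq> 0" "z \<in> ?W" for z
    using kM[OF that(2)] that(1) unfolding warped_product_def space_form_def by auto
  have lin: "linear (\<lambda>v. \<partial> v ?k y)" by (rule pd_linear[OF smooth_onD(1)[OF sm y]])
  have dsnd: "\<partial> v (\<lambda>z. snd (?k z)) y = snd (\<partial> v ?k y)" and ddiff: "(\<lambda>z. snd (?k z)) differentiable (at y)" for v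
    by (rule pd_bounded_linear[OF bounded_linear_snd smooth_onD(1)[OF sm y]])+
  have sub: "range (\<lambda>v. \<partial> v ?k y) \<subseteq> warped_tangent s c ?p"
  proof (rule image_subsetI)
    fix v
    show "\<partial> v ?k y \<in> warped_tangent s c ?p"
    proof (cases "c = 0")
      case True
      have "\<partial> v (\<lambda>z. fst (snd (?k z))) y = \<partial> v (\<lambda>z. 0) y"
        by (rule pd_cong[OF W y con[OF True]])
      moreover have "\<partial> v (\<lambda>z. fst (snd (?k z))) y = fst (snd (\<partial> v ?k y))"
        using pd_bounded_linear(1)[OF bounded_linear_fst ddiff, where v=v] unfolding dsnd .
      ultimately show ?thesis using True by (simp add: warped_tangent_def)
    next
      case False
      have bb: "bounded_bilinear (flat_form s c :: real \<times> (real^'n) \<Rightarrow> _)"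
        using flat_form_bilinear by (simp add: bilinear_conv_bounded_bilinear)
      have "\<partial> v (\<lambda>z. flat_form s c (snd (?k z)) (snd (?k z))) y = \<partial> v (\<lambda>z. 1 / c) y"
        by (rule pd_cong[OF W y con'[OF False]])
      moreover have "\<partial> v (\<lambda>z. flat_form s c (snd (?k z)) (snd (?k z))) y =
          flat_form s c (snd ?p) (snd (\<partial> v ?k y)) + flat_form s c (snd (\<partial> v ?k y)) (snd ?p)"
        using pd_bounded_bilinear(1)[OF bb ddiff ddiff, where v=v] unfolding dsnd .
      ultimately show ?thesis
        using False sym_form_commute[OF flat_form_sym_form, of s c "snd ?p"] by (simp add: warped_tangent_def)
    qed
  qed
  have "dim (range (\<lambda>v. \<partial> v ?k y)) = DIM(real \<times> (real^'n))"
    using dim_image_eq[OF lin, of UNIV] inj by simp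
  then have "dim (warped_tangent s c ?p) \<le> dim (range (\<lambda>v. \<partial> v ?k y))"
    using warped_tangent_subspace(2)[OF kM[OF y]] by simp
  then show ?thesis
    using subspace_dim_equal[OF linear_subspace_image[OF lin subspace_UNIV] warped_tangent_subspace(1)[OF kM[OF y]] sub]
    by simp
qed

subsection \<open>Graph charts\<close>

lemma smooth_on_Pair:
  assumes "open S" "smooth_on S f" "smooth_on S g"
  shows "smooth_on S (\<lambda>x. (f x, g x))"
proof -
  have l: "bounded_linear (\<lambda>t. (t, 0))" "bounded_linear (\<lambda>t. (0, t))"
    by (auto intro: bounded_linear_Pair bounded_linear_ident bounded_linear_zero)
  from smooth_on_add[OF assms(1) smooth_on_bounded_linear[OF l(1) assms(1,2)] smooth_on_bounded_linear[OF l(2) assms(1,3)]]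
  show ?thesis by simp
qed

text \<open>Graphs have global charts: \<open>\<pi>\<close> is the projection to the parameter space and \<open>k\<close> the graph map, which is
  an immersion because \<open>\<pi>\<close> is linear and inverts it.\<close>

lemma graph_chart:
  fixes \<pi> :: "'b::euclidean_space \<Rightarrow> 'd::euclidean_space" and k :: "'d \<Rightarrow> 'b"
  assumes D: "openin (top_of_set S) D" and W: "open W" and \<pi>: "bounded_linear \<pi>"
    and k: "smooth_on W k" and kD: "\<And>y. y \<in> W \<Longrightarrow> k y \<in> D" and \<pi>k: "\<And>y. y \<in> W \<Longrightarrow> \<pi> (k y) = y"
    and \<pi>W: "\<And>p. p \<in> D \<Longrightarrow> \<pi> p \<in> W" and k\<pi>: "\<And>p. p \<in> D \<Longrightarrow> k (\<pi> p) = p"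
  shows "(D, \<pi>) \<in> submanifold_charts S"
proof -
  have im: "\<pi> ` D = W" using kD \<pi>k \<pi>W by force
  have inj: "inj_on \<pi> D" using k\<pi> by (rule inj_on_inverseI)
  have inv: "chart_inv (D, \<pi>) y = k y" if "y \<in> W" for y
    unfolding chart_inv_def using inv_into_f_f[OF inj kD[OF that]] \<pi>k[OF that] by simp
  have DS: "D \<subseteq> S" using openin_imp_subset[OF D] .
  have top: "subtopology (top_of_set S) D = top_of_set D"
    using DS by (simp add: subtopology_subtopology Int_absorb1)
  have "homeomorphic_maps (top_of_set D) (top_of_set W) \<pi> k"
    unfolding homeomorphic_maps_def
    using linear_continuous_on[OF \<pi>] smooth_onD(3)[OF k] kD \<pi>k \<pi>W k\<pi> by auto
  then have "homeomorphic_map (top_of_set D) (top_of_set W) \<pi>"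
    by (rule homeomorphic_maps_imp_map)
  then have "is_chart (top_of_set S) (D, \<pi>)"
    unfolding is_chart_def by (simp add: top im D W)
  moreover have sm: "smooth_on W (chart_inv (D, \<pi>))"
    by (rule smooth_on_cong[OF W inv[symmetric] k])
  moreover have "inj (frechet_derivative (chart_inv (D, \<pi>)) (at y))" if y: "y \<in> W" for y
  proof (rule inj_on_inverseI)
    fix v
    have "\<pi> (\<partial> v k y) = \<partial> v (\<lambda>z. \<pi> (k z)) y"
      by (rule pd_bounded_linear(1)[OF \<pi> smooth_onD(1)[OF k y], symmetric])
    also have "\<dots> = \<partial> v (\<lambda>z. z) y"
      by (rule pd_cong[OF W y \<pi>k])
    also have "\<partial> v k y = \<partial> v (chart_inv (D, \<pi>)) y"
      by (rule pd_cong[OF W y inv[symmetric]])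
    finally show "\<pi> (\<partial> v (chart_inv (D, \<pi>)) y) = v" by simp
  qed
  ultimately show ?thesis
    unfolding submanifold_charts_def fst_conv snd_conv im mem_Collect_eq by blast
qed

text \<open>Around a point \<open>x\<^sub>0\<close> the hyperquadric is the graph of \<open>z \<mapsto> sqrt (1 - c \<langle>z,z\<rangle>) x\<^sub>0\<close> over the orthogonal
  complement \<open>V\<close> of \<open>x\<^sub>0\<close>; the map \<open>\<iota>\<close> identifies the coordinate space with \<open>V\<close>.\<close>

lemma warped_charts_cover:
  fixes p :: "real \<times> real \<times> (real^'n)"
  assumes I: "open I" and p: "p \<in> warped_product I s c"
  shows "\<exists>B \<in> (warped_charts I s c :: (_, real \<times> (real^'n)) chart set). p \<in> fst B"
proof (cases "c = 0")
  case True
  have W: "open (I \<times> (UNIV :: (real^'n) set))" using I by (simp add: open_Times)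
  have l: "bounded_linear (\<lambda>p::real \<times> real \<times> (real^'n). (fst p, snd (snd p)))"
    "bounded_linear (\<lambda>y::real \<times> (real^'n). (fst y, 0::real, snd y))"
    by (intro bounded_linear_Pair bounded_linear_fst bounded_linear_snd bounded_linear_zero
        bounded_linear_compose[OF bounded_linear_snd bounded_linear_snd])+
  have "(warped_product I s c, \<lambda>p::real \<times> real \<times> (real^'n). (fst p, snd (snd p))) \<in> warped_charts I s c"
    unfolding warped_charts_def
  proof (rule graph_chart[OF _ W l(1) smooth_on_bounded_linear[OF l(2) W smooth_on_id]])
    show "openin (top_of_set (warped_product I s c)) (warped_product I s c)"
      by (rule openin_subtopology_self)
  qed (auto simp: warped_product_def space_form_def True)
  then show ?thesis using p by force
next
  case False
  define x0 where "x0 = snd p"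
  define q :: "real \<times> (real^'n) \<Rightarrow> real \<times> (real^'n) \<Rightarrow> real" where "q = flat_form s c"
  have q: "sym_form q" unfolding q_def by (rule flat_form_sym_form)
  note qs = sym_form_simps[OF q] and q_comm = sym_form_commute[OF q]
  \<comment> \<open>The cases in which the space form is one of two components of the hyperquadric.\<close>
  define cond where "cond \<longleftrightarrow> (c < 0 \<and> s = 0) \<or> (c > 0 \<and> s = CARD('n))"
  have sf: "x \<in> space_form s c \<longleftrightarrow> q x x = 1 / c \<and> (cond \<longrightarrow> fst x > 0)" for x :: "real \<times> (real^'n)"
    using False unfolding space_form_def q_def cond_def by auto
  have x0: "q x0 x0 = 1 / c" "cond \<longrightarrow> fst x0 > 0" "fst p \<in> I"
    using p sf[of x0] unfolding warped_product_def x0_def by auto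
  define V where "V = {w. q x0 w = 0}"
  have V: "subspace V" unfolding V_def subspace_def by (auto simp: qs)
  have x0V: "x0 \<notin> span V"
  proof -
    have "span V = V" by (rule span_eq_iff[THEN iffD2, OF V])
    moreover have "x0 \<notin> V" using x0(1) False unfolding V_def by simp
    ultimately show ?thesis by metis
  qed
  have "w \<in> span (insert x0 V)" for w
  proof -
    have "w - (c * q x0 w) *\<^sub>R x0 \<in> V" unfolding V_def using False by (simp add: qs x0(1))
    then have "w - (c * q x0 w) *\<^sub>R x0 \<in> span V" by (rule span_base)
    then show ?thesis unfolding span_breakdown_eq by blast
  qed
  then have "dim (insert x0 V) = DIM(real \<times> (real^'n))"
    using dim_eq_full by blast
  then have "dim V = dim (UNIV :: (real^'n) set)"
    using x0V by (simp add: dim_insert)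
  then obtain \<iota> :: "real^'n \<Rightarrow> real \<times> (real^'n)" where \<iota>: "linear \<iota>" "\<iota> ` UNIV = V" "inj \<iota>"
    using subspace_isomorphism[OF subspace_UNIV V] by metis
  obtain g where g: "linear g" "g \<circ> \<iota> = id"
    using linear_injective_left_inverse[OF \<iota>(1,3)] by blast
  have gi: "g (\<iota> z) = z" for z using g(2) by (simp add: o_def fun_eq_iff)
  have ig: "\<iota> (g w) = w" if "w \<in> V" for w using that \<iota>(2) gi by (metis imageE)
  have iV: "q x0 (\<iota> z) = 0" for z
    using \<iota>(2) unfolding V_def by blast
  have iV': "q (\<iota> z) x0 = 0" for z
    using iV[of z] q_comm[of "\<iota> z" x0] by metis
  have b_\<iota>: "bounded_linear \<iota>" and b_g: "bounded_linear g"
    using \<iota>(1) g(1) by (simp_all add: linear_conv_bounded_linear)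
  have b_q: "bounded_bilinear q"
    using flat_form_bilinear[of s c] unfolding q_def by (simp add: bilinear_conv_bounded_bilinear)
  define \<rho> where "\<rho> z = 1 - c * q (\<iota> z) (\<iota> z)" for z
  define \<gamma> where "\<gamma> z = sqrt (\<rho> z) *\<^sub>R x0 + \<iota> z" for z
  define k where "k y = (fst y, \<gamma> (snd y))" for y :: "real \<times> (real^'n)"
  define \<pi> where "\<pi> r = (fst r, g (snd r - (c * q x0 (snd r)) *\<^sub>R x0))" for r :: "real \<times> real \<times> (real^'n)"
  define P where "P = {z. \<rho> z > 0}"
  define W0 where "W0 = {z \<in> P. cond \<longrightarrow> fst (\<gamma> z) > 0}"
  define W where "W = I \<times> W0"
  define D where "D = warped_product I s c \<inter> {r. c * q x0 (snd r) > 0}"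
  have sm_\<rho>: "smooth_on UNIV \<rho>"
    unfolding \<rho>_def using smooth_on_bounded_linear[OF b_\<iota> open_UNIV smooth_on_id]
    by (intro smooth_on_diff smooth_on_mult smooth_on_const smooth_on_bounded_bilinear[OF b_q] open_UNIV)
  have "open P"
    unfolding P_def using smooth_onD(3)[OF sm_\<rho>] by (intro open_Collect_less) auto
  have sm_\<gamma>: "smooth_on P \<gamma>"
    unfolding \<gamma>_def
    by (rule smooth_on_add[OF \<open>open P\<close> smooth_on_scaleR[OF \<open>open P\<close> smooth_on_sqrt[OF \<open>open P\<close>
              smooth_on_subset[OF sm_\<rho> subset_UNIV]] smooth_on_const] smooth_on_bounded_linear[OF b_\<iota> \<open>open P\<close> smooth_on_id]])
      (simp add: P_def)
  have "open W0"
  proof (cases cond)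
    case True
    have "W0 = P \<inter> (\<lambda>z. fst (\<gamma> z)) -` {0<..}" using True by (auto simp: W0_def)
    moreover have "open (P \<inter> (\<lambda>z. fst (\<gamma> z)) -` {0<..})"
      by (rule continuous_open_preimage[OF continuous_on_fst[OF smooth_onD(3)[OF sm_\<gamma>]] \<open>open P\<close>]) simp
    ultimately show ?thesis by simp
  next
    case False
    then show ?thesis using \<open>open P\<close> by (simp add: W0_def)
  qed
  then have "open W" unfolding W_def using I by (simp add: open_Times)
  have W0P: "W0 \<subseteq> P" by (auto simp: W0_def)
  have sm_k: "smooth_on W k"
    unfolding k_def
    by (rule smooth_on_Pair[OF \<open>open W\<close> smooth_on_bounded_linear[OF bounded_linear_fst \<open>open W\<close> smooth_on_id]
          smooth_on_compose[where f=\<gamma> and F=snd, OF \<open>open W\<close>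
            smooth_on_bounded_linear[OF bounded_linear_snd \<open>open W\<close> smooth_on_id] sm_\<gamma>]])
      (use W0P in \<open>auto simp: W_def\<close>)
  have \<gamma>q: "c * q x0 (\<gamma> z) = sqrt (\<rho> z)" "q (\<gamma> z) (\<gamma> z) = 1 / c" if "z \<in> P" for z
  proof -
    show "c * q x0 (\<gamma> z) = sqrt (\<rho> z)"
      using False by (simp add: \<gamma>_def qs iV iV' x0(1))
    have "q (\<gamma> z) (\<gamma> z) = sqrt (\<rho> z) * sqrt (\<rho> z) * (1 / c) + q (\<iota> z) (\<iota> z)"
      by (simp add: \<gamma>_def qs iV iV' x0(1))
    also have "sqrt (\<rho> z) * sqrt (\<rho> z) = \<rho> z"
      using that by (simp add: P_def)
    finally show "q (\<gamma> z) (\<gamma> z) = 1 / c"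
      using False by (simp add: \<rho>_def field_simps)
  qed
  have graph_proj: "\<gamma> (g (x - (c * q x0 x) *\<^sub>R x0)) = x" "g (x - (c * q x0 x) *\<^sub>R x0) \<in> P"
    if "q x x = 1 / c" "c * q x0 x > 0" for x
  proof -
    let ?w = "x - (c * q x0 x) *\<^sub>R x0"
    have "?w \<in> V" unfolding V_def using False by (simp add: qs x0(1))
    from ig[OF this] have w: "\<iota> (g ?w) = ?w" .
    have qw: "q ?w ?w = 1 / c - c * q x0 x * q x0 x"
      using False that(1) q_comm[of x x0] by (simp add: qs x0(1) algebra_simps)
    have \<rho>w: "\<rho> (g ?w) = (c * q x0 x)\<^sup>2"
      using False unfolding \<rho>_def w qw by (simp add: field_simps power2_eq_square)
    then show "g ?w \<in> P" unfolding P_def using that(2) by (auto simp: zero_less_power2)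
    have "sqrt (\<rho> (g ?w)) = c * q x0 x" unfolding \<rho>w using that(2) by simp
    then show "\<gamma> (g ?w) = x" unfolding \<gamma>_def w by simp
  qed
  have "(D, \<pi>) \<in> submanifold_charts (warped_product I s c)"
  proof (rule graph_chart[OF _ \<open>open W\<close> _ sm_k])
    have "continuous_on UNIV (\<lambda>r::real \<times> real \<times> (real^'n). c * q x0 (snd r))"
      by (intro continuous_on_mult continuous_on_const bounded_bilinear.continuous_on[OF b_q] continuous_on_snd continuous_on_id)
    then have "open {r::real \<times> real \<times> (real^'n). c * q x0 (snd r) > 0}"
      by (intro open_Collect_less continuous_on_const)
    then show "openin (top_of_set (warped_product I s c)) D"
      unfolding D_def by (rule openin_open_Int)
    show "bounded_linear \<pi>"
      unfolding \<pi>_def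
      by (intro bounded_linear_Pair bounded_linear_fst bounded_linear_compose[OF b_g] bounded_linear_sub
          bounded_linear_snd bounded_linear_scaleR_const bounded_linear_const_mult
          bounded_linear_compose[OF bounded_bilinear.bounded_linear_right[OF b_q] bounded_linear_snd])
    show "k y \<in> D" if "y \<in> W" for y
      using that \<gamma>q[of "snd y"] W0P unfolding D_def warped_product_def W_def
      by (auto simp: k_def sf W0_def P_def)
    show "\<pi> (k y) = y" if "y \<in> W" for y
    proof -
      have "\<gamma> (snd y) - (c * q x0 (\<gamma> (snd y))) *\<^sub>R x0 = \<iota> (snd y)"
        using that W0P \<gamma>q(1)[of "snd y"] by (auto simp: W_def \<gamma>_def)
      then show ?thesis by (simp add: \<pi>_def k_def gi)
    qed
    show "\<pi> r \<in> W" "k (\<pi> r) = r" if "r \<in> D" for r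
      using that graph_proj[of "snd r"] unfolding D_def warped_product_def
      by (auto simp: \<pi>_def k_def W_def W0_def sf)
  qed
  moreover have "p \<in> D"
    using p x0(1) False unfolding D_def by (simp add: x0_def[symmetric])
  ultimately show ?thesis
    unfolding warped_charts_def by force
qed

theorem corollary4:
  fixes I :: "real set" and a :: "real \<Rightarrow> real" and \<epsilon> c :: real and s :: nat
    and X :: "'m topology" and A :: "('m, real^'n) chart set"
    and f :: "'m \<Rightarrow> real \<times> real \<times> (real^'n)"
  assumes "open I" and "is_interval I" and "I \<noteq> {}"
    and "smooth_on I a" and "\<And>t. t \<in> I \<Longrightarrow> a t > 0"
    and "\<epsilon> \<in> {-1, 1}" and "s \<le> CARD('n)"
    and "constant_curvature (warped_charts I s c :: (real \<times> real \<times> (real^'n), _) chart set)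
           (warped_metric \<epsilon> a s c)"
    and "smooth_manifold X A" and "connected_space X" and "compact_space X"
    and "immersion A (warped_product I s c) f"
    and "spacelike A (warped_metric \<epsilon> a s c) f"
    and "nonneg_sectional_curvature A (warped_metric \<epsilon> a s c) f"
    and "pmc A (warped_charts I s c) (warped_metric \<epsilon> a s c) f"
  shows "isoparametric X A (warped_charts I s c) (warped_metric \<epsilon> a s c) f"
proof -
  let ?charts = "warped_charts I s c :: (real \<times> real \<times> (real^'n), real \<times> (real^'n)) chart set"
  obtain \<kappa> where \<kappa>: "\<forall>B\<in>?charts. \<forall>y\<in>chart_image B. \<forall>u v.
      nondegenerate_plane (pullback_metric (warped_metric \<epsilon> a s c) (chart_inv B)) y u v \<longrightarrow>
      sectional_curvature (pullback_metric (warped_metric \<epsilon> a s c) (chart_inv B)) y u v = \<kappa>"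
    using assms(8) unfolding constant_curvature_def by blast
  interpret immersed_hypersurface "I \<times> UNIV" "warped_metric \<epsilon> a s c" "warped_product I s c"
    "warped_tangent s c" ?charts \<kappa> X A f
  proof
    show "open (I \<times> (UNIV :: (real \<times> (real^'n)) set))"
      using assms(1) by (simp add: open_Times)
    show "sym_form (warped_metric \<epsilon> a s c p)" for p :: "real \<times> real \<times> (real^'n)"
      by (rule warped_metric_sym_form)
    show "smooth_on (I \<times> UNIV) (\<lambda>p. warped_metric \<epsilon> a s c p u v)" for u v :: "real \<times> real \<times> (real^'n)"
      by (rule warped_metric_smooth[OF assms(1,4)])
    show "warped_product I s c \<subseteq> I \<times> (UNIV :: (real \<times> (real^'n)) set)"
      unfolding warped_product_def by blast
    show "?charts = submanifold_charts (warped_product I s c)"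
      unfolding warped_charts_def ..
    show "range (\<lambda>v. \<partial> v (chart_inv B) y) = warped_tangent s c (chart_inv B y)"
      if "B \<in> ?charts" "y \<in> chart_image B" for B y
      by (rule warped_chart_tangent[OF that])
    show "u = 0" if p: "p \<in> warped_product I s c" and "u \<in> warped_tangent s c p"
      "\<And>v. v \<in> warped_tangent s c p \<Longrightarrow> warped_metric \<epsilon> a s c p u v = 0"
      for p u :: "real \<times> real \<times> (real^'n)"
      by (rule warped_tangent_nondegenerate[OF p _ assms(6) that(2,3)])
        (use p assms(5) in \<open>auto simp: warped_product_def\<close>)
    show "\<exists>B\<in>?charts. p \<in> fst B" if "p \<in> warped_product I s c" for p
      by (rule warped_charts_cover[OF assms(1) that])
    show "sectional_curvature (pullback_metric (warped_metric \<epsilon> a s c) (chart_inv B)) y u v = \<kappa>"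
      if "B \<in> ?charts" "y \<in> chart_image B"
        "nondegenerate_plane (pullback_metric (warped_metric \<epsilon> a s c) (chart_inv B)) y u v" for B y u v
      using \<kappa> that by blast
    show "DIM(real \<times> (real^'n)) = CARD('n) + 1" by simp
  qed (use assms in auto)
  show ?thesis
    by (rule isoparametric_if_pmc[OF assms(11,10,14,15)])
qed


end
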